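(* Let $(\mu_t)_{t>0}$ be a family of Borel probability measures on $\mathbb R^d$ and let $(\psi_t)_{t>0}$ be a family of functions $\mathbb R^d\to\mathbb R^d$. Assume: (1) there exists $h_0>0$ such that $$\sup_{h\in(0,h_0)}\frac1h\Big(\int_{\mathbb R^d}(1\wedge|y|^2)\,\mu_h(dy)+\Big|\int_{\{|y|\le1\}}y\,\mu_h(dy)\Big|\Big)<\infty;$$ (2) for every $\varepsilon>0$ there exists $M_\varepsilon>0$ such that $\limsup_{h\downarrow0}\frac1h\,\mu_h(\{y\in\mathbb R^d: |y|>M_\varepsilon\})<\varepsilon$; (3) there exist $\omega\ge0$, $\delta>0$ and $h_0>0$ such that $\sup_{h\in(0,h_0)}\sup_{x\in\mathbb R^d}\frac{|\psi_h(x+u)-\psi_h(x)-u|}{h}\le\omega|u|$ for all $u\in\mathbb R^d$ with $|u|\le\delta$, and moreover $\limsup_{h\downarrow0}\frac{|\psi_h(0)|}{h}<\infty$. Then, for every null sequence in $(0,\infty)$, there exist a subsequence $(h_n)_{n\in\mathbb N}$, a Lévy process $(Y_t)_{t\ge0}$ on some probability space $(\Omega,\mathcal F,\mathbb P)$, and an $\omega$-Lipschitz function $F\colon\mathbb R^d\to\mathbb R^d$ such that, for all $t\ge0$, all $f\in C_b(\mathbb R^d)$, all $(k_n)_{n\in\mathbb N}\subset\mathbb N$ with $k_nh_n\to t$, all $(f_n)_{n\in\mathbb N}\subset C_b(\mathbb R^d)$ with $f_n\to f$ in the mixed topology, and all $r\ge0$, $$\sup_{|x|\le r}\Big|\big(P_{h_n}^{k_n}f_n\big)(x)-\mathbb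 E_{\mathbb P}[f(X_t^x)]\Big|\to0\quad\text{as }n\to\infty,$$ where, for each $x\in\mathbb R^d$, $(X_t^x)_{t\ge0}$ is the unique strong solution of the SDE $dX_t^x=F(X_t^x)\,dt+dY_t$, $X_0^x=x$. Moreover, if $f\in C_b(\mathbb R^d)$ is such that $\big(\frac{P_{h_n}f-f}{h_n}\big)_{n\in\mathbb N}$ converges in the mixed topology, then $$\lim_{h\downarrow0}\frac{\mathbb E_{\mathbb P}[f(X_h^{\,\cdot})]-f}{h}=\lim_{n\to\infty}\frac{P_{h_n}f-f}{h_n}\quad\text{in the mixed topology.}$$
   Context: $d\in\mathbb N$; $|\cdot|$ is the Euclidean norm on $\mathbb R^d$. $C_b(\mathbb R^d)$ is the space of bounded continuous functions $\mathbb R^d\to\mathbb R$, with supremum norm $\|\cdot\|_\infty$. A null sequence in $(0,\infty)$ is a sequence of positive reals converging to $0$. Convergence in the mixed topology: $f_n\to f$ in the mixed topology (for $f_n,f\in C_b(\mathbb R^d)$) means $\sup_n\|f_n\|_\infty<\infty$ and $\sup_{|x|\le r}|f_n(x)-f(x)|\to0$ for all $r\ge0$. For a family, $f=\lim_{h\downarrow0}f_h$ in the mixed topology means $f_{h_n}\to f$ in the mixed topology for every null sequence $(h_n)$ in $(0,\infty)$. For $t>0$, $f\in C_b(\mathbb R^d)$, $x\in\mathbb R^d$, define $(P_tf)(x):=\int_{\mathbb R^d}f(\psi_t(x)+y)\,\mu_t(dy)$. It is a standing convention that the $\psi_t$ are such that each $P_t$ is an operator $C_b(\mathbb R^d)\to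 C_b(\mathbb R^d)$. $P_t^k$ is the $k$-fold composition. A Lévy process $(Y_t)_{t\ge0}$ is an $\mathbb R^d$-valued process with $Y_0=0$ a.s., stationary independent increments, stochastically continuous, with a.s. càdlàg paths. $F$ is $\omega$-Lipschitz if $|F(x_1)-F(x_2)|\le\omega|x_1-x_2|$ for all $x_1,x_2$. The SDE means $X_t^x=x+\int_0^tF(X_s^x)\,ds+Y_t$ for all $t\geq 0$ a.s. *)

theory Defs
  imports "HOL-Probability.Probability"
begin

definition null_seq :: "(nat \<Rightarrow> real) \<Rightarrow> bool" where
  "null_seq h \<longleftrightarrow> (\<forall>n. 0 < h n) \<and> h \<longlonglongrightarrow> 0"


text \<open>
  \<^term>\<open>bcontfun\<close> is the library's set of bounded continuous functions.  Membership is
  part of the definition, so the real-valued suprema below range over bounded sets.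
\<close>

definition mixed_tendsto ::
    "(nat \<Rightarrow> 'a::real_normed_vector \<Rightarrow> real) \<Rightarrow> ('a \<Rightarrow> real) \<Rightarrow> bool" where
  "mixed_tendsto f g \<longleftrightarrow>
     (\<forall>n. f n \<in> bcontfun) \<and> g \<in> bcontfun \<and>
     bdd_above (range (\<lambda>n. SUP x. \<bar>f n x\<bar>)) \<and>
     (\<forall>r\<ge>0. (\<lambda>n. SUP x\<in>cball 0 r. \<bar>f n x - g x\<bar>) \<longlonglongrightarrow> 0)"

definition mixed_tendsto_at_0 ::
    "(real \<Rightarrow> 'a::real_normed_vector \<Rightarrow> real) \<Rightarrow> ('a \<Rightarrow> real) \<Rightarrow> bool" where
  "mixed_tendsto_at_0 f g \<longleftrightarrow> (\<forall>h. null_seq h \<longrightarrow> mixed_tendsto (\<lambda>n. f (h n)) g)"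

definition transition ::
    "(real \<Rightarrow> 'a measure) \<Rightarrow> (real \<Rightarrow> 'a \<Rightarrow> 'a) \<Rightarrow> real \<Rightarrow> ('a \<Rightarrow> real) \<Rightarrow> 'a::real_normed_vector \<Rightarrow> real"
  where "transition \<mu> \<psi> t f x = (\<integral>y. f (\<psi> t x + y) \<partial>\<mu> t)"


text \<open>
  Processes are maps \<open>Y :: real \<Rightarrow> 'w \<Rightarrow> 'a\<close>; only times \<open>t \<ge> 0\<close> matter.
\<close>

definition cadlag :: "(real \<Rightarrow> 'a::topological_space) \<Rightarrow> bool" where
  "cadlag y \<longleftrightarrow>
     (\<forall>t\<ge>0. (y \<longlongrightarrow> y t) (at_right t)) \<and> (\<forall>t>0. \<exists>l. (y \<longlongrightarrow> l) (at_left t))"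

definition independent_increments ::
    "'w measure \<Rightarrow> (real \<Rightarrow> 'w \<Rightarrow> 'a::euclidean_space) \<Rightarrow> bool" where
  "independent_increments M Y \<longleftrightarrow>
     (\<forall>(n::nat) t. 0 \<le> t 0 \<and> (\<forall>i<n. t i \<le> t (Suc i)) \<longrightarrow>
        prob_space.indep_vars M (\<lambda>_. borel) (\<lambda>i w. Y (t (Suc i)) w - Y (t i) w) {..<n})"

definition stationary_increments ::
    "'w measure \<Rightarrow> (real \<Rightarrow> 'w \<Rightarrow> 'a::euclidean_space) \<Rightarrow> bool" where
  "stationary_increments M Y \<longleftrightarrow>
     (\<forall>s\<ge>0. \<forall>t\<ge>0. distr M borel (\<lambda>w. Y (s + t) w - Y s w) = distr M borel (\<lambda>w. Y t w - Y 0 w))"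

definition stochastically_continuous ::
    "'w measure \<Rightarrow> (real \<Rightarrow> 'w \<Rightarrow> 'a::euclidean_space) \<Rightarrow> bool" where
  "stochastically_continuous M Y \<longleftrightarrow>
     (\<forall>s\<ge>0. \<forall>\<epsilon>>0.
        ((\<lambda>t. measure M {w \<in> space M. norm (Y t w - Y s w) > \<epsilon>}) \<longlongrightarrow> 0) (at s within {0..}))"

definition levy_process ::
    "'w measure \<Rightarrow> (real \<Rightarrow> 'w \<Rightarrow> 'a::euclidean_space) \<Rightarrow> bool" where
  "levy_process M Y \<longleftrightarrow>
     prob_space M \<and>
     (\<forall>t\<ge>0. Y t \<in> borel_measurable M) \<and>
     (AE w in M. Y 0 w = 0) \<and>
     stationary_increments M Y \<and>
     independent_increments M Y \<and>
     stochastically_continuous M Y \<and>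
     (AE w in M. cadlag (\<lambda>t. Y t w))"


text \<open>
  The filtration generated by \<open>Y\<close>, augmented by the null sets of \<open>M\<close>.  The measure on
  it is irrelevant; only its \<open>\<sigma>\<close>-algebra is used.
\<close>

definition augmented_filtration ::
    "'w measure \<Rightarrow> (real \<Rightarrow> 'w \<Rightarrow> 'a::euclidean_space) \<Rightarrow> real \<Rightarrow> 'w measure" where
  "augmented_filtration M Y t =
     sigma (space M)
       ({Y s -` A \<inter> space M | s A. 0 \<le> s \<and> s \<le> t \<and> A \<in> sets borel} \<union> null_sets M)"

text \<open>
  A strong solution of \<open>dX = F(X) dt + dY\<close>, \<open>X\<^sub>0 = x\<close> is driven by the given process \<open>Y\<close> on
  the given space and adapted to the augmented filtration of \<open>Y\<close>.  Integrability is required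
  explicitly because the integral of a non-integrable function is 0 by convention.  Path
  regularity need not be required: the integral term is continuous in \<open>t\<close>, so the paths
  are a.s. cadlag when those of \<open>Y\<close> are.
\<close>

definition strong_solution ::
    "'w measure \<Rightarrow> (real \<Rightarrow> 'w \<Rightarrow> 'a::euclidean_space) \<Rightarrow> ('a \<Rightarrow> 'a) \<Rightarrow> 'a \<Rightarrow> (real \<Rightarrow> 'w \<Rightarrow> 'a) \<Rightarrow> bool"
  where
  "strong_solution M Y F x X \<longleftrightarrow>
     (\<forall>t\<ge>0. X t \<in> borel_measurable (augmented_filtration M Y t)) \<and>
     (AE w in M. \<forall>t\<ge>0.
        set_integrable lborel {0..t} (\<lambda>s. F (X s w)) \<and>
        X t w = x + (LINT s:{0..t}|lborel. F (X s w)) + Y t w)"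

text \<open>Uniqueness is up to indistinguishability.\<close>

definition unique_strong_solution ::
    "'w measure \<Rightarrow> (real \<Rightarrow> 'w \<Rightarrow> 'a::euclidean_space) \<Rightarrow> ('a \<Rightarrow> 'a) \<Rightarrow> 'a \<Rightarrow> (real \<Rightarrow> 'w \<Rightarrow> 'a) \<Rightarrow> bool"
  where
  "unique_strong_solution M Y F x X \<longleftrightarrow>
     strong_solution M Y F x X \<and>
     (\<forall>X'. strong_solution M Y F x X' \<longrightarrow> (AE w in M. \<forall>t\<ge>0. X' t w = X t w))"

end

theory Submission
  imports Defs "HOL-Complex_Analysis.Great_Picard"
begin

text \<open>
  Writing \<open>\<psi>\<^sub>h x = x + h G\<^sub>h x\<close>, hypothesis (3) makes \<open>G\<^sub>h\<close> \<open>\<omega>\<close>-Lipschitz for small \<open>h\<close>: the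
  smallness of \<open>u\<close> is removed by splitting it into small steps.  So \<open>G\<^sub>h\<close> converges locally uniformly
  along a subsequence to some \<open>F\<close>, and \<open>P\<^sub>h\<^sup>k f x\<close> is the expectation of \<open>f\<close> at the \<open>k\<close>-th step of the
  Euler scheme for \<open>dX = F(X) dt + dY\<close> driven by the random walk with step distribution \<open>\<mu>\<^sub>h\<close>.

  The walks are shown to converge to a Levy process without the theory of infinitely divisible
  laws.  The bounded function \<open>|x|\<^sup>2 / (1 + |x|\<^sup>2)\<close> has drift \<open>O(h)\<close> by hypothesis (1), which bounds
  both the maximum of a walk and the expected number of its oscillations of a given size on a
  bounded time interval.  By tightness, the one-dimensional Skorokhod theorem, applied after coding
  a whole walk by one real number through Schoenberg's curve, couples the walks of a subsequence
  on one probability space so that they converge a.s. at all rational times.  The oscillation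
  bound passes to the limit, so it extends to a cadlag process \<open>Y\<close>, which inherits stationary and
  independent increments.

  As the noise is additive, the equation is solved path by path, and Gronwall's inequality compares
  the Euler scheme with its solution, uniformly for bounded initial values.  For the generator, let
  \<open>n \<longrightarrow> \<infinity>\<close> in the telescoping identity \<open>P\<^sup>k f - f = \<Sum>\<^bsub>j<k\<^esub> h P\<^sup>j ((P f - f) / h)\<close> and then
  \<open>t \<longrightarrow> 0\<close> in the resulting Dynkin formula.
\<close>

section \<open>Facts from analysis and measure theory\<close>

text \<open>Each walk lives on its own product space, so no pathwise comparison makes sense before a
  coupling. The coupling has to carry the complete noise sequence of every walk, because the Euler
  scheme is a function of the individual increments; hence a code from which the whole sequence can
  be decoded. It yields convergence only at rational times, and a walk need not be uniformly close
  to \<open>Y\<close>, as the two may jump at slightly different times. What survives is convergence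
  in probability at each fixed time and, by Fubini, smallness of the time integral of the distance.
  Since the noise is additive, a Gronwall argument for the integrated error gets by with this and
  the distance at the terminal time. Locally uniform convergence in the initial value is obtained by
  letting the initial value vary with \<open>n\<close> inside a ball. The sample space consists of
  functions on the reals because the conclusion fixes that type for \<open>M\<close>; the coupling
  is built on the real line and transported.\<close>

lemma set_integrable_exp: "set_integrable lborel {0..s} (\<lambda>r. c * exp (k * r))" for c k s :: real
  unfolding set_integrable_def
  by (rule borel_integrable_compact) (auto intro!: continuous_intros)

lemma set_integral_exp:
  fixes k s :: real
  assumes "0 \<le> s"
  shows "(LINT r:{0..s}|lborel. k * exp (k * r)) = exp (k * s) - 1"
proof -
  have "(\<integral>r. indicator {0..s} r *\<^sub>R (k * exp (k * r)) \<partial>lborel) = exp (k * s) - exp (k * 0)"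
    by (rule integral_FTC_Icc[OF assms])
       (auto intro!: derivative_eq_intros continuous_intros
             simp flip: has_real_derivative_iff_has_vector_derivative)
  then show ?thesis unfolding set_lebesgue_integral_def by simp
qed

text \<open>The function \<open>A * exp (\<omega> * s)\<close> satisfies the integral relation with
  equality, so the excess \<open>J\<close> is bounded by \<open>\<omega>\<close> times its own
  integral. In the supremum weighted by \<open>exp (- 2 * \<omega> * r)\<close> this integral
  operator contracts by 1/2, which makes the supremum nonpositive. Integrability and an upper bound
  are all that is asked of \<open>u\<close>, since step processes and cadlag paths are not
  continuous.\<close>

lemma gronwall:
  fixes u :: "real \<Rightarrow> real"
  assumes "\<omega> \<ge> 0" "A \<ge> 0"
    and int: "set_integrable lborel {0..T} u"
    and bdd: "\<And>s. s \<in> {0..T} \<Longrightarrow> u s \<le> B"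
    and le: "\<And>s. s \<in> {0..T} \<Longrightarrow> u s \<le> A + \<omega> * (LINT r:{0..s}|lborel. u r)"
    and s: "s \<in> {0..T}"
  shows "u s \<le> A * exp (\<omega> * s)"
proof -
  define J where "J r = u r - A * exp (\<omega> * r)" for r
  have int': "set_integrable lborel {0..s} u" if "s \<in> {0..T}" for s
    by (rule set_integrable_subset[OF int]) (use that in auto)
  have J_int: "set_integrable lborel {0..s} J" if "s \<in> {0..T}" for s
    unfolding J_def by (intro set_integral_diff(1) int' that set_integrable_exp)
  have J_le: "J s \<le> \<omega> * (LINT r:{0..s}|lborel. J r)" if s: "s \<in> {0..T}" for s
  proof -
    have "(LINT r:{0..s}|lborel. J r) = (LINT r:{0..s}|lborel. u r) - (LINT r:{0..s}|lborel. A * exp (\<omega> * r))"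
      unfolding J_def by (intro set_integral_diff(2) int' s set_integrable_exp)
    then have "\<omega> * (LINT r:{0..s}|lborel. J r)
      = \<omega> * (LINT r:{0..s}|lborel. u r) - A * (LINT r:{0..s}|lborel. \<omega> * exp (\<omega> * r))"
      by (simp only: set_integral_mult_right right_diff_distrib) simp
    also have "(LINT r:{0..s}|lborel. \<omega> * exp (\<omega> * r)) = exp (\<omega> * s) - 1"
      using s by (intro set_integral_exp) auto
    finally show ?thesis using le[OF s] by (simp add: J_def algebra_simps)
  qed
  define m where "m = (SUP r\<in>{0..T}. exp (- 2 * \<omega> * r) * J r)"
  have bdd_m: "bdd_above ((\<lambda>r. exp (- 2 * \<omega> * r) * J r) ` {0..T})"
  proof (rule bdd_aboveI2)
    fix r assume r: "r \<in> {0..T}"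
    have "J r \<le> \<bar>B\<bar>" using bdd[OF r] \<open>A \<ge> 0\<close> by (simp add: J_def) (smt (verit) exp_gt_zero mult_nonneg_nonneg)
    then have "exp (- 2 * \<omega> * r) * J r \<le> exp (- 2 * \<omega> * r) * \<bar>B\<bar>"
      by simp
    also have "\<dots> \<le> 1 * \<bar>B\<bar>"
      using r \<open>\<omega> \<ge> 0\<close> by (intro mult_right_mono) auto
    finally show "exp (- 2 * \<omega> * r) * J r \<le> \<bar>B\<bar>" by simp
  qed
  have J_m: "J r \<le> exp (2 * \<omega> * r) * m" if r: "r \<in> {0..T}" for r
  proof -
    have "exp (- 2 * \<omega> * r) * J r \<le> m"
      unfolding m_def by (rule cSUP_upper[OF r bdd_m])
    then have "exp (2 * \<omega> * r) * (exp (- 2 * \<omega> * r) * J r) \<le> exp (2 * \<omega> * r) * m"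
      by simp
    then show ?thesis by (simp add: exp_minus field_simps)
  qed
  define m' where "m' = max m 0"
  have "exp (- 2 * \<omega> * r) * J r \<le> m' / 2" if r: "r \<in> {0..T}" for r
  proof -
    have "J r \<le> \<omega> * (LINT v:{0..r}|lborel. J v)" by (rule J_le[OF r])
    also have "\<dots> \<le> \<omega> * (LINT v:{0..r}|lborel. m' * exp ((2 * \<omega>) * v))"
    proof (intro mult_left_mono set_integral_mono J_int r set_integrable_exp \<open>\<omega> \<ge> 0\<close>)
      fix v assume v: "v \<in> {0..r}"
      have "J v \<le> exp (2 * \<omega> * v) * m" using v r by (intro J_m) auto
      also have "\<dots> \<le> exp (2 * \<omega> * v) * m'" by (simp add: m'_def)
      finally show "J v \<le> m' * exp (2 * \<omega> * v)" by (simp add: mult.commute)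
    qed
    also have "\<dots> = m' / 2 * (LINT v:{0..r}|lborel. (2 * \<omega>) * exp ((2 * \<omega>) * v))"
      by (simp add: algebra_simps)
    also have "\<dots> = m' / 2 * (exp (2 * \<omega> * r) - 1)"
      using r by (subst set_integral_exp) auto
    also have "\<dots> \<le> m' / 2 * exp (2 * \<omega> * r)" by (intro mult_left_mono) (auto simp: m'_def)
    finally show ?thesis by (simp add: exp_minus field_simps)
  qed
  then have "m \<le> m' / 2"
    unfolding m_def using s by (intro cSUP_least) auto
  then have "m \<le> 0" by (simp add: m'_def max_def split: if_splits)
  then have "J s \<le> 0" using J_m[OF s] by (smt (verit) exp_gt_zero mult_nonneg_nonpos)
  then show ?thesis by (simp add: J_def)
qed

section \<open>Bounded continuous functions, convergence in probability, and equality of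
  laws\<close>

lemma abs_min_1: "0 \<le> a \<Longrightarrow> \<bar>min 1 a\<bar> \<le> (1::real)"
  by simp

lemma bcontfun_continuous: "f \<in> bcontfun \<Longrightarrow> continuous_on UNIV f"
  by (simp add: bcontfun_def)

lemma bcontfun_bounded:
  fixes f :: "'a::topological_space \<Rightarrow> real"
  assumes "f \<in> bcontfun"
  shows "\<exists>B\<ge>0. \<forall>x. \<bar>f x\<bar> \<le> B"
proof -
  have "bounded (range f)" using assms by (simp add: bcontfun_def)
  then obtain C where "\<forall>y\<in>range f. norm y \<le> C" unfolding bounded_iff by blast
  then have "\<forall>x. \<bar>f x\<bar> \<le> \<bar>C\<bar>" by (force intro: order_trans)
  then show ?thesis by (intro exI[of _ "\<bar>C\<bar>"]) simp
qed

lemma bcontfunI_abs: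
  fixes f :: "'a::topological_space \<Rightarrow> real"
  assumes "continuous_on UNIV f" "\<And>x. \<bar>f x\<bar> \<le> C"
  shows "f \<in> bcontfun"
  using assms unfolding bcontfun_def bounded_iff by auto

lemma (in prob_space) integrable_bounded_real:
  fixes f :: "'a \<Rightarrow> real"
  assumes "f \<in> borel_measurable M" "\<And>x. \<bar>f x\<bar> \<le> C"
  shows "integrable M f"
  using assms by (intro integrable_const_bound[where B = C]) auto

lemma (in prob_space) abs_expectation_le:
  fixes f :: "'a \<Rightarrow> real"
  assumes "f \<in> borel_measurable M" "\<And>x. \<bar>f x\<bar> \<le> C"
  shows "\<bar>expectation f\<bar> \<le> C"
proof -
  have "\<bar>expectation f\<bar> \<le> expectation (\<lambda>x. \<bar>f x\<bar>)" by simp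
  also have "\<dots> \<le> expectation (\<lambda>_. C)"
    using assms by (intro integral_mono integrable_bounded_real[where C="\<bar>C\<bar>"]) (auto intro: order_trans[OF assms(2)])
  finally show ?thesis by (simp add: prob_space)
qed

text \<open>Truncation at 1 turns convergence in probability into convergence in mean without
  integrability of \<open>R n\<close>. An almost surely convergent subsequence follows, and the
  truncation is inactive once the values are below 1.\<close>

lemma (in prob_space) exists_AE_subseq_min_norm:
  fixes R :: "nat \<Rightarrow> 'a \<Rightarrow> real"
  assumes R[measurable]: "\<And>n. R n \<in> borel_measurable M"
    and nonneg: "\<And>n x. 0 \<le> R n x"
    and lim: "(\<lambda>n. expectation (\<lambda>x. min 1 (R n x))) \<longlonglongrightarrow> 0"
  obtains r :: "nat \<Rightarrow> nat" where "strict_mono r" "AE x in M. (\<lambda>n. R (r n) x) \<longlonglongrightarrow> 0"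
proof -
  have "\<exists>r::nat\<Rightarrow>nat. strict_mono r \<and> (AE x in M. (\<lambda>n. min 1 (R (r n) x)) \<longlonglongrightarrow> 0)"
  proof (rule tendsto_L1_AE_subseq)
    show "integrable M (\<lambda>x. min 1 (R n x))" for n
      using nonneg by (intro integrable_bounded_real[where C=1]) (auto simp: abs_if not_less intro: order_trans[of _ 0])
    show "(\<lambda>n. expectation (\<lambda>x. norm (min 1 (R n x)))) \<longlonglongrightarrow> 0"
      using lim nonneg by (simp add: abs_of_nonneg)
  qed
  then obtain r :: "nat \<Rightarrow> nat" where r: "strict_mono r" and ae: "AE x in M. (\<lambda>n. min 1 (R (r n) x)) \<longlonglongrightarrow> 0"
    by blast
  have "(\<lambda>n. R (r n) x) \<longlonglongrightarrow> 0" if "(\<lambda>n. min 1 (R (r n) x)) \<longlonglongrightarrow> 0" for x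
  proof -
    have "eventually (\<lambda>n. min 1 (R (r n) x) < 1) sequentially"
      using that by (rule order_tendstoD) simp
    then have "eventually (\<lambda>n. min 1 (R (r n) x) = R (r n) x) sequentially"
      by eventually_elim auto
    then show ?thesis using that by (simp add: filterlim_cong)
  qed
  with ae have "AE x in M. (\<lambda>n. R (r n) x) \<longlonglongrightarrow> 0" by (auto elim: AE_mp)
  with r show ?thesis by (rule that)
qed

text \<open>The general way in which convergence in probability is used: it may be treated as almost
  sure convergence, by passing to subsequences of subsequences.\<close>

lemma (in prob_space) expectation_tendsto_0_of_min:
  fixes R \<Phi> :: "nat \<Rightarrow> 'a \<Rightarrow> real"
  assumes R: "\<And>n. R n \<in> borel_measurable M" "\<And>n x. 0 \<le> R n x"
    and lim: "(\<lambda>n. expectation (\<lambda>x. min 1 (R n x))) \<longlonglongrightarrow> 0"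
    and \<Phi>[measurable]: "\<And>n. \<Phi> n \<in> borel_measurable M" and bdd: "\<And>n x. \<bar>\<Phi> n x\<bar> \<le> C"
    and imp: "AE x in M. \<forall>r. strict_mono r \<longrightarrow> (\<lambda>n. R (r n) x) \<longlonglongrightarrow> 0 \<longrightarrow> (\<lambda>n. \<Phi> (r n) x) \<longlonglongrightarrow> 0"
  shows "(\<lambda>n. expectation (\<Phi> n)) \<longlonglongrightarrow> 0"
proof (rule ccontr)
  assume "\<not> ?thesis"
  then obtain \<epsilon> where "\<epsilon> > 0" and "\<not> (\<forall>\<^sub>F n in sequentially. \<bar>expectation (\<Phi> n)\<bar> < \<epsilon>)"
    unfolding tendsto_iff by auto
  then have "infinite {n. \<not> \<bar>expectation (\<Phi> n)\<bar> < \<epsilon>}"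
    by (simp add: cofinite_eq_sequentially[symmetric] eventually_cofinite)
  then obtain r :: "nat \<Rightarrow> nat" where r: "strict_mono r" and ge: "\<And>n. \<not> \<bar>expectation (\<Phi> (r n))\<bar> < \<epsilon>"
    by (auto dest: infinite_enumerate)
  obtain r' :: "nat \<Rightarrow> nat" where r': "strict_mono r'" "AE x in M. (\<lambda>n. R (r (r' n)) x) \<longlonglongrightarrow> 0"
    using exists_AE_subseq_min_norm[of "\<lambda>n. R (r n)"] R LIMSEQ_subseq_LIMSEQ[OF lim r]
    by (auto simp: o_def)
  have sm: "strict_mono (\<lambda>n. r (r' n))" using strict_mono_o[OF r r'(1)] by (simp add: o_def)
  have "AE x in M. (\<lambda>n. \<Phi> (r (r' n)) x) \<longlonglongrightarrow> 0"
    using imp r'(2) by eventually_elim (use sm in auto)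
  then have "(\<lambda>n. expectation (\<Phi> (r (r' n)))) \<longlonglongrightarrow> expectation (\<lambda>_. 0)"
    using bdd by (intro integral_dominated_convergence[where w = "\<lambda>_. C"]) auto
  then have "\<forall>\<^sub>F n in sequentially. \<bar>expectation (\<Phi> (r (r' n)))\<bar> < \<epsilon>"
    using \<open>\<epsilon> > 0\<close> by (simp add: tendsto_iff)
  then show False using ge by (auto simp: eventually_sequentially)
qed

text \<open>Nonemptiness matters: \<open>infdist x {}\<close> is 0 by convention, and the functions
  would be constantly 1.\<close>

lemma closed_indicator_limit:
  fixes C :: "'a::metric_space set"
  assumes "closed C" "C \<noteq> {}"
  shows "(\<lambda>n. max 0 (1 - real n * infdist x C)) \<longlonglongrightarrow> indicator C x"
proof (cases "x \<in> C")
  case True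
  then show ?thesis by simp
next
  case False
  then have pos: "infdist x C > 0"
    using assms in_closed_iff_infdist_zero[of C x] infdist_nonneg[of x C] by auto
  obtain N :: nat where N: "1 / infdist x C < N" using reals_Archimedean2 by blast
  have "eventually (\<lambda>n. max 0 (1 - real n * infdist x C) = 0) sequentially"
    using eventually_ge_at_top[of N]
  proof eventually_elim
    case (elim n)
    have "1 < real N * infdist x C" using N pos by (simp add: field_simps)
    also have "\<dots> \<le> real n * infdist x C" using elim pos by simp
    finally show ?case by simp
  qed
  then show ?thesis using False by (simp add: tendsto_eventually)
qed

text \<open>Closed sets form an intersection-stable generator, and the indicator of a nonempty one
  is a bounded limit of continuous functions.\<close>

lemma borel_measure_eqI_bcontfun:
  fixes M N :: "'a::{metric_space} measure"
  assumes M: "prob_space M" "sets M = sets borel" and N: "prob_space N" "sets N = sets borel"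
    and eq: "\<And>f. f \<in> bcontfun \<Longrightarrow> (\<integral>x. f x \<partial>M) = (\<integral>x. f x \<partial>N :: real)"
  shows "M = N"
proof (rule measure_eqI_generator_eq[where A = "\<lambda>_. UNIV"])
  interpret M: prob_space M by fact
  interpret N: prob_space N by fact
  show "Int_stable (Collect closed :: 'a set set)" by (auto simp: Int_stable_def)
  show "sets M = sigma_sets UNIV (Collect closed)" "sets N = sigma_sets UNIV (Collect closed)"
    using M N by (simp_all add: borel_eq_closed)
  show "emeasure M C = emeasure N C" if "C \<in> Collect closed" for C
  proof (cases "C = {}")
    case False
    from that have C: "closed C" by simp
    let ?f = "\<lambda>n x. max 0 (1 - real n * infdist x C)"
    have f: "?f n \<in> bcontfun" for n
      by (rule bcontfunI_abs[where C = 1]) (auto intro!: continuous_intros infdist_nonneg mult_nonneg_nonneg)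
    have meas: "?f n \<in> borel_measurable borel" for n
      by (rule borel_measurable_continuous_onI) (auto intro!: continuous_intros)
    have "(\<lambda>n. \<integral>x. ?f n x \<partial>K) \<longlonglongrightarrow> (\<integral>x. indicator C x \<partial>K)" if "prob_space K" "sets K = sets borel" for K
    proof -
      interpret K: prob_space K by fact
      have [measurable]: "?f n \<in> borel_measurable K" "C \<in> sets K" for n
        using meas that C by (auto cong: measurable_cong_sets)
      show ?thesis
        by (rule integral_dominated_convergence[where w = "\<lambda>_. 1"])
           (use closed_indicator_limit[OF C False] in \<open>auto intro!: infdist_nonneg mult_nonneg_nonneg\<close>)
    qed
    from this[OF M] this[OF N] have "(\<integral>x. indicator C x \<partial>M) = (\<integral>x. indicator C x \<partial>N :: real)"
      using eq[OF f] by (simp add: LIMSEQ_unique)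
    then show ?thesis
      using C M N by (simp add: M.emeasure_eq_measure N.emeasure_eq_measure sets_eq_imp_space_eq[of _ borel])
  qed simp
  show "emeasure M UNIV \<noteq> \<infinity>"
    using prob_space.emeasure_space_1[OF M(1)] sets_eq_imp_space_eq[OF M(2)] by simp
qed auto

section \<open>A bounded Lyapunov function for random walks\<close>

text \<open>Bounded, smooth and comparable with \<open>min 1 ((norm x)\<^sup>2)\<close>, hence
  matched to the integral in hypothesis (1). Being bounded by 1, it charges a large jump no more
  than 1.\<close>

definition bump :: "'a::real_inner \<Rightarrow> real" where
  "bump x = (norm x)\<^sup>2 / (1 + (norm x)\<^sup>2)"

lemma bump_nonneg: "0 \<le> bump x"
  by (simp add: bump_def)

lemma bump_le_1: "bump x \<le> 1"
proof -
  have "1 + (norm x)\<^sup>2 > 0" by (simp add: add_pos_nonneg)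
  then show ?thesis by (simp add: bump_def field_simps)
qed

lemma abs_bump_le: "\<bar>bump x\<bar> \<le> 1"
  by (simp add: bump_nonneg bump_le_1)

lemma bump_0 [simp]: "bump 0 = 0"
  by (simp add: bump_def)

lemma bump_minus: "bump (- x) = bump x"
  by (simp add: bump_def)

lemma continuous_on_bump: "continuous_on UNIV (bump :: 'a::real_inner \<Rightarrow> real)"
proof -
  have "1 + (norm x)\<^sup>2 \<noteq> 0" for x :: 'a
    by (metis add.commute add_pos_nonneg less_irrefl zero_le_power2 zero_less_one)
  then show ?thesis unfolding bump_def[abs_def] by (intro continuous_intros) auto
qed

lemma borel_measurable_bump [measurable]: "(bump :: 'a::real_inner \<Rightarrow> real) \<in> borel_measurable borel"
  by (rule borel_measurable_continuous_onI[OF continuous_on_bump])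

lemma bump_eq: "bump x = 1 - 1 / (1 + (norm x)\<^sup>2)"
proof -
  have "1 + (norm x)\<^sup>2 > 0" by (simp add: add_pos_nonneg)
  then show ?thesis by (simp add: bump_def field_simps)
qed

lemma bump_mono: "norm x \<le> norm y \<Longrightarrow> bump x \<le> bump y"
  unfolding bump_eq by (intro diff_left_mono divide_left_mono) (auto intro: power_mono simp: add_pos_nonneg)

text \<open>The square of \<open>min 1 (norm x)\<close> is at most twice the bump, and a number
  \<open>m > \<epsilon>\<close> is at most \<open>m\<^sup>2 / \<epsilon>\<close>. The free
  \<open>\<epsilon>\<close> lets expected bumps control convergence in probability.\<close>

lemma min_norm_le_bump:
  assumes "\<epsilon> > 0"
  shows "min 1 (norm x) \<le> \<epsilon> + 2 / \<epsilon> * bump x"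
proof -
  have sq: "(min 1 (norm x))\<^sup>2 \<le> 2 * bump x"
  proof (cases "norm x \<le> 1")
    case True
    then have "(norm x)\<^sup>2 \<le> 1" by (simp add: power_le_one)
    then have "(norm x)\<^sup>2 * (1 + (norm x)\<^sup>2) \<le> (norm x)\<^sup>2 * 2" by (intro mult_left_mono) auto
    moreover have "1 + (norm x)\<^sup>2 > 0" by (simp add: add_pos_nonneg)
    ultimately show ?thesis using True by (simp add: bump_def field_simps)
  next
    case False
    then have "1 \<le> (norm x)\<^sup>2" by (simp add: one_le_power)
    then show ?thesis using False by (simp add: bump_def field_simps add_pos_nonneg)
  qed
  let ?m = "min 1 (norm x)"
  show ?thesis
  proof (cases "?m \<le> \<epsilon>")
    case True
    have "0 \<le> 2 / \<epsilon> * bump x" using assms bump_nonneg[of x] by simp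
    then show ?thesis using True by linarith
  next
    case False
    have "\<epsilon> * ?m \<le> ?m * ?m" using False assms by (intro mult_right_mono) auto
    then have "\<epsilon> * ?m \<le> 2 * bump x" using sq by (simp add: power2_eq_square)
    then have "?m \<le> 2 / \<epsilon> * bump x" using assms by (simp add: field_simps)
    then show ?thesis using assms by linarith
  qed
qed

text \<open>A second-order Taylor bound whose remainder is uniform in \<open>x\<close>; the linear
  coefficient comes from the gradient \<open>2 x / (1 + |x|^2)^2\<close>. The uniformity makes the
  drift bound of a walk independent of its position.\<close>

lemma bump_add_le:
  fixes x y :: "'a::real_inner"
  assumes "norm y \<le> 1"
  shows "bump (x + y) \<le> bump x + (2 / (1 + (norm x)\<^sup>2)\<^sup>2) * (x \<bullet> y) + 2 * (norm y)\<^sup>2"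
proof -
  define a b p q where "a = (norm x)\<^sup>2" "b = (norm (x + y))\<^sup>2" "p = x \<bullet> y" "q = (norm y)\<^sup>2"
  have b: "b = a + 2 * p + q"
    unfolding a_b_p_q_def by (simp add: power2_norm_eq_inner inner_add_left inner_add_right inner_commute)
  have nn: "a \<ge> 0" "b \<ge> 0" "q \<ge> 0" by (simp_all add: a_b_p_q_def)
  define G G' where "G = 1 / (1 + a)" "G' = 1 / (1 + b)"
  have G: "0 \<le> G" "G \<le> 1" "0 \<le> G'" "G' \<le> 1" using nn by (simp_all add: G_G'_def)
  \<comment> \<open>The difference of the fractions is \<open>G - G' = (2 * p + q) * G * G'\<close>;
    in its part \<open>2 * p * G * G'\<close> the factor \<open>G'\<close> is replaced by
    \<open>G - (2 * p + q) * G * G'\<close>. The term quadratic in \<open>p\<close> then has a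
    favourable sign.\<close>
  have "b / (1 + b) - a / (1 + a) - 2 * G\<^sup>2 * p = q * G * G' - 4 * p\<^sup>2 * (G\<^sup>2 * G') - (2 * p * G) * q * (G * G')"
  proof -
    have n1: "1 + a \<noteq> 0" "1 + a + 2 * p + q \<noteq> 0" using nn b by auto
    show ?thesis unfolding G_G'_def b using n1
      by (simp add: divide_simps power2_eq_square) (simp add: algebra_simps power2_eq_square)
  qed
  also have "\<dots> \<le> q + 0 + q"
  proof -
    have "q * G * G' \<le> q * 1 * 1" using G nn by (intro mult_mono) auto
    moreover have "0 \<le> 4 * p\<^sup>2 * (G\<^sup>2 * G')" using G by simp
    moreover have "\<bar>2 * p * G\<bar> \<le> 1"
    proof -
      have "\<bar>p\<bar> \<le> norm x * norm y" unfolding a_b_p_q_def by (rule Cauchy_Schwarz_ineq2)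
      also have "\<dots> \<le> norm x * 1" using assms by (intro mult_left_mono) auto
      finally have "2 * \<bar>p\<bar> \<le> 2 * norm x" by simp
      also have "\<dots> \<le> 1 + a" using sum_squares_bound[of 1 "norm x"] by (simp add: a_b_p_q_def)
      finally show ?thesis using nn by (simp add: G_G'_def abs_mult field_simps)
    qed
    then have "\<bar>(2 * p * G) * (q * (G * G'))\<bar> \<le> 1 * (q * (1 * 1))"
      using G nn unfolding abs_mult by (intro mult_mono) (auto simp: abs_mult intro!: mult_mono mult_nonneg_nonneg mult_le_one)
    ultimately show ?thesis by (simp add: algebra_simps)
  qed
  finally show ?thesis
    by (simp add: bump_def G_G'_def a_b_p_q_def power_divide)
qed

text \<open>At \<open>R = 1\<close> this is the quantity that hypothesis (1) bounds by a multiple of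
  \<open>h\<close>. For other \<open>R\<close> it is the same quantity for jumps rescaled by
  \<open>R\<close>.\<close>

definition spread :: "'a::euclidean_space measure \<Rightarrow> real \<Rightarrow> real" where
  "spread \<mu> R = (\<integral>y. min 1 ((norm y / R)\<^sup>2) \<partial>\<mu>) + norm (LINT y:{y. norm y \<le> R}|\<mu>. y) / R"

lemma spread_nonneg: "R > 0 \<Longrightarrow> 0 \<le> spread \<mu> R"
  unfolding spread_def by (intro add_nonneg_nonneg Bochner_Integration.integral_nonneg) auto

locale noise = prob_space \<mu> for \<mu> :: "'a::euclidean_space measure" +
  assumes sets_noise [measurable_cong]: "sets \<mu> = sets borel"
begin

lemma space_noise [simp]: "space \<mu> = UNIV"
  using sets_eq_imp_space_eq[OF sets_noise] by simp

lemma prob_UNIV [simp]: "prob UNIV = 1"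
  using prob_space by simp

sublocale S: sequence_space \<mu> ..

abbreviation W :: "(nat \<Rightarrow> 'a) measure" where "W \<equiv> \<Pi>\<^sub>M i\<in>UNIV. \<mu>"

lemma set_integrable_ball: "set_integrable \<mu> {y. norm y \<le> R} (\<lambda>y. y)"
  unfolding set_integrable_def
  by (rule integrable_const_bound[where B = "\<bar>R\<bar>"]) (auto simp: indicator_def)

text \<open>For \<open>norm y \<le> R\<close> the Taylor bound of the rescaled bump is integrated. A
  larger jump costs at most 1, which the truncated square already counts. The gradient
  \<open>c\<close> has norm at most 1, so the linear term costs no more than the truncated
  mean.\<close>

lemma expectation_bump_le:
  assumes "R > 0"
  shows "(\<integral>y. bump ((z + y) /\<^sub>R R) \<partial>\<mu>) \<le> bump (z /\<^sub>R R) + 2 * spread \<mu> R"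
proof -
  define x where "x = z /\<^sub>R R"
  define c where "c = (2 / (1 + (norm x)\<^sup>2)\<^sup>2) *\<^sub>R x"
  have c: "norm c \<le> 1"
  proof -
    have pos: "1 + (norm x)\<^sup>2 \<ge> 1" by simp
    have "2 * norm x \<le> 1 + (norm x)\<^sup>2" using sum_squares_bound[of 1 "norm x"] by simp
    also have "\<dots> \<le> (1 + (norm x)\<^sup>2)\<^sup>2" using self_le_power[OF pos, of 2] by simp
    finally show ?thesis using pos by (simp add: c_def divide_le_eq mult.commute)
  qed
  have *: "bump ((z + y) /\<^sub>R R) \<le> bump x + 2 * min 1 ((norm y / R)\<^sup>2) + c \<bullet> (indicator {y. norm y \<le> R} y *\<^sub>R y) / R" for y
  proof (cases "norm y \<le> R")
    case True
    have "bump (x + y /\<^sub>R R) \<le> bump x + (2 / (1 + (norm x)\<^sup>2)\<^sup>2) * (x \<bullet> (y /\<^sub>R R)) + 2 * (norm (y /\<^sub>R R))\<^sup>2"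
      using True assms by (intro bump_add_le) (simp add: field_simps)
    moreover have "norm (y /\<^sub>R R) = norm y / R" using assms by (simp add: field_simps)
    moreover have "(norm y / R)\<^sup>2 \<le> 1" using True assms by (simp add: power_le_one)
    ultimately show ?thesis using True
      by (simp add: c_def x_def scaleR_add_right field_simps min_absorb2)
  next
    case False
    then have "1 \<le> (norm y / R)\<^sup>2" using assms by (simp add: one_le_power)
    then have "2 * min 1 ((norm y / R)\<^sup>2) = 2" by simp
    moreover have "bump ((z + y) /\<^sub>R R) \<le> 1" "0 \<le> bump x" by (simp_all add: bump_le_1 bump_nonneg)
    ultimately show ?thesis using False by simp
  qed
  have i1: "integrable \<mu> (\<lambda>y. min 1 ((norm y / R)\<^sup>2))"
    by (rule integrable_bounded_real[where C = 1]) (auto simp: abs_min_1)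
  have i2: "integrable \<mu> (\<lambda>y. indicator {y. norm y \<le> R} y *\<^sub>R y)"
    using set_integrable_ball by (simp add: set_integrable_def)
  have "(\<integral>y. bump ((z + y) /\<^sub>R R) \<partial>\<mu>)
      \<le> (\<integral>y. bump x + 2 * min 1 ((norm y / R)\<^sup>2) + c \<bullet> (indicator {y. norm y \<le> R} y *\<^sub>R y) / R \<partial>\<mu>)"
  proof (rule integral_mono)
    show "integrable \<mu> (\<lambda>y. bump ((z + y) /\<^sub>R R))"
      by (rule integrable_bounded_real[where C = 1]) (auto simp: abs_bump_le)
    show "integrable \<mu> (\<lambda>y. bump x + 2 * min 1 ((norm y / R)\<^sup>2) + c \<bullet> (indicator {y. norm y \<le> R} y *\<^sub>R y) / R)"
      by (intro Bochner_Integration.integrable_add integrable_mult_right integrable_divide integrable_inner_right impI i1 i2) auto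
  qed (use * in blast)
  also have "\<dots> = bump x + 2 * (\<integral>y. min 1 ((norm y / R)\<^sup>2) \<partial>\<mu>)
      + c \<bullet> (LINT y:{y. norm y \<le> R}|\<mu>. y) / R"
    using i1 i2 by (simp add: prob_space set_lebesgue_integral_def del: inner_scaleR_right)
  also have "c \<bullet> (LINT y:{y. norm y \<le> R}|\<mu>. y) \<le> norm (LINT y:{y. norm y \<le> R}|\<mu>. y)"
    using norm_cauchy_schwarz[of c "LINT y:{y. norm y \<le> R}|\<mu>. y"] c
    by (smt (verit) mult_left_le_one_le norm_ge_zero)
  finally have "(\<integral>y. bump ((z + y) /\<^sub>R R) \<partial>\<mu>) \<le> bump x + 2 * (\<integral>y. min 1 ((norm y / R)\<^sup>2) \<partial>\<mu>)
      + norm (LINT y:{y. norm y \<le> R}|\<mu>. y) / R"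
    using assms by (simp add: divide_right_mono)
  moreover have "0 \<le> norm (LINT y:{y. norm y \<le> R}|\<mu>. y) / R" using assms by simp
  moreover have "a \<le> b + 2 * c + d \<Longrightarrow> 0 \<le> d \<Longrightarrow> a \<le> b + 2 * (c + d)" for a b c d :: real by simp
  ultimately show ?thesis unfolding spread_def x_def by blast
qed

lemma nn_integral_bump_le:
  assumes "R > 0"
  shows "(\<integral>\<^sup>+y. ennreal (bump ((z + y) /\<^sub>R R)) \<partial>\<mu>) \<le> ennreal (bump (z /\<^sub>R R)) + ennreal (2 * spread \<mu> R)"
proof -
  have "(\<integral>\<^sup>+y. ennreal (bump ((z + y) /\<^sub>R R)) \<partial>\<mu>) = ennreal (\<integral>y. bump ((z + y) /\<^sub>R R) \<partial>\<mu>)"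
    by (intro nn_integral_eq_integral integrable_bounded_real[where C = 1]) (auto simp: bump_nonneg bump_le_1 abs_bump_le)
  also have "\<dots> \<le> ennreal (bump (z /\<^sub>R R) + 2 * spread \<mu> R)"
    by (intro ennreal_leI expectation_bump_le assms)
  finally show ?thesis using spread_nonneg[OF assms, of \<mu>] by (simp add: ennreal_plus bump_nonneg)
qed

text \<open>Jumps beyond \<open>M\<close> contribute at most their probability to each of the two
  summands of \<open>spread \<mu> R\<close>; the rest is seen at scale \<open>R\<close> and
  contributes order \<open>M\<^sup>2 / R\<close>. With the tails small by hypothesis (2) and
  \<open>R\<close> large in comparison with \<open>M\<^sup>2\<close>, this becomes a small multiple
  of \<open>h\<close>.\<close>

lemma spread_le:
  assumes "1 \<le> M" "M \<le> R"
  shows "spread \<mu> R \<le> 2 * measure \<mu> {y. norm y > M} + 3 * M\<^sup>2 / R * spread \<mu> 1"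
proof -
  have R: "R > 0" using assms by simp
  let ?q = "\<lambda>y::'a. min 1 ((norm y)\<^sup>2)"
  let ?I = "\<lambda>y. indicator {y. norm y > M} y :: real"
  have q[simp]: "integrable \<mu> ?q" by (rule integrable_bounded_real[where C = 1]) (auto simp: abs_min_1)
  have I[simp]: "integrable \<mu> ?I" by (rule integrable_bounded_real[where C = 1]) (auto simp: indicator_def)
  have qM: "(norm y)\<^sup>2 \<le> M\<^sup>2 * ?q y" if "norm y \<le> M" for y :: 'a
  proof (cases "(norm y)\<^sup>2 \<le> 1")
    case True
    have "1 * (norm y)\<^sup>2 \<le> M\<^sup>2 * (norm y)\<^sup>2" using assms by (intro mult_right_mono) auto
    then show ?thesis using True by simp
  next
    case False
    then show ?thesis using that by (simp add: power_mono)
  qed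
  have MR: "M\<^sup>2 / R\<^sup>2 \<le> M\<^sup>2 / R"
  proof -
    have "R \<le> R\<^sup>2" using assms by (simp add: self_le_power)
    then show ?thesis using R by (intro divide_left_mono) auto
  qed
  have "(\<integral>y. min 1 ((norm y / R)\<^sup>2) \<partial>\<mu>) \<le> (\<integral>y. ?I y + M\<^sup>2 / R\<^sup>2 * ?q y \<partial>\<mu>)"
  proof (rule integral_mono)
    show "integrable \<mu> (\<lambda>y. min 1 ((norm y / R)\<^sup>2))"
      by (rule integrable_bounded_real[where C = 1]) (auto simp: abs_min_1)
    fix y :: 'a
    show "min 1 ((norm y / R)\<^sup>2) \<le> ?I y + M\<^sup>2 / R\<^sup>2 * ?q y"
    proof (cases "norm y \<le> M")
      case True
      have "(norm y / R)\<^sup>2 \<le> M\<^sup>2 * ?q y / R\<^sup>2"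
        using qM[OF True] R by (simp add: power_divide divide_right_mono)
      then show ?thesis using True by (simp add: min_le_iff_disj)
    next
      case False
      have "0 \<le> M\<^sup>2 / R\<^sup>2 * ?q y" by simp
      moreover have "?I y = 1" "min 1 ((norm y / R)\<^sup>2) \<le> 1" using False by auto
      ultimately show ?thesis by linarith
    qed
  qed simp
  also have "\<dots> = measure \<mu> {y. norm y > M} + M\<^sup>2 / R\<^sup>2 * (\<integral>y. ?q y \<partial>\<mu>)" by simp
  also have "\<dots> \<le> measure \<mu> {y. norm y > M} + M\<^sup>2 / R * (\<integral>y. ?q y \<partial>\<mu>)"
    using MR by (intro add_left_mono mult_right_mono Bochner_Integration.integral_nonneg) auto
  finally have 1: "(\<integral>y. min 1 ((norm y / R)\<^sup>2) \<partial>\<mu>) \<le> measure \<mu> {y. norm y > M} + M\<^sup>2 / R * (\<integral>y. ?q y \<partial>\<mu>)" .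

  let ?B = "\<lambda>r. indicator {y::'a. norm y \<le> r} :: 'a \<Rightarrow> real"
  have i: "integrable \<mu> (\<lambda>y. ?B r y *\<^sub>R y)" for r
    using set_integrable_ball by (simp add: set_integrable_def)
  \<comment> \<open>The hypothesis controls the mean over \<open>norm y \<le> 1\<close>, so the
    truncation level is moved from 1 to \<open>R\<close>. Jumps in between are bounded by
    \<open>M\<close> or, on the tail event, by \<open>R\<close>.\<close>
  have "(LINT y:{y. norm y \<le> R}|\<mu>. y) - (LINT y:{y. norm y \<le> 1}|\<mu>. y) = (\<integral>y. ?B R y *\<^sub>R y - ?B 1 y *\<^sub>R y \<partial>\<mu>)"
    using i by (simp add: set_lebesgue_integral_def)
  also have "norm \<dots> \<le> (\<integral>y. norm (?B R y *\<^sub>R y - ?B 1 y *\<^sub>R y) \<partial>\<mu>)" by (rule integral_norm_bound)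
  also have "\<dots> \<le> (\<integral>y. R * ?I y + M * ?q y \<partial>\<mu>)"
  proof (intro integral_mono integrable_norm)
    show "integrable \<mu> (\<lambda>y. ?B R y *\<^sub>R y - ?B 1 y *\<^sub>R y)" using i by simp
    fix y :: 'a
    consider "norm y \<le> 1" | "1 < norm y" "norm y \<le> M" | "M < norm y" "norm y \<le> R" | "norm y > R" "norm y > M" "norm y > 1"
      using assms by linarith
    then show "norm (?B R y *\<^sub>R y - ?B 1 y *\<^sub>R y) \<le> R * ?I y + M * ?q y"
    proof cases
      case 1 then show ?thesis using assms by (auto intro!: add_nonneg_nonneg mult_nonneg_nonneg)
    next
      case 2
      then have "?q y = 1" by (simp add: one_le_power)
      then show ?thesis using 2 assms by simp
    next
      case 3
      have "0 \<le> M * ?q y" using assms by simp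
      then show ?thesis using 3 assms by simp
    next
      case 4 then show ?thesis using assms by (auto intro!: add_nonneg_nonneg mult_nonneg_nonneg)
    qed
  qed auto
  also have "\<dots> = R * measure \<mu> {y. norm y > M} + M * (\<integral>y. ?q y \<partial>\<mu>)" by simp
  finally have "norm (LINT y:{y. norm y \<le> R}|\<mu>. y) \<le> norm (LINT y:{y. norm y \<le> 1}|\<mu>. y)
      + (R * measure \<mu> {y. norm y > M} + M * (\<integral>y. ?q y \<partial>\<mu>))"
    using norm_triangle_sub by (smt (verit))
  then have "norm (LINT y:{y. norm y \<le> R}|\<mu>. y) / R \<le> (norm (LINT y:{y. norm y \<le> 1}|\<mu>. y)
      + (R * measure \<mu> {y. norm y > M} + M * (\<integral>y. ?q y \<partial>\<mu>))) / R"
    using R by (simp add: divide_right_mono)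
  also have "\<dots> = norm (LINT y:{y. norm y \<le> 1}|\<mu>. y) / R + measure \<mu> {y. norm y > M} + M / R * (\<integral>y. ?q y \<partial>\<mu>)"
    using R by (simp add: field_simps)
  finally have 2: "norm (LINT y:{y. norm y \<le> R}|\<mu>. y) / R
     \<le> norm (LINT y:{y. norm y \<le> 1}|\<mu>. y) / R + measure \<mu> {y. norm y > M} + M / R * (\<integral>y. ?q y \<partial>\<mu>)" .
  let ?A = "\<integral>y. ?q y \<partial>\<mu>" and ?m = "norm (LINT y:{y. norm y \<le> 1}|\<mu>. y)"
  have sp1: "spread \<mu> 1 = ?A + ?m" by (simp add: spread_def)
  have A: "0 \<le> ?A" by (rule Bochner_Integration.integral_nonneg) auto
  have "1 \<le> M\<^sup>2" "M \<le> M\<^sup>2" using assms by (auto simp: self_le_power)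
  then have "1 / R * ?m \<le> 3 * M\<^sup>2 / R * ?m" "M / R * ?A \<le> M\<^sup>2 / R * ?A"
    using R A by (auto intro!: mult_right_mono divide_right_mono simp del: times_divide_eq_left mult_le_cancel_right2 mult_le_cancel_right1)
  moreover have "3 * M\<^sup>2 / R * spread \<mu> 1 = 3 * M\<^sup>2 / R * ?m + 3 * (M\<^sup>2 / R * ?A)"
    unfolding sp1 by (simp add: algebra_simps)
  moreover have "0 \<le> M\<^sup>2 / R * ?A" using R A by simp
  ultimately show ?thesis using 1 2 unfolding spread_def[of \<mu> R] by simp
qed

end

section \<open>Recursions driven by independent noise\<close>

primrec chain :: "('s \<Rightarrow> 'a \<Rightarrow> 's) \<Rightarrow> 's \<Rightarrow> (nat \<Rightarrow> 'a) \<Rightarrow> nat \<Rightarrow> 's" where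
  "chain f s \<xi> 0 = s"
| "chain f s \<xi> (Suc k) = f (chain f s \<xi> k) (\<xi> k)"

text \<open>The product measure splits off the first coordinate, and the outermost factor of an
  operator power belongs to the first step; both call for a recursion in the first input.\<close>

lemma chain_front: "chain f s \<xi> (Suc k) = chain f (f s (\<xi> 0)) (\<lambda>i. \<xi> (Suc i)) k"
  by (induction k) simp_all

lemma chain_case_nat: "chain f s (case_nat y \<xi>) (Suc k) = chain f (f s y) \<xi> k"
  unfolding chain_front by simp

lemma measurable_chain:
  assumes f: "(\<lambda>(s, y). f s y) \<in> N \<Otimes>\<^sub>M B \<rightarrow>\<^sub>M N" and s: "s \<in> space N"
  shows "(\<lambda>\<xi>. chain f s \<xi> k) \<in> (\<Pi>\<^sub>M i\<in>UNIV. B) \<rightarrow>\<^sub>M N"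
proof (induction k)
  case 0
  then show ?case using s by simp
next
  case (Suc k)
  note [measurable] = f Suc
  have "(\<lambda>\<xi>. (\<lambda>(s, y). f s y) (chain f s \<xi> k, \<xi> k)) \<in> (\<Pi>\<^sub>M i\<in>UNIV. B) \<rightarrow>\<^sub>M N"
    by measurable
  then show ?case by simp
qed

definition shift :: "nat \<Rightarrow> (nat \<Rightarrow> 'a) \<Rightarrow> nat \<Rightarrow> 'a" where
  "shift l \<xi> = (\<lambda>i. \<xi> (i + l))"

lemma measurable_shift [measurable]: "shift l \<in> (\<Pi>\<^sub>M i\<in>UNIV. B) \<rightarrow>\<^sub>M (\<Pi>\<^sub>M i\<in>UNIV. B)"
  unfolding shift_def[abs_def] by (intro measurable_PiM_single') (auto simp: space_PiM)

definition walk :: "(nat \<Rightarrow> 'a::ab_group_add) \<Rightarrow> nat \<Rightarrow> 'a" where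
  "walk \<xi> k = (\<Sum>j<k. \<xi> j)"

lemma walk_0 [simp]: "walk \<xi> 0 = 0"
  by (simp add: walk_def)

lemma walk_Suc: "walk \<xi> (Suc k) = walk \<xi> k + \<xi> k"
  by (simp add: walk_def)

lemma walk_add: "walk \<xi> (l + k) = walk \<xi> l + walk (shift l \<xi>) k"
  by (induction k) (simp_all add: walk_Suc shift_def add_ac)

lemma walk_diff: "l \<le> k \<Longrightarrow> walk \<xi> k - walk \<xi> l = walk (shift l \<xi>) (k - l)"
  using walk_add[of \<xi> l "k - l"] by simp

lemma walk_cong: "(\<And>i. i < k \<Longrightarrow> \<xi> i = \<zeta> i) \<Longrightarrow> walk \<xi> k = walk \<zeta> k"
  by (simp add: walk_def)

lemma chain_plus: "chain (+) z \<xi> k = z + walk \<xi> k"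
  by (induction k) (simp_all add: walk_Suc add_ac)

lemma measurable_walk [measurable]:
  "(\<lambda>\<xi>. walk \<xi> k :: 'a::euclidean_space) \<in> borel_measurable (\<Pi>\<^sub>M i\<in>UNIV. borel)"
  unfolding walk_def by measurable

text \<open>The state \<open>(z, n)\<close> records the displacement \<open>z\<close> since the last time the displacement
  exceeded \<open>\<eta>\<close> and the number \<open>n\<close> of such times.\<close>

definition reset_step :: "real \<Rightarrow> 'a::real_normed_vector \<times> nat \<Rightarrow> 'a \<Rightarrow> 'a \<times> nat" where
  "reset_step \<eta> s y = (if norm (fst s + y) > \<eta> then (0, Suc (snd s)) else (fst s + y, snd s))"

definition oscillation_count :: "real \<Rightarrow> (nat \<Rightarrow> 'a::real_normed_vector) \<Rightarrow> nat \<Rightarrow> nat" where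
  "oscillation_count \<eta> \<xi> k = snd (chain (reset_step \<eta>) (0, 0) \<xi> k)"

lemma fst_reset_step: "fst (reset_step \<eta> s y) = (if norm (fst s + y) > \<eta> then 0 else fst s + y)"
  and snd_reset_step: "snd (reset_step \<eta> s y) = (if norm (fst s + y) > \<eta> then Suc (snd s) else snd s)"
  by (simp_all add: reset_step_def)

lemma oscillation_count_mono: "a \<le> b \<Longrightarrow> oscillation_count \<eta> \<xi> a \<le> oscillation_count \<eta> \<xi> b"
  by (rule lift_Suc_mono_le) (auto simp: oscillation_count_def reset_step_def)

lemma reset_chain_norm_le: "0 \<le> \<eta> \<Longrightarrow> norm (fst (chain (reset_step \<eta>) (0, 0) \<xi> k)) \<le> \<eta>"
  by (induction k) (auto simp: reset_step_def)

lemma reset_chain_diff: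
  assumes "a \<le> b" "oscillation_count \<eta> \<xi> a = oscillation_count \<eta> \<xi> b"
  shows "fst (chain (reset_step \<eta>) (0, 0) \<xi> b) - fst (chain (reset_step \<eta>) (0, 0) \<xi> a) = walk \<xi> b - walk \<xi> a"
  using assms
proof (induction b rule: dec_induct)
  case (step b)
  have "oscillation_count \<eta> \<xi> a = oscillation_count \<eta> \<xi> b" "oscillation_count \<eta> \<xi> b = oscillation_count \<eta> \<xi> (Suc b)"
    using oscillation_count_mono[of a b \<eta> \<xi>] oscillation_count_mono[of b "Suc b" \<eta> \<xi>] step by auto
  then show ?case
    using step.IH by (auto simp: oscillation_count_def fst_reset_step snd_reset_step walk_Suc algebra_simps split: if_splits)
qed simp

text \<open>Without a reset in between, both displacements are measured from the same base point and
  have norm at most \<open>\<eta>\<close>; this is the origin of the factor 2.\<close>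

lemma oscillation_count_increase:
  assumes "0 \<le> \<eta>" "a \<le> b" "norm (walk \<xi> b - walk \<xi> a) > 2 * \<eta>"
  shows "Suc (oscillation_count \<eta> \<xi> a) \<le> oscillation_count \<eta> \<xi> b"
proof (rule ccontr)
  assume "\<not> ?thesis"
  then have "oscillation_count \<eta> \<xi> a = oscillation_count \<eta> \<xi> b"
    using oscillation_count_mono[OF assms(2), of \<eta> \<xi>] by simp
  then have "norm (walk \<xi> b - walk \<xi> a) \<le> \<eta> + \<eta>"
    using reset_chain_diff[OF assms(2)] reset_chain_norm_le[OF assms(1), of \<xi>]
    by (metis norm_triangle_le_diff add_mono)
  then show False using assms(3) by simp
qed

context noise
begin

lemma emeasure_noise_UNIV [simp]: "emeasure \<mu> UNIV = 1"
  using emeasure_space_1 by simp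

lemma sets_W [measurable_cong]: "sets W = sets (\<Pi>\<^sub>M i\<in>UNIV. borel)"
  by (intro sets_PiM_cong refl sets_noise)

lemma space_W [simp]: "space W = UNIV"
  by (simp add: space_PiM)

lemma emeasure_W_UNIV [simp]: "emeasure W UNIV = 1"
  using S.P.emeasure_space_1 by simp

lemma measure_W_UNIV [simp]: "measure W UNIV = 1"
  using S.P.prob_space by simp

lemma UNIV_in_sets_W [simp]: "UNIV \<in> sets W"
  using sets.top[of W] by simp

lemma nn_integral_W_first:
  assumes [measurable]: "\<Phi> \<in> borel_measurable W"
  shows "(\<integral>\<^sup>+\<xi>. \<Phi> \<xi> \<partial>W) = (\<integral>\<^sup>+y. \<integral>\<^sup>+\<xi>. \<Phi> (case_nat y \<xi>) \<partial>W \<partial>\<mu>)"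
proof -
  have "(\<integral>\<^sup>+\<xi>. \<Phi> \<xi> \<partial>W) = (\<integral>\<^sup>+\<xi>. \<Phi> \<xi> \<partial>distr (\<mu> \<Otimes>\<^sub>M W) W (\<lambda>(s, \<omega>). case_nat s \<omega>))"
    by (simp add: S.PiM_iter)
  also have "\<dots> = (\<integral>\<^sup>+p. \<Phi> (case_nat (fst p) (snd p)) \<partial>(\<mu> \<Otimes>\<^sub>M W))"
    by (subst nn_integral_distr) (auto simp: split_beta')
  also have "\<dots> = (\<integral>\<^sup>+y. \<integral>\<^sup>+\<xi>. \<Phi> (case_nat y \<xi>) \<partial>W \<partial>\<mu>)"
    by (subst S.P.nn_integral_fst[symmetric]) auto
  finally show ?thesis .
qed

lemma integral_W_first:
  fixes \<Phi> :: "_ \<Rightarrow> real"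
  assumes [measurable]: "\<Phi> \<in> borel_measurable W" and bdd: "\<And>\<xi>. \<bar>\<Phi> \<xi>\<bar> \<le> C"
  shows "(\<integral>\<xi>. \<Phi> \<xi> \<partial>W) = (\<integral>y. \<integral>\<xi>. \<Phi> (case_nat y \<xi>) \<partial>W \<partial>\<mu>)"
proof -
  interpret P: pair_prob_space \<mu> W ..
  have "(\<integral>\<xi>. \<Phi> \<xi> \<partial>W) = (\<integral>\<xi>. \<Phi> \<xi> \<partial>distr (\<mu> \<Otimes>\<^sub>M W) W (\<lambda>(s, \<omega>). case_nat s \<omega>))"
    by (simp add: S.PiM_iter)
  also have "\<dots> = (\<integral>p. \<Phi> (case_nat (fst p) (snd p)) \<partial>(\<mu> \<Otimes>\<^sub>M W))"
    by (subst integral_distr) (auto simp: split_beta')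
  also have "\<dots> = (\<integral>y. \<integral>\<xi>. \<Phi> (case_nat y \<xi>) \<partial>W \<partial>\<mu>)"
    by (subst P.integral_fst'[symmetric]) (auto intro!: P.integrable_bounded_real bdd)
  finally show ?thesis .
qed

text \<open>A Foster-Lyapunov bound. After the first input the chain restarts from
  \<open>f s y\<close>, so the induction generalises the initial state. Values in
  \<open>ennreal\<close> admit an unbounded \<open>V\<close>, such as one containing a
  count.\<close>

lemma nn_integral_chain_le:
  assumes f[measurable]: "(\<lambda>(s, y). f s y) \<in> N \<Otimes>\<^sub>M borel \<rightarrow>\<^sub>M N"
    and V[measurable]: "V \<in> borel_measurable N"
    and drift: "\<And>s. s \<in> space N \<Longrightarrow> (\<integral>\<^sup>+y. V (f s y) \<partial>\<mu>) \<le> V s + L"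
    and s: "s \<in> space N"
  shows "(\<integral>\<^sup>+\<xi>. V (chain f s \<xi> k) \<partial>W) \<le> V s + of_nat k * L"
  using s
proof (induction k arbitrary: s)
  case 0
  then show ?case by (simp add: S.P.emeasure_space_1)
next
  case (Suc k)
  have [measurable]: "(\<lambda>\<xi>. chain f s \<xi> k) \<in> W \<rightarrow>\<^sub>M N" if "s \<in> space N" for s k
    using measurable_chain[OF f that] by (simp cong: measurable_cong_sets add: measurable_cong_sets[OF sets_W refl])
  have sp: "f s y \<in> space N" for y
    using measurable_space[OF f, of "(s, y)"] Suc.prems by (simp add: space_pair_measure)
  have [measurable]: "(\<lambda>y. f s y) \<in> borel \<rightarrow>\<^sub>M N"
    using measurable_compose[OF measurable_Pair1'[OF Suc.prems, of borel] f] by simp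
  have "(\<integral>\<^sup>+\<xi>. V (chain f s \<xi> (Suc k)) \<partial>W) = (\<integral>\<^sup>+y. \<integral>\<^sup>+\<xi>. V (chain f s (case_nat y \<xi>) (Suc k)) \<partial>W \<partial>\<mu>)"
    by (rule nn_integral_W_first) (use Suc.prems in measurable)
  also have "\<dots> = (\<integral>\<^sup>+y. \<integral>\<^sup>+\<xi>. V (chain f (f s y) \<xi> k) \<partial>W \<partial>\<mu>)"
    by (simp only: chain_case_nat)
  also have "\<dots> \<le> (\<integral>\<^sup>+y. V (f s y) + of_nat k * L \<partial>\<mu>)"
    by (intro nn_integral_mono Suc.IH sp)
  also have "\<dots> = (\<integral>\<^sup>+y. V (f s y) \<partial>\<mu>) + of_nat k * L"
    by (subst nn_integral_add) (auto simp: emeasure_space_1)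
  also have "\<dots> \<le> V s + L + of_nat k * L"
    by (intro add_right_mono drift Suc.prems)
  finally show ?case by (simp add: algebra_simps)
qed

lemma measurable_walk_W [measurable]: "(\<lambda>\<xi>. walk \<xi> k) \<in> borel_measurable W"
  by measurable

lemma measurable_oscillation_count [measurable]:
  "(\<lambda>\<xi>. oscillation_count \<eta> \<xi> k) \<in> W \<rightarrow>\<^sub>M count_space UNIV"
proof -
  have "(\<lambda>\<xi>. chain (reset_step \<eta>) (0, 0) \<xi> k) \<in> W \<rightarrow>\<^sub>M (borel \<Otimes>\<^sub>M count_space UNIV)"
    unfolding measurable_cong_sets[OF sets_W refl]
    by (rule measurable_chain) (auto simp: reset_step_def space_pair_measure split_beta')
  then show ?thesis unfolding oscillation_count_def by measurable
qed

text \<open>To the bump of the current displacement, \<open>V\<close> adds a credit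
  \<open>bump (\<eta> / R)\<close> per reset. The bump erased at a reset is at least this credit, so
  \<open>V\<close> drifts no faster than the bump alone.\<close>

lemma nn_integral_oscillation_count_le:
  assumes "R > 0" "\<eta> \<ge> 0"
  shows "ennreal (bump (\<eta> / R)) * (\<integral>\<^sup>+\<xi>. of_nat (oscillation_count \<eta> \<xi> k) \<partial>W) \<le> ennreal (real k * (2 * spread \<mu> R))"
proof -
  let ?N = "borel \<Otimes>\<^sub>M count_space UNIV :: ('a \<times> nat) measure"
  define V :: "'a \<times> nat \<Rightarrow> ennreal" where
    "V s = ennreal (bump (fst s /\<^sub>R R)) + ennreal (bump (\<eta> / R)) * of_nat (snd s)" for s
  have V[measurable]: "V \<in> borel_measurable ?N" unfolding V_def[abs_def] by measurable
  have f: "(\<lambda>(s, y). reset_step \<eta> s y) \<in> ?N \<Otimes>\<^sub>M borel \<rightarrow>\<^sub>M ?N"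
    by (auto simp: reset_step_def split_beta')
  have step: "V (reset_step \<eta> s y) \<le> ennreal (bump ((fst s + y) /\<^sub>R R)) + ennreal (bump (\<eta> / R)) * of_nat (snd s)" for s y
  proof (cases "norm (fst s + y) > \<eta>")
    case True
    have "bump (\<eta> / R) \<le> bump ((fst s + y) /\<^sub>R R)"
      using True assms by (intro bump_mono) (simp add: divide_simps)
    then show ?thesis using True
      by (simp add: V_def reset_step_def distrib_left add.commute) (intro disjI2 ennreal_leI, simp add: add.commute)
  qed (simp add: V_def reset_step_def)
  have "(\<integral>\<^sup>+y. V (reset_step \<eta> s y) \<partial>\<mu>) \<le> V s + ennreal (2 * spread \<mu> R)" for s
  proof -
    have "(\<integral>\<^sup>+y. V (reset_step \<eta> s y) \<partial>\<mu>)
      \<le> (\<integral>\<^sup>+y. ennreal (bump ((fst s + y) /\<^sub>R R)) + ennreal (bump (\<eta> / R)) * of_nat (snd s) \<partial>\<mu>)"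
      by (intro nn_integral_mono step)
    also have "\<dots> = (\<integral>\<^sup>+y. ennreal (bump ((fst s + y) /\<^sub>R R)) \<partial>\<mu>) + ennreal (bump (\<eta> / R)) * of_nat (snd s)"
      by (subst nn_integral_add) (auto simp: emeasure_space_1)
    also have "\<dots> \<le> ennreal (bump (fst s /\<^sub>R R)) + ennreal (2 * spread \<mu> R) + ennreal (bump (\<eta> / R)) * of_nat (snd s)"
      by (intro add_right_mono nn_integral_bump_le assms)
    finally show ?thesis by (simp add: V_def algebra_simps)
  qed
  then have le: "(\<integral>\<^sup>+\<xi>. V (chain (reset_step \<eta>) (0, 0) \<xi> k) \<partial>W) \<le> V (0, 0) + of_nat k * ennreal (2 * spread \<mu> R)"
    using nn_integral_chain_le[OF f V, of "ennreal (2 * spread \<mu> R)" "(0, 0)" k] by (simp add: space_pair_measure)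
  have "ennreal (bump (\<eta> / R)) * (\<integral>\<^sup>+\<xi>. of_nat (oscillation_count \<eta> \<xi> k) \<partial>W)
    = (\<integral>\<^sup>+\<xi>. ennreal (bump (\<eta> / R)) * of_nat (oscillation_count \<eta> \<xi> k) \<partial>W)"
    by (subst nn_integral_cmult) auto
  also have "\<dots> \<le> (\<integral>\<^sup>+\<xi>. V (chain (reset_step \<eta>) (0, 0) \<xi> k) \<partial>W)"
    by (intro nn_integral_mono) (simp add: V_def oscillation_count_def)
  also note le
  also have "V (0, 0) + of_nat k * ennreal (2 * spread \<mu> R) = ennreal (real k * (2 * spread \<mu> R))"
    using spread_nonneg[OF assms(1), of \<mu>] by (simp add: V_def ennreal_mult ennreal_of_nat_eq_real_of_nat)
  finally show ?thesis .
qed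

lemma prob_oscillation_count_ge:
  assumes "R > 0" "\<eta> > 0" "p > 0"
  shows "S.P.prob {\<xi>. p \<le> oscillation_count \<eta> \<xi> k} \<le> real k * (2 * spread \<mu> R) / (bump (\<eta> / R) * real p)"
proof -
  have b: "0 < bump (\<eta> / R)" using assms by (simp add: bump_def add_pos_nonneg)
  have "emeasure W {\<xi> \<in> space W. 1 \<le> ennreal (1 / real p) * of_nat (oscillation_count \<eta> \<xi> k)}
    \<le> ennreal (1 / real p) * (\<integral>\<^sup>+\<xi>. of_nat (oscillation_count \<eta> \<xi> k) * indicator (space W) \<xi> \<partial>W)"
    by (rule nn_integral_Markov_inequality) auto
  also have "{\<xi> \<in> space W. 1 \<le> ennreal (1 / real p) * of_nat (oscillation_count \<eta> \<xi> k)} = {\<xi>. p \<le> oscillation_count \<eta> \<xi> k}"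
  proof -
    have "1 \<le> ennreal (1 / real p) * of_nat m \<longleftrightarrow> p \<le> m" for m
    proof -
      have "ennreal (1 / real p) * of_nat m = ennreal (real m / real p)"
        by (simp add: ennreal_of_nat_eq_real_of_nat flip: ennreal_mult)
      then show ?thesis
        using assms ennreal_le_iff[of "real m / real p" 1] by (simp add: field_simps)
    qed
    then show ?thesis by simp
  qed
  finally have "ennreal (bump (\<eta> / R) * real p) * emeasure W {\<xi>. p \<le> oscillation_count \<eta> \<xi> k}
    \<le> ennreal (bump (\<eta> / R) * real p) * (ennreal (1 / real p) * (\<integral>\<^sup>+\<xi>. of_nat (oscillation_count \<eta> \<xi> k) \<partial>W))"
    by (intro mult_left_mono) auto
  also have "\<dots> = (ennreal (real p) * ennreal (1 / real p)) * (ennreal (bump (\<eta> / R)) * (\<integral>\<^sup>+\<xi>. of_nat (oscillation_count \<eta> \<xi> k) \<partial>W))"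
    using b by (simp add: ennreal_mult mult_ac)
  also have "ennreal (real p) * ennreal (1 / real p) = 1"
    using assms by (simp flip: ennreal_mult)
  also have "1 * (ennreal (bump (\<eta> / R)) * (\<integral>\<^sup>+\<xi>. of_nat (oscillation_count \<eta> \<xi> k) \<partial>W)) \<le> ennreal (real k * (2 * spread \<mu> R))"
    using nn_integral_oscillation_count_le[of R \<eta> k] assms by simp
  finally have "ennreal (bump (\<eta> / R) * real p * S.P.prob {\<xi>. p \<le> oscillation_count \<eta> \<xi> k}) \<le> ennreal (real k * (2 * spread \<mu> R))"
    using b by (simp add: S.P.emeasure_eq_measure ennreal_mult)
  then have "bump (\<eta> / R) * real p * S.P.prob {\<xi>. p \<le> oscillation_count \<eta> \<xi> k} \<le> real k * (2 * spread \<mu> R)"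
    using spread_nonneg[OF assms(1), of \<mu>] by (simp add: ennreal_le_iff)
  then show ?thesis using b assms by (simp add: field_simps)
qed

text \<open>A maximal inequality without martingales: a value beyond \<open>2 * R\<close> forces a
  reset with threshold \<open>R\<close>. The constant 4 is 2 divided by the bump at 1, which is
  1/2.\<close>

lemma prob_walk_max_gt:
  assumes "R > 0"
  shows "S.P.prob {\<xi>. \<exists>j\<le>k. norm (walk \<xi> j) > 2 * R} \<le> 4 * real k * spread \<mu> R"
proof -
  have "{\<xi> :: nat \<Rightarrow> 'a. \<exists>j\<le>k. norm (walk \<xi> j) > 2 * R} \<subseteq> {\<xi>. 1 \<le> oscillation_count R \<xi> k}"
  proof (rule subsetI)
    fix \<xi> :: "nat \<Rightarrow> 'a" assume "\<xi> \<in> {\<xi>. \<exists>j\<le>k. norm (walk \<xi> j) > 2 * R}"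
    then obtain j where j: "j \<le> k" "2 * R < norm (walk \<xi> j)" by blast
    then have "Suc (oscillation_count R \<xi> 0) \<le> oscillation_count R \<xi> j"
      using assms by (intro oscillation_count_increase) auto
    also have "\<dots> \<le> oscillation_count R \<xi> k" by (rule oscillation_count_mono[OF j(1)])
    finally show "\<xi> \<in> {\<xi>. 1 \<le> oscillation_count R \<xi> k}" by simp
  qed
  moreover have "{\<xi>. 1 \<le> oscillation_count R \<xi> k} \<in> S.P.events"
    using measurable_sets[OF measurable_oscillation_count, of "{1..}" R k] by (simp add: vimage_def)
  ultimately have "S.P.prob {\<xi>. \<exists>j\<le>k. norm (walk \<xi> j) > 2 * R} \<le> S.P.prob {\<xi>. 1 \<le> oscillation_count R \<xi> k}"
    by (rule S.P.finite_measure_mono)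
  also have "\<dots> \<le> real k * (2 * spread \<mu> R) / (bump (R / R) * real 1)"
    using assms by (intro prob_oscillation_count_ge) auto
  finally show ?thesis using assms by (simp add: bump_def)
qed

section \<open>Stationarity and independence of the increments of one walk\<close>

lemma distr_shift: "distr W W (shift l) = W"
proof -
  interpret P: pair_prob_space W W ..
  have "distr W W (shift l) = distr (distr (W \<Otimes>\<^sub>M W) W (\<lambda>(\<omega>, \<omega>'). comb_seq l \<omega> \<omega>')) W (shift l)"
    by (simp add: S.PiM_comb_seq)
  also have "\<dots> = distr (W \<Otimes>\<^sub>M W) W (shift l \<circ> (\<lambda>(\<omega>, \<omega>'). comb_seq l \<omega> \<omega>'))"
    by (intro distr_distr) (auto intro: measurable_comb_seq)
  also have "shift l \<circ> (\<lambda>(\<omega>, \<omega>'). comb_seq l \<omega> \<omega>') = snd"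
    by (auto simp: fun_eq_iff shift_def comb_seq_add)
  also have "distr (W \<Otimes>\<^sub>M W) W snd = W"
  proof (rule measure_eqI)
    fix A assume "A \<in> sets (distr (W \<Otimes>\<^sub>M W) W snd)"
    then have A[measurable]: "A \<in> sets W" by simp
    have "emeasure (distr (W \<Otimes>\<^sub>M W) W snd) A = emeasure (W \<Otimes>\<^sub>M W) (UNIV \<times> A)"
      by (subst emeasure_distr) (auto simp: space_pair_measure intro!: arg_cong2[where f = emeasure])
    also have "\<dots> = emeasure W A"
      by (subst S.P.emeasure_pair_measure_Times) auto
    finally show "emeasure (distr (W \<Otimes>\<^sub>M W) W snd) A = emeasure W A" .
  qed simp
  finally show ?thesis .
qed

lemma integral_shift:
  fixes \<Phi> :: "_ \<Rightarrow> real"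
  assumes [measurable]: "\<Phi> \<in> borel_measurable W"
  shows "(\<integral>\<xi>. \<Phi> (shift l \<xi>) \<partial>W) = (\<integral>\<xi>. \<Phi> \<xi> \<partial>W)"
proof -
  have "(\<integral>\<xi>. \<Phi> (shift l \<xi>) \<partial>W) = (\<integral>\<xi>. \<Phi> \<xi> \<partial>distr W W (shift l))"
    by (subst integral_distr) auto
  then show ?thesis by (simp add: distr_shift)
qed

text \<open>Gluing the first \<open>l\<close> terms of one sequence to an independent second
  sequence preserves the product law. Then \<open>\<Phi>\<close> sees only the first sequence and
  the shifted \<open>\<Psi>\<close> only the second.\<close>

lemma integral_mult_shift:
  fixes \<Phi> \<Psi> :: "_ \<Rightarrow> real"
  assumes [measurable]: "\<Phi> \<in> borel_measurable W" "\<Psi> \<in> borel_measurable W"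
    and dep: "\<And>\<xi> \<zeta>. (\<And>i. i < l \<Longrightarrow> \<xi> i = \<zeta> i) \<Longrightarrow> \<Phi> \<xi> = \<Phi> \<zeta>"
    and bdd: "\<And>\<xi>. \<bar>\<Phi> \<xi>\<bar> \<le> C" "\<And>\<xi>. \<bar>\<Psi> \<xi>\<bar> \<le> D"
  shows "(\<integral>\<xi>. \<Phi> \<xi> * \<Psi> (shift l \<xi>) \<partial>W) = (\<integral>\<xi>. \<Phi> \<xi> \<partial>W) * (\<integral>\<xi>. \<Psi> \<xi> \<partial>W)"
proof -
  interpret P: pair_prob_space W W ..
  have "(\<integral>\<xi>. \<Phi> \<xi> * \<Psi> (shift l \<xi>) \<partial>W)
    = (\<integral>\<xi>. \<Phi> \<xi> * \<Psi> (shift l \<xi>) \<partial>distr (W \<Otimes>\<^sub>M W) W (\<lambda>(\<omega>, \<omega>'). comb_seq l \<omega> \<omega>'))"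
    by (simp add: S.PiM_comb_seq)
  also have "\<dots> = (\<integral>p. \<Phi> (comb_seq l (fst p) (snd p)) * \<Psi> (shift l (comb_seq l (fst p) (snd p))) \<partial>(W \<Otimes>\<^sub>M W))"
    by (subst integral_distr) (auto simp: split_beta' intro: measurable_comb_seq)
  also have "\<dots> = (\<integral>p. \<Phi> (fst p) * \<Psi> (snd p) \<partial>(W \<Otimes>\<^sub>M W))"
  proof (intro Bochner_Integration.integral_cong refl arg_cong2[where f = "(*)"])
    fix p :: "(nat \<Rightarrow> 'a) \<times> (nat \<Rightarrow> 'a)"
    show "\<Phi> (comb_seq l (fst p) (snd p)) = \<Phi> (fst p)" by (rule dep) (simp add: comb_seq_less)
    show "\<Psi> (shift l (comb_seq l (fst p) (snd p))) = \<Psi> (snd p)" by (simp add: shift_def comb_seq_add)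
  qed
  also have "\<dots> = (\<integral>\<xi>. \<integral>\<zeta>. \<Phi> \<xi> * \<Psi> \<zeta> \<partial>W \<partial>W)"
  proof (subst P.integral_fst'[symmetric])
    have "\<bar>\<Phi> (fst p) * \<Psi> (snd p)\<bar> \<le> \<bar>C\<bar> * \<bar>D\<bar>" for p
      unfolding abs_mult by (intro mult_mono) (auto intro: order_trans[OF bdd(1)] order_trans[OF bdd(2)])
    then show "integrable (W \<Otimes>\<^sub>M W) (\<lambda>p. \<Phi> (fst p) * \<Psi> (snd p))"
      by (intro P.integrable_bounded_real) auto
  qed simp
  finally show ?thesis by simp
qed

text \<open>By induction on \<open>m\<close>: the earlier increments read only terms before
  \<open>k m\<close>, and the last one is a function of the shifted sequence. The bound 1 on the
  factors is stable under products.\<close>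

lemma integral_prod_walk_increments:
  fixes f :: "nat \<Rightarrow> 'a \<Rightarrow> real" and k :: "nat \<Rightarrow> nat"
  assumes f[measurable]: "\<And>i. f i \<in> borel_measurable borel" and bdd: "\<And>i x. \<bar>f i x\<bar> \<le> 1"
    and mono: "\<And>i. i < m \<Longrightarrow> k i \<le> k (Suc i)"
  shows "(\<integral>\<xi>. (\<Prod>i<m. f i (walk \<xi> (k (Suc i)) - walk \<xi> (k i))) \<partial>W)
    = (\<Prod>i<m. \<integral>\<xi>. f i (walk \<xi> (k (Suc i) - k i)) \<partial>W)"
  using mono
proof (induction m)
  case 0
  then show ?case by (simp add: S.P.prob_space)
next
  case (Suc m)
  have le: "k i \<le> k m" if "i \<le> m" for i
    using that Suc.prems by (induction rule: dec_induct) (auto intro: order_trans elim: le_SucE)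
  let ?\<Phi> = "\<lambda>\<xi>. \<Prod>i<m. f i (walk \<xi> (k (Suc i)) - walk \<xi> (k i))"
  let ?\<Psi> = "\<lambda>\<xi>. f m (walk \<xi> (k (Suc m) - k m))"
  have "(\<integral>\<xi>. (\<Prod>i<Suc m. f i (walk \<xi> (k (Suc i)) - walk \<xi> (k i))) \<partial>W) = (\<integral>\<xi>. ?\<Phi> \<xi> * ?\<Psi> (shift (k m) \<xi>) \<partial>W)"
    using Suc.prems by (simp add: walk_diff)
  also have "\<dots> = (\<integral>\<xi>. ?\<Phi> \<xi> \<partial>W) * (\<integral>\<xi>. ?\<Psi> \<xi> \<partial>W)"
  proof (rule integral_mult_shift[where C = 1 and D = 1])
    show "?\<Phi> \<xi> = ?\<Phi> \<zeta>" if "\<And>i. i < k m \<Longrightarrow> \<xi> i = \<zeta> i" for \<xi> \<zeta>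
    proof (rule prod.cong[OF refl])
      fix i assume "i \<in> {..<m}"
      then show "f i (walk \<xi> (k (Suc i)) - walk \<xi> (k i)) = f i (walk \<zeta> (k (Suc i)) - walk \<zeta> (k i))"
        using that le[of i] le[of "Suc i"] walk_cong[of "k i" \<xi> \<zeta>] walk_cong[of "k (Suc i)" \<xi> \<zeta>] by simp
    qed
    show "\<bar>?\<Phi> \<xi>\<bar> \<le> 1" for \<xi>
      unfolding abs_prod by (intro prod_le_1) (simp add: bdd)
  qed (auto simp: bdd)
  finally show ?case using Suc by simp
qed

end

section \<open>A Skorokhod coupling for sequences of random sequences\<close>

text \<open>Schoenberg's space-filling curve, with countably many coordinates.  It turns the
  one-dimensional Skorokhod theorem into one for random sequences.\<close>

definition plateau :: "real \<Rightarrow> real" where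
  "plateau t = max 0 (min 1 (1 / 2 - cos (pi * t)))"

text \<open>The digits of coordinate \<open>m\<close> sit at the positions
  \<open>prod_encode (m, n)\<close>, so all coordinates are read off one expansion without
  interference.\<close>

definition schoenberg :: "nat \<Rightarrow> real \<Rightarrow> real" where
  "schoenberg m t = (\<Sum>n. plateau (3 ^ prod_encode (m, n) * t) / 2 ^ Suc n)"

text \<open>A point of the Cantor set: only the ternary digits 0 and 2 occur.\<close>

definition ternary :: "(nat \<Rightarrow> bool) \<Rightarrow> real" where
  "ternary b = (\<Sum>k. 2 * of_bool (b k) / 3 ^ Suc k)"

definition binary_digit :: "real \<Rightarrow> nat \<Rightarrow> bool" where
  "binary_digit x n \<longleftrightarrow> odd \<lfloor>2 ^ Suc n * x\<rfloor>"

definition schoenberg_section :: "(nat \<Rightarrow> real) \<Rightarrow> real" where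
  "schoenberg_section y = ternary (\<lambda>k. binary_digit (y (fst (prod_decode k))) (snd (prod_decode k)))"

lemma plateau_range: "0 \<le> plateau t" "plateau t \<le> 1"
  by (auto simp: plateau_def)

lemma plateau_even: "plateau (2 * of_int N + t) = plateau t"
proof -
  have "pi * (2 * of_int N + t) = pi * t + (2 * pi) * of_int N"
    by (simp add: algebra_simps)
  then show ?thesis by (simp add: plateau_def cos_add cos_int_2pin sin_int_2pin)
qed

lemma summable_geometric_bound:
  fixes f :: "nat \<Rightarrow> real"
  assumes "\<And>k. 0 \<le> f k" "\<And>k. f k \<le> C * r ^ k" "0 \<le> r" "r < 1"
  shows "summable f"
proof (rule summable_comparison_test')
  show "summable (\<lambda>k. C * r ^ k)" using assms by (intro summable_mult summable_geometric) simp
  show "norm (f k) \<le> C * r ^ k" if "k \<ge> 0" for k using assms by simp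
qed

lemma summable_ternary: "summable (\<lambda>k. 2 * of_bool (b k) / 3 ^ Suc k :: real)"
  by (rule summable_geometric_bound[where C = "2 / 3" and r = "1 / 3"]) (auto simp: power_divide)

lemma ternary_nonneg: "0 \<le> ternary b"
  unfolding ternary_def by (intro suminf_nonneg summable_ternary) auto

lemma ternary_le_1: "ternary b \<le> 1"
proof -
  have "ternary b \<le> (\<Sum>k. 2 / 3 * (1 / 3) ^ k)"
    unfolding ternary_def
    by (intro suminf_le summable_ternary summable_mult summable_geometric) (auto simp: power_divide)
  also have "\<dots> = 1"
    by (subst suminf_mult) (simp_all add: suminf_geometric summable_geometric)
  finally show ?thesis .
qed

lemma ternary_unfold: "3 * ternary b = 2 * of_bool (b 0) + ternary (\<lambda>k. b (Suc k))"
proof -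
  have "ternary b = (\<Sum>k. 2 * of_bool (b (Suc k)) / 3 ^ Suc (Suc k)) + 2 * of_bool (b 0) / 3 ^ Suc 0"
    using suminf_split_head[OF summable_ternary[of b]] by (simp add: ternary_def)
  also have "(\<Sum>k. 2 * of_bool (b (Suc k)) / 3 ^ Suc (Suc k)) = (\<Sum>k. 1 / 3 * (2 * of_bool (b (Suc k)) / 3 ^ Suc k) :: real)"
    by simp
  also have "\<dots> = 1 / 3 * ternary (\<lambda>k. b (Suc k))"
    unfolding ternary_def by (rule suminf_mult[OF summable_ternary])
  finally show ?thesis by simp
qed

lemma ternary_scale: "\<exists>N::int. 3 ^ k * ternary b = 2 * of_int N + ternary (\<lambda>j. b (j + k))"
proof (induction k)
  case 0
  show ?case by (rule exI[of _ 0]) simp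
next
  case (Suc k)
  then obtain N :: int where "3 ^ k * ternary b = 2 * of_int N + ternary (\<lambda>j. b (j + k))" by blast
  then have "3 ^ Suc k * ternary b = 6 * of_int N + 3 * ternary (\<lambda>j. b (j + k))" by simp
  also have "\<dots> = 2 * of_int (3 * N + of_bool (b k)) + ternary (\<lambda>j. b (j + Suc k))"
    unfolding ternary_unfold by simp
  finally show ?case by blast
qed

text \<open>Multiplication by \<open>3 ^ k\<close> shifts the digits; as these are 0 or 2, the
  integer split off is even and disappears by the period 2 of \<open>plateau\<close>. The remainder
  lies in the first or the last third of the unit interval, where \<open>plateau\<close> is
  constantly 0 or 1.\<close>

lemma plateau_ternary: "plateau (3 ^ k * ternary b) = of_bool (b k)"
proof -
  obtain N :: int where N: "3 ^ k * ternary b = 2 * of_int N + ternary (\<lambda>j. b (j + k))"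
    using ternary_scale by blast
  define t where "t = ternary (\<lambda>j. b (j + k))"
  define r where "r = ternary (\<lambda>j. b (Suc j + k))"
  have t: "t = (2 * of_bool (b k) + r) / 3"
    using ternary_unfold[of "\<lambda>j. b (j + k)"] by (simp add: t_def r_def)
  have r: "0 \<le> r" "r \<le> 1" by (simp_all add: r_def ternary_nonneg ternary_le_1)
  have "plateau t = of_bool (b k)"
  proof (cases "b k")
    case True
    then have "pi * t = pi - pi * ((1 - r) / 3)" using t by (simp add: field_simps)
    then have "cos (pi * t) = - cos (pi * ((1 - r) / 3))" by simp
    also have "cos (pi * ((1 - r) / 3)) \<ge> cos (pi / 3)"
      using r by (intro cos_monotone_0_pi_le) (auto simp: field_simps)
    ultimately have "cos (pi * t) \<le> - 1 / 2" by (simp add: cos_60)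
    then show ?thesis using True by (simp add: plateau_def)
  next
    case False
    then have "cos (pi * t) \<ge> cos (pi / 3)"
      using r t by (intro cos_monotone_0_pi_le) (auto simp: field_simps)
    then show ?thesis using False by (simp add: plateau_def cos_60)
  qed
  then show ?thesis by (simp add: N plateau_even flip: t_def)
qed

text \<open>The partial sums are \<open>\<lfloor>2 ^ N * x\<rfloor> / 2 ^ N\<close>. The point 1 is
  excluded because all its digits are 0 in this definition.\<close>

lemma binary_digit_sum:
  assumes "0 \<le> x" "x < 1"
  shows "(\<lambda>n. of_bool (binary_digit x n) / 2 ^ Suc n) sums x"
proof -
  have partial: "(\<Sum>n<N. of_bool (binary_digit x n) / 2 ^ Suc n) = of_int \<lfloor>2 ^ N * x\<rfloor> / (2 ^ N :: real)" for N
  proof (induction N)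
    case 0
    have "\<lfloor>x\<rfloor> = 0" using assms by linarith
    then show ?case by simp
  next
    case (Suc N)
    let ?y = "2 ^ N * x"
    have fl: "\<lfloor>2 * ?y\<rfloor> = 2 * \<lfloor>?y\<rfloor> \<or> \<lfloor>2 * ?y\<rfloor> = 2 * \<lfloor>?y\<rfloor> + 1"
    proof -
      have "2 * \<lfloor>?y\<rfloor> \<le> \<lfloor>2 * ?y\<rfloor>" by (simp add: le_floor_iff)
      moreover have "\<lfloor>2 * ?y\<rfloor> < 2 * \<lfloor>?y\<rfloor> + 2"
        unfolding floor_less_iff using floor_correct[of ?y] by linarith
      ultimately show ?thesis by linarith
    qed
    have "real_of_int \<lfloor>2 * ?y\<rfloor> = 2 * real_of_int \<lfloor>?y\<rfloor> + of_bool (odd \<lfloor>2 * ?y\<rfloor>)"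
      using fl by (elim disjE) simp_all
    then have "real_of_int \<lfloor>2 ^ Suc N * x\<rfloor> = 2 * real_of_int \<lfloor>2 ^ N * x\<rfloor> + of_bool (binary_digit x N)"
      unfolding binary_digit_def by (simp add: mult.assoc)
    then show ?case using Suc by (simp add: field_simps)
  qed
  have "(\<lambda>N. of_int \<lfloor>2 ^ N * x\<rfloor> / (2 ^ N :: real)) \<longlonglongrightarrow> x"
  proof (rule tendsto_sandwich[where f = "\<lambda>N. x - 1 / 2 ^ N" and h = "\<lambda>_. x"])
    have "x - 1 / 2 ^ N \<le> of_int \<lfloor>2 ^ N * x\<rfloor> / 2 ^ N" for N
    proof -
      have "(2 ^ N * x - 1) / 2 ^ N \<le> of_int \<lfloor>2 ^ N * x\<rfloor> / (2 ^ N :: real)"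
        by (intro divide_right_mono) (linarith, simp)
      then show ?thesis by (simp add: diff_divide_distrib)
    qed
    then show "eventually (\<lambda>N. x - 1 / 2 ^ N \<le> of_int \<lfloor>2 ^ N * x\<rfloor> / 2 ^ N) sequentially"
      by simp
    have "of_int \<lfloor>2 ^ N * x\<rfloor> / 2 ^ N \<le> x" for N
      using of_int_floor_le[of "2 ^ N * x"] by (simp add: pos_divide_le_eq mult.commute)
    then show "eventually (\<lambda>N. of_int \<lfloor>2 ^ N * x\<rfloor> / 2 ^ N \<le> x) sequentially"
      by simp
    have "(\<lambda>N. x - (1 / 2) ^ N) \<longlonglongrightarrow> x - 0"
      by (intro tendsto_intros LIMSEQ_power_zero) simp
    then show "(\<lambda>N. x - 1 / 2 ^ N) \<longlonglongrightarrow> x" by (simp add: power_divide)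
  qed simp
  then show ?thesis unfolding sums_def partial .
qed

lemma schoenberg_section:
  assumes "0 \<le> y m" "y m < 1"
  shows "schoenberg m (schoenberg_section y) = y m"
  using sums_unique[OF binary_digit_sum[OF assms]]
  by (simp add: schoenberg_def schoenberg_section_def plateau_ternary)

lemma schoenberg_section_range: "0 \<le> schoenberg_section y" "schoenberg_section y \<le> 1"
  by (simp_all add: schoenberg_section_def ternary_nonneg ternary_le_1)

text \<open>The section only transports laws to the line, for which measurability is enough; limits
  pass through the continuous \<open>schoenberg\<close>.\<close>

lemma measurable_schoenberg_section:
  assumes [measurable]: "\<And>m. (\<lambda>v. y v m) \<in> borel_measurable N"
  shows "(\<lambda>v. schoenberg_section (y v)) \<in> borel_measurable N"
  unfolding schoenberg_section_def ternary_def binary_digit_def by measurable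

lemma continuous_on_schoenberg: "continuous_on UNIV (schoenberg m)"
proof (rule uniform_limit_theorem)
  show "uniform_limit UNIV (\<lambda>N t. \<Sum>n<N. plateau (3 ^ prod_encode (m, n) * t) / 2 ^ Suc n) (schoenberg m) sequentially"
    unfolding schoenberg_def[abs_def]
  proof (rule Weierstrass_m_test[where M = "\<lambda>n. (1 / 2) ^ Suc n"])
    fix n and t :: real
    have "plateau (3 ^ prod_encode (m, n) * t) / 2 ^ Suc n \<le> 1 / 2 ^ Suc n"
      by (intro divide_right_mono plateau_range) simp
    then show "norm (plateau (3 ^ prod_encode (m, n) * t) / 2 ^ Suc n) \<le> (1 / 2) ^ Suc n"
      by (simp add: plateau_range power_divide)
  qed (simp add: summable_geometric summable_mult)
  show "\<forall>\<^sub>F N in sequentially. continuous_on UNIV (\<lambda>t. \<Sum>n<N. plateau (3 ^ prod_encode (m, n) * t) / 2 ^ Suc n)"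
    unfolding plateau_def by (intro always_eventually allI continuous_intros) auto
qed simp

lemma borel_measurable_schoenberg [measurable]: "schoenberg m \<in> borel_measurable borel"
  by (rule borel_measurable_continuous_onI[OF continuous_on_schoenberg])

text \<open>Laws on the unit interval are tight, so a weakly convergent subsequence exists and is
  realised by convergent random variables on a real sample space. The second half moves that space
  into the type demanded for \<open>M\<close>.\<close>

lemma real_sequence_coupling:
  fixes \<nu> :: "nat \<Rightarrow> real measure"
  assumes prob: "\<And>n. prob_space (\<nu> n)" and sets: "\<And>n. sets (\<nu> n) = sets borel"
    and supp: "\<And>n. AE x in \<nu> n. 0 \<le> x \<and> x \<le> 1"
  obtains \<rho> :: "nat \<Rightarrow> nat" and M :: "(real \<Rightarrow> 'a::euclidean_space) measure"
    and T :: "nat \<Rightarrow> (real \<Rightarrow> 'a) \<Rightarrow> real" and U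
  where "strict_mono \<rho>" "prob_space M" "\<And>n. T n \<in> borel_measurable M" "U \<in> borel_measurable M"
    "\<And>n. distr M borel (T n) = \<nu> (\<rho> n)" "AE w in M. (\<lambda>n. T n w) \<longlonglongrightarrow> U w"
proof -
  have rd: "real_distribution (\<nu> n)" for n
    using prob sets by (simp add: real_distribution_def real_distribution_axioms_def sets_eq_imp_space_eq[OF sets])
  have "tight \<nu>"
    unfolding tight_def
  proof (intro conjI allI impI rd)
    fix \<epsilon> :: real assume "\<epsilon> > 0"
    have "measure (\<nu> n) {-1<..1} = 1" for n
    proof -
      interpret prob_space "\<nu> n" by (rule prob)
      show ?thesis
        using supp[of n] by (subst prob_eq_1) (auto simp: sets elim!: AE_mp)
    qed
    then show "\<exists>a b. a < b \<and> (\<forall>n. 1 - \<epsilon> < measure (\<nu> n) {a<..b})"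
      using \<open>\<epsilon> > 0\<close> by (intro exI[of _ "-1"] exI[of _ 1]) simp
  qed
  then obtain \<rho> N where \<rho>: "strict_mono (\<rho> :: nat \<Rightarrow> nat)" and N: "real_distribution N"
    and conv: "weak_conv_m (\<nu> \<circ> id \<circ> \<rho>) N"
    using tight_imp_convergent_subsubsequence[of \<nu> id] strict_mono_id by blast
  obtain \<Omega> :: "real measure" and T :: "nat \<Rightarrow> real \<Rightarrow> real" and U :: "real \<Rightarrow> real"
    where sk: "prob_space \<Omega> \<and> (\<forall>n. T n \<in> borel_measurable \<Omega>) \<and>
      (\<forall>n. distr \<Omega> borel (T n) = (\<nu> \<circ> id \<circ> \<rho>) n) \<and> U \<in> measurable \<Omega> lborel \<and>
      distr \<Omega> borel U = N \<and> (\<forall>x\<in>space \<Omega>. (\<lambda>n. T n x) \<longlonglongrightarrow> U x)"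
    using Skorohod[of "\<nu> \<circ> id \<circ> \<rho>" N] rd N conv by auto
  from sk have \<Omega>: "prob_space \<Omega>" and T[measurable]: "\<And>n. T n \<in> borel_measurable \<Omega>"
    and law: "\<And>n. distr \<Omega> borel (T n) = \<nu> (\<rho> n)" and U: "U \<in> measurable \<Omega> lborel"
    and lim: "\<And>x. x \<in> space \<Omega> \<Longrightarrow> (\<lambda>n. T n x) \<longlonglongrightarrow> U x"
    by simp_all
  have U[measurable]: "U \<in> borel_measurable \<Omega>" using U by simp
  obtain v :: 'a where v: "v \<in> Basis" using nonempty_Basis by blast
  define B where "B = (\<Pi>\<^sub>M t\<in>(UNIV::real set). borel :: 'a measure)"
  \<comment> \<open>The path \<open>\<iota> x\<close> stores \<open>U x\<close> at time 0 and
    \<open>T n x\<close> at time \<open>n + 1\<close>, as multiples of a unit vector; evaluation at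
    these times recovers them.\<close>
  define \<iota> where "\<iota> x = (\<lambda>t::real. (if t = 0 then U x else T (nat \<lfloor>t\<rfloor> - 1) x) *\<^sub>R v)" for x
  have \<iota>[measurable]: "\<iota> \<in> \<Omega> \<rightarrow>\<^sub>M B"
    unfolding \<iota>_def[abs_def] B_def
  proof (rule measurable_PiM_single')
    show "(\<lambda>x. (if t = 0 then U x else T (nat \<lfloor>t\<rfloor> - 1) x) *\<^sub>R v) \<in> borel_measurable \<Omega>" for t :: real
      by (cases "t = 0") simp_all
  qed (simp add: space_PiM)
  define T' where "T' n f = f (real n + 1) \<bullet> v" for n and f :: "real \<Rightarrow> 'a"
  define U' where "U' f = f 0 \<bullet> v" for f :: "real \<Rightarrow> 'a"
  have [measurable]: "T' n \<in> borel_measurable B" for n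
    unfolding T'_def[abs_def] B_def by measurable
  have [measurable]: "U' \<in> borel_measurable B"
    unfolding U'_def[abs_def] B_def by measurable
  have TI: "T' n (\<iota> x) = T n x" for n x
  proof -
    have "nat \<lfloor>real n + 1\<rfloor> - 1 = n" by linarith
    moreover have "real n + 1 \<noteq> 0" by linarith
    ultimately show ?thesis using v by (simp add: T'_def \<iota>_def)
  qed
  have UI: "U' (\<iota> x) = U x" for x using v by (simp add: U'_def \<iota>_def)
  show ?thesis
  proof (rule that[of \<rho> "distr \<Omega> B \<iota>" T' U'])
    show "prob_space (distr \<Omega> B \<iota>)" using \<Omega> by (rule prob_space.prob_space_distr) measurable
    show "distr (distr \<Omega> B \<iota>) borel (T' n) = \<nu> (\<rho> n)" for n
      by (subst distr_distr) (auto simp: o_def TI law)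
    show "AE w in distr \<Omega> B \<iota>. (\<lambda>n. T' n w) \<longlonglongrightarrow> U' w"
      by (subst AE_distr_iff) (auto simp: TI UI lim)
  qed (auto simp: \<rho>)
qed

abbreviation noise_seq :: "'a measure \<Rightarrow> (nat \<Rightarrow> 'a) measure" where
  "noise_seq \<mu> \<equiv> \<Pi>\<^sub>M i\<in>UNIV. \<mu>"

text \<open>A homeomorphism of the line with the open unit interval. Limits of squashed values can
  still reach the end points, which tightness has to exclude.\<close>

definition squash :: "real \<Rightarrow> real" where
  "squash x = 1 / 2 + arctan x / pi"

definition unsquash :: "real \<Rightarrow> real" where
  "unsquash u = tan (pi * (u - 1 / 2))"

lemma squash_range: "0 < squash x" "squash x < 1"
  using arctan_bounded[of x] pi_gt_zero by (auto simp: squash_def field_simps)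

lemma unsquash_squash: "unsquash (squash x) = x"
  by (simp add: squash_def unsquash_def tan_arctan)

lemma squash_mono: "x \<le> y \<Longrightarrow> squash x \<le> squash y"
  by (auto simp: squash_def intro!: divide_right_mono arctan_monotone')

lemma tendsto_unsquash:
  assumes "(u \<longlongrightarrow> l) F" "0 < l" "l < 1"
  shows "((\<lambda>x. unsquash (u x)) \<longlongrightarrow> unsquash l) F"
proof -
  have "- (pi / 2) < pi * (l - 1 / 2)" "pi * (l - 1 / 2) < pi / 2"
    using assms pi_gt_zero by (simp_all add: field_simps)
  then have "cos (pi * (l - 1 / 2)) \<noteq> 0" using cos_gt_zero_pi by force
  show ?thesis unfolding unsquash_def
    using isCont_tendsto_compose[OF isCont_tan[OF \<open>cos (pi * (l - 1 / 2)) \<noteq> 0\<close>]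
        tendsto_mult[OF tendsto_const tendsto_diff[OF assms(1) tendsto_const]]] by simp
qed

lemma borel_measurable_squash [measurable]: "squash \<in> borel_measurable borel"
  unfolding squash_def[abs_def] by measurable

lemma borel_measurable_unsquash [measurable]: "unsquash \<in> borel_measurable borel"
  unfolding unsquash_def[abs_def] tan_def by measurable

text \<open>Fatou for events: the lower limit is an increasing union of sets, each contained in some
  \<open>E n\<close> of measure at most \<open>\<epsilon>\<close>.\<close>

lemma measure_eventually_le:
  assumes "prob_space M" and [measurable]: "\<And>n. E n \<in> sets M"
    and rare: "\<forall>\<^sub>F n in sequentially. measure M (E n) \<le> \<epsilon>"
  shows "measure M {w\<in>space M. \<forall>\<^sub>F n in sequentially. w \<in> E n} \<le> \<epsilon>"
proof -
  interpret prob_space M by fact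
  let ?A = "\<lambda>N. {w\<in>space M. \<forall>n\<ge>N. w \<in> E n}"
  have A[measurable]: "?A N \<in> sets M" for N by measurable
  have "(\<lambda>N. measure M (?A N)) \<longlonglongrightarrow> measure M (\<Union>N. ?A N)"
    by (rule finite_Lim_measure_incseq) (auto simp: incseq_def A)
  moreover have "measure M (?A N) \<le> \<epsilon>" for N
  proof -
    obtain N0 where "\<forall>n\<ge>N0. measure M (E n) \<le> \<epsilon>"
      using rare unfolding eventually_sequentially by blast
    then obtain n where "n \<ge> N" "measure M (E n) \<le> \<epsilon>"
      using max.cobounded1[of N N0] max.cobounded2[of N0 N] by blast
    moreover have "measure M (?A N) \<le> measure M (E n)"
      using \<open>n \<ge> N\<close> by (intro finite_measure_mono) auto
    ultimately show ?thesis by simp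
  qed
  ultimately have "measure M (\<Union>N. ?A N) \<le> \<epsilon>"
    by (intro LIMSEQ_le_const2) auto
  also have "(\<Union>N. ?A N) = {w\<in>space M. \<forall>\<^sub>F n in sequentially. w \<in> E n}"
    by (auto simp: eventually_sequentially)
  finally show ?thesis .
qed

text \<open>The index \<open>j\<close> stands for a time common to all walks and
  \<open>K n j\<close> for the number of steps that walk \<open>n\<close> has made by then. The code
  of a noise sequence collects the squashed coordinates of its walk at all indices. Continuity of
  \<open>schoenberg\<close> gives convergence at every \<open>j\<close>, tightness keeps the limits
  away from 0 and 1, and surjectivity of \<open>K n\<close> lets the noise itself be
  decoded.\<close>

lemma walk_coupling:
  fixes \<mu> :: "nat \<Rightarrow> 'a::euclidean_space measure" and K :: "nat \<Rightarrow> nat \<Rightarrow> nat"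
  assumes noise: "\<And>n. noise (\<mu> n)"
    and surj: "\<And>n k. \<exists>j. K n j = k"
    and tight: "\<And>j \<epsilon>. \<epsilon> > 0 \<Longrightarrow> \<exists>R. \<forall>\<^sub>F n in sequentially.
      measure (noise_seq (\<mu> n)) {\<xi>. norm (walk \<xi> (K n j)) > R} \<le> \<epsilon>"
  obtains \<rho> :: "nat \<Rightarrow> nat" and M :: "(real \<Rightarrow> 'a) measure" and \<xi> :: "nat \<Rightarrow> (real \<Rightarrow> 'a) \<Rightarrow> nat \<Rightarrow> 'a"
    and y :: "nat \<Rightarrow> (real \<Rightarrow> 'a) \<Rightarrow> 'a"
  where "strict_mono \<rho>" "prob_space M" "\<And>n. \<xi> n \<in> M \<rightarrow>\<^sub>M noise_seq (\<mu> (\<rho> n))"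
    "\<And>n. distr M (noise_seq (\<mu> (\<rho> n))) (\<xi> n) = noise_seq (\<mu> (\<rho> n))"
    "\<And>j. y j \<in> borel_measurable M"
    "AE w in M. \<forall>j. (\<lambda>n. walk (\<xi> n w) (K (\<rho> n) j)) \<longlonglongrightarrow> y j w"
proof -
  define bas where "bas = from_nat_into (Basis :: 'a set)"
  define idx where "idx = to_nat_on (Basis :: 'a set)"
  have bas: "bas i \<in> Basis" for i unfolding bas_def by (rule from_nat_into) simp
  have bas_idx: "bas (idx b) = b" if "b \<in> Basis" for b
    using that unfolding bas_def idx_def by (intro from_nat_into_to_nat_on countable_finite) auto
  define Z where "Z n \<zeta> m = squash (walk \<zeta> (K n (fst (prod_decode m))) \<bullet> bas (snd (prod_decode m)))"
    for n m and \<zeta> :: "nat \<Rightarrow> 'a"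
  define enc where "enc n \<zeta> = schoenberg_section (Z n \<zeta>)" for n \<zeta>
  define dec :: "nat \<Rightarrow> real \<Rightarrow> 'a" where
    "dec j \<tau> = (\<Sum>b\<in>Basis. unsquash (schoenberg (prod_encode (j, idx b)) \<tau>) *\<^sub>R b)" for j \<tau>
  have sch: "schoenberg m (enc n \<zeta>) = Z n \<zeta> m" for m n \<zeta>
    unfolding enc_def by (rule schoenberg_section) (auto simp: Z_def squash_range less_imp_le)
  have dec_enc: "dec j (enc n \<zeta>) = walk \<zeta> (K n j)" for j n \<zeta>
    unfolding dec_def sch by (simp add: Z_def bas_idx unsquash_squash euclidean_representation)
  define J where "J n k = (SOME j. K n j = k)" for n k
  have J: "K n (J n k) = k" for n k unfolding J_def by (rule someI_ex[OF surj])
  \<comment> \<open>The noise is recovered as the differences of consecutive decoded walk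
    values.\<close>
  define \<Xi> where "\<Xi> n \<tau> i = dec (J n (Suc i)) \<tau> - dec (J n i) \<tau>" for n \<tau> i
  have \<Xi>_enc: "\<Xi> n (enc n \<zeta>) = \<zeta>" for n \<zeta>
    by (simp add: \<Xi>_def dec_enc J walk_Suc fun_eq_iff)
  have [measurable]: "dec j \<in> borel_measurable borel" for j
    unfolding dec_def[abs_def] by measurable
  have [measurable]: "enc n \<in> borel_measurable (noise_seq (\<mu> k))" for n k
  proof -
    interpret noise "\<mu> k" by (rule noise)
    show ?thesis unfolding enc_def[abs_def] Z_def
      by (rule measurable_schoenberg_section) measurable
  qed
  have [measurable]: "\<Xi> n \<in> borel \<rightarrow>\<^sub>M noise_seq (\<mu> k)" for n k
  proof -
    interpret noise "\<mu> k" by (rule noise)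
    show ?thesis unfolding \<Xi>_def[abs_def]
      by (rule measurable_PiM_single') (auto simp: space_PiM)
  qed
  define \<nu> where "\<nu> n = distr (noise_seq (\<mu> n)) borel (enc n)" for n
  have ps: "prob_space (noise_seq (\<mu> n))" for n
    by (intro prob_space_PiM) (use noise in \<open>simp add: noise_def\<close>)
  obtain \<rho> :: "nat \<Rightarrow> nat" and M :: "(real \<Rightarrow> 'a) measure" and T and U
    where \<rho>: "strict_mono \<rho>" and M: "prob_space M"
      and T[measurable]: "\<And>n. T n \<in> borel_measurable M" and U[measurable]: "U \<in> borel_measurable M"
      and law: "\<And>n. distr M borel (T n) = \<nu> (\<rho> n)" and lim: "AE w in M. (\<lambda>n. T n w) \<longlonglongrightarrow> U w"
  proof (rule real_sequence_coupling[of \<nu>])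
    show "prob_space (\<nu> n)" for n unfolding \<nu>_def by (rule prob_space.prob_space_distr[OF ps]) measurable
    show "AE x in \<nu> n. 0 \<le> x \<and> x \<le> 1" for n
      unfolding \<nu>_def by (subst AE_distr_iff) (auto simp: enc_def schoenberg_section_range)
  qed (auto simp: \<nu>_def)
  interpret prob_space M by (rule M)
  have tendsto_sch: "(\<lambda>n. schoenberg m (u n)) \<longlonglongrightarrow> schoenberg m l" if "u \<longlonglongrightarrow> l" for m u l
    using continuous_on_tendsto_compose[OF continuous_on_schoenberg that] by simp
  \<comment> \<open>The variable \<open>T n\<close> has the law of the code, so measurable
    properties shared by all codes hold for it almost surely; no claim is made that
    \<open>T n w\<close> is a code for every \<open>w\<close>.\<close>
  have AE_T: "AE w in M. P (T n w)" if [measurable]: "Measurable.pred borel P" and "\<And>\<zeta>. P (enc (\<rho> n) \<zeta>)" for P n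
  proof -
    have "AE x in \<nu> (\<rho> n). P x" unfolding \<nu>_def by (subst AE_distr_iff) (use that in auto)
    then show ?thesis unfolding law[symmetric] by (subst (asm) AE_distr_iff) auto
  qed
  have prob_T: "measure M {w\<in>space M. P (T n w)} = measure (noise_seq (\<mu> (\<rho> n))) {\<zeta>\<in>space (noise_seq (\<mu> (\<rho> n))). P (enc (\<rho> n) \<zeta>)}"
    if [measurable]: "Measurable.pred borel P" for P n
  proof -
    have "measure M {w\<in>space M. P (T n w)} = measure (distr M borel (T n)) {x. P x}"
      by (subst measure_distr) (auto intro!: arg_cong2[where f = measure])
    also have "\<dots> = measure (noise_seq (\<mu> (\<rho> n))) {\<zeta>\<in>space (noise_seq (\<mu> (\<rho> n))). P (enc (\<rho> n) \<zeta>)}"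
      unfolding law \<nu>_def by (subst measure_distr) (auto intro!: arg_cong2[where f = measure])
    finally show ?thesis .
  qed
  \<comment> \<open>If the limit is not in the open interval, the approximations eventually leave
    the compact interval \<open>?I\<close>. By tightness and Fatou this has probability at most
    \<open>\<epsilon>\<close>.\<close>
  have inside: "AE w in M. 0 < schoenberg (prod_encode (j, idx b)) (U w) \<and> schoenberg (prod_encode (j, idx b)) (U w) < 1"
    if b: "b \<in> Basis" for j b
  proof -
    let ?H = "schoenberg (prod_encode (j, idx b))"
    let ?Bad = "{w\<in>space M. \<not> (0 < ?H (U w) \<and> ?H (U w) < 1)}"
    obtain N where N: "N \<in> null_sets M" "\<And>w. w \<in> space M - N \<Longrightarrow> (\<lambda>n. T n w) \<longlonglongrightarrow> U w"
      using lim by (auto elim!: AE_E3)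
    have [measurable]: "N \<in> sets M" using N by auto
    have "measure M ?Bad \<le> \<epsilon>" if \<epsilon>: "\<epsilon> > 0" for \<epsilon>
    proof -
      obtain R where R: "\<forall>\<^sub>F n in sequentially. measure (noise_seq (\<mu> n)) {\<xi>. norm (walk \<xi> (K n j)) > R} \<le> \<epsilon>"
        using tight[OF \<epsilon>] by blast
      let ?I = "{squash (- R)..squash R}"
      let ?E = "\<lambda>n. {w\<in>space M. ?H (T n w) \<notin> ?I}"
      have ev: "\<forall>\<^sub>F n in sequentially. measure M (?E n) \<le> \<epsilon>"
        using eventually_subseq[OF \<rho> R]
      proof eventually_elim
        case (elim n)
        interpret N: noise "\<mu> (\<rho> n)" by (rule noise)
        have "measure M (?E n) = N.S.P.prob {\<zeta>. ?H (enc (\<rho> n) \<zeta>) \<notin> ?I}"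
          by (subst prob_T) auto
        also have "\<dots> \<le> N.S.P.prob {\<xi>. norm (walk \<xi> (K (\<rho> n) j)) > R}"
        proof (rule N.S.P.finite_measure_mono)
          have "{\<zeta>\<in>space N.W. norm (walk \<zeta> (K (\<rho> n) j)) > R} \<in> N.S.P.events" by measurable
          then show "{\<xi>. norm (walk \<xi> (K (\<rho> n) j)) > R} \<in> N.S.P.events" by simp
          show "{\<zeta>. ?H (enc (\<rho> n) \<zeta>) \<notin> ?I} \<subseteq> {\<xi>. norm (walk \<xi> (K (\<rho> n) j)) > R}"
          proof (rule subsetI)
            fix \<zeta> assume "\<zeta> \<in> {\<zeta>. ?H (enc (\<rho> n) \<zeta>) \<notin> ?I}"
            then have "squash (walk \<zeta> (K (\<rho> n) j) \<bullet> b) \<notin> ?I"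
              unfolding sch by (simp add: Z_def bas_idx[OF b])
            then have "\<not> (- R \<le> walk \<zeta> (K (\<rho> n) j) \<bullet> b \<and> walk \<zeta> (K (\<rho> n) j) \<bullet> b \<le> R)"
              by (auto intro: squash_mono)
            then have "\<bar>walk \<zeta> (K (\<rho> n) j) \<bullet> b\<bar> > R"
              by linarith
            then show "\<zeta> \<in> {\<xi>. norm (walk \<xi> (K (\<rho> n) j)) > R}"
              using Basis_le_norm[OF b, of "walk \<zeta> (K (\<rho> n) j)"] by simp
          qed
        qed
        finally show ?case using elim by simp
      qed
      have "measure M ?Bad \<le> measure M ({w\<in>space M. \<forall>\<^sub>F n in sequentially. w \<in> ?E n} \<union> N)"
      proof (rule finite_measure_mono)
        show "?Bad \<subseteq> {w\<in>space M. \<forall>\<^sub>F n in sequentially. w \<in> ?E n} \<union> N"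
        proof (rule subsetI, rule ccontr)
          fix w assume w: "w \<in> ?Bad" "w \<notin> {w\<in>space M. \<forall>\<^sub>F n in sequentially. w \<in> ?E n} \<union> N"
          then have "(\<lambda>n. T n w) \<longlonglongrightarrow> U w" using N(2) by auto
          then have "(\<lambda>n. ?H (T n w)) \<longlonglongrightarrow> ?H (U w)" by (rule tendsto_sch)
          moreover have "?H (U w) \<in> - ?I"
            using w(1) squash_range[of R] squash_range[of "- R"] by auto
          ultimately have "\<forall>\<^sub>F n in sequentially. ?H (T n w) \<in> - ?I"
            using topological_tendstoD[of "\<lambda>n. ?H (T n w)" "?H (U w)" sequentially "- ?I"] by (simp add: open_Compl)
          then show False using w by auto
        qed
      qed measurable
      also have "\<dots> = measure M {w\<in>space M. \<forall>\<^sub>F n in sequentially. w \<in> ?E n}"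
        using N(1) by (intro measure_Un_null_set) auto
      also have "\<dots> \<le> \<epsilon>"
        by (rule measure_eventually_le[OF M _ ev]) measurable
      finally show ?thesis .
    qed
    then have "measure M ?Bad \<le> 0" by (rule field_le_epsilon) simp
    then have "measure M ?Bad = 0" by (simp add: measure_le_0_iff)
    moreover have "?Bad \<in> sets M" by measurable
    ultimately have "?Bad \<in> null_sets M" by (simp add: null_sets_def emeasure_eq_measure)
    then show ?thesis by (rule AE_I') auto
  qed
  show ?thesis
  proof (rule that[of \<rho> M "\<lambda>n w. \<Xi> (\<rho> n) (T n w)" "\<lambda>j w. dec j (U w)"])
    show "distr M (noise_seq (\<mu> (\<rho> n))) (\<lambda>w. \<Xi> (\<rho> n) (T n w)) = noise_seq (\<mu> (\<rho> n))" for n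
    proof -
      have "distr M (noise_seq (\<mu> (\<rho> n))) (\<lambda>w. \<Xi> (\<rho> n) (T n w)) = distr (distr M borel (T n)) (noise_seq (\<mu> (\<rho> n))) (\<Xi> (\<rho> n))"
        by (subst distr_distr) (auto simp: o_def)
      also have "\<dots> = distr (noise_seq (\<mu> (\<rho> n))) (noise_seq (\<mu> (\<rho> n))) (\<lambda>\<zeta>. \<Xi> (\<rho> n) (enc (\<rho> n) \<zeta>))"
        unfolding law \<nu>_def by (subst distr_distr) (auto simp: o_def)
      finally show ?thesis by (simp add: \<Xi>_enc distr_id)
    qed
    have walk_dec: "AE w in M. \<forall>j n. walk (\<Xi> (\<rho> n) (T n w)) (K (\<rho> n) j) = dec j (T n w)"
      unfolding AE_all_countable
    proof (intro allI)
      fix j n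
      interpret N: noise "\<mu> (\<rho> n)" by (rule noise)
      show "AE w in M. walk (\<Xi> (\<rho> n) (T n w)) (K (\<rho> n) j) = dec j (T n w)"
        by (rule AE_T) (measurable, simp add: \<Xi>_enc dec_enc)
    qed
    have "AE w in M. \<forall>j. \<forall>b\<in>Basis. 0 < schoenberg (prod_encode (j, idx b)) (U w) \<and> schoenberg (prod_encode (j, idx b)) (U w) < 1"
      unfolding AE_all_countable by (intro allI AE_finite_allI finite_Basis inside)
    then show "AE w in M. \<forall>j. (\<lambda>n. walk (\<Xi> (\<rho> n) (T n w)) (K (\<rho> n) j)) \<longlonglongrightarrow> dec j (U w)"
      using walk_dec lim
    proof eventually_elim
      case (elim w)
      have "(\<lambda>n. dec j (T n w)) \<longlonglongrightarrow> dec j (U w)" for j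
        unfolding dec_def
      proof (intro tendsto_sum tendsto_scaleR tendsto_const tendsto_unsquash)
        fix b :: 'a assume "b \<in> Basis"
        show "(\<lambda>n. schoenberg (prod_encode (j, idx b)) (T n w)) \<longlonglongrightarrow> schoenberg (prod_encode (j, idx b)) (U w)"
          using elim by (intro tendsto_sch) simp
      qed (use elim in auto)
      then show ?case using elim by simp
    qed
  qed (auto simp: \<rho> M)
qed

section \<open>Cadlag extension of a function on the rationals\<close>

text \<open>Finitely many points and strict inequalities are involved, so the property passes from a
  limit function to its pointwise approximations. In this form the oscillation bound for walks
  survives the limit.\<close>

primrec oscillates :: "nat \<Rightarrow> real set \<Rightarrow> real \<Rightarrow> (real \<Rightarrow> 'a::real_normed_vector) \<Rightarrow> real \<Rightarrow> bool" where
  "oscillates 0 A e y s = True"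
| "oscillates (Suc p) A e y s =
    (\<exists>a\<in>A. \<exists>b\<in>A. s \<le> a \<and> a < b \<and> e < norm (y b - y a) \<and> oscillates p A e y b)"

lemma oscillates_mono: "oscillates p A e y s \<Longrightarrow> s' \<le> s \<Longrightarrow> oscillates p A e y s'"
  by (cases p) (auto intro: order_trans)

lemma oscillates_e_mono: "oscillates p A e y s \<Longrightarrow> e' \<le> e \<Longrightarrow> oscillates p A e' y s"
  by (induction p arbitrary: s) (auto intro: le_less_trans)

lemma ordered_pair:
  fixes a b :: real
  assumes "a \<in> A" "b \<in> A" "u < a" "a < v" "u < b" "b < v" "e \<ge> 0" "e < norm (y b - y a)"
  shows "\<exists>a\<in>A. \<exists>b\<in>A. u < a \<and> a < b \<and> b < v \<and> e < norm (y b - y a)"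
proof -
  have "a \<noteq> b" using assms by auto
  then consider "a < b" | "b < a" by linarith
  then show ?thesis
  proof cases
    case 1 then show ?thesis using assms by blast
  next
    case 2
    have "e < norm (y a - y b)" using assms by (simp add: norm_minus_commute)
    then show ?thesis using 2 assms by blast
  qed
qed

text \<open>Otherwise every interval to the right of \<open>t\<close> contains a pair with increment
  above \<open>e\<close>. Each new pair is placed between \<open>t\<close> and the earlier ones, so
  any number of oscillations accumulates.\<close>

lemma right_cauchy_of_not_oscillates:
  assumes "\<not> oscillates p A e y t" "e \<ge> 0"
  shows "\<exists>\<delta>>0. \<forall>a\<in>A. \<forall>b\<in>A. t < a \<longrightarrow> a < t + \<delta> \<longrightarrow> t < b \<longrightarrow> b < t + \<delta> \<longrightarrow> norm (y b - y a) \<le> e"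
proof (rule ccontr)
  assume neg: "\<not> ?thesis"
  have pair: "\<exists>a\<in>A. \<exists>b\<in>A. t < a \<and> a < b \<and> b < t + \<delta> \<and> e < norm (y b - y a)" if \<delta>: "\<delta> > 0" for \<delta>
  proof (rule ccontr)
    assume "\<not> ?thesis"
    then have "norm (y b - y a) \<le> e" if "a \<in> A" "b \<in> A" "t < a" "a < t + \<delta>" "t < b" "b < t + \<delta>" for a b
      using ordered_pair[OF that \<open>e \<ge> 0\<close>, of y] by (meson not_le)
    then show False using \<delta> neg by blast
  qed
  have "\<exists>s>t. oscillates p A e y s" for p
  proof (induction p)
    case 0
    then show ?case by (intro exI[of _ "t + 1"]) simp
  next
    case (Suc p)
    then obtain s where s: "s > t" "oscillates p A e y s" by blast
    then obtain a b where "a \<in> A" "b \<in> A" "t < a" "a < b" "b < s" "e < norm (y b - y a)"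
      using pair[of "s - t"] by auto
    then show ?case
      using oscillates_mono[OF s(2), of b] by (intro exI[of _ a]) auto
  qed
  then show False using assms(1) oscillates_mono less_imp_le by blast
qed

text \<open>The mirror image: from any \<open>s < t\<close> a pair is found below \<open>t\<close>,
  and the next ones between it and \<open>t\<close>.\<close>

lemma left_cauchy_of_not_oscillates:
  assumes "\<not> oscillates p A e y s" "s < t" "e \<ge> 0"
  shows "\<exists>\<delta>>0. \<forall>a\<in>A. \<forall>b\<in>A. t - \<delta> < a \<longrightarrow> a < t \<longrightarrow> t - \<delta> < b \<longrightarrow> b < t \<longrightarrow> norm (y b - y a) \<le> e"
proof (rule ccontr)
  assume neg: "\<not> ?thesis"
  have pair: "\<exists>a\<in>A. \<exists>b\<in>A. t - \<delta> < a \<and> a < b \<and> b < t \<and> e < norm (y b - y a)" if \<delta>: "\<delta> > 0" for \<delta>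
  proof (rule ccontr)
    assume "\<not> ?thesis"
    then have "norm (y b - y a) \<le> e" if "a \<in> A" "b \<in> A" "t - \<delta> < a" "a < t" "t - \<delta> < b" "b < t" for a b
      using ordered_pair[OF that \<open>e \<ge> 0\<close>, of y] by (meson not_le)
    then show False using \<delta> neg by blast
  qed
  have "s < t \<Longrightarrow> oscillates p A e y s" for p s
  proof (induction p arbitrary: s)
    case (Suc p)
    then obtain a b where "a \<in> A" "b \<in> A" "s < a" "a < b" "b < t" "e < norm (y b - y a)"
      using pair[of "t - s"] by auto
    then show ?case using Suc.IH[of b] unfolding oscillates.simps by (meson less_imp_le)
  qed simp
  then show False using assms by blast
qed

text \<open>A rational strictly to the right of \<open>t\<close>, given by a formula so that it is
  measurable in \<open>t\<close> and takes countably many values for each \<open>n\<close>.\<close>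

definition rat_right :: "real \<Rightarrow> nat \<Rightarrow> real" where
  "rat_right t n = (of_int \<lfloor>t * (real n + 1)\<rfloor> + 1) / (real n + 1)"

definition rat_left :: "real \<Rightarrow> nat \<Rightarrow> real" where
  "rat_left t n = (of_int \<lceil>t * (real n + 1)\<rceil> - 1) / (real n + 1)"

lemma rat_right: "rat_right t n \<in> \<rat>" "t < rat_right t n" "rat_right t n \<le> t + 1 / (real n + 1)"
proof -
  have pos: "real n + 1 > 0" by simp
  show "rat_right t n \<in> \<rat>" unfolding rat_right_def by (intro Rats_divide Rats_add) auto
  have "t * (real n + 1) < of_int \<lfloor>t * (real n + 1)\<rfloor> + 1" "of_int \<lfloor>t * (real n + 1)\<rfloor> \<le> t * (real n + 1)" by linarith+
  then have "t < rat_right t n" "rat_right t n \<le> (t * (real n + 1) + 1) / (real n + 1)"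
    unfolding rat_right_def using pos by (simp add: pos_less_divide_eq, intro divide_right_mono) auto
  then show "t < rat_right t n" "rat_right t n \<le> t + 1 / (real n + 1)"
    using pos by (simp_all add: add_divide_distrib)
qed

lemma rat_left: "rat_left t n \<in> \<rat>" "rat_left t n < t" "t - 1 / (real n + 1) \<le> rat_left t n" "t > 0 \<Longrightarrow> 0 \<le> rat_left t n"
proof -
  have pos: "real n + 1 > 0" by simp
  show "rat_left t n \<in> \<rat>" unfolding rat_left_def by (intro Rats_divide Rats_add Rats_diff) auto
  have "of_int \<lceil>t * (real n + 1)\<rceil> - 1 < t * (real n + 1)" "t * (real n + 1) \<le> of_int \<lceil>t * (real n + 1)\<rceil>" by linarith+
  then have "rat_left t n < t" "(t * (real n + 1) - 1) / (real n + 1) \<le> rat_left t n"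
    unfolding rat_left_def using pos by (simp add: pos_divide_less_eq, intro divide_right_mono) auto
  then show "rat_left t n < t" "t - 1 / (real n + 1) \<le> rat_left t n"
    using pos by (simp_all add: diff_divide_distrib)
  show "0 \<le> rat_left t n" if "t > 0"
  proof -
    have "0 < t * (real n + 1)" using that by simp
    then have "1 \<le> \<lceil>t * (real n + 1)\<rceil>" by linarith
    then show ?thesis unfolding rat_left_def by simp
  qed
qed

lemma inverse_Suc_eventually_less: "\<delta> > 0 \<Longrightarrow> \<forall>\<^sub>F n in sequentially. 1 / (real n + 1) < \<delta>"
  using order_tendstoD(2)[OF LIMSEQ_inverse_real_of_nat] by (simp add: inverse_eq_divide add.commute)

lemma rat_right_tendsto: "rat_right t \<longlonglongrightarrow> t"
proof (rule tendsto_sandwich[where f = "\<lambda>_. t" and h = "\<lambda>n. t + 1 / (real n + 1)"])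
  show "(\<lambda>n. t + 1 / (real n + 1)) \<longlonglongrightarrow> t"
    using tendsto_add[OF tendsto_const LIMSEQ_inverse_real_of_nat, of t] by (simp add: inverse_eq_divide add.commute)
qed (auto simp: rat_right less_imp_le)

text \<open>The approximating rationals exclude \<open>t\<close> itself, so even at a rational
  \<open>t\<close> the value may differ from \<open>y t\<close>.\<close>

definition right_extension :: "(real \<Rightarrow> 'a::banach) \<Rightarrow> real \<Rightarrow> 'a" where
  "right_extension y t = lim (\<lambda>n. y (rat_right t n))"

lemma convergent_of_eventually_close:
  fixes u :: "nat \<Rightarrow> 'a::banach"
  assumes "\<And>e. e > 0 \<Longrightarrow> \<exists>S. (\<forall>\<^sub>F n in sequentially. u n \<in> S) \<and> (\<forall>a\<in>S. \<forall>b\<in>S. norm (b - a) \<le> e)"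
  shows "convergent u"
proof (rule Cauchy_convergent, rule metric_CauchyI)
  fix e :: real assume "e > 0"
  then obtain S where "\<forall>\<^sub>F n in sequentially. u n \<in> S" and S: "\<forall>a\<in>S. \<forall>b\<in>S. norm (b - a) \<le> e / 2"
    using assms[of "e / 2"] by auto
  then obtain N where "\<forall>n\<ge>N. u n \<in> S" unfolding eventually_sequentially by blast
  then have "\<forall>m\<ge>N. \<forall>n\<ge>N. dist (u m) (u n) \<le> e / 2" using S by (auto simp: dist_norm)
  then have "\<forall>m\<ge>N. \<forall>n\<ge>N. dist (u m) (u n) < e" using \<open>e > 0\<close> by fastforce
  then show "\<exists>N. \<forall>m\<ge>N. \<forall>n\<ge>N. dist (u m) (u n) < e" by blast
qed

lemma norm_lim_diff_le:
  fixes u :: "nat \<Rightarrow> 'a::real_normed_vector"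
  assumes "u \<longlonglongrightarrow> l" "\<forall>\<^sub>F n in sequentially. norm (u n - a) \<le> e"
  shows "norm (l - a) \<le> e"
  using assms by (intro tendsto_upperbound[where f = "\<lambda>n. norm (u n - a)"]) (auto intro!: tendsto_intros)

text \<open>Finitely many oscillations of each size give one-sided Cauchy criteria along the
  rationals. These yield the one-sided limits, and the closeness bounds pass to the
  extension.\<close>

lemma cadlag_right_extension:
  fixes y :: "real \<Rightarrow> 'a::banach"
  assumes fin: "\<And>N e. e > 0 \<Longrightarrow> \<exists>p. \<not> oscillates p (\<rat> \<inter> {0..real N}) e y 0"
  shows "cadlag (right_extension y)" and "t \<ge> 0 \<Longrightarrow> (\<lambda>n. y (rat_right t n)) \<longlonglongrightarrow> right_extension y t"
proof -
  have right: "\<exists>\<delta>>0. \<forall>a\<in>\<rat>. \<forall>b\<in>\<rat>. t < a \<longrightarrow> a < t + \<delta> \<longrightarrow> t < b \<longrightarrow> b < t + \<delta> \<longrightarrow> norm (y b - y a) \<le> e"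
    if "t \<ge> 0" "e > 0" for t e
  proof -
    obtain N :: nat where N: "t + 1 \<le> real N" using real_arch_simple by blast
    obtain p where "\<not> oscillates p (\<rat> \<inter> {0..real N}) e y 0" using fin[OF \<open>e > 0\<close>] by blast
    then have no: "\<not> oscillates p (\<rat> \<inter> {0..real N}) e y t"
      using oscillates_mono[OF _ \<open>t \<ge> 0\<close>] by blast
    then obtain \<delta> where "\<delta> > 0" and \<delta>: "\<forall>a\<in>\<rat> \<inter> {0..real N}. \<forall>b\<in>\<rat> \<inter> {0..real N}.
        t < a \<longrightarrow> a < t + \<delta> \<longrightarrow> t < b \<longrightarrow> b < t + \<delta> \<longrightarrow> norm (y b - y a) \<le> e"
      using right_cauchy_of_not_oscillates[OF no less_imp_le[OF \<open>e > 0\<close>]] by blast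
    \<comment> \<open>The cap 1 keeps all points below \<open>t + 1\<close>, hence inside
      \<open>{0..real N}\<close>.\<close>
    then show ?thesis using N that by (intro exI[of _ "min \<delta> 1"]) auto
  qed
  have left: "\<exists>\<delta>>0. \<forall>a\<in>\<rat>. \<forall>b\<in>\<rat>. 0 \<le> a \<longrightarrow> 0 \<le> b \<longrightarrow> t - \<delta> < a \<longrightarrow> a < t \<longrightarrow> t - \<delta> < b \<longrightarrow> b < t \<longrightarrow> norm (y b - y a) \<le> e"
    if "t > 0" "e > 0" for t e
  proof -
    obtain N :: nat where N: "t \<le> real N" using real_arch_simple by blast
    obtain p where no: "\<not> oscillates p (\<rat> \<inter> {0..real N}) e y 0" using fin[OF \<open>e > 0\<close>] by blast
    obtain \<delta> where "\<delta> > 0" and \<delta>: "\<forall>a\<in>\<rat> \<inter> {0..real N}. \<forall>b\<in>\<rat> \<inter> {0..real N}.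
        t - \<delta> < a \<longrightarrow> a < t \<longrightarrow> t - \<delta> < b \<longrightarrow> b < t \<longrightarrow> norm (y b - y a) \<le> e"
      using left_cauchy_of_not_oscillates[OF no \<open>t > 0\<close> less_imp_le[OF \<open>e > 0\<close>]] by blast
    then show ?thesis using N by (intro exI[of _ \<delta>]) auto
  qed
  have ev_right: "\<forall>\<^sub>F n in sequentially. rat_right t n < t + \<delta>" if "\<delta> > 0" for t \<delta>
    using inverse_Suc_eventually_less[OF that]
  proof eventually_elim
    case (elim n)
    then show ?case using rat_right(3)[of t n] by linarith
  qed
  have ev_left: "\<forall>\<^sub>F n in sequentially. t - \<delta> < rat_left t n" if "\<delta> > 0" for t \<delta>
    using inverse_Suc_eventually_less[OF that]
  proof eventually_elim
    case (elim n)
    then show ?case using rat_left(3)[of t n] by linarith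
  qed
  have lim: "(\<lambda>n. y (rat_right t n)) \<longlonglongrightarrow> right_extension y t" if t: "t \<ge> 0" for t
  proof -
    have "convergent (\<lambda>n. y (rat_right t n))"
    proof (rule convergent_of_eventually_close)
      fix e :: real assume "e > 0"
      then obtain \<delta> where \<delta>: "\<delta> > 0" "\<forall>a\<in>\<rat>. \<forall>b\<in>\<rat>. t < a \<longrightarrow> a < t + \<delta> \<longrightarrow> t < b \<longrightarrow> b < t + \<delta> \<longrightarrow> norm (y b - y a) \<le> e"
        using right[OF t] by blast
      show "\<exists>S. (\<forall>\<^sub>F n in sequentially. y (rat_right t n) \<in> S) \<and> (\<forall>a\<in>S. \<forall>b\<in>S. norm (b - a) \<le> e)"
      proof (intro exI conjI)
        show "\<forall>\<^sub>F n in sequentially. y (rat_right t n) \<in> y ` {a\<in>\<rat>. t < a \<and> a < t + \<delta>}"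
          using ev_right[OF \<delta>(1), of t] by eventually_elim (use rat_right in blast)
        show "\<forall>a\<in>y ` {a\<in>\<rat>. t < a \<and> a < t + \<delta>}. \<forall>b\<in>y ` {a\<in>\<rat>. t < a \<and> a < t + \<delta>}. norm (b - a) \<le> e"
          using \<delta>(2) by blast
      qed
    qed
    then show ?thesis unfolding right_extension_def by (simp add: convergent_LIMSEQ_iff)
  qed
  then show "t \<ge> 0 \<Longrightarrow> (\<lambda>n. y (rat_right t n)) \<longlonglongrightarrow> right_extension y t" .
  show "cadlag (right_extension y)"
    unfolding cadlag_def
  proof (intro conjI allI impI)
    fix t :: real assume t: "t \<ge> 0"
    show "(right_extension y \<longlongrightarrow> right_extension y t) (at_right t)"
      unfolding tendsto_iff
    proof (intro allI impI)
      fix e :: real assume "e > 0"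
      then obtain \<delta> where \<delta>: "\<delta> > 0" "\<forall>a\<in>\<rat>. \<forall>b\<in>\<rat>. t < a \<longrightarrow> a < t + \<delta> \<longrightarrow> t < b \<longrightarrow> b < t + \<delta> \<longrightarrow> norm (y b - y a) \<le> e / 2"
        using right[OF t, of "e / 2"] by auto
      have close: "norm (right_extension y t - y a) \<le> e / 2" if "a \<in> \<rat>" "t < a" "a < t + \<delta>" for a
      proof (rule norm_lim_diff_le[OF lim[OF t]])
        show "\<forall>\<^sub>F n in sequentially. norm (y (rat_right t n) - y a) \<le> e / 2"
          using ev_right[OF \<delta>(1), of t]
        proof eventually_elim
          case (elim n)
          then show ?case using \<delta>(2) rat_right(1,2)[of t n] that by blast
        qed
      qed
      have "dist (right_extension y u) (right_extension y t) < e" if u: "t < u" "u < t + \<delta>" for u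
      proof -
        have "norm (right_extension y u - right_extension y t) \<le> e / 2"
        proof (rule norm_lim_diff_le[OF lim])
          show "\<forall>\<^sub>F n in sequentially. norm (y (rat_right u n) - right_extension y t) \<le> e / 2"
          proof (rule eventually_mono)
            show "\<forall>\<^sub>F n in sequentially. rat_right u n < t + \<delta>"
              using ev_right[of "t + \<delta> - u" u] u by simp
            fix n assume "rat_right u n < t + \<delta>"
            then have "norm (right_extension y t - y (rat_right u n)) \<le> e / 2"
              using less_trans[OF u(1) rat_right(2)] by (intro close rat_right(1))
            then show "norm (y (rat_right u n) - right_extension y t) \<le> e / 2"
              by (subst norm_minus_commute)
          qed
        qed (use u t in simp)
        then show ?thesis using \<open>e > 0\<close> by (simp add: dist_norm)
      qed
      then show "\<forall>\<^sub>F u in at_right t. dist (right_extension y u) (right_extension y t) < e"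
        unfolding eventually_at_right_field using \<delta>(1) by (intro exI[of _ "t + \<delta>"]) auto
    qed
  next
    fix t :: real assume t: "t > 0"
    have "convergent (\<lambda>n. y (rat_left t n))"
    proof (rule convergent_of_eventually_close)
      fix e :: real assume "e > 0"
      then obtain \<delta> where \<delta>: "\<delta> > 0" "\<forall>a\<in>\<rat>. \<forall>b\<in>\<rat>. 0 \<le> a \<longrightarrow> 0 \<le> b \<longrightarrow> t - \<delta> < a \<longrightarrow> a < t \<longrightarrow> t - \<delta> < b \<longrightarrow> b < t \<longrightarrow> norm (y b - y a) \<le> e"
        using left[OF t] by blast
      show "\<exists>S. (\<forall>\<^sub>F n in sequentially. y (rat_left t n) \<in> S) \<and> (\<forall>a\<in>S. \<forall>b\<in>S. norm (b - a) \<le> e)"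
      proof (intro exI conjI)
        show "\<forall>\<^sub>F n in sequentially. y (rat_left t n) \<in> y ` {a\<in>\<rat>. 0 \<le> a \<and> t - \<delta> < a \<and> a < t}"
          using ev_left[OF \<delta>(1), of t] by eventually_elim (use rat_left(1,2) rat_left(4)[OF t] in blast)
        show "\<forall>a\<in>y ` {a\<in>\<rat>. 0 \<le> a \<and> t - \<delta> < a \<and> a < t}. \<forall>b\<in>y ` {a\<in>\<rat>. 0 \<le> a \<and> t - \<delta> < a \<and> a < t}. norm (b - a) \<le> e"
          using \<delta>(2) by blast
      qed
    qed
    then obtain l where l: "(\<lambda>n. y (rat_left t n)) \<longlonglongrightarrow> l" by (auto simp: convergent_def)
    have "(right_extension y \<longlongrightarrow> l) (at_left t)"
      unfolding tendsto_iff
    proof (intro allI impI)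
      fix e :: real assume "e > 0"
      then obtain \<delta> where \<delta>: "\<delta> > 0" "\<forall>a\<in>\<rat>. \<forall>b\<in>\<rat>. 0 \<le> a \<longrightarrow> 0 \<le> b \<longrightarrow> t - \<delta> < a \<longrightarrow> a < t \<longrightarrow> t - \<delta> < b \<longrightarrow> b < t \<longrightarrow> norm (y b - y a) \<le> e / 2"
        using left[OF t, of "e / 2"] by auto
      have close: "norm (l - y a) \<le> e / 2" if "a \<in> \<rat>" "0 \<le> a" "t - \<delta> < a" "a < t" for a
      proof (rule norm_lim_diff_le[OF l])
        show "\<forall>\<^sub>F n in sequentially. norm (y (rat_left t n) - y a) \<le> e / 2"
          using ev_left[OF \<delta>(1), of t]
        proof eventually_elim
          case (elim n)
          then show ?case using \<delta>(2) rat_left(1,2)[of t n] rat_left(4)[OF t, of n] that by blast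
        qed
      qed
      have "dist (right_extension y u) l < e" if u: "0 \<le> u" "t - \<delta> < u" "u < t" for u
      proof -
        have "norm (right_extension y u - l) \<le> e / 2"
        proof (rule norm_lim_diff_le[OF lim[OF u(1)]])
          show "\<forall>\<^sub>F n in sequentially. norm (y (rat_right u n) - l) \<le> e / 2"
          proof (rule eventually_mono)
            show "\<forall>\<^sub>F n in sequentially. rat_right u n < t"
              using ev_right[of "t - u" u] u by simp
            fix n assume "rat_right u n < t"
            then have "norm (l - y (rat_right u n)) \<le> e / 2"
              using u rat_right(2)[of u n] by (intro close rat_right(1)) auto
            then show "norm (y (rat_right u n) - l) \<le> e / 2"
              by (subst norm_minus_commute)
          qed
        qed
        then show ?thesis using \<open>e > 0\<close> by (simp add: dist_norm)
      qed
      then show "\<forall>\<^sub>F u in at_left t. dist (right_extension y u) l < e"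
        unfolding eventually_at_left_field using \<delta>(1) t
        by (intro exI[of _ "max 0 (t - \<delta>)"]) (auto simp: less_imp_le)
    qed
    then show "\<exists>l. (right_extension y \<longlongrightarrow> l) (at_left t)" by blast
  qed
qed

lemma eventually_oscillates:
  fixes y :: "real \<Rightarrow> 'a::real_normed_vector"
  assumes "\<And>a. a \<in> A \<Longrightarrow> (\<lambda>n. z n a) \<longlonglongrightarrow> y a" and "oscillates p A e y s"
  shows "\<forall>\<^sub>F n in sequentially. oscillates p A e (z n) s"
  using assms(2)
proof (induction p arbitrary: s)
  case (Suc p)
  then obtain a b where ab: "a \<in> A" "b \<in> A" "s \<le> a" "a < b" "e < norm (y b - y a)" "oscillates p A e y b"
    by auto
  have "(\<lambda>n. norm (z n b - z n a)) \<longlonglongrightarrow> norm (y b - y a)"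
    using ab assms(1) by (intro tendsto_intros) auto
  then have "\<forall>\<^sub>F n in sequentially. e < norm (z n b - z n a)"
    using ab(5) by (rule order_tendstoD)
  with Suc.IH[OF ab(6)] show ?case
    by eventually_elim (use ab in auto)
qed simp

abbreviation time_index :: "real \<Rightarrow> real \<Rightarrow> nat" where
  "time_index h t \<equiv> nat \<lfloor>t / h\<rfloor>"

lemma time_index_mono: "h > 0 \<Longrightarrow> s \<le> t \<Longrightarrow> time_index h s \<le> time_index h t"
  by (intro nat_mono floor_mono divide_right_mono) auto

text \<open>Each oscillation above \<open>2 * \<eta>\<close> forces a reset between its two time
  indices, and these index ranges do not overlap.\<close>

lemma oscillates_walk_le_count:
  assumes "h > 0" "\<eta> \<ge> 0" "s \<le> real N"
    and "oscillates p (\<rat> \<inter> {0..real N}) (2 * \<eta>) (\<lambda>q. walk \<xi> (time_index h q)) s"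
  shows "p + oscillation_count \<eta> \<xi> (time_index h s) \<le> oscillation_count \<eta> \<xi> (time_index h (real N))"
  using assms(3,4)
proof (induction p arbitrary: s)
  case 0
  then show ?case using time_index_mono[OF \<open>h > 0\<close>, of s N] by (auto intro: oscillation_count_mono)
next
  case (Suc p)
  then obtain a b where ab: "s \<le> a" "a < b" "b \<le> real N"
    "2 * \<eta> < norm (walk \<xi> (time_index h b) - walk \<xi> (time_index h a))"
    "oscillates p (\<rat> \<inter> {0..real N}) (2 * \<eta>) (\<lambda>q. walk \<xi> (time_index h q)) b"
    by auto
  have "oscillation_count \<eta> \<xi> (time_index h s) \<le> oscillation_count \<eta> \<xi> (time_index h a)"
    using ab \<open>h > 0\<close> by (intro oscillation_count_mono time_index_mono)
  moreover have "Suc (oscillation_count \<eta> \<xi> (time_index h a)) \<le> oscillation_count \<eta> \<xi> (time_index h b)"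
    using ab assms by (intro oscillation_count_increase time_index_mono) auto
  moreover have "p + oscillation_count \<eta> \<xi> (time_index h b) \<le> oscillation_count \<eta> \<xi> (time_index h (real N))"
    using ab by (intro Suc.IH) auto
  ultimately show ?case by simp
qed

section \<open>The limit process\<close>

lemma cadlag_cong:
  assumes eq: "\<And>t. t \<ge> 0 \<Longrightarrow> z t = y t" and y: "cadlag y"
  shows "cadlag z"
  unfolding cadlag_def
proof (intro conjI allI impI)
  fix t :: real assume t: "t \<ge> 0"
  have "\<forall>\<^sub>F u in at_right t. z u = y u"
    unfolding eventually_at_right_field using eq t by (intro exI[of _ "t + 1"]) auto
  then show "(z \<longlongrightarrow> z t) (at_right t)"
    using y t unfolding cadlag_def by (simp add: tendsto_cong eq)
next
  fix t :: real assume t: "t > 0"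
  have "\<forall>\<^sub>F u in at_left t. z u = y u"
    unfolding eventually_at_left_field using eq t by (intro exI[of _ 0]) auto
  then show "\<exists>l. (z \<longlongrightarrow> l) (at_left t)"
    using y t unfolding cadlag_def by (simp add: tendsto_cong)
qed

text \<open>The walk \<open>n\<close> makes steps of law \<open>\<mu> n\<close> at time spacing
  \<open>h n\<close>. The bound \<open>spread_one\<close> comes from hypothesis (1) and governs
  oscillations and the modulus of continuity in probability; \<open>spread_large\<close> combines
  (1) and (2) and confines the walks to a ball with high probability.\<close>

locale small_noise =
  fixes \<mu> :: "nat \<Rightarrow> 'a::euclidean_space measure" and h :: "nat \<Rightarrow> real" and C :: real
  assumes noise: "noise (\<mu> n)"
    and h_pos: "0 < h n"
    and h_lim: "h \<longlonglongrightarrow> 0"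
    and spread_one: "spread (\<mu> n) 1 \<le> C * h n"
    and spread_large: "\<epsilon> > 0 \<Longrightarrow> \<exists>R>0. \<forall>\<^sub>F n in sequentially. spread (\<mu> n) R \<le> \<epsilon> * h n"
begin

lemma C_nonneg: "C \<ge> 0"
proof -
  have "0 \<le> C * h 0" using spread_nonneg[of 1 "\<mu> 0"] spread_one[of 0] by simp
  then show ?thesis using h_pos[of 0] by (simp add: zero_le_mult_iff)
qed

lemma small_noise_subseq:
  assumes \<rho>: "strict_mono \<rho>"
  shows "small_noise (\<lambda>n. \<mu> (\<rho> n)) (\<lambda>n. h (\<rho> n)) C"
proof (rule small_noise.intro)
  show "(\<lambda>n. h (\<rho> n)) \<longlonglongrightarrow> 0" using LIMSEQ_subseq_LIMSEQ[OF h_lim \<rho>] by (simp add: o_def)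
  fix \<epsilon> :: real assume "\<epsilon> > 0"
  then obtain R where R: "R > 0" "\<forall>\<^sub>F n in sequentially. spread (\<mu> n) R \<le> \<epsilon> * h n"
    using spread_large by blast
  show "\<exists>R>0. \<forall>\<^sub>F n in sequentially. spread (\<mu> (\<rho> n)) R \<le> \<epsilon> * h (\<rho> n)"
    using R(1) eventually_subseq[OF \<rho> R(2)] by blast
qed (rule noise h_pos spread_one)+

lemma max_tight:
  assumes "\<epsilon> > 0" "T \<ge> 0"
  obtains R where "R > 0" "\<forall>\<^sub>F n in sequentially. \<forall>k. real k * h n \<le> T \<longrightarrow>
    measure (noise_seq (\<mu> n)) {\<xi>. \<exists>j\<le>k. norm (walk \<xi> j) > R} \<le> \<epsilon>"
proof -
  \<comment> \<open>The 4 is the constant of the maximal inequality; \<open>T + 1\<close> replaces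
    \<open>T\<close> to cover \<open>T = 0\<close>.\<close>
  define \<epsilon>' where "\<epsilon>' = \<epsilon> / (4 * (T + 1))"
  have \<epsilon>': "\<epsilon>' > 0" "4 * T * \<epsilon>' \<le> \<epsilon>" using assms by (auto simp: \<epsilon>'_def field_simps)
  obtain R where R: "R > 0" "\<forall>\<^sub>F n in sequentially. spread (\<mu> n) R \<le> \<epsilon>' * h n"
    using spread_large[OF \<epsilon>'(1)] by blast
  from R(2) have "\<forall>\<^sub>F n in sequentially. \<forall>k. real k * h n \<le> T \<longrightarrow>
    measure (noise_seq (\<mu> n)) {\<xi>. \<exists>j\<le>k. norm (walk \<xi> j) > 2 * R} \<le> \<epsilon>"
  proof eventually_elim
    case (elim n)
    interpret N: noise "\<mu> n" by (rule noise)
    show ?case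
    proof (intro allI impI)
      fix k assume k: "real k * h n \<le> T"
      have "N.S.P.prob {\<xi>. \<exists>j\<le>k. norm (walk \<xi> j) > 2 * R} \<le> 4 * real k * spread (\<mu> n) R"
        by (rule N.prob_walk_max_gt[OF R(1)])
      also have "\<dots> \<le> 4 * real k * (\<epsilon>' * h n)"
        using elim by (intro mult_left_mono) auto
      also have "\<dots> = 4 * (real k * h n) * \<epsilon>'" by simp
      also have "\<dots> \<le> 4 * T * \<epsilon>'" using k \<epsilon>' by (intro mult_right_mono) auto
      also have "\<dots> \<le> \<epsilon>" by (rule \<epsilon>')
      finally show "N.S.P.prob {\<xi>. \<exists>j\<le>k. norm (walk \<xi> j) > 2 * R} \<le> \<epsilon>" .
    qed
  qed
  then show ?thesis using R(1) by (intro that[of "2 * R"]) auto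
qed

lemma time_index_times: "0 \<le> t \<Longrightarrow> real (time_index (h n) t) * h n \<le> t" "t - h n \<le> real (time_index (h n) t) * h n"
proof -
  have fl: "of_int \<lfloor>t / h n\<rfloor> \<le> t / h n" "t / h n - 1 \<le> of_int \<lfloor>t / h n\<rfloor>" by linarith+
  have "t - h n = (t / h n - 1) * h n" using h_pos[of n] by (simp add: field_simps)
  also have "\<dots> \<le> of_int \<lfloor>t / h n\<rfloor> * h n" using fl h_pos[of n] by (intro mult_right_mono) auto
  also have "\<dots> \<le> real (time_index (h n) t) * h n" using h_pos[of n] by (intro mult_right_mono) auto
  finally show "t - h n \<le> real (time_index (h n) t) * h n" .
  assume "0 \<le> t"
  then have "real (time_index (h n) t) = of_int \<lfloor>t / h n\<rfloor>" using h_pos[of n] by simp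
  then have "real (time_index (h n) t) * h n \<le> t / h n * h n"
    using fl(1) h_pos[of n] by (simp del: times_divide_eq_left)
  then show "real (time_index (h n) t) * h n \<le> t" using h_pos[of n] by simp
qed

lemma time_index_tendsto:
  assumes "0 \<le> t"
  shows "(\<lambda>n. real (time_index (h n) t) * h n) \<longlonglongrightarrow> t"
proof (rule tendsto_sandwich[where f = "\<lambda>n. t - h n" and h = "\<lambda>_. t"])
  show "(\<lambda>n. t - h n) \<longlonglongrightarrow> t" using tendsto_diff[OF tendsto_const h_lim, of t] by simp
qed (use time_index_times assms in auto)

end

text \<open>Convergence is asked at nonnegative rational times only. The noises keep their exact
  laws, so the expectation of any bounded functional of a single walk can be computed on the product
  space.\<close>

locale walk_limit = small_noise \<mu> h C + prob_space M
  for \<mu> :: "nat \<Rightarrow> 'a::euclidean_space measure" and h C and M :: "'w measure" +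
  fixes \<xi> :: "nat \<Rightarrow> 'w \<Rightarrow> nat \<Rightarrow> 'a" and y :: "real \<Rightarrow> 'w \<Rightarrow> 'a"
  assumes xi_measurable [measurable]: "\<xi> n \<in> M \<rightarrow>\<^sub>M noise_seq (\<mu> n)"
    and xi_law: "distr M (noise_seq (\<mu> n)) (\<xi> n) = noise_seq (\<mu> n)"
    and y_measurable [measurable]: "y q \<in> borel_measurable M"
    and y_lim: "AE w in M. \<forall>q\<in>\<rat>. 0 \<le> q \<longrightarrow> (\<lambda>n. walk (\<xi> n w) (time_index (h n) q)) \<longlonglongrightarrow> y q w"

lemma (in small_noise) ex_walk_limit:
  obtains \<rho> :: "nat \<Rightarrow> nat" and M :: "(real \<Rightarrow> 'a) measure" and \<xi> y
  where "strict_mono \<rho>" "walk_limit (\<lambda>n. \<mu> (\<rho> n)) (\<lambda>n. h (\<rho> n)) C M \<xi> y"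
proof -
  let ?Q = "\<rat> \<inter> {0..} :: real set"
  have Q: "countable ?Q" "?Q \<noteq> {}" using countable_rat by (auto intro: exI[of _ 0])
  define q where "q = from_nat_into ?Q"
  have q: "q j \<in> ?Q" for j unfolding q_def by (rule from_nat_into[OF Q(2)])
  define K where "K n j = time_index (h n) (q j)" for n j
  obtain \<rho> :: "nat \<Rightarrow> nat" and M :: "(real \<Rightarrow> 'a) measure" and \<xi> y
    where \<rho>: "strict_mono \<rho>" and M: "prob_space M" and \<xi>: "\<And>n. \<xi> n \<in> M \<rightarrow>\<^sub>M noise_seq (\<mu> (\<rho> n))"
    and law: "\<And>n. distr M (noise_seq (\<mu> (\<rho> n))) (\<xi> n) = noise_seq (\<mu> (\<rho> n))"
    and y: "\<And>j. y j \<in> borel_measurable M"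
    and lim: "AE w in M. \<forall>j. (\<lambda>n. walk (\<xi> n w) (K (\<rho> n) j)) \<longlonglongrightarrow> y j w"
  proof (rule walk_coupling[of \<mu> K])
    show "noise (\<mu> n)" for n by (rule noise)
    \<comment> \<open>Every rational strictly between \<open>k * h n\<close> and
      \<open>(k + 1) * h n\<close> has time index \<open>k\<close>.\<close>
    show "\<exists>j. K n j = k" for n k
    proof -
      obtain r where r: "r \<in> \<rat>" "real k * h n < r" "r < (real k + 1) * h n"
        using Rats_dense_in_real[of "real k * h n" "(real k + 1) * h n"] h_pos[of n] by auto
      have "0 \<le> real k * h n" using h_pos[of n] by simp
      then have "r \<in> ?Q" using r by auto
      then obtain j where j: "q j = r" using from_nat_into_surj[OF Q(1)] unfolding q_def by blast
      have "\<lfloor>r / h n\<rfloor> = int k"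
        using r h_pos[of n] by (intro floor_unique) (auto simp: field_simps)
      then show ?thesis using j by (intro exI[of _ j]) (simp add: K_def)
    qed
    show "\<exists>R. \<forall>\<^sub>F n in sequentially. measure (noise_seq (\<mu> n)) {\<xi>. R < norm (walk \<xi> (K n j))} \<le> \<epsilon>"
      if \<epsilon>: "\<epsilon> > 0" for j \<epsilon>
    proof -
      obtain R where R: "R > 0" "\<forall>\<^sub>F n in sequentially. \<forall>k. real k * h n \<le> q j \<longrightarrow>
        measure (noise_seq (\<mu> n)) {\<xi>. \<exists>j\<le>k. norm (walk \<xi> j) > R} \<le> \<epsilon>"
        using max_tight[OF \<epsilon>, of "q j"] q[of j] by auto
      from R(2) have "\<forall>\<^sub>F n in sequentially. measure (noise_seq (\<mu> n)) {\<xi>. R < norm (walk \<xi> (K n j))} \<le> \<epsilon>"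
      proof eventually_elim
        case (elim n)
        interpret N: noise "\<mu> n" by (rule noise)
        have "{\<xi>\<in>space N.W. \<exists>i\<le>K n j. norm (walk \<xi> i) > R} \<in> N.S.P.events" by measurable
        then have "N.S.P.prob {\<xi>. R < norm (walk \<xi> (K n j))} \<le> N.S.P.prob {\<xi>. \<exists>i\<le>K n j. norm (walk \<xi> i) > R}"
          by (intro N.S.P.finite_measure_mono) auto
        also have "\<dots> \<le> \<epsilon>"
          using elim time_index_times(1)[of "q j" n] q[of j] by (auto simp: K_def)
        finally show ?case .
      qed
      then show ?thesis by blast
    qed
  qed blast
  define y' where "y' r = (if r \<in> ?Q then y (to_nat_on ?Q r) else (\<lambda>_. 0))" for r
  have y'_q: "q (to_nat_on ?Q r) = r" if "r \<in> ?Q" for r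
    unfolding q_def using Q(1) that by (rule from_nat_into_to_nat_on)
  have "walk_limit (\<lambda>n. \<mu> (\<rho> n)) (\<lambda>n. h (\<rho> n)) C M \<xi> y'"
  proof (intro walk_limit.intro walk_limit_axioms.intro small_noise_subseq \<rho> M \<xi> law)
    show "y' r \<in> borel_measurable M" for r using y by (simp add: y'_def)
    show "AE w in M. \<forall>r\<in>\<rat>. 0 \<le> r \<longrightarrow> (\<lambda>n. walk (\<xi> n w) (time_index (h (\<rho> n)) r)) \<longlonglongrightarrow> y' r w"
      using lim
    proof eventually_elim
      case (elim w)
      show ?case
      proof (intro ballI impI)
        fix r :: real assume "r \<in> \<rat>" "0 \<le> r"
        then have r: "r \<in> ?Q" by simp
        show "(\<lambda>n. walk (\<xi> n w) (time_index (h (\<rho> n)) r)) \<longlonglongrightarrow> y' r w"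
          using elim[rule_format, of "to_nat_on ?Q r"] r by (simp add: K_def y'_q y'_def)
      qed
    qed
  qed
  with \<rho> show ?thesis by (rule that)
qed

context walk_limit
begin

lemma expectation_xi:
  fixes \<Phi> :: "_ \<Rightarrow> real"
  assumes [measurable]: "\<Phi> \<in> borel_measurable (noise_seq (\<mu> n))"
  shows "expectation (\<lambda>w. \<Phi> (\<xi> n w)) = (\<integral>\<zeta>. \<Phi> \<zeta> \<partial>noise_seq (\<mu> n))"
proof -
  have "expectation (\<lambda>w. \<Phi> (\<xi> n w)) = (\<integral>\<zeta>. \<Phi> \<zeta> \<partial>distr M (noise_seq (\<mu> n)) (\<xi> n))"
    by (subst integral_distr) auto
  then show ?thesis by (simp add: xi_law)
qed

lemma prob_xi:
  assumes [measurable]: "Measurable.pred (noise_seq (\<mu> n)) P"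
  shows "prob {w\<in>space M. P (\<xi> n w)} = measure (noise_seq (\<mu> n)) {\<zeta>. P \<zeta>}"
proof -
  interpret N: noise "\<mu> n" by (rule noise)
  have "prob {w\<in>space M. P (\<xi> n w)} = measure (distr M N.W (\<xi> n)) {\<zeta>\<in>space N.W. P \<zeta>}"
  proof (subst measure_distr)
    show "{\<zeta> \<in> space N.W. P \<zeta>} \<in> N.S.P.events" by measurable
  qed (auto intro!: arg_cong2[where f = measure])
  then show ?thesis by (simp add: xi_law)
qed

lemma measurable_walk_xi [measurable]: "(\<lambda>w. walk (\<xi> n w) k) \<in> borel_measurable M"
proof -
  interpret N: noise "\<mu> n" by (rule noise)
  show ?thesis by measurable
qed

text \<open>The probability of at least \<open>p\<close> resets up to time \<open>N\<close> is at
  most a constant divided by \<open>p\<close>, uniformly in \<open>n\<close>. The lower limit of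
  these events obeys the same bound, so almost no path lies in it for every \<open>p\<close>.
  Oscillations of the limit eventually appear in the walks, where each one costs a reset.\<close>

lemma AE_not_oscillates: "AE w in M. \<forall>N. \<forall>e>0. \<exists>p. \<not> oscillates p (\<rat> \<inter> {0..real N}) e (\<lambda>q. y q w) 0"
proof -
  \<comment> \<open>Countably many sizes tending to 0 suffice, so the exceptional null sets can be
    united; the factor 2 matches the threshold \<open>\<eta>\<close> of the resets.\<close>
  have fixed: "AE w in M. \<exists>p. \<not> oscillates p (\<rat> \<inter> {0..real N}) (2 * (1 / (real m + 1))) (\<lambda>q. y q w) 0" for N m :: nat
  proof -
    define \<eta> where "\<eta> = 1 / (real m + 1)"
    have \<eta>: "\<eta> > 0" by (simp add: \<eta>_def)
    have b: "bump \<eta> > 0" using \<eta> by (simp add: bump_def add_pos_nonneg)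
    let ?k = "\<lambda>n. time_index (h n) (real N)"
    let ?E = "\<lambda>p n. {w\<in>space M. p \<le> oscillation_count \<eta> (\<xi> n w) (?k n)}"
    let ?A = "\<lambda>p. {w\<in>space M. \<forall>\<^sub>F n in sequentially. w \<in> ?E p n}"
    have E[measurable]: "?E p n \<in> sets M" for p n
    proof -
      interpret N: noise "\<mu> n" by (rule noise)
      show ?thesis by measurable
    qed
    have PE: "prob (?E p n) \<le> 2 * C * real N / bump \<eta> / real p" if "p > 0" for p n
    proof -
      interpret N: noise "\<mu> n" by (rule noise)
      have "prob (?E p n) = N.S.P.prob {\<xi>. p \<le> oscillation_count \<eta> \<xi> (?k n)}"
        by (rule prob_xi) measurable
      also have "\<dots> \<le> real (?k n) * (2 * spread (\<mu> n) 1) / (bump (\<eta> / 1) * real p)"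
        using \<eta> that by (intro N.prob_oscillation_count_ge) auto
      also have "\<dots> \<le> real (?k n) * (2 * (C * h n)) / (bump (\<eta> / 1) * real p)"
        using spread_one[of n] b by (intro divide_right_mono mult_left_mono) auto
      also have "\<dots> = 2 * C * (real (?k n) * h n) / (bump \<eta> * real p)" by simp
      also have "\<dots> \<le> 2 * C * real N / (bump \<eta> * real p)"
        using time_index_times(1)[of "real N" n] C_nonneg b by (intro divide_right_mono mult_left_mono) auto
      finally show ?thesis by simp
    qed
    have A[measurable]: "?A p \<in> sets M" for p unfolding eventually_sequentially by measurable
    have PA: "prob (?A p) \<le> 2 * C * real N / bump \<eta> / real p" if "p > 0" for p
      by (rule measure_eventually_le[OF prob_space_axioms E]) (intro always_eventually allI PE that)
    define D where "D = (\<Inter>p. ?A (Suc p))"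
    have D: "D \<in> sets M" unfolding D_def using A by blast
    have le: "prob D \<le> e" if "e > 0" for e
    proof -
      obtain p :: nat where p: "2 * C * real N / bump \<eta> / e < real p" using reals_Archimedean2 by blast
      have "prob D \<le> prob (?A (Suc p))" by (intro finite_measure_mono A) (auto simp: D_def)
      also have "\<dots> \<le> 2 * C * real N / bump \<eta> / real (Suc p)" by (rule PA) simp
      also have "\<dots> \<le> e"
      proof -
        have "2 * C * real N / bump \<eta> < real p * e" using p unfolding pos_divide_less_eq[OF that] .
        then have "2 * C * real N / bump \<eta> < e * real p" by (simp only: mult.commute)
        also have "\<dots> \<le> e * real (Suc p)" using that by simp
        finally have "2 * C * real N / bump \<eta> \<le> e * real (Suc p)" by simp
        moreover have "real (Suc p) > 0" by simp
        ultimately show ?thesis by (simp only: pos_divide_le_eq)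
      qed
      finally show ?thesis .
    qed
    have "prob D \<le> 0" by (rule field_le_epsilon) (simp add: le)
    then have "prob D = 0" by (simp add: measure_le_0_iff)
    then have "D \<in> null_sets M" using D by (simp add: null_sets_def emeasure_eq_measure)
    then have "AE w in M. w \<notin> D" by (rule AE_not_in)
    then show ?thesis
      using y_lim AE_space
    proof eventually_elim
      case (elim w)
      then obtain p where p: "\<not> (\<forall>\<^sub>F n in sequentially. Suc p \<le> oscillation_count \<eta> (\<xi> n w) (?k n))"
        unfolding D_def by auto
      have "\<not> oscillates (Suc p) (\<rat> \<inter> {0..real N}) (2 * \<eta>) (\<lambda>q. y q w) 0"
      proof
        assume "oscillates (Suc p) (\<rat> \<inter> {0..real N}) (2 * \<eta>) (\<lambda>q. y q w) 0"
        then have "\<forall>\<^sub>F n in sequentially. oscillates (Suc p) (\<rat> \<inter> {0..real N}) (2 * \<eta>) (\<lambda>q. walk (\<xi> n w) (time_index (h n) q)) 0"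
          using elim by (intro eventually_oscillates[where y = "\<lambda>q. y q w"]) auto
        then have "\<forall>\<^sub>F n in sequentially. Suc p \<le> oscillation_count \<eta> (\<xi> n w) (?k n)"
        proof eventually_elim
          case (elim n)
          then show ?case
            using oscillates_walk_le_count[OF h_pos[of n] less_imp_le[OF \<eta>] _ elim] by simp
        qed
        with p show False by simp
      qed
      then show ?case unfolding \<eta>_def by blast
    qed
  qed
  have "AE w in M. \<forall>N m. \<exists>p. \<not> oscillates p (\<rat> \<inter> {0..real N}) (2 * (1 / (real m + 1))) (\<lambda>q. y q w) 0"
    unfolding AE_all_countable using fixed by blast
  then show ?thesis
  proof eventually_elim
    case (elim w)
    show ?case
    proof (intro allI impI)
      fix N :: nat and e :: real assume "e > 0"
      then obtain m where m: "1 / (real m + 1) < e / 2" using inverse_Suc_eventually_less[of "e / 2"]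
        by (auto simp: eventually_sequentially)
      obtain p where "\<not> oscillates p (\<rat> \<inter> {0..real N}) (2 * (1 / (real m + 1))) (\<lambda>q. y q w) 0"
        using elim by blast
      then show "\<exists>p. \<not> oscillates p (\<rat> \<inter> {0..real N}) e (\<lambda>q. y q w) 0"
        using oscillates_e_mono[of p _ e _ 0 "2 * (1 / (real m + 1))"] m by (intro exI[of _ p]) auto
    qed
  qed
qed

text \<open>On the exceptional null set and at negative times \<open>Y\<close> is set to 0. Thus
  every path is cadlag and every \<open>Y t\<close> measurable without completing \<open>M\<close>,
  which permits solving the equation for every point of the sample space.\<close>

lemma ex_limit_process:
  obtains Y where "\<And>t. Y t \<in> borel_measurable M" "\<And>w. cadlag (\<lambda>t. Y t w)"
    "\<And>t. t \<ge> 0 \<Longrightarrow> AE w in M. (\<lambda>n. y (rat_right t n) w) \<longlonglongrightarrow> Y t w"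
proof -
  obtain N where N: "N \<in> null_sets M"
    "\<And>w. w \<in> space M - N \<Longrightarrow> \<forall>N. \<forall>e>0. \<exists>p. \<not> oscillates p (\<rat> \<inter> {0..real N}) e (\<lambda>q. y q w) 0"
    using AE_not_oscillates by (auto elim!: AE_E3)
  have [measurable]: "N \<in> sets M" using N by auto
  define Y where "Y t w = (if t < 0 \<or> w \<notin> space M - N then 0 else right_extension (\<lambda>q. y q w) t)" for t w
  have lim: "(\<lambda>n. y (rat_right t n) w) \<longlonglongrightarrow> Y t w" if "w \<in> space M - N" "t \<ge> 0" for w t
    using cadlag_right_extension(2)[of "\<lambda>q. y q w" t] N(2)[OF that(1)] that by (auto simp: Y_def)
  show ?thesis
  proof (rule that[of Y])
    show "Y t \<in> borel_measurable M" for t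
    proof (cases "t < 0")
      case True
      then have "Y t = (\<lambda>_. 0)" by (auto simp: Y_def)
      then show ?thesis by simp
    next
      case False
      show ?thesis
      proof (rule borel_measurable_LIMSEQ_metric[where f = "\<lambda>n w. if w \<in> N then 0 else y (rat_right t n) w"])
        show "(\<lambda>n. if w \<in> N then 0 else y (rat_right t n) w) \<longlonglongrightarrow> Y t w" if "w \<in> space M" for w
          using lim[of w t] False that by (cases "w \<in> N") (auto simp: Y_def)
      qed measurable
    qed
    show "cadlag (\<lambda>t. Y t w)" for w
    proof (cases "w \<in> space M - N")
      case True
      have "cadlag (right_extension (\<lambda>q. y q w))"
        using N(2)[OF True] by (intro cadlag_right_extension) auto
      then show ?thesis by (rule cadlag_cong[rotated]) (use True in \<open>simp add: Y_def\<close>)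
    next
      case False
      then have "(\<lambda>t. Y t w) = (\<lambda>_. 0)" by (auto simp: Y_def)
      then show ?thesis by (auto simp: cadlag_def)
    qed
    show "AE w in M. (\<lambda>n. y (rat_right t n) w) \<longlonglongrightarrow> Y t w" if "t \<ge> 0" for t
      using AE_not_in[OF N(1)] AE_space by eventually_elim (use lim that in auto)
  qed
qed

end

locale limit_process = walk_limit \<mu> h C M \<xi> y
  for \<mu> :: "nat \<Rightarrow> 'a::euclidean_space measure" and h C and M :: "'w measure" and \<xi> y +
  fixes Y :: "real \<Rightarrow> 'w \<Rightarrow> 'a"
  assumes Y_measurable [measurable]: "Y t \<in> borel_measurable M"
    and Y_cadlag: "cadlag (\<lambda>t. Y t w)"
    and Y_lim: "t \<ge> 0 \<Longrightarrow> AE w in M. (\<lambda>n. y (rat_right t n) w) \<longlonglongrightarrow> Y t w"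

section \<open>Convergence of the walks in probability at each fixed time\<close>

lemma min_1_norm_triangle:
  "min 1 (norm (a - d)) \<le> min 1 (norm (a - b)) + min 1 (norm (b - c)) + min 1 (norm (c - d))"
proof -
  have "norm (a - d) \<le> norm (a - b) + norm (b - c) + norm (c - d)"
    using norm_triangle_ineq[of "a - b" "b - d"] norm_triangle_ineq[of "b - c" "c - d"] by simp
  moreover have "min 1 x \<le> min 1 p + min 1 q + min 1 r"
    if "x \<le> p + q + r" "0 \<le> p" "0 \<le> q" "0 \<le> r" for x p q r :: real
    using that by (simp add: min_def)
  ultimately show ?thesis by simp
qed

lemma tendsto_min_1_norm_0: "(\<lambda>n. u n) \<longlonglongrightarrow> l \<Longrightarrow> (\<lambda>n. min 1 (norm (u n - l))) \<longlonglongrightarrow> 0"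
  using tendsto_min[OF tendsto_const tendsto_norm_zero[OF LIM_zero], of u l sequentially 1] by simp

context walk_limit
begin

lemma integrable_min_1: "f \<in> borel_measurable M \<Longrightarrow> integrable M (\<lambda>w. min 1 (norm (f w)))" for f :: "'w \<Rightarrow> 'a"
  by (rule integrable_bounded_real[where C = 1]) auto

lemma expectation_walk_increment:
  fixes f :: "'a \<Rightarrow> real"
  assumes [measurable]: "f \<in> borel_measurable borel" and "l \<le> k"
  shows "expectation (\<lambda>w. f (walk (\<xi> n w) k - walk (\<xi> n w) l)) = expectation (\<lambda>w. f (walk (\<xi> n w) (k - l)))"
proof -
  interpret N: noise "\<mu> n" by (rule noise)
  have "expectation (\<lambda>w. f (walk (\<xi> n w) k - walk (\<xi> n w) l)) = (\<integral>\<zeta>. f (walk \<zeta> k - walk \<zeta> l) \<partial>N.W)"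
    by (rule expectation_xi[of "\<lambda>\<zeta>. f (walk \<zeta> k - walk \<zeta> l)"]) measurable
  also have "\<dots> = (\<integral>\<zeta>. f (walk (shift l \<zeta>) (k - l)) \<partial>N.W)"
    by (simp add: walk_diff[OF \<open>l \<le> k\<close>])
  also have "\<dots> = (\<integral>\<zeta>. f (walk \<zeta> (k - l)) \<partial>N.W)"
    by (rule N.integral_shift) measurable
  also have "\<dots> = expectation (\<lambda>w. f (walk (\<xi> n w) (k - l)))"
    by (rule expectation_xi[symmetric, of "\<lambda>\<zeta>. f (walk \<zeta> (k - l))"]) measurable
  finally show ?thesis .
qed

lemma expectation_bump_walk: "expectation (\<lambda>w. bump (walk (\<xi> n w) k)) \<le> 2 * C * (real k * h n)"
proof -
  interpret N: noise "\<mu> n" by (rule noise)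
  have "(\<integral>\<^sup>+\<zeta>. ennreal (bump (chain (+) 0 \<zeta> k)) \<partial>N.W) \<le> ennreal (bump (0::'a)) + of_nat k * ennreal (2 * spread (\<mu> n) 1)"
  proof (rule N.nn_integral_chain_le[where N = borel])
    show "(\<integral>\<^sup>+y. ennreal (bump (s + y)) \<partial>\<mu> n) \<le> ennreal (bump s) + ennreal (2 * spread (\<mu> n) 1)" for s
      using N.nn_integral_bump_le[of 1 s] by simp
  qed simp_all
  then have "(\<integral>\<^sup>+\<zeta>. ennreal (bump (walk \<zeta> k)) \<partial>N.W) \<le> ennreal (real k * (2 * spread (\<mu> n) 1))"
    using spread_nonneg[of 1 "\<mu> n"] by (simp add: chain_plus ennreal_mult ennreal_of_nat_eq_real_of_nat)
  moreover have "(\<integral>\<^sup>+\<zeta>. ennreal (bump (walk \<zeta> k)) \<partial>N.W) = ennreal (\<integral>\<zeta>. bump (walk \<zeta> k) \<partial>N.W)"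
    by (intro nn_integral_eq_integral N.S.P.integrable_bounded_real[where C = 1]) (auto simp: bump_nonneg bump_le_1)
  ultimately have "(\<integral>\<zeta>. bump (walk \<zeta> k) \<partial>N.W) \<le> real k * (2 * spread (\<mu> n) 1)"
    using spread_nonneg[of 1 "\<mu> n"] by (simp add: ennreal_le_iff)
  also have "\<dots> \<le> real k * (2 * (C * h n))"
    using spread_one[of n] by (intro mult_left_mono) auto
  finally have "(\<integral>\<zeta>. bump (walk \<zeta> k) \<partial>N.W) \<le> 2 * C * (real k * h n)" by (simp add: mult_ac)
  moreover have "expectation (\<lambda>w. bump (walk (\<xi> n w) k)) = (\<integral>\<zeta>. bump (walk \<zeta> k) \<partial>N.W)"
    by (rule expectation_xi[of "\<lambda>\<zeta>. bump (walk \<zeta> k)"]) measurable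
  ultimately show ?thesis by simp
qed

text \<open>By stationarity the increment between two steps is distributed as a walk of the
  corresponding length. This is a modulus of continuity in probability, uniform in
  \<open>n\<close>.\<close>

lemma expectation_bump_increment:
  "expectation (\<lambda>w. bump (walk (\<xi> n w) k - walk (\<xi> n w) l)) \<le> 2 * C * \<bar>real k * h n - real l * h n\<bar>"
proof -
  have *: "expectation (\<lambda>w. bump (walk (\<xi> n w) k - walk (\<xi> n w) l)) \<le> 2 * C * \<bar>real k * h n - real l * h n\<bar>"
    if "l \<le> k" for k l
  proof -
    have "expectation (\<lambda>w. bump (walk (\<xi> n w) k - walk (\<xi> n w) l)) = expectation (\<lambda>w. bump (walk (\<xi> n w) (k - l)))"
      using that by (intro expectation_walk_increment) measurable
    also have "\<dots> \<le> 2 * C * (real (k - l) * h n)" by (rule expectation_bump_walk)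
    also have "real (k - l) * h n = \<bar>real k * h n - real l * h n\<bar>"
      using that h_pos[of n] by (simp add: of_nat_diff left_diff_distrib mult_right_mono)
    finally show ?thesis .
  qed
  show ?thesis
  proof (cases "l \<le> k")
    case False
    have "expectation (\<lambda>w. bump (walk (\<xi> n w) k - walk (\<xi> n w) l)) = expectation (\<lambda>w. bump (walk (\<xi> n w) l - walk (\<xi> n w) k))"
      by (subst bump_minus[symmetric]) simp
    also have "\<dots> \<le> 2 * C * \<bar>real l * h n - real k * h n\<bar>" using False by (intro *) simp
    finally show ?thesis by (simp add: abs_minus_commute)
  qed (rule *)
qed

end

context limit_process
begin

text \<open>The walk at step \<open>k n\<close> is compared with the walk at a rational time
  \<open>q\<close> slightly after \<open>t\<close>, then with \<open>y q\<close>, then with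
  \<open>Y t\<close>. The modulus of continuity handles the first difference, convergence at
  \<open>q\<close> the second, and the construction of \<open>Y\<close> the third; \<open>q\<close>
  is fixed before \<open>n\<close>.\<close>

lemma walk_tendsto_Y:
  assumes t: "t \<ge> 0" and k: "(\<lambda>n. real (k n) * h n) \<longlonglongrightarrow> t"
  shows "(\<lambda>n. expectation (\<lambda>w. min 1 (norm (walk (\<xi> n w) (k n) - Y t w)))) \<longlonglongrightarrow> 0"
proof (rule LIMSEQ_I)
  fix e :: real assume e: "e > 0"
  \<comment> \<open>Four terms \<open>\<epsilon>\<close> arise, two of them from the first
    difference through \<open>min_norm_le_bump\<close>; the fifth gives the strict
    inequality.\<close>
  define \<epsilon> where "\<epsilon> = e / 5"
  have \<epsilon>: "\<epsilon> > 0" using e by (simp add: \<epsilon>_def)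
  have "(\<lambda>m. expectation (\<lambda>w. min 1 (norm (y (rat_right t m) w - Y t w)))) \<longlonglongrightarrow> expectation (\<lambda>w. 0)"
  proof (rule integral_dominated_convergence[where w = "\<lambda>_. 1"])
    show "AE w in M. (\<lambda>m. min 1 (norm (y (rat_right t m) w - Y t w))) \<longlonglongrightarrow> 0"
      using Y_lim[OF t] by eventually_elim (rule tendsto_min_1_norm_0)
  qed auto
  then have "\<forall>\<^sub>F m in sequentially. expectation (\<lambda>w. min 1 (norm (y (rat_right t m) w - Y t w))) < \<epsilon>"
    using \<epsilon> by (intro order_tendstoD(2)) simp_all
  moreover have "(\<lambda>m. 2 / \<epsilon> * (2 * C * \<bar>t - rat_right t m\<bar>)) \<longlonglongrightarrow> 2 / \<epsilon> * (2 * C * \<bar>t - t\<bar>)"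
    by (intro tendsto_intros rat_right_tendsto)
  then have "\<forall>\<^sub>F m in sequentially. 2 / \<epsilon> * (2 * C * \<bar>t - rat_right t m\<bar>) < \<epsilon>"
    using \<epsilon> by (intro order_tendstoD(2)) simp_all
  ultimately have "\<forall>\<^sub>F m in sequentially. expectation (\<lambda>w. min 1 (norm (y (rat_right t m) w - Y t w))) < \<epsilon> \<and>
     2 / \<epsilon> * (2 * C * \<bar>t - rat_right t m\<bar>) < \<epsilon>" by eventually_elim simp
  then obtain m where m: "expectation (\<lambda>w. min 1 (norm (y (rat_right t m) w - Y t w))) < \<epsilon>"
     "2 / \<epsilon> * (2 * C * \<bar>t - rat_right t m\<bar>) < \<epsilon>" by (auto simp: eventually_sequentially)
  define q where "q = rat_right t m"
  have q: "q \<in> \<rat>" "0 \<le> q" using rat_right[of t m] t by (auto simp: q_def)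
  define j where "j n = time_index (h n) q" for n
  have "(\<lambda>n. expectation (\<lambda>w. min 1 (norm (walk (\<xi> n w) (j n) - y q w)))) \<longlonglongrightarrow> expectation (\<lambda>w. 0)"
  proof (rule integral_dominated_convergence[where w = "\<lambda>_. 1"])
    show "AE w in M. (\<lambda>n. min 1 (norm (walk (\<xi> n w) (j n) - y q w))) \<longlonglongrightarrow> 0"
      using y_lim
    proof eventually_elim
      case (elim w)
      then have "(\<lambda>n. walk (\<xi> n w) (j n)) \<longlonglongrightarrow> y q w" using q by (simp add: j_def)
      then show ?case by (rule tendsto_min_1_norm_0)
    qed
  qed auto
  then have ev1: "\<forall>\<^sub>F n in sequentially. expectation (\<lambda>w. min 1 (norm (walk (\<xi> n w) (j n) - y q w))) < \<epsilon>"
    using \<epsilon> by (intro order_tendstoD(2)) simp_all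
  have "(\<lambda>n. 2 / \<epsilon> * (2 * C * \<bar>real (k n) * h n - real (j n) * h n\<bar>)) \<longlonglongrightarrow> 2 / \<epsilon> * (2 * C * \<bar>t - q\<bar>)"
    unfolding j_def by (intro tendsto_intros k time_index_tendsto q)
  then have ev2: "\<forall>\<^sub>F n in sequentially. 2 / \<epsilon> * (2 * C * \<bar>real (k n) * h n - real (j n) * h n\<bar>) < \<epsilon>"
    using m(2) by (intro order_tendstoD(2)) (simp_all add: q_def)
  have "\<forall>\<^sub>F n in sequentially. norm (expectation (\<lambda>w. min 1 (norm (walk (\<xi> n w) (k n) - Y t w))) - 0) < e"
    using ev1 ev2
  proof eventually_elim
    case (elim n)
    let ?a = "\<lambda>w. min 1 (norm (walk (\<xi> n w) (k n) - walk (\<xi> n w) (j n)))"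
    let ?b = "\<lambda>w. min 1 (norm (walk (\<xi> n w) (j n) - y q w))"
    let ?c = "\<lambda>w. min 1 (norm (y q w - Y t w))"
    have ib: "integrable M (\<lambda>w. bump (walk (\<xi> n w) (k n) - walk (\<xi> n w) (j n)))"
      by (rule integrable_bounded_real[where C = 1]) (auto simp: abs_bump_le)
    have int: "integrable M ?a" "integrable M ?b" "integrable M ?c"
      by (intro integrable_min_1; measurable)+
    have "expectation (\<lambda>w. min 1 (norm (walk (\<xi> n w) (k n) - Y t w))) \<le> expectation (\<lambda>w. ?a w + ?b w + ?c w)"
      by (intro integral_mono integrable_min_1 Bochner_Integration.integrable_add int min_1_norm_triangle) measurable
    also have "\<dots> = expectation ?a + expectation ?b + expectation ?c"
      using int by simp
    also have "expectation ?a \<le> expectation (\<lambda>w. \<epsilon> + 2 / \<epsilon> * bump (walk (\<xi> n w) (k n) - walk (\<xi> n w) (j n)))"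
    proof (intro integral_mono int min_norm_le_bump \<epsilon>)
      show "integrable M (\<lambda>w. \<epsilon> + 2 / \<epsilon> * bump (walk (\<xi> n w) (k n) - walk (\<xi> n w) (j n)))"
        by (intro Bochner_Integration.integrable_add integrable_mult_right integrable_const ib)
    qed
    also have "\<dots> = \<epsilon> + 2 / \<epsilon> * expectation (\<lambda>w. bump (walk (\<xi> n w) (k n) - walk (\<xi> n w) (j n)))"
      using ib by (simp add: prob_space)
    also have "\<dots> \<le> \<epsilon> + 2 / \<epsilon> * (2 * C * \<bar>real (k n) * h n - real (j n) * h n\<bar>)"
      using \<epsilon> by (intro add_left_mono mult_left_mono expectation_bump_increment) simp
    finally have "expectation (\<lambda>w. min 1 (norm (walk (\<xi> n w) (k n) - Y t w))) \<le> \<epsilon> + \<epsilon> + \<epsilon> + \<epsilon>"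
      using elim m(1) by (simp add: q_def)
    moreover have "0 \<le> expectation (\<lambda>w. min 1 (norm (walk (\<xi> n w) (k n) - Y t w)))"
      by (rule Bochner_Integration.integral_nonneg) simp
    ultimately show ?case using e by (simp add: \<epsilon>_def)
  qed
  then show "\<exists>no. \<forall>n\<ge>no. norm (expectation (\<lambda>w. min 1 (norm (walk (\<xi> n w) (k n) - Y t w))) - 0) < e"
    by (simp add: eventually_sequentially)
qed

text \<open>For finitely many times the sum of the distances tends to 0 in probability. Hence
  \<open>imp\<close> may assume pointwise convergence at these times, at the price of admitting
  subsequences.\<close>

lemma expectation_tendsto_of_walk:
  fixes \<Phi> :: "nat \<Rightarrow> 'w \<Rightarrow> real" and k :: "nat \<Rightarrow> nat \<Rightarrow> nat"
  assumes t: "\<And>i. i \<in> I \<Longrightarrow> t i \<ge> 0" and k: "\<And>i. i \<in> I \<Longrightarrow> (\<lambda>n. real (k i n) * h n) \<longlonglongrightarrow> t i" and I: "finite I"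
    and \<Phi>: "\<And>n. \<Phi> n \<in> borel_measurable M" "\<And>n w. \<bar>\<Phi> n w\<bar> \<le> B"
    and \<Psi>: "\<Psi> \<in> borel_measurable M" "\<And>w. \<bar>\<Psi> w\<bar> \<le> B"
    and imp: "\<And>r w. strict_mono r \<Longrightarrow> (\<And>i. i \<in> I \<Longrightarrow> (\<lambda>n. walk (\<xi> (r n) w) (k i (r n))) \<longlonglongrightarrow> Y (t i) w) \<Longrightarrow> (\<lambda>n. \<Phi> (r n) w) \<longlonglongrightarrow> \<Psi> w"
  shows "(\<lambda>n. expectation (\<Phi> n)) \<longlonglongrightarrow> expectation \<Psi>"
proof -
  let ?d = "\<lambda>i n w. norm (walk (\<xi> n w) (k i n) - Y (t i) w)"
  have int: "integrable M (\<Phi> n)" "integrable M \<Psi>" for n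
    by (rule integrable_bounded_real[OF \<Phi>], rule integrable_bounded_real[OF \<Psi>])
  have "(\<lambda>n. expectation (\<lambda>w. \<Phi> n w - \<Psi> w)) \<longlonglongrightarrow> 0"
  proof (rule expectation_tendsto_0_of_min[where R = "\<lambda>n w. \<Sum>i\<in>I. ?d i n w" and C = "2 * B"])
    show "(\<lambda>n. expectation (\<lambda>w. min 1 (\<Sum>i\<in>I. ?d i n w))) \<longlonglongrightarrow> 0"
    proof (rule tendsto_sandwich[where f = "\<lambda>_. 0" and h = "\<lambda>n. \<Sum>i\<in>I. expectation (\<lambda>w. min 1 (?d i n w))"])
      have "(\<lambda>n. \<Sum>i\<in>I. expectation (\<lambda>w. min 1 (?d i n w))) \<longlonglongrightarrow> (\<Sum>i\<in>I. 0)"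
        by (intro tendsto_sum walk_tendsto_Y t k)
      then show "(\<lambda>n. \<Sum>i\<in>I. expectation (\<lambda>w. min 1 (?d i n w))) \<longlonglongrightarrow> 0" by simp
      have sub: "min 1 (\<Sum>i\<in>I. a i) \<le> (\<Sum>i\<in>I. min 1 (a i))" if "\<And>i. 0 \<le> a i" for a :: "nat \<Rightarrow> real"
        using I
      proof (induction I rule: finite_induct)
        case (insert i J)
        have "0 \<le> a i" "0 \<le> (\<Sum>i\<in>J. min 1 (a i))" using that by (auto intro: sum_nonneg)
        then show ?case using insert by (simp add: min_def split: if_splits)
      qed simp
      have "expectation (\<lambda>w. min 1 (\<Sum>i\<in>I. ?d i n w)) \<le> expectation (\<lambda>w. \<Sum>i\<in>I. min 1 (?d i n w))" for n
        by (intro integral_mono sub Bochner_Integration.integrable_sum integrable_min_1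
              integrable_bounded_real[where C = 1]) (auto intro!: abs_min_1 sum_nonneg)
      also have "expectation (\<lambda>w. \<Sum>i\<in>I. min 1 (?d i n w)) = (\<Sum>i\<in>I. expectation (\<lambda>w. min 1 (?d i n w)))" for n
        by (intro Bochner_Integration.integral_sum integrable_min_1) measurable
      finally show "\<forall>\<^sub>F n in sequentially. expectation (\<lambda>w. min 1 (\<Sum>i\<in>I. ?d i n w)) \<le> (\<Sum>i\<in>I. expectation (\<lambda>w. min 1 (?d i n w)))"
        by simp
      show "\<forall>\<^sub>F n in sequentially. 0 \<le> expectation (\<lambda>w. min 1 (\<Sum>i\<in>I. ?d i n w))"
        by (intro always_eventually allI Bochner_Integration.integral_nonneg) (auto intro!: sum_nonneg)
    qed simp
    show "\<bar>\<Phi> n w - \<Psi> w\<bar> \<le> 2 * B" for n w using \<Phi>(2)[of n w] \<Psi>(2)[of w] by linarith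
    show "AE w in M. \<forall>r. strict_mono r \<longrightarrow> (\<lambda>n. \<Sum>i\<in>I. ?d i (r n) w) \<longlonglongrightarrow> 0 \<longrightarrow> (\<lambda>n. \<Phi> (r n) w - \<Psi> w) \<longlonglongrightarrow> 0"
    proof (intro AE_I2 allI impI)
      fix w and r :: "nat \<Rightarrow> nat" assume r: "strict_mono r" and lim: "(\<lambda>n. \<Sum>i\<in>I. ?d i (r n) w) \<longlonglongrightarrow> 0"
      have "(\<lambda>n. walk (\<xi> (r n) w) (k i (r n))) \<longlonglongrightarrow> Y (t i) w" if i: "i \<in> I" for i
      proof -
        have "(\<lambda>n. ?d i (r n) w) \<longlonglongrightarrow> 0"
        proof (rule tendsto_sandwich[where f = "\<lambda>_. 0" and h = "\<lambda>n. \<Sum>i\<in>I. ?d i (r n) w"])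
          show "\<forall>\<^sub>F n in sequentially. ?d i (r n) w \<le> (\<Sum>i\<in>I. ?d i (r n) w)"
            using I i by (intro always_eventually allI member_le_sum) auto
        qed (auto simp: lim)
        then show ?thesis by (simp add: tendsto_norm_zero_iff LIM_zero_iff)
      qed
      then have "(\<lambda>n. \<Phi> (r n) w) \<longlonglongrightarrow> \<Psi> w" by (rule imp[OF r])
      then show "(\<lambda>n. \<Phi> (r n) w - \<Psi> w) \<longlonglongrightarrow> 0" by (rule LIM_zero)
    qed
    show "(\<lambda>w. \<Phi> n w - \<Psi> w) \<in> borel_measurable M" for n using \<Phi>(1) \<Psi>(1) by measurable
  qed (auto intro: sum_nonneg)
  then show ?thesis using int by (simp add: LIM_zero_iff)
qed

section \<open>The limit process is a Levy process\<close>

lemma AE_Y_0: "AE w in M. Y 0 w = 0"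
proof -
  have "(\<lambda>n. expectation (\<lambda>w. min 1 (norm (walk (\<xi> n w) 0 - Y 0 w)))) \<longlonglongrightarrow> 0"
    by (rule walk_tendsto_Y) simp_all
  then have "expectation (\<lambda>w. min 1 (norm (Y 0 w))) = 0" by (simp add: LIMSEQ_const_iff)
  moreover have "integrable M (\<lambda>w. min 1 (norm (Y 0 w)))" by (rule integrable_min_1) measurable
  ultimately have "AE w in M. min 1 (norm (Y 0 w)) = 0"
    by (subst (asm) integral_nonneg_eq_0_iff_AE) auto
  then show ?thesis by eventually_elim (auto simp: min_def split: if_splits)
qed

text \<open>The difference of the two time indices may differ from the index of \<open>t\<close>,
  but multiplied by \<open>h n\<close> it still tends to \<open>t\<close>, and
  \<open>walk_tendsto_Y\<close> accepts any such index.\<close>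

lemma expectation_increment:
  fixes f :: "'a \<Rightarrow> real"
  assumes f: "f \<in> bcontfun" and "s \<ge> 0" "t \<ge> 0"
  shows "expectation (\<lambda>w. f (Y (s + t) w - Y s w)) = expectation (\<lambda>w. f (Y t w))"
proof -
  obtain B where "B \<ge> 0" and B: "\<And>x. \<bar>f x\<bar> \<le> B" and cont: "continuous_on UNIV f" using bcontfun_bounded[OF f] bcontfun_continuous[OF f] by blast
  have [measurable]: "f \<in> borel_measurable borel" using cont by (rule borel_measurable_continuous_onI)
  have tf: "(\<lambda>n. f (u n)) \<longlonglongrightarrow> f l" if "u \<longlonglongrightarrow> l" for u l
    using continuous_on_tendsto_compose[OF cont that] by simp
  let ?k = "\<lambda>(i::nat) n. time_index (h n) (if i = 0 then s else s + t)"
  let ?d = "\<lambda>n. time_index (h n) (s + t) - time_index (h n) s"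
  have le: "time_index (h n) s \<le> time_index (h n) (s + t)" for n
    using h_pos assms by (intro time_index_mono) auto
  have 1: "(\<lambda>n. expectation (\<lambda>w. f (walk (\<xi> n w) (?k 1 n) - walk (\<xi> n w) (?k 0 n)))) \<longlonglongrightarrow> expectation (\<lambda>w. f (Y (s + t) w - Y s w))"
  proof (rule expectation_tendsto_of_walk[where I = "{0, 1}" and t = "\<lambda>i::nat. if i = 0 then s else s + t" and k = ?k and B = B])
    fix r w assume lim: "\<And>i. i \<in> {0, 1} \<Longrightarrow> (\<lambda>n. walk (\<xi> (r n) w) (?k i (r n))) \<longlonglongrightarrow> Y (if i = 0 then s else s + t) w"
    show "(\<lambda>n. f (walk (\<xi> (r n) w) (?k 1 (r n)) - walk (\<xi> (r n) w) (?k 0 (r n)))) \<longlonglongrightarrow> f (Y (s + t) w - Y s w)"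
      using tendsto_diff[OF lim[of 1] lim[of 0]] by (intro tf) simp
  qed (use assms B time_index_tendsto in auto)
  have 2: "(\<lambda>n. expectation (\<lambda>w. f (walk (\<xi> n w) (?d n)))) \<longlonglongrightarrow> expectation (\<lambda>w. f (Y t w))"
  proof (rule expectation_tendsto_of_walk[where I = "{0}" and t = "\<lambda>_. t" and k = "\<lambda>_. ?d" and B = B])
    have "(\<lambda>n. real (time_index (h n) (s + t)) * h n - real (time_index (h n) s) * h n) \<longlonglongrightarrow> (s + t) - s"
      using assms by (intro tendsto_diff time_index_tendsto) auto
    then show "(\<lambda>n. real (?d n) * h n) \<longlonglongrightarrow> t" using le by (simp add: of_nat_diff left_diff_distrib)
    fix r w assume lim: "\<And>i::nat. i \<in> {0} \<Longrightarrow> (\<lambda>n. walk (\<xi> (r n) w) (?d (r n))) \<longlonglongrightarrow> Y t w"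
    show "(\<lambda>n. f (walk (\<xi> (r n) w) (?d (r n)))) \<longlonglongrightarrow> f (Y t w)" using lim[of 0] by (intro tf) simp
  qed (use assms B in auto)
  have "(\<lambda>n. expectation (\<lambda>w. f (walk (\<xi> n w) (?k 1 n) - walk (\<xi> n w) (?k 0 n)))) = (\<lambda>n. expectation (\<lambda>w. f (walk (\<xi> n w) (?d n))))"
    using expectation_walk_increment[of f, OF _ le] by simp
  with 1 have "(\<lambda>n. expectation (\<lambda>w. f (walk (\<xi> n w) (?d n)))) \<longlonglongrightarrow> expectation (\<lambda>w. f (Y (s + t) w - Y s w))"
    by (simp only:)
  then show ?thesis by (rule LIMSEQ_unique[OF _ 2])
qed

lemma stationary: "stationary_increments M Y"
  unfolding stationary_increments_def
proof (intro allI impI)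
  fix s t :: real assume st: "0 \<le> s" "0 \<le> t"
  show "distr M borel (\<lambda>w. Y (s + t) w - Y s w) = distr M borel (\<lambda>w. Y t w - Y 0 w)"
  proof (rule borel_measure_eqI_bcontfun)
    fix f :: "'a \<Rightarrow> real" assume f: "f \<in> bcontfun"
    then have [measurable]: "f \<in> borel_measurable borel"
      by (intro borel_measurable_continuous_onI bcontfun_continuous)
    have "expectation (\<lambda>w. f (Y (s + t) w - Y s w)) = expectation (\<lambda>w. f (Y (0 + t) w - Y 0 w))"
      using expectation_increment[OF f, of s t] expectation_increment[OF f, of 0 t] st by simp
    then show "(\<integral>x. f x \<partial>distr M borel (\<lambda>w. Y (s + t) w - Y s w)) = (\<integral>x. f x \<partial>distr M borel (\<lambda>w. Y t w - Y 0 w))"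
      by (subst (1 2) integral_distr) auto
  qed (auto intro: prob_space_distr)
qed

text \<open>The product formula is exact for every walk at the discretised times, and both of its
  sides converge.\<close>

lemma expectation_prod_increments:
  fixes f :: "nat \<Rightarrow> 'a \<Rightarrow> real"
  assumes f: "\<And>i. continuous_on UNIV (f i)" "\<And>i x. \<bar>f i x\<bar> \<le> 1"
    and t: "0 \<le> t 0" "\<And>i. i < m \<Longrightarrow> t i \<le> t (Suc i)"
  shows "expectation (\<lambda>w. \<Prod>i<m. f i (Y (t (Suc i)) w - Y (t i) w))
    = (\<Prod>i<m. expectation (\<lambda>w. f i (Y (t (Suc i)) w - Y (t i) w)))"
proof -
  have f_meas[measurable]: "f i \<in> borel_measurable borel" for i using f(1) by (rule borel_measurable_continuous_onI)
  have tf: "(\<lambda>n. f i (u n)) \<longlonglongrightarrow> f i l" if "u \<longlonglongrightarrow> l" for u l i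
    using continuous_on_tendsto_compose[OF f(1) that] by simp
  have t_nonneg: "0 \<le> t i" if "i \<le> m" for i
    using that
  proof (induction i)
    case (Suc i)
    then show ?case using t(2)[of i] by simp
  qed (rule t(1))
  let ?k = "\<lambda>i n. time_index (h n) (t i)"
  have le: "?k i n \<le> ?k (Suc i) n" if "i < m" for i n
    using h_pos[of n] t(2)[OF that] by (intro time_index_mono) auto
  let ?S = "\<lambda>n w i. walk (\<xi> n w) (?k (Suc i) n) - walk (\<xi> n w) (?k i n)"
  have prod_le: "\<bar>\<Prod>i<m. f i (a i)\<bar> \<le> 1" for a
    unfolding abs_prod by (intro prod_le_1) (simp add: f(2))
  have eq: "expectation (\<lambda>w. \<Prod>i<m. f i (?S n w i)) = (\<Prod>i<m. expectation (\<lambda>w. f i (?S n w i)))" for n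
  proof -
    interpret N: noise "\<mu> n" by (rule noise)
    have "expectation (\<lambda>w. \<Prod>i<m. f i (?S n w i)) = (\<integral>\<zeta>. (\<Prod>i<m. f i (walk \<zeta> (?k (Suc i) n) - walk \<zeta> (?k i n))) \<partial>N.W)"
      by (rule expectation_xi[of "\<lambda>\<zeta>. \<Prod>i<m. f i (walk \<zeta> (?k (Suc i) n) - walk \<zeta> (?k i n))"]) measurable
    also have "\<dots> = (\<Prod>i<m. \<integral>\<zeta>. f i (walk \<zeta> (?k (Suc i) n - ?k i n)) \<partial>N.W)"
      using le f(2) by (intro N.integral_prod_walk_increments[where k = "\<lambda>i. ?k i n"]) auto
    also have "\<dots> = (\<Prod>i<m. expectation (\<lambda>w. f i (?S n w i)))"
    proof (rule prod.cong[OF refl])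
      fix i assume "i \<in> {..<m}"
      then have "expectation (\<lambda>w. f i (?S n w i)) = expectation (\<lambda>w. f i (walk (\<xi> n w) (?k (Suc i) n - ?k i n)))"
        using le by (intro expectation_walk_increment) auto
      also have "\<dots> = (\<integral>\<zeta>. f i (walk \<zeta> (?k (Suc i) n - ?k i n)) \<partial>N.W)"
        by (rule expectation_xi[of "\<lambda>\<zeta>. f i (walk \<zeta> (?k (Suc i) n - ?k i n))"]) measurable
      finally show "(\<integral>\<zeta>. f i (walk \<zeta> (?k (Suc i) n - ?k i n)) \<partial>N.W) = expectation (\<lambda>w. f i (?S n w i))" by simp
    qed
    finally show ?thesis .
  qed
  have l1: "(\<lambda>n. expectation (\<lambda>w. \<Prod>i<m. f i (?S n w i))) \<longlonglongrightarrow> expectation (\<lambda>w. \<Prod>i<m. f i (Y (t (Suc i)) w - Y (t i) w))"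
  proof (rule expectation_tendsto_of_walk[where I = "{..m}" and t = t and k = ?k and B = 1])
    fix r w assume lim: "\<And>i. i \<in> {..m} \<Longrightarrow> (\<lambda>n. walk (\<xi> (r n) w) (?k i (r n))) \<longlonglongrightarrow> Y (t i) w"
    show "(\<lambda>n. \<Prod>i<m. f i (?S (r n) w i)) \<longlonglongrightarrow> (\<Prod>i<m. f i (Y (t (Suc i)) w - Y (t i) w))"
      by (intro tendsto_prod tf tendsto_diff lim) auto
  qed (auto simp: prod_le t_nonneg intro: time_index_tendsto)
  have l2: "(\<lambda>n. \<Prod>i<m. expectation (\<lambda>w. f i (?S n w i))) \<longlonglongrightarrow> (\<Prod>i<m. expectation (\<lambda>w. f i (Y (t (Suc i)) w - Y (t i) w)))"
  proof (rule tendsto_prod)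
    fix i assume i: "i \<in> {..<m}"
    show "(\<lambda>n. expectation (\<lambda>w. f i (?S n w i))) \<longlonglongrightarrow> expectation (\<lambda>w. f i (Y (t (Suc i)) w - Y (t i) w))"
    proof (rule expectation_tendsto_of_walk[where I = "{..m}" and t = t and k = ?k and B = 1])
      fix r w assume lim: "\<And>i. i \<in> {..m} \<Longrightarrow> (\<lambda>n. walk (\<xi> (r n) w) (?k i (r n))) \<longlonglongrightarrow> Y (t i) w"
      show "(\<lambda>n. f i (?S (r n) w i)) \<longlonglongrightarrow> f i (Y (t (Suc i)) w - Y (t i) w)"
        using i by (intro tf tendsto_diff lim) auto
    qed (auto simp: f(2) t_nonneg intro: time_index_tendsto)
  qed
  show ?thesis using l1 unfolding eq by (rule LIMSEQ_unique[OF _ l2])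
qed

lemma independent: "independent_increments M Y"
  unfolding independent_increments_def
proof (intro allI impI)
  fix m :: nat and t :: "nat \<Rightarrow> real"
  assume t: "0 \<le> t 0 \<and> (\<forall>i<m. t i \<le> t (Suc i))"
  let ?X = "\<lambda>i w. Y (t (Suc i)) w - Y (t i) w"
  show "indep_vars (\<lambda>_. borel) ?X {..<m}"
  proof (cases "m = 0")
    case True
    then show ?thesis by (simp add: indep_vars_def2 indep_sets_def)
  next
    case False
    have "prob (\<Inter>j\<in>{..<m}. ?X j -` A j \<inter> space M) = (\<Prod>j<m. prob (?X j -` A j \<inter> space M))"
      if A: "A \<in> {..<m} \<rightarrow> Collect closed" for A
    \<comment> \<open>Empty sets are separated because the approximation of indicators by distances
      is meant for nonempty closed sets.\<close>
    proof (cases "\<exists>j<m. A j = {}")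
      case True
      then obtain j where j: "j < m" "A j = {}" by blast
      then have "(\<Inter>j\<in>{..<m}. ?X j -` A j \<inter> space M) = {}" by blast
      moreover have "(\<Prod>j<m. prob (?X j -` A j \<inter> space M)) = 0"
        using j by (intro prod_zero bexI[of _ j]) simp_all
      ultimately show ?thesis by simp
    next
      case ne: False
      have cl: "closed (A j)" "A j \<noteq> {}" if "j < m" for j using A ne that by auto
      have [measurable]: "A j \<in> sets borel" if "j < m" for j using cl[OF that] by simp
      define f :: "nat \<Rightarrow> nat \<Rightarrow> 'a \<Rightarrow> real" where "f n j x = max 0 (1 - real n * infdist x (A j))" for n j x
      have fc: "continuous_on UNIV (f n j)" for n j
        unfolding f_def by (intro continuous_intros)
      have fm[measurable]: "f n j \<in> borel_measurable borel" for n j using fc by (rule borel_measurable_continuous_onI)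
      have fb: "\<bar>f n j x\<bar> \<le> 1" for n j x by (simp add: f_def infdist_nonneg)
      have flim: "(\<lambda>n. f n j x) \<longlonglongrightarrow> indicator (A j) x" if "j < m" for j x
        unfolding f_def by (rule closed_indicator_limit[OF cl[OF that]])
      have lim1: "(\<lambda>n. expectation (\<lambda>w. \<Prod>j<m. f n j (?X j w))) \<longlonglongrightarrow> expectation (\<lambda>w. \<Prod>j<m. indicat_real (A j) (?X j w))"
      proof (rule integral_dominated_convergence[where w = "\<lambda>_. 1"])
        show "AE w in M. (\<lambda>n. \<Prod>j<m. f n j (?X j w)) \<longlonglongrightarrow> (\<Prod>j<m. indicat_real (A j) (?X j w))"
          by (intro AE_I2 tendsto_prod flim) simp
        show "AE w in M. norm (\<Prod>j<m. f n j (?X j w)) \<le> 1" for n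
          unfolding real_norm_def abs_prod by (intro AE_I2 prod_le_1) (simp add: fb)
        show "(\<lambda>w. \<Prod>j<m. indicat_real (A j) (?X j w) :: real) \<in> borel_measurable M"
          by (intro borel_measurable_prod) measurable
      qed simp_all
      have lim2: "(\<lambda>n. \<Prod>j<m. expectation (\<lambda>w. f n j (?X j w))) \<longlonglongrightarrow> (\<Prod>j<m. expectation (\<lambda>w. indicat_real (A j) (?X j w)))"
      proof (rule tendsto_prod)
        fix j assume j: "j \<in> {..<m}"
        then have [measurable]: "A j \<in> sets borel" by simp
        show "(\<lambda>n. expectation (\<lambda>w. f n j (?X j w))) \<longlonglongrightarrow> expectation (\<lambda>w. indicat_real (A j) (?X j w))"
          by (rule integral_dominated_convergence[where w = "\<lambda>_. 1"]) (use j in \<open>auto intro: flim fb simp: fb\<close>)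
      qed
      have eq1: "expectation (\<lambda>w. \<Prod>j<m. f n j (?X j w)) = (\<Prod>j<m. expectation (\<lambda>w. f n j (?X j w)))" for n
        using t by (intro expectation_prod_increments fc fb) auto
      have eq: "expectation (\<lambda>w. \<Prod>j<m. indicat_real (A j) (?X j w)) = (\<Prod>j<m. expectation (\<lambda>w. indicat_real (A j) (?X j w)))"
        using lim1 unfolding eq1 by (rule LIMSEQ_unique[OF _ lim2])
      have "expectation (\<lambda>w. \<Prod>j<m. indicat_real (A j) (?X j w)) = expectation (indicator (\<Inter>j\<in>{..<m}. ?X j -` A j \<inter> space M))"
      proof (rule Bochner_Integration.integral_cong[OF refl])
        fix w assume w: "w \<in> space M"
        show "(\<Prod>j<m. indicat_real (A j) (?X j w)) = (indicator (\<Inter>j\<in>{..<m}. ?X j -` A j \<inter> space M) w :: real)"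
        proof (cases "\<forall>j<m. ?X j w \<in> A j")
          case True
          then show ?thesis using w \<open>m \<noteq> 0\<close> by simp
        next
          case False
          then obtain j where "j < m" "?X j w \<notin> A j" by blast
          then have "(\<Prod>j<m. indicat_real (A j) (?X j w)) = 0" by (intro prod_zero bexI[of _ j]) auto
          moreover have "w \<notin> (\<Inter>j\<in>{..<m}. ?X j -` A j \<inter> space M)" using False by auto
          ultimately show ?thesis by simp
        qed
      qed
      also have "\<dots> = prob (\<Inter>j\<in>{..<m}. ?X j -` A j \<inter> space M)"
      proof -
        have "(\<Inter>j\<in>{..<m}. ?X j -` A j \<inter> space M) \<inter> space M = (\<Inter>j\<in>{..<m}. ?X j -` A j \<inter> space M)"
          using False by blast
        then show ?thesis by simp
      qed
      finally have e1: "expectation (\<lambda>w. \<Prod>j<m. indicat_real (A j) (?X j w)) = prob (\<Inter>j\<in>{..<m}. ?X j -` A j \<inter> space M)" .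
      have e2: "expectation (\<lambda>w. indicat_real (A j) (?X j w)) = prob (?X j -` A j \<inter> space M)" for j
      proof -
        have "expectation (\<lambda>w. indicat_real (A j) (?X j w)) = expectation (indicator (?X j -` A j \<inter> space M))"
          by (rule Bochner_Integration.integral_cong[OF refl]) (auto simp: indicator_def)
        then show ?thesis by (simp add: Int_assoc)
      qed
      show ?thesis using eq e1 e2 by simp
    qed
    then show ?thesis
    proof (subst indep_vars_finite[where E = "\<lambda>_. Collect closed"])
      show "sets (borel :: 'a measure) = sigma_sets (space borel) (Collect closed)"
        by (simp add: borel_eq_closed)
      show "Int_stable (Collect closed :: 'a set set)" by (auto simp: Int_stable_def)
    qed (use False in auto)
  qed
qed

lemma expectation_bump_Y:
  assumes "s \<ge> 0" "t \<ge> 0"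
  shows "expectation (\<lambda>w. bump (Y t w - Y s w)) \<le> 2 * C * \<bar>t - s\<bar>"
proof (rule LIMSEQ_le)
  let ?k = "\<lambda>(i::nat) n. time_index (h n) (if i = 0 then s else t)"
  have tf: "(\<lambda>n. bump (u n)) \<longlonglongrightarrow> bump l" if "u \<longlonglongrightarrow> l" for u and l :: 'a
    using continuous_on_tendsto_compose[OF continuous_on_bump that] by simp
  show "(\<lambda>n. expectation (\<lambda>w. bump (walk (\<xi> n w) (?k 1 n) - walk (\<xi> n w) (?k 0 n)))) \<longlonglongrightarrow> expectation (\<lambda>w. bump (Y t w - Y s w))"
  proof (rule expectation_tendsto_of_walk[where I = "{0, 1}" and t = "\<lambda>i::nat. if i = 0 then s else t" and k = ?k and B = 1])
    fix r w assume lim: "\<And>i. i \<in> {0, 1} \<Longrightarrow> (\<lambda>n. walk (\<xi> (r n) w) (?k i (r n))) \<longlonglongrightarrow> Y (if i = 0 then s else t) w"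
    show "(\<lambda>n. bump (walk (\<xi> (r n) w) (?k 1 (r n)) - walk (\<xi> (r n) w) (?k 0 (r n)))) \<longlonglongrightarrow> bump (Y t w - Y s w)"
      using tendsto_diff[OF lim[of 1] lim[of 0]] by (intro tf) simp
  qed (use assms abs_bump_le time_index_tendsto in auto)
  show "(\<lambda>n. 2 * C * \<bar>real (time_index (h n) t) * h n - real (time_index (h n) s) * h n\<bar>) \<longlonglongrightarrow> 2 * C * \<bar>t - s\<bar>"
    using assms by (intro tendsto_intros time_index_tendsto)
  show "\<exists>N. \<forall>n\<ge>N. expectation (\<lambda>w. bump (walk (\<xi> n w) (?k 1 n) - walk (\<xi> n w) (?k 0 n)))
    \<le> 2 * C * \<bar>real (time_index (h n) t) * h n - real (time_index (h n) s) * h n\<bar>"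
    using expectation_bump_increment by simp
qed

lemma stochastically_continuous: "stochastically_continuous M Y"
  unfolding stochastically_continuous_def
proof (intro allI impI)
  fix s \<epsilon> :: real assume s: "s \<ge> 0" and \<epsilon>: "\<epsilon> > 0"
  have b: "bump \<epsilon> > 0" using \<epsilon> by (simp add: bump_def add_pos_nonneg)
  have le: "prob {w\<in>space M. norm (Y t w - Y s w) > \<epsilon>} \<le> 2 * C * \<bar>t - s\<bar> / bump \<epsilon>" if t: "t \<ge> 0" for t
  proof -
    have "prob {w\<in>space M. norm (Y t w - Y s w) > \<epsilon>} \<le> prob {w\<in>space M. bump \<epsilon> \<le> bump (Y t w - Y s w)}"
      using \<epsilon> by (intro finite_measure_mono) (auto intro!: bump_mono)
    also have "\<dots> \<le> expectation (\<lambda>w. bump (Y t w - Y s w)) / bump \<epsilon>"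
      using b by (intro integral_Markov_inequality_measure[where A = "space M"] integrable_bounded_real[where C = 1])
        (auto simp: bump_le_1 bump_nonneg)
    also have "\<dots> \<le> 2 * C * \<bar>t - s\<bar> / bump \<epsilon>"
      using b by (intro divide_right_mono expectation_bump_Y s t) simp
    finally show ?thesis .
  qed
  show "((\<lambda>t. prob {w\<in>space M. norm (Y t w - Y s w) > \<epsilon>}) \<longlongrightarrow> 0) (at s within {0..})"
  proof (rule tendsto_sandwich[where f = "\<lambda>_. 0" and h = "\<lambda>t. 2 * C * \<bar>t - s\<bar> / bump \<epsilon>"])
    have "((\<lambda>t. 2 * C * \<bar>t - s\<bar> / bump \<epsilon>) \<longlongrightarrow> 2 * C * \<bar>s - s\<bar> / bump \<epsilon>) (at s within {0..})"
      using b by (intro tendsto_intros) simp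
    then show "((\<lambda>t. 2 * C * \<bar>t - s\<bar> / bump \<epsilon>) \<longlongrightarrow> 0) (at s within {0..})" by simp
    show "\<forall>\<^sub>F t in at s within {0..}. prob {w\<in>space M. norm (Y t w - Y s w) > \<epsilon>} \<le> 2 * C * \<bar>t - s\<bar> / bump \<epsilon>"
      using le by (auto simp: eventually_at intro: exI[of _ 1])
  qed simp_all
qed

theorem levy_process_Y: "levy_process M Y"
  unfolding levy_process_def
  using prob_space_axioms Y_measurable AE_Y_0 stationary independent stochastically_continuous Y_cadlag by simp

end

section \<open>Differential equations driven by a cadlag process\<close>

text \<open>Freezing time outside \<open>[0, T]\<close> gives a map on the whole line that reads the
  process only up to \<open>T\<close>, so measurability can be stated on the full product
  space.\<close>

abbreviation clamp_time :: "real \<Rightarrow> real \<Rightarrow> real" where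
  "clamp_time T s \<equiv> min (max s 0) T"

text \<open>Right continuity and the left limit bound the path near each point; compactness leaves
  finitely many such neighbourhoods.\<close>

lemma cadlag_bounded:
  fixes y :: "real \<Rightarrow> 'a::real_normed_vector"
  assumes "cadlag y"
  shows "\<exists>B\<ge>0. \<forall>t\<in>{0..T}. norm (y t) \<le> B"
proof -
  have loc: "\<exists>\<delta>>0. \<exists>B. \<forall>s\<in>ball t \<delta>. 0 \<le> s \<longrightarrow> norm (y s) \<le> B" if t: "t \<in> {0..T}" for t
  proof -
    have "\<forall>\<^sub>F u in at_right t. dist (y u) (y t) < 1"
      using assms t unfolding cadlag_def by (intro tendstoD) auto
    then obtain b where b: "b > t" "\<And>u. t < u \<Longrightarrow> u < b \<Longrightarrow> dist (y u) (y t) < 1"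
      unfolding eventually_at_right_field by auto
    have right: "norm (y u) \<le> norm (y t) + 1" if "t \<le> u" "u < b" for u
      using b(2)[of u] that norm_triangle_sub[of "y u" "y t"] by (cases "u = t") (auto simp: dist_norm)
    show ?thesis
    proof (cases "t = 0")
      case True
      then show ?thesis
        using b(1) right by (intro exI[of _ b] conjI exI[of _ "norm (y t) + 1"]) (auto simp: dist_real_def)
    next
      case False
      then obtain l where "(y \<longlongrightarrow> l) (at_left t)" using assms t unfolding cadlag_def by force
      then have "\<forall>\<^sub>F u in at_left t. dist (y u) l < 1" by (rule tendstoD) simp
      then obtain a where a: "a < t" "\<And>u. a < u \<Longrightarrow> u < t \<Longrightarrow> dist (y u) l < 1"
        unfolding eventually_at_left_field by auto
      have left: "norm (y u) \<le> norm l + 1" if "a < u" "u < t" for u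
        using a(2)[of u] that norm_triangle_sub[of "y u" l] by (auto simp: dist_norm)
      have "norm (y u) \<le> (norm l + 1) + (norm (y t) + 1)" if "a < u" "u < b" for u
      proof (cases "u < t")
        case True
        then show ?thesis using left[of u] that norm_ge_zero[of "y t"] by linarith
      next
        case False
        then show ?thesis using right[of u] that norm_ge_zero[of l] by linarith
      qed
      then show ?thesis
        using a(1) b(1)
        by (intro exI[of _ "min (t - a) (b - t)"] conjI exI[of _ "(norm l + 1) + (norm (y t) + 1)"])
          (auto simp: dist_real_def abs_if split: if_splits)
    qed
  qed
  then obtain \<delta> B where \<delta>: "\<And>t. t \<in> {0..T} \<Longrightarrow> \<delta> t > 0"
    and B: "\<And>t s. t \<in> {0..T} \<Longrightarrow> s \<in> ball t (\<delta> t) \<Longrightarrow> 0 \<le> s \<Longrightarrow> norm (y s) \<le> B t"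
    by metis
  obtain C where C: "C \<subseteq> {0..T}" "finite C" "{0..T} \<subseteq> (\<Union>t\<in>C. ball t (\<delta> t))"
  proof (rule compactE_image[of "{0..T}" "{0..T}" "\<lambda>t. ball t (\<delta> t)"])
    show "{0..T} \<subseteq> (\<Union>t\<in>{0..T}. ball t (\<delta> t))" using \<delta> by force
  qed (auto simp: that)
  have "norm (y s) \<le> (\<Sum>t\<in>C. \<bar>B t\<bar>)" if s: "s \<in> {0..T}" for s
  proof -
    obtain t where t: "t \<in> C" "s \<in> ball t (\<delta> t)" using C(3) s by blast
    have "norm (y s) \<le> \<bar>B t\<bar>" using B[of t s] t C(1) s by force
    also have "\<dots> \<le> (\<Sum>t\<in>C. \<bar>B t\<bar>)" using t(1) C(2) by (intro member_le_sum) auto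
    finally show ?thesis .
  qed
  then show ?thesis by (intro exI[of _ "\<Sum>t\<in>C. \<bar>B t\<bar>"]) (auto intro: sum_nonneg)
qed

text \<open>\<open>N\<close> stands for the \<open>\<sigma>\<close>-algebra of events up to time \<open>T\<close>.\<close>

definition progressive :: "'w measure \<Rightarrow> real \<Rightarrow> (real \<Rightarrow> 'w \<Rightarrow> 'a::topological_space) \<Rightarrow> bool" where
  "progressive N T Z \<longleftrightarrow> (\<lambda>p. Z (clamp_time T (fst p)) (snd p)) \<in> borel_measurable (borel \<Otimes>\<^sub>M N)"

text \<open>The path is approximated from the right at rational times, capped at \<open>T\<close> so
  that nothing later is read. For fixed \<open>n\<close> countably many times occur, which gives
  joint measurability. Right continuity gives the limit for times below \<open>T\<close>; at
  \<open>T\<close> the cap makes the approximation exact.\<close>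

lemma progressive_cadlag:
  fixes Z :: "real \<Rightarrow> 'w \<Rightarrow> 'a::euclidean_space"
  assumes T: "T \<ge> 0" and meas: "\<And>u. u \<in> {0..T} \<Longrightarrow> Z u \<in> borel_measurable N"
    and cadlag: "\<And>w. w \<in> space N \<Longrightarrow> cadlag (\<lambda>t. Z t w)"
  shows "progressive N T Z"
  unfolding progressive_def
proof (rule borel_measurable_LIMSEQ_metric[where f = "\<lambda>n p. Z (min (rat_right (max (fst p) 0) n) T) (snd p)"])
  fix n :: nat
  let ?g = "\<lambda>p :: real \<times> 'w. nat \<lfloor>max (fst p) 0 * (real n + 1)\<rfloor>"
  have "(\<lambda>p. (\<lambda>i p. Z (min ((real i + 1) / (real n + 1)) T) (snd p)) (?g p) p) \<in> borel_measurable (borel \<Otimes>\<^sub>M N)"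
  proof (rule measurable_compose_countable[where f = "\<lambda>i p. Z (min ((real i + 1) / (real n + 1)) T) (snd p)" and g = ?g])
    fix i :: nat
    have [measurable]: "Z (min ((real i + 1) / (real n + 1)) T) \<in> borel_measurable N"
      using T by (intro meas) auto
    show "(\<lambda>p :: real \<times> 'w. Z (min ((real i + 1) / (real n + 1)) T) (snd p)) \<in> borel_measurable (borel \<Otimes>\<^sub>M N)"
      by measurable
  qed measurable
  moreover have "real (?g p) = of_int \<lfloor>max (fst p) 0 * (real n + 1)\<rfloor>" for p by simp
  ultimately show "(\<lambda>p. Z (min (rat_right (max (fst p) 0) n) T) (snd p)) \<in> borel_measurable (borel \<Otimes>\<^sub>M N)"
    unfolding rat_right_def by simp
next
  fix p assume "p \<in> space (borel \<Otimes>\<^sub>M N :: (real \<times> 'w) measure)"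
  then have w: "snd p \<in> space N" by (auto simp: space_pair_measure)
  define t where "t = max (fst p) 0"
  show "(\<lambda>n. Z (min (rat_right (max (fst p) 0) n) T) (snd p)) \<longlonglongrightarrow> Z (clamp_time T (fst p)) (snd p)"
    unfolding t_def[symmetric]
  proof (cases "t < T")
    case True
    have "filterlim (rat_right t) (at_right t) sequentially"
      by (rule tendsto_imp_filterlim_at_right[OF rat_right_tendsto]) (simp add: rat_right(2))
    moreover have "((\<lambda>u. Z u (snd p)) \<longlongrightarrow> Z t (snd p)) (at_right t)"
      using cadlag[OF w] unfolding cadlag_def by (simp add: t_def)
    ultimately have lim: "(\<lambda>n. Z (rat_right t n) (snd p)) \<longlonglongrightarrow> Z t (snd p)" by (rule filterlim_compose[rotated])
    have "\<forall>\<^sub>F n in sequentially. rat_right t n < T"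
      using True rat_right_tendsto by (intro order_tendstoD)
    then have "\<forall>\<^sub>F n in sequentially. Z (min (rat_right t n) T) (snd p) = Z (rat_right t n) (snd p)"
      by eventually_elim simp
    then show "(\<lambda>n. Z (min (rat_right t n) T) (snd p)) \<longlonglongrightarrow> Z (min t T) (snd p)"
      using True lim by (simp add: tendsto_cong)
  next
    case False
    then have "min (rat_right t n) T = T" for n using rat_right(2)[of t n] by simp
    then show "(\<lambda>n. Z (min (rat_right t n) T) (snd p)) \<longlonglongrightarrow> Z (min t T) (snd p)" using False by simp
  qed
qed

lemma progressive_section:
  fixes Z :: "real \<Rightarrow> 'w \<Rightarrow> 'a::euclidean_space"
  assumes "progressive N T Z" and w: "w \<in> space N"
  shows "(\<lambda>s. Z (clamp_time T s) w) \<in> borel_measurable borel"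
proof -
  have "(\<lambda>s. (s, w)) \<in> borel \<rightarrow>\<^sub>M borel \<Otimes>\<^sub>M N" using w by measurable
  from measurable_compose[OF this assms(1)[unfolded progressive_def]] show ?thesis by simp
qed

lemma progressive_at:
  assumes "progressive N T Z" and t: "0 \<le> t" "t \<le> T"
  shows "Z t \<in> borel_measurable N"
proof -
  have "(\<lambda>w. (t, w)) \<in> N \<rightarrow>\<^sub>M borel \<Otimes>\<^sub>M N" by measurable
  from measurable_compose[OF this assms(1)[unfolded progressive_def]] show ?thesis using t by simp
qed

lemma progressive_integral:
  fixes Z :: "real \<Rightarrow> 'w \<Rightarrow> 'a::euclidean_space" and f :: "'a \<Rightarrow> 'c::euclidean_space"
  assumes Z: "progressive N T Z" and f[measurable]: "f \<in> borel_measurable borel"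
  shows "progressive N T (\<lambda>t w. LINT s:{0..t}|lborel. f (Z s w))"
proof -
  note [measurable] = Z[unfolded progressive_def]
  have [measurable]: "(\<lambda>(p, u). Z (clamp_time T u) (snd p)) \<in> borel_measurable ((borel \<Otimes>\<^sub>M N) \<Otimes>\<^sub>M lborel)"
  proof -
    have "(\<lambda>q. (snd q, snd (fst q))) \<in> (borel \<Otimes>\<^sub>M N) \<Otimes>\<^sub>M lborel \<rightarrow>\<^sub>M borel \<Otimes>\<^sub>M N"
      by measurable
    from measurable_compose[OF this Z[unfolded progressive_def]] show ?thesis by (simp add: split_beta')
  qed
  have "(\<lambda>p. \<integral>u. indicator {0..clamp_time T (fst p)} u *\<^sub>R f (Z (clamp_time T u) (snd p)) \<partial>lborel) \<in> borel_measurable (borel \<Otimes>\<^sub>M N)"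
    by (rule lborel.borel_measurable_lebesgue_integral) (unfold split_beta' indicator_def atLeastAtMost_iff mem_Collect_eq, measurable)
  moreover have "(\<integral>u. indicator {0..clamp_time T s} u *\<^sub>R f (Z (clamp_time T u) w) \<partial>lborel)
    = (LINT u:{0..clamp_time T s}|lborel. f (Z u w))" for s w
    unfolding set_lebesgue_integral_def
    by (rule Bochner_Integration.integral_cong[OF refl]) (auto simp: indicator_def min_def max_def)
  ultimately show ?thesis unfolding progressive_def by simp
qed

lemma progressive_add:
  fixes Z1 Z2 :: "real \<Rightarrow> 'w \<Rightarrow> 'a::euclidean_space"
  assumes "progressive N T Z1" "progressive N T Z2"
  shows "progressive N T (\<lambda>t w. Z1 t w + Z2 t w)"
  using assms unfolding progressive_def by (rule borel_measurable_add)

lemma progressive_const: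
  fixes x :: "'a::euclidean_space"
  shows "progressive N T (\<lambda>t w. x)"
  unfolding progressive_def by simp

lemma progressive_lim:
  fixes Z :: "nat \<Rightarrow> real \<Rightarrow> 'w \<Rightarrow> 'a::euclidean_space"
  assumes "T \<ge> 0" "\<And>i. progressive N T (Z i)" "\<And>t w. t \<in> {0..T} \<Longrightarrow> w \<in> space N \<Longrightarrow> (\<lambda>i. Z i t w) \<longlonglongrightarrow> Z' t w"
  shows "progressive N T Z'"
  unfolding progressive_def
proof (rule borel_measurable_LIMSEQ_metric[OF assms(2)[unfolded progressive_def]])
  fix p assume "p \<in> space (borel \<Otimes>\<^sub>M N :: (real \<times> 'w) measure)"
  then show "(\<lambda>i. Z i (clamp_time T (fst p)) (snd p)) \<longlonglongrightarrow> Z' (clamp_time T (fst p)) (snd p)"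
    using assms(1) by (intro assms(3)) (auto simp: space_pair_measure)
qed

lemma clamp_set_integrable:
  fixes g :: "real \<Rightarrow> 'a::euclidean_space"
  assumes meas: "(\<lambda>s. g (clamp_time T s)) \<in> borel_measurable borel" and bdd: "\<And>s. s \<in> {0..T} \<Longrightarrow> norm (g s) \<le> B"
    and t: "t \<le> T"
  shows "set_integrable lborel {0..t} g"
proof -
  have "set_integrable lborel {0..t} (\<lambda>s. g (clamp_time T s))"
    unfolding set_integrable_def
  proof (rule integrableI_bounded_set_indicator[where B = "\<bar>B\<bar>"])
    show "AE s in lborel. s \<in> {0..t} \<longrightarrow> norm (g (clamp_time T s)) \<le> \<bar>B\<bar>"
      using t by (intro AE_I2 impI order_trans[OF bdd]) auto
  qed (use meas in \<open>auto simp: emeasure_lborel_Icc_eq\<close>)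
  then show ?thesis
    by (rule set_integrable_cong[THEN iffD1, rotated -1]) (use t in \<open>auto simp: min_def max_def\<close>)
qed

lemma norm_set_integral_le:
  fixes g :: "real \<Rightarrow> 'a::euclidean_space"
  assumes g: "set_integrable lborel A g" and f: "set_integrable lborel A f" and le: "\<And>s. s \<in> A \<Longrightarrow> norm (g s) \<le> f s"
  shows "norm (LINT s:A|lborel. g s) \<le> (LINT s:A|lborel. f s)"
proof -
  have "norm (LINT s:A|lborel. g s) \<le> (LINT s:A|lborel. norm (g s))"
    by (rule set_integral_norm_bound[OF g])
  also have "\<dots> \<le> (LINT s:A|lborel. f s)"
    by (rule set_integral_mono[OF set_integrable_norm[OF g] f le])
  finally show ?thesis .
qed

lemma set_integral_const_Icc: "0 \<le> t \<Longrightarrow> (LINT s:{0..t}|lborel. (c::real)) = c * t" for t :: real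
  unfolding set_lebesgue_integral_def by simp

lemma set_integrable_const_Icc: "set_integrable lborel {0..t} (\<lambda>s. c :: 'a::euclidean_space)" for t :: real
  unfolding set_integrable_def by (intro integrable_scaleR_left impI integrable_real_indicator) (auto simp: emeasure_lborel_Icc_eq)

lemma measurable_indefinite_integral:
  fixes g :: "real \<Rightarrow> 'a::euclidean_space"
  assumes "set_integrable lborel {0..T} g"
  shows "(\<lambda>t. LINT s:{0..clamp_time T t}|lborel. g s) \<in> borel_measurable borel"
proof -
  define f where "f s = indicator {0..T} s *\<^sub>R g s" for s
  have [measurable]: "f \<in> borel_measurable borel"
    using assms unfolding set_integrable_def f_def by (auto dest: borel_measurable_integrable)
  have "(\<lambda>t. \<integral>u. indicator {0..clamp_time T t} u *\<^sub>R f u \<partial>lborel) \<in> borel_measurable borel"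
    by (rule lborel.borel_measurable_lebesgue_integral) (unfold split_beta' indicator_def atLeastAtMost_iff mem_Collect_eq, measurable)
  moreover have "(\<integral>u. indicator {0..clamp_time T t} u *\<^sub>R f u \<partial>lborel) = (LINT s:{0..clamp_time T t}|lborel. g s)" for t
    unfolding set_lebesgue_integral_def
    by (rule Bochner_Integration.integral_cong[OF refl]) (auto simp: f_def indicator_def)
  ultimately show ?thesis by simp
qed

text \<open>The driving term cancels in the difference, so Gronwall applies however rough
  \<open>y\<close> is. The bound on the difference is derived from integrability, which is what an
  arbitrary strong solution offers.\<close>

lemma integral_equation_compare:
  fixes F :: "'a::euclidean_space \<Rightarrow> 'a"
  assumes F: "lipschitz_on \<omega> UNIV F"
    and int: "set_integrable lborel {0..T} (\<lambda>s. F (z1 s))" "set_integrable lborel {0..T} (\<lambda>s. F (z2 s))"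
    and eq: "\<And>t. t \<in> {0..T} \<Longrightarrow> z1 t = x1 + (LINT s:{0..t}|lborel. F (z1 s)) + y t"
      "\<And>t. t \<in> {0..T} \<Longrightarrow> z2 t = x2 + (LINT s:{0..t}|lborel. F (z2 s)) + y t"
    and t: "t \<in> {0..T}"
  shows "norm (z1 t - z2 t) \<le> norm (x1 - x2) * exp (\<omega> * t)"
proof -
  have \<omega>: "\<omega> \<ge> 0" using F by (rule lipschitz_on_nonneg)
  define g where "g s = F (z1 s) - F (z2 s)" for s
  have g: "set_integrable lborel {0..T} g" unfolding g_def by (intro set_integral_diff(1) int)
  have sub: "set_integrable lborel {0..t} f" if "set_integrable lborel {0..T} f" "t \<in> {0..T}" for t and f :: "real \<Rightarrow> 'b::{banach, second_countable_topology}"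
    using that(1) by (rule set_integrable_subset) (use that(2) in auto)
  have diff: "z1 t - z2 t = (x1 - x2) + (LINT s:{0..t}|lborel. g s)" if t: "t \<in> {0..T}" for t
  proof -
    have "(LINT s:{0..t}|lborel. g s) = (LINT s:{0..t}|lborel. F (z1 s)) - (LINT s:{0..t}|lborel. F (z2 s))"
      unfolding g_def by (intro set_integral_diff(2) sub[OF _ t] int)
    then show ?thesis using eq[OF t] by simp
  qed
  define B where "B = norm (x1 - x2) + (LINT s:{0..T}|lborel. norm (g s))"
  have bdd: "norm (z1 t - z2 t) \<le> B" if t: "t \<in> {0..T}" for t
  proof -
    have "norm (z1 t - z2 t) \<le> norm (x1 - x2) + norm (LINT s:{0..t}|lborel. g s)"
      unfolding diff[OF t] by (rule norm_triangle_ineq)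
    also have "norm (LINT s:{0..t}|lborel. g s) \<le> (LINT s:{0..t}|lborel. norm (g s))"
      by (rule set_integral_norm_bound[OF sub[OF g t]])
    also have "\<dots> \<le> (LINT s:{0..T}|lborel. norm (g s))"
      unfolding set_lebesgue_integral_def
    proof (rule integral_mono)
      show "integrable lborel (\<lambda>s. indicator {0..t} s *\<^sub>R norm (g s))" "integrable lborel (\<lambda>s. indicator {0..T} s *\<^sub>R norm (g s))"
        using set_integrable_norm[OF sub[OF g t]] set_integrable_norm[OF g] by (simp_all add: set_integrable_def)
      show "indicator {0..t} s *\<^sub>R norm (g s) \<le> indicator {0..T} s *\<^sub>R norm (g s)" for s
        using t by (auto simp: indicator_def)
    qed
    finally show ?thesis by (simp add: B_def)
  qed
  have meas: "(\<lambda>s. norm (z1 (clamp_time T s) - z2 (clamp_time T s))) \<in> borel_measurable borel"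
  proof -
    have "(\<lambda>s. norm ((x1 - x2) + (LINT r:{0..clamp_time T s}|lborel. g r))) \<in> borel_measurable borel"
      using measurable_indefinite_integral[OF g] by measurable
    moreover have "clamp_time T s \<in> {0..T}" for s using t by auto
    ultimately show ?thesis using diff by simp
  qed
  have nint: "set_integrable lborel {0..T} (\<lambda>s. norm (z1 s - z2 s))"
    using meas by (rule clamp_set_integrable[where B = B]) (use bdd in auto)
  show ?thesis
  proof (rule gronwall[OF \<omega> _ nint bdd _ t])
    fix t assume t: "t \<in> {0..T}"
    have "norm (z1 t - z2 t) \<le> norm (x1 - x2) + norm (LINT s:{0..t}|lborel. g s)"
      unfolding diff[OF t] by (rule norm_triangle_ineq)
    also have "norm (LINT s:{0..t}|lborel. g s) \<le> (LINT s:{0..t}|lborel. \<omega> * norm (z1 s - z2 s))"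
    proof (rule norm_set_integral_le)
      show "norm (g s) \<le> \<omega> * norm (z1 s - z2 s)" for s
        unfolding g_def using lipschitz_onD[OF F, of "z1 s" "z2 s"] by (simp add: dist_norm)
    qed (use sub[OF g t] sub[OF nint t] in auto)
    finally show "norm (z1 t - z2 t) \<le> norm (x1 - x2) + \<omega> * (LINT s:{0..t}|lborel. norm (z1 s - z2 s))"
      by simp
  qed simp_all
qed

section \<open>Picard iteration for the equation along a single path\<close>

locale driven_equation =
  fixes M :: "'w measure" and Y :: "real \<Rightarrow> 'w \<Rightarrow> 'a::euclidean_space" and F :: "'a \<Rightarrow> 'a" and \<omega> :: real
  assumes Y_measurable [measurable]: "Y t \<in> borel_measurable M"
    and Y_cadlag: "cadlag (\<lambda>t. Y t w)"
    and F_lipschitz: "lipschitz_on \<omega> UNIV F"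
begin

primrec picard :: "nat \<Rightarrow> 'a \<Rightarrow> real \<Rightarrow> 'w \<Rightarrow> 'a" where
  "picard 0 x t w = x + Y t w"
| "picard (Suc i) x t w = x + (LINT s:{0..t}|lborel. F (picard i x s w)) + Y t w"

definition solution :: "'a \<Rightarrow> real \<Rightarrow> 'w \<Rightarrow> 'a" where
  "solution x t w = lim (\<lambda>i. picard i x t w)"

lemma \<omega>_nonneg: "\<omega> \<ge> 0"
  using F_lipschitz by (rule lipschitz_on_nonneg)

lemma F_diff: "norm (F a - F b) \<le> \<omega> * norm (a - b)"
  using lipschitz_onD[OF F_lipschitz, of a b] by (simp add: dist_norm)

lemma F_growth: "norm (F a) \<le> norm (F 0) + \<omega> * norm a"
  using F_diff[of a 0] norm_triangle_sub[of "F a" "F 0"] by simp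

lemma F_measurable [measurable]: "F \<in> borel_measurable borel"
  by (rule borel_measurable_continuous_onI, rule lipschitz_on_continuous_on[OF F_lipschitz])

lemma progressive_picard:
  assumes T: "T \<ge> 0" and N: "\<And>u. u \<in> {0..T} \<Longrightarrow> Y u \<in> borel_measurable N"
  shows "progressive N T (picard i x)"
proof (induction i)
  have Y: "progressive N T Y" by (rule progressive_cadlag[OF T N Y_cadlag])
  case 0
  have "progressive N T (\<lambda>t w. x + Y t w)" by (intro progressive_add progressive_const Y)
  then show ?case by (simp add: progressive_def)
next
  have Y: "progressive N T Y" by (rule progressive_cadlag[OF T N Y_cadlag])
  case (Suc i)
  have "progressive N T (\<lambda>t w. x + (LINT s:{0..t}|lborel. F (picard i x s w)) + Y t w)"
    by (intro progressive_add progressive_const Y progressive_integral Suc) measurable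
  then show ?case by (simp add: progressive_def)
qed

lemma picard_measurable: "w \<in> space M \<Longrightarrow> T \<ge> 0 \<Longrightarrow> (\<lambda>s. picard i x (clamp_time T s) w) \<in> borel_measurable borel"
  by (rule progressive_section[OF progressive_picard[of T M]]) auto

lemma picard_bounded:
  assumes "T \<ge> 0" "w \<in> space M"
  shows "\<exists>B\<ge>0. \<forall>t\<in>{0..T}. norm (picard i x t w) \<le> B"
proof (induction i)
  obtain A where A: "A \<ge> 0" "\<And>t. t \<in> {0..T} \<Longrightarrow> norm (Y t w) \<le> A" using cadlag_bounded[OF Y_cadlag] by blast
  case 0
  have "norm (x + Y t w) \<le> norm x + A" if "t \<in> {0..T}" for t
    using A(2)[OF that] norm_triangle_ineq[of x "Y t w"] by linarith
  then show ?case using A(1) by (intro exI[of _ "norm x + A"]) auto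
next
  obtain A where A: "A \<ge> 0" "\<And>t. t \<in> {0..T} \<Longrightarrow> norm (Y t w) \<le> A" using cadlag_bounded[OF Y_cadlag] by blast
  case (Suc i)
  then obtain B where B: "B \<ge> 0" "\<And>t. t \<in> {0..T} \<Longrightarrow> norm (picard i x t w) \<le> B" by blast
  define K where "K = norm (F 0) + \<omega> * B"
  have K: "K \<ge> 0" "norm (F (picard i x s w)) \<le> K" if "s \<in> {0..T}" for s
    using B \<omega>_nonneg F_growth[of "picard i x s w"] mult_left_mono[OF B(2)[OF that] \<omega>_nonneg] by (auto simp: K_def)
  have "norm (picard (Suc i) x t w) \<le> norm x + K * T + A" if t: "t \<in> {0..T}" for t
  proof -
    have int: "set_integrable lborel {0..t} (\<lambda>s. F (picard i x s w))"
      by (rule clamp_set_integrable[where B = K and T = T]) (use picard_measurable[OF assms(2,1)] K t in auto)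
    have "norm (LINT s:{0..t}|lborel. F (picard i x s w)) \<le> (LINT s:{0..t}|lborel. K)"
      by (rule norm_set_integral_le[OF int set_integrable_const_Icc]) (use K t in auto)
    also have "\<dots> \<le> K * T" using t K(1)[OF t] by (subst set_integral_const_Icc) (auto intro: mult_left_mono)
    finally have "norm (LINT s:{0..t}|lborel. F (picard i x s w)) \<le> K * T" .
    then show ?thesis
      using norm_triangle_ineq[of "x + (LINT s:{0..t}|lborel. F (picard i x s w))" "Y t w"]
        norm_triangle_ineq[of x "LINT s:{0..t}|lborel. F (picard i x s w)"] A(2)[OF t] by simp
  qed
  moreover have "0 \<le> norm x + K * T + A" using assms(1) K(1)[of 0] A(1) by simp
  ultimately show ?case by (intro exI[of _ "norm x + K * T + A"]) auto
qed

lemma set_integrable_of_bounded: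
  assumes "progressive M T Z" "w \<in> space M" "t \<le> T" "\<And>s. s \<in> {0..T} \<Longrightarrow> norm (Z s w) \<le> B"
  shows "set_integrable lborel {0..t} (\<lambda>s. F (Z s w))"
proof (rule clamp_set_integrable[where T = T and B = "norm (F 0) + \<omega> * B"])
  show "(\<lambda>s. F (Z (clamp_time T s) w)) \<in> borel_measurable borel"
    using progressive_section[OF assms(1,2)] by measurable
  show "norm (F (Z s w)) \<le> norm (F 0) + \<omega> * B" if "s \<in> {0..T}" for s
    using F_growth[of "Z s w"] mult_left_mono[OF assms(4)[OF that] \<omega>_nonneg] by linarith
qed (rule assms(3))

lemma picard_set_integrable:
  assumes "T \<ge> 0" "w \<in> space M" "t \<le> T"
  shows "set_integrable lborel {0..t} (\<lambda>s. F (picard i x s w))"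
proof -
  obtain B where "\<And>t. t \<in> {0..T} \<Longrightarrow> norm (picard i x t w) \<le> B" using picard_bounded[OF assms(1,2)] by blast
  then show ?thesis
    using progressive_picard[of T M] assms by (intro set_integrable_of_bounded[where T = T and B = B]) auto
qed

text \<open>In the supremum weighted by \<open>exp (- 2 * \<omega> * t)\<close> one iteration
  contracts by 1/2, whatever the length of the interval. The constant \<open>A\<close> depends on
  the path, on \<open>x\<close> and on \<open>T\<close>.\<close>

lemma picard_step:
  assumes "T \<ge> 0" "w \<in> space M"
  obtains A where "A \<ge> 0" "\<And>i t. t \<in> {0..T} \<Longrightarrow> norm (picard (Suc i) x t w - picard i x t w) \<le> A * (1 / 2) ^ i * exp (2 * \<omega> * t)"
proof -
  obtain B1 where B1: "B1 \<ge> 0" "\<And>t. t \<in> {0..T} \<Longrightarrow> norm (picard 1 x t w) \<le> B1" using picard_bounded[OF assms, of 1 x] by auto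
  obtain B0 where B0: "B0 \<ge> 0" "\<And>t. t \<in> {0..T} \<Longrightarrow> norm (picard 0 x t w) \<le> B0" using picard_bounded[OF assms, of 0 x] by blast
  define A where "A = B1 + B0"
  have A: "A \<ge> 0" using B1 B0 by (simp add: A_def)
  have "norm (picard (Suc i) x t w - picard i x t w) \<le> A * (1 / 2) ^ i * exp (2 * \<omega> * t)" if "t \<in> {0..T}" for i t
    using that
  proof (induction i arbitrary: t)
    case 0
    have "norm (picard (Suc 0) x t w - picard 0 x t w) \<le> A"
      using B1(2)[OF 0] B0(2)[OF 0] norm_triangle_ineq4[of "picard 1 x t w" "picard 0 x t w"] by (simp add: A_def)
    also have "\<dots> \<le> A * exp (2 * \<omega> * t)" using A \<omega>_nonneg 0 by (simp add: mult_le_cancel_left1)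
    finally show ?case by simp
  next
    case (Suc i)
    have t: "0 \<le> t" "t \<le> T" using Suc.prems by auto
    have "picard (Suc (Suc i)) x t w - picard (Suc i) x t w
      = (LINT s:{0..t}|lborel. F (picard (Suc i) x s w)) - (LINT s:{0..t}|lborel. F (picard i x s w))"
      by simp
    also have "\<dots> = (LINT s:{0..t}|lborel. F (picard (Suc i) x s w) - F (picard i x s w))"
      by (intro set_integral_diff(2)[symmetric] picard_set_integrable[OF assms t(2)])
    also have "norm \<dots> \<le> (LINT s:{0..t}|lborel. (A * (1 / 2) ^ i * \<omega>) * exp ((2 * \<omega>) * s))"
    proof (intro norm_set_integral_le set_integral_diff(1) picard_set_integrable[OF assms t(2)] set_integrable_exp)
      fix s assume s: "s \<in> {0..t}"
      have "norm (F (picard (Suc i) x s w) - F (picard i x s w)) \<le> \<omega> * norm (picard (Suc i) x s w - picard i x s w)"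
        by (rule F_diff)
      also have "\<dots> \<le> \<omega> * (A * (1 / 2) ^ i * exp (2 * \<omega> * s))"
        using s t by (intro mult_left_mono Suc.IH \<omega>_nonneg) auto
      finally show "norm (F (picard (Suc i) x s w) - F (picard i x s w)) \<le> (A * (1 / 2) ^ i * \<omega>) * exp ((2 * \<omega>) * s)"
        by (simp only: mult_ac)
    qed
    also have "\<dots> = A * (1 / 2) ^ Suc i * (LINT s:{0..t}|lborel. (2 * \<omega>) * exp ((2 * \<omega>) * s))"
    proof -
      have "(LINT s:{0..t}|lborel. (2 * \<omega>) * exp ((2 * \<omega>) * s)) = 2 * \<omega> * (LINT s:{0..t}|lborel. exp ((2 * \<omega>) * s))"
        by (rule set_integral_mult_right)
      moreover have "(LINT s:{0..t}|lborel. (A * (1 / 2) ^ i * \<omega>) * exp ((2 * \<omega>) * s)) = A * (1 / 2) ^ i * \<omega> * (LINT s:{0..t}|lborel. exp ((2 * \<omega>) * s))"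
        by (rule set_integral_mult_right)
      ultimately show ?thesis by simp
    qed
    also have "\<dots> = A * (1 / 2) ^ Suc i * (exp (2 * \<omega> * t) - 1)" using t by (subst set_integral_exp) auto
    also have "\<dots> \<le> A * (1 / 2) ^ Suc i * exp (2 * \<omega> * t)" using A by (intro mult_left_mono) auto
    finally show ?case .
  qed
  with A show ?thesis by (rule that)
qed

lemma picard_uniform:
  assumes "T \<ge> 0" "w \<in> space M"
  obtains A where "A \<ge> 0" "\<And>i t. t \<in> {0..T} \<Longrightarrow> norm (solution x t w - picard i x t w) \<le> A * (1 / 2) ^ i"
    "\<And>t. t \<in> {0..T} \<Longrightarrow> (\<lambda>i. picard i x t w) \<longlonglongrightarrow> solution x t w"
proof -
  obtain A' where A': "A' \<ge> 0" "\<And>i t. t \<in> {0..T} \<Longrightarrow> norm (picard (Suc i) x t w - picard i x t w) \<le> A' * (1 / 2) ^ i * exp (2 * \<omega> * t)"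
    using picard_step[OF assms] by blast
  define A where "A = A' * exp (2 * \<omega> * T)"
  have A: "A \<ge> 0" using A' by (simp add: A_def)
  have step: "norm (picard (Suc i) x t w - picard i x t w) \<le> A * (1 / 2) ^ i" if t: "t \<in> {0..T}" for i t
  proof -
    have "A' * (1 / 2) ^ i * exp (2 * \<omega> * t) \<le> A' * (1 / 2) ^ i * exp (2 * \<omega> * T)"
      using A'(1) t \<omega>_nonneg by (intro mult_left_mono) (auto intro: mult_left_mono)
    then show ?thesis using A'(2)[OF t, of i] by (simp add: A_def mult_ac)
  qed
  \<comment> \<open>The subtracted term is the tail of the geometric series; keeping it closes the
    induction on \<open>k\<close>.\<close>
  have dist: "norm (picard (i + k) x t w - picard i x t w) \<le> 2 * A * (1 / 2) ^ i - A * 2 * (1 / 2) ^ (i + k)" if t: "t \<in> {0..T}" for i k t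
  proof (induction k)
    case (Suc k)
    have "norm (picard (i + Suc k) x t w - picard i x t w)
      \<le> norm (picard (Suc (i + k)) x t w - picard (i + k) x t w) + norm (picard (i + k) x t w - picard i x t w)"
      using norm_triangle_ineq[of "picard (Suc (i + k)) x t w - picard (i + k) x t w" "picard (i + k) x t w - picard i x t w"]
      by (simp del: picard.simps)
    also have "\<dots> \<le> A * (1 / 2) ^ (i + k) + (2 * A * (1 / 2) ^ i - A * 2 * (1 / 2) ^ (i + k))"
      by (intro add_mono step[OF t] Suc)
    finally show ?case by simp
  qed simp
  have bound: "norm (picard (i + k) x t w - picard i x t w) \<le> 2 * A * (1 / 2) ^ i" if t: "t \<in> {0..T}" for i k t
  proof -
    have "0 \<le> A * 2 * (1 / 2) ^ (i + k)" using A by simp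
    then show ?thesis using dist[OF t, of i k] by linarith
  qed
  have half: "(\<lambda>i. 2 * A * (1 / 2) ^ i) \<longlonglongrightarrow> 0"
    using tendsto_mult[OF tendsto_const LIMSEQ_power_zero[of "1 / 2 :: real"], of "2 * A"] by simp
  have lim: "(\<lambda>i. picard i x t w) \<longlonglongrightarrow> solution x t w" if t: "t \<in> {0..T}" for t
  proof -
    have "convergent (\<lambda>i. picard i x t w)"
    proof (rule convergent_of_eventually_close)
      fix e :: real assume e: "e > 0"
      obtain i where i: "2 * A * (1 / 2) ^ i < e / 2"
        using order_tendstoD(2)[OF half, of "e / 2"] e by (auto simp: eventually_sequentially)
      let ?S = "{a. norm (a - picard i x t w) \<le> e / 2}"
      have "\<forall>\<^sub>F n in sequentially. picard n x t w \<in> ?S"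
        using eventually_ge_at_top[of i]
      proof eventually_elim
        case (elim n)
        then show ?case using bound[OF t, of i "n - i"] i by simp
      qed
      moreover have "norm (b - a) \<le> e" if "a \<in> ?S" "b \<in> ?S" for a b
        using that norm_triangle_ineq4[of "b - picard i x t w" "a - picard i x t w"] by simp
      ultimately show "\<exists>S. (\<forall>\<^sub>F n in sequentially. picard n x t w \<in> S) \<and> (\<forall>a\<in>S. \<forall>b\<in>S. norm (b - a) \<le> e)"
        by blast
    qed
    then show ?thesis unfolding solution_def by (simp add: convergent_LIMSEQ_iff)
  qed
  show ?thesis
  proof (rule that[of "2 * A"])
    fix i t assume t: "t \<in> {0..T}"
    show "norm (solution x t w - picard i x t w) \<le> 2 * A * (1 / 2) ^ i"
    proof (rule norm_lim_diff_le[OF lim[OF t]])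
      show "\<forall>\<^sub>F n in sequentially. norm (picard n x t w - picard i x t w) \<le> 2 * A * (1 / 2) ^ i"
        using eventually_ge_at_top[of i]
      proof eventually_elim
        case (elim n)
        then show ?case using bound[OF t, of i "n - i"] by simp
      qed
    qed
  qed (use A lim in auto)
qed

lemma picard_tendsto:
  assumes "w \<in> space M" "t \<ge> 0"
  shows "(\<lambda>i. picard i x t w) \<longlonglongrightarrow> solution x t w"
proof (rule picard_uniform[OF assms(2,1), of x])
  assume "\<And>s. s \<in> {0..t} \<Longrightarrow> (\<lambda>i. picard i x s w) \<longlonglongrightarrow> solution x s w"
  then show ?thesis using assms(2) by simp
qed

lemma picard_error:
  assumes "T \<ge> 0" "w \<in> space M"
  shows "\<exists>A\<ge>0. \<forall>i. \<forall>t\<in>{0..T}. norm (solution x t w - picard i x t w) \<le> A * (1 / 2) ^ i"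
proof (rule picard_uniform[OF assms, of x])
  fix A assume "A \<ge> 0" "\<And>i t. t \<in> {0..T} \<Longrightarrow> norm (solution x t w - picard i x t w) \<le> A * (1 / 2) ^ i"
  then show ?thesis by (intro exI[of _ A] conjI allI ballI)
qed

text \<open>The measure \<open>N\<close> only supplies a \<open>\<sigma>\<close>-algebra: it will be
  \<open>M\<close> for measurability, and the augmented filtration at time \<open>T\<close> for
  adaptedness.\<close>

lemma progressive_solution:
  assumes T: "T \<ge> 0" and N: "\<And>u. u \<in> {0..T} \<Longrightarrow> Y u \<in> borel_measurable N" and sp: "space N \<subseteq> space M"
  shows "progressive N T (solution x)"
proof (rule progressive_lim[OF T progressive_picard[OF T N]])
  fix t w assume "t \<in> {0..T}" "w \<in> space N"
  then show "(\<lambda>i. picard i x t w) \<longlonglongrightarrow> solution x t w"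
    using sp by (intro picard_tendsto) auto
qed

lemma solution_bounded:
  assumes "T \<ge> 0" "w \<in> space M"
  shows "\<exists>B\<ge>0. \<forall>t\<in>{0..T}. norm (solution x t w) \<le> B"
proof -
  obtain A where A: "A \<ge> 0" "\<And>i t. t \<in> {0..T} \<Longrightarrow> norm (solution x t w - picard i x t w) \<le> A * (1 / 2) ^ i"
    using picard_error[OF assms] by blast
  obtain B where B: "B \<ge> 0" "\<And>t. t \<in> {0..T} \<Longrightarrow> norm (picard 0 x t w) \<le> B" using picard_bounded[OF assms] by blast
  have "norm (solution x t w) \<le> A + B" if t: "t \<in> {0..T}" for t
    using A(2)[OF t, of 0] B(2)[OF t] norm_triangle_sub[of "solution x t w" "picard 0 x t w"] by (simp del: picard.simps)
  then show ?thesis using A(1) B(1) by (intro exI[of _ "A + B"]) auto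
qed

lemma solution_set_integrable:
  assumes "w \<in> space M" "t \<ge> 0"
  shows "set_integrable lborel {0..t} (\<lambda>s. F (solution x s w))"
proof -
  obtain B where "\<And>s. s \<in> {0..t} \<Longrightarrow> norm (solution x s w) \<le> B" using solution_bounded[OF assms(2,1)] by blast
  then show ?thesis
    using progressive_solution[of t M] assms by (intro set_integrable_of_bounded[where T = t and B = B]) auto
qed

lemma solution_eq:
  assumes w: "w \<in> space M" and t: "t \<ge> 0"
  shows "solution x t w = x + (LINT s:{0..t}|lborel. F (solution x s w)) + Y t w"
proof -
  obtain A where A: "A \<ge> 0" "\<And>i s. s \<in> {0..t} \<Longrightarrow> norm (solution x s w - picard i x s w) \<le> A * (1 / 2) ^ i"
    using picard_error[OF t w] by blast
  have lim: "(\<lambda>i. picard i x s w) \<longlonglongrightarrow> solution x s w" if "s \<in> {0..t}" for s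
    using that by (intro picard_tendsto w) auto
  have "(\<lambda>i. LINT s:{0..t}|lborel. F (picard i x s w)) \<longlonglongrightarrow> (LINT s:{0..t}|lborel. F (solution x s w))"
  proof (rule LIM_zero_cancel, rule Lim_null_comparison)
    have "norm ((LINT s:{0..t}|lborel. F (picard i x s w)) - (LINT s:{0..t}|lborel. F (solution x s w))) \<le> \<omega> * A * t * (1 / 2) ^ i" for i
    proof -
      have "(LINT s:{0..t}|lborel. F (picard i x s w)) - (LINT s:{0..t}|lborel. F (solution x s w))
        = (LINT s:{0..t}|lborel. F (picard i x s w) - F (solution x s w))"
        by (intro set_integral_diff(2)[symmetric] picard_set_integrable[OF t w] solution_set_integrable[OF w t]) simp
      also have "norm \<dots> \<le> (LINT s:{0..t}|lborel. \<omega> * (A * (1 / 2) ^ i))"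
      proof (intro norm_set_integral_le set_integral_diff(1) picard_set_integrable[OF t w] solution_set_integrable[OF w t] set_integrable_const_Icc)
        fix s assume s: "s \<in> {0..t}"
        have "norm (F (picard i x s w) - F (solution x s w)) \<le> \<omega> * norm (picard i x s w - solution x s w)" by (rule F_diff)
        also have "\<dots> \<le> \<omega> * (A * (1 / 2) ^ i)"
          using A(2)[OF s, of i] by (intro mult_left_mono \<omega>_nonneg) (simp add: norm_minus_commute)
        finally show "norm (F (picard i x s w) - F (solution x s w)) \<le> \<omega> * (A * (1 / 2) ^ i)" .
      qed simp
      also have "\<dots> = \<omega> * A * t * (1 / 2) ^ i" using t by (simp add: set_integral_const_Icc)
      finally show ?thesis .
    qed
    then show "\<forall>\<^sub>F i in sequentially. norm ((LINT s:{0..t}|lborel. F (picard i x s w)) - (LINT s:{0..t}|lborel. F (solution x s w))) \<le> \<omega> * A * t * (1 / 2) ^ i"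
      by simp
    show "(\<lambda>i. \<omega> * A * t * (1 / 2) ^ i) \<longlonglongrightarrow> 0"
      using tendsto_mult[OF tendsto_const LIMSEQ_power_zero[of "1 / 2 :: real"], of "\<omega> * A * t"] by simp
  qed
  then have "(\<lambda>i. picard (Suc i) x t w) \<longlonglongrightarrow> x + (LINT s:{0..t}|lborel. F (solution x s w)) + Y t w"
    unfolding picard.simps by (intro tendsto_add tendsto_const)
  moreover have "(\<lambda>i. picard (Suc i) x t w) \<longlonglongrightarrow> solution x t w"
    using lim[of t] t by (intro LIMSEQ_Suc) simp
  ultimately show ?thesis by (rule LIMSEQ_unique[rotated])
qed

lemma space_augmented [simp]: "space (augmented_filtration M Y t) = space M"
  by (simp add: augmented_filtration_def space_measure_of_conv)

lemma sets_augmented: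
  "sets (augmented_filtration M Y t) = sigma_sets (space M)
     ({Y s -` A \<inter> space M | s A. 0 \<le> s \<and> s \<le> t \<and> A \<in> sets borel} \<union> null_sets M)"
  unfolding augmented_filtration_def by (rule sets_measure_of) (auto dest: null_setsD2 sets.sets_into_space)

lemma Y_adapted: "0 \<le> s \<Longrightarrow> s \<le> t \<Longrightarrow> Y s \<in> borel_measurable (augmented_filtration M Y t)"
  by (rule measurableI) (auto simp: sets_augmented intro!: sigma_sets.Basic)

text \<open>Adaptedness is inherited from the Picard iterates, which read \<open>Y\<close> only up
  to the current time. Off a single null set any other strong solution obeys the same equation at
  all times, and the comparison with initial distance 0 identifies the two.\<close>

lemma solution_unique_strong: "unique_strong_solution M Y F x (solution x)"
  unfolding unique_strong_solution_def
proof (intro conjI allI impI)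
  show "strong_solution M Y F x (solution x)"
    unfolding strong_solution_def
  proof (intro conjI allI impI AE_I2)
    fix t :: real assume t: "t \<ge> 0"
    show "solution x t \<in> borel_measurable (augmented_filtration M Y t)"
      by (rule progressive_at[OF progressive_solution]) (use t in \<open>auto intro: Y_adapted\<close>)
  qed (use solution_set_integrable solution_eq in auto)
  fix X' assume "strong_solution M Y F x X'"
  then have "AE w in M. \<forall>t\<ge>0. set_integrable lborel {0..t} (\<lambda>s. F (X' s w)) \<and>
      X' t w = x + (LINT s:{0..t}|lborel. F (X' s w)) + Y t w"
    unfolding strong_solution_def by blast
  then show "AE w in M. \<forall>t\<ge>0. X' t w = solution x t w"
    using AE_space
  proof eventually_elim
    case (elim w)
    show ?case
    proof (intro allI impI)
      fix t :: real assume t: "t \<ge> 0"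
      have "norm (X' t w - solution x t w) \<le> norm (x - x) * exp (\<omega> * t)"
        by (rule integral_equation_compare[OF F_lipschitz, where T = t and y = "\<lambda>t. Y t w"])
           (use elim t solution_set_integrable solution_eq in auto)
      then show "X' t w = solution x t w" by simp
    qed
  qed
qed

lemma solution_lipschitz:
  assumes "w \<in> space M" "t \<ge> 0"
  shows "norm (solution x t w - solution x' t w) \<le> norm (x - x') * exp (\<omega> * t)"
  by (rule integral_equation_compare[OF F_lipschitz, where T = t and y = "\<lambda>t. Y t w"])
     (use assms solution_set_integrable solution_eq in auto)

lemma solution_measurable: "t \<ge> 0 \<Longrightarrow> solution x t \<in> borel_measurable M"
  by (rule progressive_at[OF progressive_solution]) auto

end

section \<open>The Euler scheme driven by a random walk\<close>

definition euler :: "real \<Rightarrow> ('a::real_vector \<Rightarrow> 'a) \<Rightarrow> 'a \<Rightarrow> (nat \<Rightarrow> 'a) \<Rightarrow> nat \<Rightarrow> 'a" where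
  "euler h G = chain (\<lambda>x y. x + h *\<^sub>R G x + y)"

lemma euler_0 [simp]: "euler h G x \<zeta> 0 = x"
  by (simp add: euler_def)

lemma euler_Suc: "euler h G x \<zeta> (Suc k) = euler h G x \<zeta> k + h *\<^sub>R G (euler h G x \<zeta> k) + \<zeta> k"
  by (simp add: euler_def)

lemma euler_eq: "euler h G x \<zeta> k = x + (\<Sum>j<k. h *\<^sub>R G (euler h G x \<zeta> j)) + walk \<zeta> k"
  by (induction k) (simp_all add: euler_Suc walk_Suc)

lemma measurable_time_index [measurable]: "time_index h \<in> borel \<rightarrow>\<^sub>M count_space UNIV"
  by measurable

lemma measurable_step [measurable]:
  fixes g :: "nat \<Rightarrow> 'a::topological_space"
  shows "(\<lambda>s. g (time_index h s)) \<in> borel_measurable borel"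
  by (rule measurable_compose[OF measurable_time_index]) simp

lemma step_bounded:
  fixes g :: "nat \<Rightarrow> 'a::real_normed_vector"
  assumes "h > 0" "s \<in> {0..T}"
  shows "norm (g (time_index h s)) \<le> (\<Sum>j\<le>time_index h T. norm (g j))"
  using time_index_mono[OF assms(1), of s T] assms(2) by (intro member_le_sum) auto

lemma step_set_integrable:
  fixes g :: "nat \<Rightarrow> 'a::euclidean_space"
  assumes "h > 0"
  shows "set_integrable lborel {0..T} (\<lambda>s. g (time_index h s))"
proof (rule clamp_set_integrable[where T = T])
  have "(\<lambda>s. clamp_time T s) \<in> borel \<rightarrow>\<^sub>M borel" by measurable
  from measurable_compose[OF this measurable_step] show "(\<lambda>s. g (time_index h (clamp_time T s))) \<in> borel_measurable borel" .
  show "norm (g (time_index h s)) \<le> (\<Sum>j\<le>time_index h T. norm (g j))" if "s \<in> {0..T}" for s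
    by (rule step_bounded[OF assms that])
qed simp

lemma set_integral_split:
  fixes g :: "real \<Rightarrow> 'a::euclidean_space"
  assumes "set_integrable lborel {0..b} g" "0 \<le> a" "a \<le> b"
  shows "(LINT s:{0..b}|lborel. g s) = (LINT s:{0..a}|lborel. g s) + (LINT s:{a<..b}|lborel. g s)"
proof -
  have "{0..b} = {0..a} \<union> {a<..b}" using assms by auto
  moreover have "set_integrable lborel {0..a} g" "set_integrable lborel {a<..b} g"
    by (rule set_integrable_subset[OF assms(1)]; use assms in auto)+
  moreover have "{0..a} \<inter> {a<..b} = {}" by auto
  ultimately show ?thesis by (simp only: set_integral_Un)
qed

text \<open>The right end point of each step already has the next index; a single point is
  negligible.\<close>

lemma step_integral:
  fixes g :: "nat \<Rightarrow> 'a::euclidean_space"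
  assumes h: "h > 0"
  shows "(LINT s:{0..real k * h}|lborel. g (time_index h s)) = (\<Sum>j<k. h *\<^sub>R g j)"
proof (induction k)
  case 0
  have "(\<integral>s. indicator {0..0} s *\<^sub>R g (time_index h s) \<partial>lborel) = 0"
  proof (rule integral_eq_zero_AE)
    show "AE s in lborel. indicator {0..0::real} s *\<^sub>R g (time_index h s) = 0"
      using AE_lborel_singleton[of "0::real"] by eventually_elim (auto simp: indicator_def)
  qed
  then show ?case by (simp add: set_lebesgue_integral_def)
next
  case (Suc k)
  let ?a = "real k * h" and ?b = "real (Suc k) * h"
  have ab: "0 \<le> ?a" "?a \<le> ?b" using h by auto
  have "(LINT s:{?a<..?b}|lborel. g (time_index h s)) = (\<integral>s. indicator {?a<..?b} s *\<^sub>R g k \<partial>lborel)"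
    unfolding set_lebesgue_integral_def
  proof (rule Bochner_Integration.integral_cong_AE)
    show "AE s in lborel. indicator {?a<..?b} s *\<^sub>R g (time_index h s) = indicator {?a<..?b} s *\<^sub>R g k"
      using AE_lborel_singleton[of ?b]
    proof eventually_elim
      case (elim s)
      show ?case
      proof (cases "s \<in> {?a<..?b}")
        case True
        then have "\<lfloor>s / h\<rfloor> = int k" using elim h by (intro floor_unique) (auto simp: field_simps)
        then show ?thesis by simp
      qed simp
    qed
  qed measurable
  also have "\<dots> = h *\<^sub>R g k"
    using ab by (simp add: algebra_simps)
  finally have "(LINT s:{?a<..?b}|lborel. g (time_index h s)) = h *\<^sub>R g k" .
  then show ?case
    using set_integral_split[OF step_set_integrable[OF h, where g = g] ab] Suc by simp
qed

lemma norm_set_integral_diff_le: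
  fixes g :: "real \<Rightarrow> 'a::euclidean_space"
  assumes int: "set_integrable lborel {0..T} g" and bdd: "\<And>s. s \<in> {0..T} \<Longrightarrow> norm (g s) \<le> K"
    and a: "a \<in> {0..T}" and b: "b \<in> {0..T}"
  shows "norm ((LINT s:{0..b}|lborel. g s) - (LINT s:{0..a}|lborel. g s)) \<le> K * \<bar>b - a\<bar>"
proof -
  have *: "norm ((LINT s:{0..b}|lborel. g s) - (LINT s:{0..a}|lborel. g s)) \<le> K * (b - a)"
    if ab: "a \<le> b" "a \<in> {0..T}" "b \<in> {0..T}" for a b
  proof -
    have ib: "set_integrable lborel {0..b} g" by (rule set_integrable_subset[OF int]) (use ab in auto)
    have iab: "set_integrable lborel {a<..b} g" by (rule set_integrable_subset[OF int]) (use ab in auto)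
    have "norm ((LINT s:{0..b}|lborel. g s) - (LINT s:{0..a}|lborel. g s)) = norm (LINT s:{a<..b}|lborel. g s)"
      using set_integral_split[OF ib, of a] ab by simp
    also have "\<dots> \<le> (LINT s:{a<..b}|lborel. K)"
    proof (rule norm_set_integral_le[OF iab])
      show "set_integrable lborel {a<..b} (\<lambda>s. K)"
        unfolding set_integrable_def using ab by (intro integrable_scaleR_left impI integrable_real_indicator) auto
    qed (use bdd ab in auto)
    also have "\<dots> = K * (b - a)" using ab unfolding set_lebesgue_integral_def by simp
    finally show ?thesis .
  qed
  show ?thesis
  proof (cases "a \<le> b")
    case True
    then show ?thesis using *[OF True a b] by simp
  next
    case False
    then show ?thesis using *[of b a] a b by (simp add: norm_minus_commute)
  qed
qed

lemma set_integral_mono_upper: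
  fixes g :: "real \<Rightarrow> real"
  assumes int: "set_integrable lborel {0..b} g" and nonneg: "\<And>s. s \<in> {0..b} \<Longrightarrow> 0 \<le> g s" and ab: "0 \<le> a" "a \<le> b"
  shows "(LINT s:{0..a}|lborel. g s) \<le> (LINT s:{0..b}|lborel. g s)"
proof -
  have "0 \<le> (LINT s:{a<..b}|lborel. g s)"
    unfolding set_lebesgue_integral_def
    using nonneg ab by (intro Bochner_Integration.integral_nonneg) (auto simp: indicator_def)
  then show ?thesis using set_integral_split[OF int ab] by simp
qed

context driven_equation
begin

text \<open>The scheme solves an integral equation with a piecewise constant integrand, driven by
  the walk. Since the walk and \<open>Y\<close> may be far apart at single times, Gronwall is
  applied not to the error \<open>D\<close> but to its integral \<open>I\<close>, where their
  distance appears integrated over time; the pointwise distance enters once, at the end. The drifts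
  \<open>G\<close> and \<open>F\<close> are compared at the solution, whose bound \<open>B\<close>
  is known, so closeness on a ball is enough.\<close>

lemma euler_error:
  fixes G :: "'a \<Rightarrow> 'a" and \<zeta> :: "nat \<Rightarrow> 'a"
  assumes w: "w \<in> space M" and T: "T \<ge> 0" and h: "h > 0" and G: "lipschitz_on \<omega> UNIV G"
    and B: "B \<ge> 0" "\<And>s. s \<in> {0..T} \<Longrightarrow> norm (solution x s w) \<le> B"
    and \<epsilon>: "\<epsilon> \<ge> 0" "\<And>b. norm b \<le> B \<Longrightarrow> norm (G b - F b) \<le> \<epsilon>"
    and k: "real k * h \<le> T" and t: "t \<in> {0..T}"
  defines "K \<equiv> norm (F 0) + \<omega> * B"
  shows "norm (euler h G x \<zeta> k - solution x t w)
    \<le> \<omega> * ((T * (\<epsilon> * T + K * h) + (LINT s:{0..T}|lborel. norm (walk \<zeta> (time_index h s) - Y s w))) * exp (\<omega> * T))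
      + \<epsilon> * T + K * \<bar>t - real k * h\<bar> + norm (walk \<zeta> k - Y t w)"
proof -
  let ?E = "euler h G x \<zeta>" and ?X = "\<lambda>s. solution x s w"
  have K: "K \<ge> 0" using B(1) \<omega>_nonneg by (simp add: K_def)
  have FK: "norm (F (?X s)) \<le> K" if "s \<in> {0..T}" for s
    using F_growth[of "?X s"] mult_left_mono[OF B(2)[OF that] \<omega>_nonneg] by (simp add: K_def)
  define D where "D s = norm (?E (time_index h s) - ?X s)" for s
  have X_meas: "(\<lambda>s. ?X (clamp_time T s)) \<in> borel_measurable borel"
    by (rule progressive_section[OF progressive_solution w]) (use T in auto)
  have clamp: "(\<lambda>s. clamp_time T s) \<in> borel \<rightarrow>\<^sub>M borel" by measurable
  have step_meas: "(\<lambda>s. g (time_index h (clamp_time T s))) \<in> borel_measurable borel" for g :: "nat \<Rightarrow> 'a"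
    by (rule measurable_compose[OF clamp measurable_step])
  have D_int: "set_integrable lborel {0..T} D"
  proof (rule clamp_set_integrable[where T = T])
    show "(\<lambda>s. D (clamp_time T s)) \<in> borel_measurable borel"
      unfolding D_def using X_meas step_meas[of ?E] by measurable
    show "norm (D s) \<le> (\<Sum>j\<le>time_index h T. norm (?E j)) + B" if "s \<in> {0..T}" for s
      using step_bounded[OF h that, of ?E] B(2)[OF that] norm_triangle_ineq4[of "?E (time_index h s)" "?X s"]
      by (simp add: D_def)
  qed simp
  have sub: "set_integrable lborel {0..a} f" if "set_integrable lborel {0..T} f" "a \<le> T" for a and f :: "real \<Rightarrow> 'z::{banach, second_countable_topology}"
    using that(1) by (rule set_integrable_subset) (use that(2) in auto)
  have GF: "norm (G a - F b) \<le> \<omega> * norm (a - b) + \<epsilon>" if "norm b \<le> B" for a b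
  proof -
    have "norm (G a - F b) \<le> norm (G a - G b) + norm (G b - F b)"
      using norm_triangle_ineq[of "G a - G b" "G b - F b"] by simp
    then show ?thesis using lipschitz_onD[OF G, of a b] \<epsilon>(2)[OF that] by (simp add: dist_norm)
  qed
  have FX_int: "set_integrable lborel {0..T} (\<lambda>s. F (?X s))" by (rule solution_set_integrable[OF w T])
  have GE_int: "set_integrable lborel {0..T} (\<lambda>s. G (?E (time_index h s)))"
    by (rule step_set_integrable[OF h])
  have main: "norm (?E k - ?X t) \<le> \<omega> * (LINT s:{0..real k * h}|lborel. D s) + \<epsilon> * T + K * \<bar>t - real k * h\<bar> + norm (walk \<zeta> k - Y t w)"
    if k: "real k * h \<le> T" and t: "t \<in> {0..T}" for k t
  proof -
    let ?a = "real k * h"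
    have a: "0 \<le> ?a" "?a \<le> T" using h k by auto
    have "?E k = x + (LINT s:{0..?a}|lborel. G (?E (time_index h s))) + walk \<zeta> k"
      unfolding step_integral[OF h, where g = "\<lambda>j. G (?E j)" and k = k] by (rule euler_eq)
    moreover have "?X t = x + (LINT s:{0..t}|lborel. F (?X s)) + Y t w"
      using t by (intro solution_eq w) simp
    moreover have "(LINT s:{0..?a}|lborel. G (?E (time_index h s)) - F (?X s))
      = (LINT s:{0..?a}|lborel. G (?E (time_index h s))) - (LINT s:{0..?a}|lborel. F (?X s))"
      by (intro set_integral_diff(2) sub[OF _ a(2)] GE_int FX_int)
    ultimately have eq: "?E k - ?X t = (LINT s:{0..?a}|lborel. G (?E (time_index h s)) - F (?X s))
      - ((LINT s:{0..t}|lborel. F (?X s)) - (LINT s:{0..?a}|lborel. F (?X s))) + (walk \<zeta> k - Y t w)"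
      by simp
    have n1: "norm (LINT s:{0..?a}|lborel. G (?E (time_index h s)) - F (?X s)) \<le> \<omega> * (LINT s:{0..?a}|lborel. D s) + \<epsilon> * T"
    proof -
      have "norm (LINT s:{0..?a}|lborel. G (?E (time_index h s)) - F (?X s)) \<le> (LINT s:{0..?a}|lborel. \<omega> * D s + \<epsilon>)"
      proof (rule norm_set_integral_le)
        show "set_integrable lborel {0..?a} (\<lambda>s. G (?E (time_index h s)) - F (?X s))"
          by (intro set_integral_diff(1) sub[OF _ a(2)] GE_int FX_int)
        show "set_integrable lborel {0..?a} (\<lambda>s. \<omega> * D s + \<epsilon>)"
          by (intro set_integral_add(1) set_integrable_const_Icc set_integrable_mult_right sub[OF _ a(2)] D_int)
        show "norm (G (?E (time_index h s)) - F (?X s)) \<le> \<omega> * D s + \<epsilon>" if "s \<in> {0..?a}" for s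
          unfolding D_def using that a by (intro GF B(2)) auto
      qed
      also have "\<dots> = \<omega> * (LINT s:{0..?a}|lborel. D s) + \<epsilon> * ?a"
        using a(1) by (subst set_integral_add(2)) (auto simp: set_integral_const_Icc intro!: set_integrable_const_Icc set_integrable_mult_right sub[OF _ a(2)] D_int)
      also have "\<dots> \<le> \<omega> * (LINT s:{0..?a}|lborel. D s) + \<epsilon> * T"
        using a \<epsilon>(1) by (intro add_left_mono mult_left_mono) auto
      finally show ?thesis .
    qed
    have n2: "norm ((LINT s:{0..t}|lborel. F (?X s)) - (LINT s:{0..?a}|lborel. F (?X s))) \<le> K * \<bar>t - ?a\<bar>"
      using a t by (intro norm_set_integral_diff_le[OF FX_int FK]) auto
    show ?thesis
      unfolding eq using n1 n2
        norm_triangle_ineq[of "(LINT s:{0..?a}|lborel. G (?E (time_index h s)) - F (?X s))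
      - ((LINT s:{0..t}|lborel. F (?X s)) - (LINT s:{0..?a}|lborel. F (?X s)))" "walk \<zeta> k - Y t w"]
        norm_triangle_ineq4[of "LINT s:{0..?a}|lborel. G (?E (time_index h s)) - F (?X s)"
          "(LINT s:{0..t}|lborel. F (?X s)) - (LINT s:{0..?a}|lborel. F (?X s))"]
      by linarith
  qed
  define I where "I s = (LINT r:{0..s}|lborel. D r)" for s
  have I_mono: "I a \<le> I b" if "0 \<le> a" "a \<le> b" "b \<le> T" for a b
    unfolding I_def using that by (intro set_integral_mono_upper sub[OF D_int]) (auto simp: D_def)
  have ti: "real (time_index h s) * h \<le> s" "\<bar>s - real (time_index h s) * h\<bar> \<le> h" if "0 \<le> s" for s
  proof -
    have "real (time_index h s) = of_int \<lfloor>s / h\<rfloor>" using that h by simp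
    moreover have "of_int \<lfloor>s / h\<rfloor> \<le> s / h" "s / h \<le> of_int \<lfloor>s / h\<rfloor> + 1" by linarith+
    ultimately have "real (time_index h s) \<le> s / h" "s / h \<le> real (time_index h s) + 1" by simp_all
    then show "real (time_index h s) * h \<le> s" "\<bar>s - real (time_index h s) * h\<bar> \<le> h"
      using h by (simp_all add: field_simps abs_if)
  qed
  let ?V = "\<lambda>s. norm (walk \<zeta> (time_index h s) - Y s w)"
  have V_int: "set_integrable lborel {0..T} ?V"
  proof -
    obtain A where A: "\<And>s. s \<in> {0..T} \<Longrightarrow> norm (Y s w) \<le> A" using cadlag_bounded[OF Y_cadlag] by blast
    have Ym: "(\<lambda>s. Y (clamp_time T s) w) \<in> borel_measurable borel"
      by (rule progressive_section[OF progressive_cadlag w]) (use T Y_cadlag in auto)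
    show ?thesis
    proof (rule clamp_set_integrable[where T = T])
      show "(\<lambda>s. ?V (clamp_time T s)) \<in> borel_measurable borel"
        using Ym step_meas[of "walk \<zeta>"] by measurable
      show "norm (?V s) \<le> (\<Sum>j\<le>time_index h T. norm (walk \<zeta> j)) + A" if "s \<in> {0..T}" for s
        using step_bounded[OF h that, of "walk \<zeta>"] A[OF that] norm_triangle_ineq4[of "walk \<zeta> (time_index h s)" "Y s w"]
        by simp
    qed simp
  qed
  \<comment> \<open>The integral over \<open>[0, T]\<close> of all terms in \<open>D_le\<close>
    other than the recursive one.\<close>
  define A where "A = T * (\<epsilon> * T + K * h) + (LINT s:{0..T}|lborel. ?V s)"
  have D_le: "D s \<le> \<omega> * I s + ((\<epsilon> * T + K * h) + ?V s)" if s: "s \<in> {0..T}" for s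
  proof -
    have "D s \<le> \<omega> * I (real (time_index h s) * h) + \<epsilon> * T + K * \<bar>s - real (time_index h s) * h\<bar> + ?V s"
      unfolding D_def[of s] I_def by (rule main[OF order_trans[OF ti(1)] s]) (use s in auto)
    \<comment> \<open>Rounding down to the grid shortens the interval of integration, and
      \<open>I\<close> is increasing because \<open>D\<close> is nonnegative.\<close>
    moreover have "I (real (time_index h s) * h) \<le> I s" using ti[of s] s h by (intro I_mono) auto
    then have "\<omega> * I (real (time_index h s) * h) \<le> \<omega> * I s" using \<omega>_nonneg by (rule mult_left_mono)
    moreover have "K * \<bar>s - real (time_index h s) * h\<bar> \<le> K * h" by (rule mult_left_mono[OF ti(2) K]) (use s in auto)
    ultimately show ?thesis by linarith
  qed
  have I_int: "set_integrable lborel {0..T} I"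
  proof (rule clamp_set_integrable[where T = T])
    show "(\<lambda>s. I (clamp_time T s)) \<in> borel_measurable borel"
      unfolding I_def by (rule measurable_indefinite_integral[OF D_int])
    show "norm (I s) \<le> \<bar>I T\<bar> + \<bar>I 0\<bar>" if "s \<in> {0..T}" for s
      using I_mono[of s T] I_mono[of 0 s] that by auto
  qed simp
  have cV_int: "set_integrable lborel {0..T} (\<lambda>s. (\<epsilon> * T + K * h) + ?V s)"
    by (intro set_integral_add(1) set_integrable_const_Icc V_int)
  have I_le: "I s \<le> A + \<omega> * (LINT r:{0..s}|lborel. I r)" if s: "s \<in> {0..T}" for s
  proof -
    have sT: "s \<le> T" "0 \<le> s" using s by auto
    have "I s \<le> (LINT r:{0..s}|lborel. \<omega> * I r + ((\<epsilon> * T + K * h) + ?V r))"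
      unfolding I_def[of s]
      by (intro set_integral_mono set_integral_add(1)[of lborel "{0..s}" "\<lambda>r. \<omega> * I r"] set_integrable_mult_right sub[OF _ sT(1)] D_int I_int cV_int D_le)
         (use s in auto)
    also have "\<dots> = \<omega> * (LINT r:{0..s}|lborel. I r) + (LINT r:{0..s}|lborel. (\<epsilon> * T + K * h) + ?V r)"
      by (subst set_integral_add(2)) (auto intro!: set_integrable_mult_right sub[OF _ sT(1)] I_int cV_int)
    also have "(LINT r:{0..s}|lborel. (\<epsilon> * T + K * h) + ?V r) \<le> (LINT r:{0..T}|lborel. (\<epsilon> * T + K * h) + ?V r)"
      using \<epsilon>(1) T K h sT by (intro set_integral_mono_upper cV_int) auto
    also have "\<dots> = A"
      unfolding A_def using T by (subst set_integral_add(2)) (auto simp: set_integral_const_Icc mult.commute intro!: set_integrable_const_Icc V_int)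
    finally show ?thesis by simp
  qed
  have A_nonneg: "A \<ge> 0"
  proof -
    have "0 \<le> (LINT s:{0..T}|lborel. ?V s)"
      unfolding set_lebesgue_integral_def by (intro Bochner_Integration.integral_nonneg) auto
    then show ?thesis using T \<epsilon>(1) K h by (simp add: A_def)
  qed
  have "I T \<le> A * exp (\<omega> * T)"
    by (rule gronwall[OF \<omega>_nonneg A_nonneg I_int, where B = "I T"]) (use I_mono I_le T in auto)
  moreover have "I (real k * h) \<le> I T" using h k by (intro I_mono) auto
  ultimately have "\<omega> * I (real k * h) \<le> \<omega> * (A * exp (\<omega> * T))"
    using \<omega>_nonneg by (intro mult_left_mono) auto
  then show ?thesis using main[OF k t] unfolding I_def A_def by linarith
qed

end

section \<open>Convergence of the scheme\<close>

text \<open>Points that attain the supremum up to \<open>1 / (n + 1)\<close> reduce uniform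
  convergence to convergence along arbitrary sequences in \<open>A\<close>. This keeps suprema out
  of the probabilistic estimates.\<close>

lemma SUP_tendsto_0_sequential:
  fixes u :: "nat \<Rightarrow> 'a \<Rightarrow> real"
  assumes ne: "A \<noteq> {}" and bdd: "\<And>n. bdd_above ((\<lambda>x. \<bar>u n x\<bar>) ` A)"
    and seq: "\<And>x. (\<And>n. x n \<in> A) \<Longrightarrow> (\<lambda>n. u n (x n)) \<longlonglongrightarrow> 0"
  shows "(\<lambda>n. SUP x\<in>A. \<bar>u n x\<bar>) \<longlonglongrightarrow> 0"
proof -
  have "\<exists>x\<in>A. (SUP x\<in>A. \<bar>u n x\<bar>) - 1 / (real n + 1) < \<bar>u n x\<bar>" for n
  proof -
    have "(SUP x\<in>A. \<bar>u n x\<bar>) - 1 / (real n + 1) < (SUP x\<in>A. \<bar>u n x\<bar>)" by simp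
    then show ?thesis by (subst (asm) less_cSUP_iff[OF ne bdd])
  qed
  then obtain x where x: "\<And>n. x n \<in> A" "\<And>n. (SUP x\<in>A. \<bar>u n x\<bar>) - 1 / (real n + 1) < \<bar>u n (x n)\<bar>"
    by metis
  show ?thesis
  proof (rule tendsto_sandwich[where f = "\<lambda>_. 0" and h = "\<lambda>n. \<bar>u n (x n)\<bar> + 1 / (real n + 1)"])
    have "(\<lambda>n. \<bar>u n (x n)\<bar> + 1 / (real n + 1)) \<longlonglongrightarrow> \<bar>0\<bar> + 0"
      using LIMSEQ_inverse_real_of_nat by (intro tendsto_add tendsto_rabs seq x) (simp add: inverse_eq_divide add.commute)
    then show "(\<lambda>n. \<bar>u n (x n)\<bar> + 1 / (real n + 1)) \<longlonglongrightarrow> 0" by simp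
    show "\<forall>\<^sub>F n in sequentially. (SUP x\<in>A. \<bar>u n x\<bar>) \<le> \<bar>u n (x n)\<bar> + 1 / (real n + 1)"
    proof (intro always_eventually allI)
      show "(SUP x\<in>A. \<bar>u n x\<bar>) \<le> \<bar>u n (x n)\<bar> + 1 / (real n + 1)" for n using x(2)[of n] by linarith
    qed
    have "0 \<le> (SUP x\<in>A. \<bar>u n x\<bar>)" for n
      using cSUP_upper[OF x(1)[of n] bdd[of n]] abs_ge_zero[of "u n (x n)"] by linarith
    then show "\<forall>\<^sub>F n in sequentially. 0 \<le> (SUP x\<in>A. \<bar>u n x\<bar>)" by simp
  qed simp
qed

lemma mixed_tendsto_bounded:
  assumes "mixed_tendsto fs f"
  obtains C where "C \<ge> 0" "\<And>n x. \<bar>fs n x\<bar> \<le> C" "\<And>x. \<bar>f x\<bar> \<le> C"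
proof -
  from assms have fs: "\<And>n. fs n \<in> bcontfun" and f: "f \<in> bcontfun"
    and bdd: "bdd_above (range (\<lambda>n. SUP x. \<bar>fs n x\<bar>))"
    unfolding mixed_tendsto_def by auto
  obtain C1 where C1: "\<And>n. (SUP x. \<bar>fs n x\<bar>) \<le> C1" using bdd by (auto simp: bdd_above_def)
  obtain C2 where C2: "C2 \<ge> 0" "\<forall>x. \<bar>f x\<bar> \<le> C2" using bcontfun_bounded[OF f] by blast
  have "\<bar>fs n x\<bar> \<le> \<bar>C1\<bar> + C2" for n x
  proof -
    obtain B where "\<forall>x. \<bar>fs n x\<bar> \<le> B" using bcontfun_bounded[OF fs] by blast
    then have "\<bar>fs n x\<bar> \<le> (SUP x. \<bar>fs n x\<bar>)" by (intro cSUP_upper bdd_aboveI2) auto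
    then show ?thesis using C1[of n] C2(1) by linarith
  qed
  moreover have "\<bar>f x\<bar> \<le> \<bar>C1\<bar> + C2" for x using C2(2)[rule_format, of x] by linarith
  ultimately show ?thesis using C2(1) by (intro that[of "\<bar>C1\<bar> + C2"]) auto
qed

text \<open>The radius \<open>B + 1\<close> leaves room for \<open>a n\<close>, which is eventually
  within distance 1 of \<open>b n\<close>. On that ball \<open>f\<close> is uniformly continuous and
  \<open>fs\<close> is uniformly close to \<open>f\<close>; the sequence \<open>b n\<close> is
  merely bounded.\<close>

lemma mixed_tendsto_eval:
  fixes fs :: "nat \<Rightarrow> 'a::euclidean_space \<Rightarrow> real"
  assumes mix: "mixed_tendsto fs f" and r: "strict_mono r"
    and ab: "(\<lambda>n. norm (a n - b n)) \<longlonglongrightarrow> 0" and b: "\<And>n. norm (b n) \<le> B"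
  shows "(\<lambda>n. fs (r n) (a n) - f (b n)) \<longlonglongrightarrow> 0"
proof (rule tendstoI)
  fix e :: real assume e: "e > 0"
  have f: "continuous_on UNIV f" using mix by (auto simp: mixed_tendsto_def intro: bcontfun_continuous)
  have B: "B \<ge> 0" using b[of 0] norm_ge_zero order_trans by blast
  obtain C where C: "\<And>n x. \<bar>fs n x\<bar> \<le> C" "\<And>x. \<bar>f x\<bar> \<le> C" using mixed_tendsto_bounded[OF mix] by metis
  have "uniformly_continuous_on (cball 0 (B + 1)) f"
    by (intro compact_uniformly_continuous continuous_on_subset[OF f]) auto
  then obtain d where d: "d > 0" "\<And>x y. x \<in> cball 0 (B + 1) \<Longrightarrow> y \<in> cball 0 (B + 1) \<Longrightarrow> dist y x < d \<Longrightarrow> dist (f y) (f x) < e / 2"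
    using half_gt_zero[OF e] unfolding uniformly_continuous_on_def by blast
  have "\<forall>\<^sub>F n in sequentially. norm (a n - b n) < min d 1"
    using ab d(1) by (intro order_tendstoD(2)) auto
  moreover have "(\<lambda>n. SUP x\<in>cball 0 (B + 1). \<bar>fs (r n) x - f x\<bar>) \<longlonglongrightarrow> 0"
  proof -
    have "0 \<le> B + 1" using B by simp
    then have "(\<lambda>n. SUP x\<in>cball 0 (B + 1). \<bar>fs n x - f x\<bar>) \<longlonglongrightarrow> 0"
      using mix unfolding mixed_tendsto_def by blast
    from LIMSEQ_subseq_LIMSEQ[OF this r] show ?thesis by (simp add: o_def)
  qed
  then have "\<forall>\<^sub>F n in sequentially. (SUP x\<in>cball 0 (B + 1). \<bar>fs (r n) x - f x\<bar>) < e / 2"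
    using e by (intro order_tendstoD(2)) auto
  ultimately show "\<forall>\<^sub>F n in sequentially. dist (fs (r n) (a n) - f (b n)) 0 < e"
  proof eventually_elim
    case (elim n)
    have a: "a n \<in> cball 0 (B + 1)"
      using elim(1) b[of n] norm_triangle_sub[of "a n" "b n"] by simp
    have bn: "b n \<in> cball 0 (B + 1)" using b[of n] by simp
    have "bdd_above ((\<lambda>x. \<bar>fs (r n) x - f x\<bar>) ` cball 0 (B + 1))"
    proof (rule bdd_aboveI2)
      show "\<bar>fs (r n) x - f x\<bar> \<le> C + C" for x using C(1)[of "r n" x] C(2)[of x] by linarith
    qed
    then have "\<bar>fs (r n) (a n) - f (a n)\<bar> \<le> (SUP x\<in>cball 0 (B + 1). \<bar>fs (r n) x - f x\<bar>)"
      by (intro cSUP_upper a)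
    moreover have "dist (f (a n)) (f (b n)) < e / 2"
      using elim(1) by (intro d(2) a bn) (simp add: dist_norm)
    ultimately show ?case using elim(2) unfolding dist_real_def by linarith
  qed
qed

lemma (in prob_space) expectation_set_integral:
  fixes Z :: "real \<Rightarrow> 'a \<Rightarrow> real"
  assumes Z: "progressive M T Z" and T: "T \<ge> 0" and bdd: "\<And>s w. \<bar>Z s w\<bar> \<le> c"
  shows "expectation (\<lambda>w. LINT s:{0..T}|lborel. Z s w) = (LINT s:{0..T}|lborel. expectation (Z s))"
proof -
  interpret P: pair_sigma_finite lborel M ..
  note [measurable] = Z[unfolded progressive_def]
  let ?f = "\<lambda>s w. indicator {0..T} s *\<^sub>R Z (clamp_time T s) w"
  have "integrable (lborel \<Otimes>\<^sub>M M) (\<lambda>p. indicator ({0..T} \<times> space M) p *\<^sub>R Z (clamp_time T (fst p)) (snd p))"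
  proof (rule integrableI_bounded_set_indicator[where B = c])
    show "(\<lambda>p. Z (clamp_time T (fst p)) (snd p)) \<in> borel_measurable (lborel \<Otimes>\<^sub>M M)"
    proof -
      have "sets (lborel \<Otimes>\<^sub>M M) = sets (borel \<Otimes>\<^sub>M M)" by (intro sets_pair_measure_cong) auto
      then show ?thesis using Z unfolding progressive_def by (simp cong: measurable_cong_sets)
    qed
    have "emeasure (lborel \<Otimes>\<^sub>M M) ({0..T} \<times> space M) = ennreal T"
      using T by (subst emeasure_pair_measure_Times) (auto simp: emeasure_space_1)
    then show "emeasure (lborel \<Otimes>\<^sub>M M) ({0..T} \<times> space M) < \<infinity>" by simp
  qed (use bdd in auto)
  then have "integrable (lborel \<Otimes>\<^sub>M M) (case_prod ?f)"
    by (rule Bochner_Integration.integrable_cong[THEN iffD1, rotated -1])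
       (auto simp: indicator_def space_pair_measure)
  then have fub: "(\<integral>w. \<integral>s. ?f s w \<partial>lborel \<partial>M) = (\<integral>s. \<integral>w. ?f s w \<partial>M \<partial>lborel)"
    by (rule P.Fubini_integral)
  have inner: "(LINT s:{0..T}|lborel. Z s w) = (\<integral>s. ?f s w \<partial>lborel)" for w
    unfolding set_lebesgue_integral_def
    by (intro Bochner_Integration.integral_cong refl) (auto simp: indicator_def)
  have outer: "(\<integral>w. ?f s w \<partial>M) = indicator {0..T} s *\<^sub>R expectation (Z s)" for s
    by (cases "s \<in> {0..T}") auto
  have "expectation (\<lambda>w. LINT s:{0..T}|lborel. Z s w) = (\<integral>w. \<integral>s. ?f s w \<partial>lborel \<partial>M)"
    by (simp only: inner)
  also have "\<dots> = (\<integral>s. indicator {0..T} s *\<^sub>R expectation (Z s) \<partial>lborel)"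
    unfolding fub by (simp only: outer)
  finally show ?thesis by (simp only: set_lebesgue_integral_def)
qed

lemma (in prob_space) measurable_expectation_progressive:
  fixes Z :: "real \<Rightarrow> 'a \<Rightarrow> real"
  assumes Z: "progressive M T Z"
  shows "(\<lambda>s. expectation (Z (clamp_time T s))) \<in> borel_measurable borel"
proof -
  have "(\<lambda>(s, w). Z (clamp_time T s) w) \<in> borel_measurable (borel \<Otimes>\<^sub>M M)"
    using Z unfolding progressive_def by (simp add: split_beta')
  then show ?thesis by (rule borel_measurable_lebesgue_integral)
qed

locale euler_scheme = limit_process \<mu> h C M \<xi> y Y
  for \<mu> :: "nat \<Rightarrow> 'a::euclidean_space measure" and h C and M :: "'w measure" and \<xi> y and Y +
  fixes F :: "'a \<Rightarrow> 'a" and G :: "nat \<Rightarrow> 'a \<Rightarrow> 'a" and \<omega> :: real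
  assumes F_lip: "lipschitz_on \<omega> UNIV F" and G_lip: "lipschitz_on \<omega> UNIV (G n)"
    and G_lim: "\<epsilon> > 0 \<Longrightarrow> \<forall>\<^sub>F n in sequentially. \<forall>b. norm b \<le> B \<longrightarrow> norm (G n b - F b) \<le> \<epsilon>"
begin

sublocale driven_equation M Y F \<omega>
  by unfold_locales (rule Y_measurable Y_cadlag F_lip)+

lemma progressive_Y: "T \<ge> 0 \<Longrightarrow> progressive M T Y"
  by (rule progressive_cadlag) (auto intro: Y_cadlag)

lemma progressive_step:
  fixes g :: "nat \<Rightarrow> 'w \<Rightarrow> 'b::euclidean_space"
  assumes g: "\<And>k. g k \<in> borel_measurable M"
  shows "progressive M T (\<lambda>s. g (time_index c s))"
  unfolding progressive_def
proof (rule measurable_compose_countable[where f = "\<lambda>k p. g k (snd p)" and g = "\<lambda>p. time_index c (clamp_time T (fst p))"])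
  show "(\<lambda>p :: real \<times> 'w. g k (snd p)) \<in> borel_measurable (borel \<Otimes>\<^sub>M M)" for k
    using g[of k] by measurable
qed measurable

text \<open>The truncation makes this integral converge to 0 in mean; the untruncated distance is
  recovered with the help of \<open>walk_max\<close>.\<close>

definition gap :: "nat \<Rightarrow> real \<Rightarrow> 'w \<Rightarrow> real" where
  "gap n T w = (LINT s:{0..T}|lborel. min 1 (norm (walk (\<xi> n w) (time_index (h n) s) - Y s w)))"

definition walk_max :: "nat \<Rightarrow> real \<Rightarrow> 'w \<Rightarrow> real" where
  "walk_max n T w = Max ((\<lambda>j. norm (walk (\<xi> n w) j)) ` {..time_index (h n) T})"

lemma progressive_gap:
  assumes T: "T \<ge> 0"
  shows "progressive M T (\<lambda>s w. min 1 (norm (walk (\<xi> n w) (time_index (h n) s) - Y s w)))"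
proof -
  note [measurable] = progressive_Y[OF T, unfolded progressive_def]
    progressive_step[of "\<lambda>k w. walk (\<xi> n w) k" T "h n", OF measurable_walk_xi, unfolded progressive_def]
  show ?thesis unfolding progressive_def by measurable
qed

lemma gap_integrand_set_integrable:
  assumes T: "T \<ge> 0" and w: "w \<in> space M"
  shows "set_integrable lborel {0..T} (\<lambda>s. min 1 (norm (walk (\<xi> n w) (time_index (h n) s) - Y s w)))"
  by (rule clamp_set_integrable[OF progressive_section[OF progressive_gap[OF T] w], where B = 1]) auto

lemma gap_measurable [measurable]:
  assumes T: "T \<ge> 0"
  shows "gap n T \<in> borel_measurable M"
proof -
  have "progressive M T (\<lambda>t w. LINT s:{0..t}|lborel. id (min 1 (norm (walk (\<xi> n w) (time_index (h n) s) - Y s w))))"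
    by (rule progressive_integral[OF progressive_gap[OF T]]) simp
  then show ?thesis using progressive_at[of M T _ T] T unfolding gap_def[abs_def] by simp
qed

lemma gap_nonneg: "0 \<le> gap n T w"
  unfolding gap_def set_lebesgue_integral_def by (intro Bochner_Integration.integral_nonneg) simp

lemma gap_le: "T \<ge> 0 \<Longrightarrow> w \<in> space M \<Longrightarrow> gap n T w \<le> T"
proof -
  assume T: "T \<ge> 0" and w: "w \<in> space M"
  have "gap n T w \<le> (LINT s:{0..T}|lborel. 1)"
    unfolding gap_def by (intro set_integral_mono gap_integrand_set_integrable T w set_integrable_const_Icc) simp
  then show ?thesis using T by (simp add: set_integral_const_Icc)
qed

lemma integrable_gap: "T \<ge> 0 \<Longrightarrow> integrable M (gap n T)"
  by (rule integrable_const_bound[where B = T]) (auto simp: gap_nonneg gap_le)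

text \<open>Fubini reduces this to convergence in probability at each fixed time, followed by
  dominated convergence in time.\<close>

lemma expectation_gap:
  assumes T: "T \<ge> 0"
  shows "(\<lambda>n. expectation (gap n T)) \<longlonglongrightarrow> 0"
proof -
  let ?Z = "\<lambda>n s w. min 1 (norm (walk (\<xi> n w) (time_index (h n) s) - Y s w))"
  have bd: "\<bar>?Z n s w\<bar> \<le> 1" for n s w by simp
  define \<phi> where "\<phi> n s = expectation (?Z n (clamp_time T s))" for n s
  have \<phi>_meas: "\<phi> n \<in> borel_measurable borel" for n
    unfolding \<phi>_def[abs_def] by (rule measurable_expectation_progressive[OF progressive_gap[OF T]])
  have \<phi>_le: "\<bar>\<phi> n s\<bar> \<le> 1" for n s
  proof -
    have "?Z n (clamp_time T s) \<in> borel_measurable M" by measurable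
    then show ?thesis unfolding \<phi>_def by (rule abs_expectation_le[OF _ bd])
  qed
  have \<phi>_lim: "(\<lambda>n. \<phi> n s) \<longlonglongrightarrow> 0" for s
    unfolding \<phi>_def using T by (intro walk_tendsto_Y time_index_tendsto) auto
  have eq: "expectation (gap n T) = (\<integral>s. indicator {0..T} s *\<^sub>R \<phi> n s \<partial>lborel)" for n
  proof -
    have "expectation (gap n T) = (LINT s:{0..T}|lborel. expectation (?Z n s))"
      unfolding gap_def by (rule expectation_set_integral[OF progressive_gap[OF T] T bd])
    also have "\<dots> = (\<integral>s. indicator {0..T} s *\<^sub>R \<phi> n s \<partial>lborel)"
      unfolding set_lebesgue_integral_def \<phi>_def
      by (intro Bochner_Integration.integral_cong refl) (auto simp: indicator_def)
    finally show ?thesis .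
  qed
  have "(\<lambda>n. \<integral>s. indicator {0..T} s *\<^sub>R \<phi> n s \<partial>lborel) \<longlonglongrightarrow> (\<integral>s. 0 \<partial>(lborel :: real measure))"
  proof (rule integral_dominated_convergence[where w = "indicator {0..T}"])
    show "AE s in lborel. (\<lambda>n. indicator {0..T} s *\<^sub>R \<phi> n s) \<longlonglongrightarrow> 0"
      using tendsto_scaleR[OF tendsto_const \<phi>_lim] by (intro AE_I2) force
    show "AE s in lborel. norm (indicator {0..T} s *\<^sub>R \<phi> n s) \<le> indicator {0..T} s" for n
      using \<phi>_le by (intro AE_I2) (simp add: indicator_def)
    show "(\<lambda>s. indicator {0..T} s *\<^sub>R \<phi> n s) \<in> borel_measurable lborel" for n
      using \<phi>_meas[of n] by measurable
    show "integrable lborel (indicator {0..T} :: real \<Rightarrow> real)"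
      by (intro integrable_real_indicator) (auto simp: emeasure_lborel_Icc_eq)
  qed simp
  then show ?thesis unfolding eq by simp
qed

lemma walk_max_measurable [measurable]: "walk_max n T \<in> borel_measurable M"
  unfolding walk_max_def[abs_def] by measurable

lemma walk_max_ge: "j \<le> time_index (h n) T \<Longrightarrow> norm (walk (\<xi> n w) j) \<le> walk_max n T w"
  unfolding walk_max_def by (intro Max_ge) auto

lemma walk_max_nonneg: "0 \<le> walk_max n T w"
  using walk_max_ge[where j = 0 and n = n and T = T and w = w] norm_ge_zero[of "walk (\<xi> n w) 0"] by simp

lemma walk_max_gt_iff: "R < walk_max n T w \<longleftrightarrow> (\<exists>j\<le>time_index (h n) T. R < norm (walk (\<xi> n w) j))"
  unfolding walk_max_def by (subst Max_gr_iff) auto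

text \<open>The maxima are tight: outside an event of probability at most \<open>e / 3\<close> the
  product is at most \<open>R\<close> times a quantity that vanishes in mean.\<close>

lemma expectation_max_gap:
  assumes T: "T \<ge> 0"
  shows "(\<lambda>n. expectation (\<lambda>w. min 1 (walk_max n T w * gap n T w))) \<longlonglongrightarrow> 0"
proof (rule LIMSEQ_I)
  fix e :: real assume e: "e > 0"
  obtain R where R: "R > 0" and tight: "\<forall>\<^sub>F n in sequentially. \<forall>k. real k * h n \<le> T \<longrightarrow>
    measure (noise_seq (\<mu> n)) {\<xi>. \<exists>j\<le>k. norm (walk \<xi> j) > R} \<le> e / 3"
    using max_tight[of "e / 3" T] e T by auto
  note [measurable] = gap_measurable[OF T]
  have "(\<lambda>n. R * expectation (gap n T)) \<longlonglongrightarrow> R * 0" by (intro tendsto_intros expectation_gap T)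
  then have "\<forall>\<^sub>F n in sequentially. R * expectation (gap n T) < e / 3" using e by (intro order_tendstoD(2)) auto
  with tight have "\<forall>\<^sub>F n in sequentially. norm (expectation (\<lambda>w. min 1 (walk_max n T w * gap n T w)) - 0) < e"
  proof eventually_elim
    case (elim n)
    let ?E = "{w\<in>space M. R < walk_max n T w}"
    interpret N: noise "\<mu> n" by (rule noise)
    have "prob ?E = prob {w\<in>space M. \<exists>j\<le>time_index (h n) T. R < norm (walk (\<xi> n w) j)}"
      by (simp add: walk_max_gt_iff)
    also have "\<dots> = measure N.W {\<zeta>. \<exists>j\<le>time_index (h n) T. R < norm (walk \<zeta> j)}"
      by (rule prob_xi) measurable
    also have "\<dots> \<le> e / 3" using elim(1) time_index_times(1)[OF T] by blast
    finally have PE: "prob ?E \<le> e / 3" .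
    have "expectation (\<lambda>w. min 1 (walk_max n T w * gap n T w)) \<le> expectation (\<lambda>w. indicator ?E w + R * gap n T w)"
    proof (rule integral_mono)
      show "integrable M (\<lambda>w. min 1 (walk_max n T w * gap n T w))"
        by (rule integrable_bounded_real[where C = 1]) (auto intro!: abs_min_1 mult_nonneg_nonneg walk_max_nonneg gap_nonneg)
      show "integrable M (\<lambda>w. indicator ?E w + R * gap n T w)"
        by (intro Bochner_Integration.integrable_add integrable_mult_right integrable_gap T) (auto simp: emeasure_eq_measure)
      fix w assume w: "w \<in> space M"
      show "min 1 (walk_max n T w * gap n T w) \<le> indicator ?E w + R * gap n T w"
      proof (cases "R < walk_max n T w")
        case True
        then have "indicator ?E w = (1::real)" using w by simp
        moreover have "0 \<le> R * gap n T w" using R gap_nonneg by simp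
        ultimately show ?thesis by simp
      next
        case False
        then have "walk_max n T w * gap n T w \<le> R * gap n T w" by (intro mult_right_mono gap_nonneg) simp
        then show ?thesis by (simp add: min_def indicator_def)
      qed
    qed
    also have "\<dots> = prob ?E + R * expectation (gap n T)"
      using integrable_gap[OF T, of n] by (subst Bochner_Integration.integral_add) (auto simp: emeasure_eq_measure)
    also have "\<dots> < e" using PE elim(2) e by linarith
    finally have "expectation (\<lambda>w. min 1 (walk_max n T w * gap n T w)) < e" .
    moreover have "0 \<le> expectation (\<lambda>w. min 1 (walk_max n T w * gap n T w))"
      by (intro Bochner_Integration.integral_nonneg) (auto intro!: mult_nonneg_nonneg walk_max_nonneg gap_nonneg)
    ultimately show ?case by simp
  qed
  then show "\<exists>no. \<forall>n\<ge>no. norm (expectation (\<lambda>w. min 1 (walk_max n T w * gap n T w)) - 0) < e"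
    by (simp add: eventually_sequentially)
qed

text \<open>If \<open>0 \<le> v \<le> b\<close>, then \<open>v \<le> (1 + b) * min 1 v\<close>; here
  \<open>b\<close> is the maximum of the walk plus the bound \<open>A\<close> for the path.\<close>

lemma full_gap_le:
  assumes T: "T \<ge> 0" and w: "w \<in> space M" and A: "\<And>s. s \<in> {0..T} \<Longrightarrow> norm (Y s w) \<le> A" "A \<ge> 0"
  shows "(LINT s:{0..T}|lborel. norm (walk (\<xi> n w) (time_index (h n) s) - Y s w)) \<le> (1 + A) * gap n T w + walk_max n T w * gap n T w"
proof -
  let ?V = "\<lambda>s. walk (\<xi> n w) (time_index (h n) s) - Y s w" and ?c = "1 + walk_max n T w + A"
  have V: "norm (?V s) \<le> walk_max n T w + A" if "s \<in> {0..T}" for s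
    using walk_max_ge[OF time_index_mono[OF h_pos], of s T n w] A(1)[OF that] that
      norm_triangle_ineq4[of "walk (\<xi> n w) (time_index (h n) s)" "Y s w"] by simp
  have c: "?c \<ge> 1" using walk_max_nonneg[of n T w] A(2) by simp
  have "(LINT s:{0..T}|lborel. norm (?V s)) \<le> (LINT s:{0..T}|lborel. ?c * min 1 (norm (?V s)))"
  proof (intro set_integral_mono set_integrable_mult_right gap_integrand_set_integrable T w)
    note [measurable] = progressive_section[OF progressive_Y[OF T] w]
      progressive_section[OF progressive_step[of "\<lambda>k w. walk (\<xi> n w) k" T "h n", OF measurable_walk_xi] w]
    show "set_integrable lborel {0..T} (\<lambda>s. norm (?V s))"
    proof (rule clamp_set_integrable[where T = T and B = "walk_max n T w + A"])
      show "(\<lambda>s. norm (?V (clamp_time T s))) \<in> borel_measurable borel" by measurable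
    qed (use V in auto)
    fix s assume s: "s \<in> {0..T}"
    show "norm (?V s) \<le> ?c * min 1 (norm (?V s))"
    proof (cases "norm (?V s) \<le> 1")
      case True
      then show ?thesis using mult_right_mono[OF c norm_ge_zero[of "?V s"]] by simp
    next
      case False
      then show ?thesis using V[OF s] by simp
    qed
  qed
  also have "\<dots> = ?c * gap n T w" unfolding gap_def by (rule set_integral_mult_right)
  finally show ?thesis by (simp add: algebra_simps)
qed

lemma measurable_euler: "(\<lambda>w. euler (h n) (G n) x (\<xi> n w) k) \<in> borel_measurable M"
proof -
  interpret N: noise "\<mu> n" by (rule noise)
  have [measurable]: "G n \<in> borel_measurable borel"
    by (rule borel_measurable_continuous_onI, rule lipschitz_on_continuous_on[OF G_lip])
  have "(\<lambda>\<zeta>. euler (h n) (G n) x \<zeta> k) \<in> borel_measurable N.W"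
    unfolding euler_def measurable_cong_sets[OF N.sets_W refl] by (rule measurable_chain) (auto simp: split_beta')
  from measurable_compose[OF xi_measurable this] show ?thesis .
qed

lemma solution_bounded_ball:
  assumes w: "w \<in> space M" and T: "T \<ge> 0" and \<rho>: "\<rho> \<ge> 0"
  obtains B where "B \<ge> 0" "\<And>x s. norm x \<le> \<rho> \<Longrightarrow> s \<in> {0..T} \<Longrightarrow> norm (solution x s w) \<le> B"
proof -
  obtain B0 where B0: "B0 \<ge> 0" "\<forall>s\<in>{0..T}. norm (solution 0 s w) \<le> B0" using solution_bounded[OF T w] by blast
  have "norm (solution x s w) \<le> B0 + \<rho> * exp (\<omega> * T)" if x: "norm x \<le> \<rho>" and s: "s \<in> {0..T}" for x s
  proof -
    have "norm (solution x s w - solution 0 s w) \<le> norm (x - 0) * exp (\<omega> * s)"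
      using s by (intro solution_lipschitz w) auto
    also have "\<dots> \<le> \<rho> * exp (\<omega> * T)"
      using s x \<rho> \<omega>_nonneg by (intro mult_mono) (auto intro: mult_left_mono)
    finally have "norm (solution x s w - solution 0 s w) \<le> \<rho> * exp (\<omega> * T)" .
    then show ?thesis
      using B0(2) s norm_triangle_sub[of "solution x s w" "solution 0 s w"] by force
  qed
  then show ?thesis using B0(1) \<rho> by (intro that[of "B0 + \<rho> * exp (\<omega> * T)"]) auto
qed

text \<open>The deterministic part: when the three error quantities vanish along \<open>r\<close>,
  so does the error bound, with initial values ranging over a ball. The horizon \<open>t + 1\<close>
  leaves room for grid times beyond \<open>t\<close>.\<close>

lemma euler_tendsto_solution:
  assumes w: "w \<in> space M" and t: "t \<ge> 0" and x: "\<And>n. norm (x n) \<le> \<rho>" and r: "strict_mono r"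
    and k: "(\<lambda>n. real (k n) * h n) \<longlonglongrightarrow> t"
    and gap: "(\<lambda>n. gap (r n) (t + 1) w) \<longlonglongrightarrow> 0" and max_gap: "(\<lambda>n. walk_max (r n) (t + 1) w * gap (r n) (t + 1) w) \<longlonglongrightarrow> 0"
    and last: "(\<lambda>n. norm (walk (\<xi> (r n) w) (k (r n)) - Y t w)) \<longlonglongrightarrow> 0"
  shows "(\<lambda>n. norm (euler (h (r n)) (G (r n)) (x (r n)) (\<xi> (r n) w) (k (r n)) - solution (x (r n)) t w)) \<longlonglongrightarrow> 0"
    and "\<exists>B. \<forall>n. norm (solution (x n) t w) \<le> B"
proof -
  define T where "T = t + 1"
  have T: "T \<ge> 0" "t \<in> {0..T}" using t by (auto simp: T_def)
  have \<rho>: "\<rho> \<ge> 0" using x[of 0] norm_ge_zero order_trans by blast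
  obtain B where B_nonneg: "B \<ge> 0" and B': "\<And>x s. norm x \<le> \<rho> \<Longrightarrow> s \<in> {0..T} \<Longrightarrow> norm (solution x s w) \<le> B"
    using solution_bounded_ball[OF w T(1) \<rho>] by blast
  have B: "norm (solution (x n) s w) \<le> B" if "s \<in> {0..T}" for n s
    using B'[OF x that] .
  then show "\<exists>B. \<forall>n. norm (solution (x n) t w) \<le> B" using T(2) by blast
  obtain A where A: "A \<ge> 0" "\<forall>s\<in>{0..T}. norm (Y s w) \<le> A" using cadlag_bounded[OF Y_cadlag] by blast
  define K where "K = norm (F 0) + \<omega> * B"
  let ?I = "\<lambda>n. LINT s:{0..T}|lborel. norm (walk (\<xi> n w) (time_index (h n) s) - Y s w)"
  have I: "(\<lambda>n. ?I (r n)) \<longlonglongrightarrow> 0"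
  proof (rule tendsto_sandwich[where f = "\<lambda>_. 0" and h = "\<lambda>n. (1 + A) * gap (r n) T w + walk_max (r n) T w * gap (r n) T w"])
    have "(\<lambda>n. (1 + A) * gap (r n) T w + walk_max (r n) T w * gap (r n) T w) \<longlonglongrightarrow> (1 + A) * 0 + 0"
      unfolding T_def by (intro tendsto_intros gap max_gap)
    then show "(\<lambda>n. (1 + A) * gap (r n) T w + walk_max (r n) T w * gap (r n) T w) \<longlonglongrightarrow> 0" by simp
    show "\<forall>\<^sub>F n in sequentially. ?I (r n) \<le> (1 + A) * gap (r n) T w + walk_max (r n) T w * gap (r n) T w"
      using A by (intro always_eventually allI full_gap_le T w) auto
    show "\<forall>\<^sub>F n in sequentially. 0 \<le> ?I (r n)"
      unfolding set_lebesgue_integral_def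
      by (intro always_eventually allI Bochner_Integration.integral_nonneg) auto
  qed simp
  have hr: "(\<lambda>n. h (r n)) \<longlonglongrightarrow> 0" using LIMSEQ_subseq_LIMSEQ[OF h_lim r] by (simp add: o_def)
  have kr: "(\<lambda>n. real (k (r n)) * h (r n)) \<longlonglongrightarrow> t" using LIMSEQ_subseq_LIMSEQ[OF k r] by (simp add: o_def)
  have kT: "\<forall>\<^sub>F n in sequentially. real (k (r n)) * h (r n) < T"
    using kr by (rule order_tendstoD) (simp add: T_def)
  define err where "err \<epsilon> n = \<omega> * ((T * (\<epsilon> * T + K * h (r n)) + ?I (r n)) * exp (\<omega> * T))
      + \<epsilon> * T + K * \<bar>t - real (k (r n)) * h (r n)\<bar> + norm (walk (\<xi> (r n) w) (k (r n)) - Y t w)" for \<epsilon> n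
  have err_lim: "err \<epsilon> \<longlonglongrightarrow> \<epsilon> * (\<omega> * (T * T * exp (\<omega> * T)) + T)" for \<epsilon>
  proof -
    have "err \<epsilon> \<longlonglongrightarrow> \<omega> * ((T * (\<epsilon> * T + K * 0) + 0) * exp (\<omega> * T)) + \<epsilon> * T + K * \<bar>t - t\<bar> + 0"
      unfolding err_def by (intro tendsto_intros hr kr I last)
    then show ?thesis by (simp add: algebra_simps)
  qed
  show "(\<lambda>n. norm (euler (h (r n)) (G (r n)) (x (r n)) (\<xi> (r n) w) (k (r n)) - solution (x (r n)) t w)) \<longlonglongrightarrow> 0"
  proof (rule tendstoI)
    fix e :: real assume e: "e > 0"
    \<comment> \<open>This is the factor in the limit of \<open>err \<epsilon>\<close>, so
      \<open>\<epsilon>\<close> below leaves half of \<open>e\<close> to spare.\<close>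
    define c where "c = \<omega> * (T * T * exp (\<omega> * T)) + T"
    have c: "c > 0" using T \<omega>_nonneg t by (auto simp: c_def T_def intro!: add_nonneg_pos mult_nonneg_nonneg)
    define \<epsilon> where "\<epsilon> = e / (2 * c)"
    have \<epsilon>: "\<epsilon> > 0" "\<epsilon> * c < e" using c e by (simp_all add: \<epsilon>_def)
    have "\<forall>\<^sub>F n in sequentially. err \<epsilon> n < e"
      using err_lim[of \<epsilon>] \<epsilon>(2) unfolding c_def by (rule order_tendstoD)
    moreover have "\<forall>\<^sub>F n in sequentially. \<forall>b. norm b \<le> B \<longrightarrow> norm (G (r n) b - F b) \<le> \<epsilon>"
      by (rule eventually_subseq[OF r G_lim[OF \<epsilon>(1)]])
    ultimately show "\<forall>\<^sub>F n in sequentially. dist (norm (euler (h (r n)) (G (r n)) (x (r n)) (\<xi> (r n) w) (k (r n)) - solution (x (r n)) t w)) 0 < e"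
      using kT
    proof eventually_elim
      case (elim n)
      have "norm (euler (h (r n)) (G (r n)) (x (r n)) (\<xi> (r n) w) (k (r n)) - solution (x (r n)) t w) \<le> err \<epsilon> n"
        unfolding err_def K_def
        by (rule euler_error[OF w T(1) h_pos G_lip B_nonneg B]) (use elim \<epsilon>(1) T(2) in auto)
      then show ?case using elim(1) by simp
    qed
  qed
qed

text \<open>The quantities in \<open>?R\<close> do not involve \<open>x n\<close>, which gives
  uniformity over bounded initial values. Functions varying with \<open>n\<close> serve the
  convergence statement and, as difference quotients, the generator.\<close>

lemma expectation_euler_tendsto:
  assumes t: "t \<ge> 0" and x: "\<And>n. norm (x n) \<le> \<rho>" and k: "(\<lambda>n. real (k n) * h n) \<longlonglongrightarrow> t" and mix: "mixed_tendsto fs f"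
  shows "(\<lambda>n. expectation (\<lambda>w. fs n (euler (h n) (G n) (x n) (\<xi> n w) (k n))) - expectation (\<lambda>w. f (solution (x n) t w))) \<longlonglongrightarrow> 0"
proof -
  define T where "T = t + 1"
  have T: "T \<ge> 0" using t by (simp add: T_def)
  obtain C where C: "C \<ge> 0" "\<And>n x. \<bar>fs n x\<bar> \<le> C" "\<And>x. \<bar>f x\<bar> \<le> C" using mixed_tendsto_bounded[OF mix] by blast
  have fs_meas: "fs n \<in> borel_measurable borel" and f_meas: "f \<in> borel_measurable borel" for n
    using mix by (auto simp: mixed_tendsto_def intro!: borel_measurable_continuous_onI bcontfun_continuous)
  note [measurable] = gap_measurable[OF T] measurable_euler solution_measurable[OF t] fs_meas f_meas
  let ?d = "\<lambda>n w. norm (walk (\<xi> n w) (k n) - Y t w)"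
  let ?R = "\<lambda>n w. gap n T w + walk_max n T w * gap n T w + ?d n w"
  let ?\<Phi> = "\<lambda>n w. fs n (euler (h n) (G n) (x n) (\<xi> n w) (k n)) - f (solution (x n) t w)"
  have mg: "0 \<le> walk_max n T w * gap n T w" for n w by (intro mult_nonneg_nonneg walk_max_nonneg gap_nonneg)
  have "(\<lambda>n. expectation (?\<Phi> n)) \<longlonglongrightarrow> 0"
  proof (rule expectation_tendsto_0_of_min[where R = ?R and C = "2 * C"])
    show "?R n \<in> borel_measurable M" for n by measurable
    show "0 \<le> ?R n w" for n w using gap_nonneg mg by (intro add_nonneg_nonneg) auto
    show "(\<lambda>n. expectation (\<lambda>w. min 1 (?R n w))) \<longlonglongrightarrow> 0"
    proof (rule tendsto_sandwich[where f = "\<lambda>_. 0" and h = "\<lambda>n. expectation (gap n T) + expectation (\<lambda>w. min 1 (walk_max n T w * gap n T w)) + expectation (\<lambda>w. min 1 (?d n w))"])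
      have "(\<lambda>n. expectation (gap n T) + expectation (\<lambda>w. min 1 (walk_max n T w * gap n T w)) + expectation (\<lambda>w. min 1 (?d n w))) \<longlonglongrightarrow> 0 + 0 + 0"
        by (intro tendsto_add expectation_gap expectation_max_gap walk_tendsto_Y T t k)
      then show "(\<lambda>n. expectation (gap n T) + expectation (\<lambda>w. min 1 (walk_max n T w * gap n T w)) + expectation (\<lambda>w. min 1 (?d n w))) \<longlonglongrightarrow> 0" by simp
      have i2: "integrable M (\<lambda>w. min 1 (walk_max n T w * gap n T w))" for n
        by (rule integrable_bounded_real[where C = 1]) (auto intro!: abs_min_1 mg)
      have i3: "integrable M (\<lambda>w. min 1 (?d n w))" for n by (rule integrable_min_1) measurable
      have m3: "min 1 (a + b + c) \<le> a + min 1 b + min 1 c" if "0 \<le> a" "0 \<le> b" "0 \<le> c" for a b c :: real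
        using that by (simp add: min_def)
      have "expectation (\<lambda>w. min 1 (?R n w)) \<le> expectation (\<lambda>w. gap n T w + min 1 (walk_max n T w * gap n T w) + min 1 (?d n w))" for n
      proof (rule integral_mono)
        show "integrable M (\<lambda>w. min 1 (?R n w))"
          by (rule integrable_bounded_real[where C = 1]) (auto intro!: abs_min_1 add_nonneg_nonneg mg gap_nonneg)
        show "integrable M (\<lambda>w. gap n T w + min 1 (walk_max n T w * gap n T w) + min 1 (?d n w))"
          by (intro Bochner_Integration.integrable_add integrable_gap T i2 i3)
        show "min 1 (?R n w) \<le> gap n T w + min 1 (walk_max n T w * gap n T w) + min 1 (?d n w)" for w
          by (rule m3[OF gap_nonneg mg norm_ge_zero])
      qed
      also have "expectation (\<lambda>w. gap n T w + min 1 (walk_max n T w * gap n T w) + min 1 (?d n w))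
        = expectation (gap n T) + expectation (\<lambda>w. min 1 (walk_max n T w * gap n T w)) + expectation (\<lambda>w. min 1 (?d n w))" for n
        using integrable_gap[OF T, of n] i2[of n] i3[of n] by simp
      finally show "\<forall>\<^sub>F n in sequentially. expectation (\<lambda>w. min 1 (?R n w)) \<le> expectation (gap n T) + expectation (\<lambda>w. min 1 (walk_max n T w * gap n T w)) + expectation (\<lambda>w. min 1 (?d n w))"
        by simp
      show "\<forall>\<^sub>F n in sequentially. 0 \<le> expectation (\<lambda>w. min 1 (?R n w))"
        by (intro always_eventually allI Bochner_Integration.integral_nonneg) (auto intro!: add_nonneg_nonneg mg gap_nonneg)
    qed simp
    show "?\<Phi> n \<in> borel_measurable M" for n by measurable
    show "\<bar>?\<Phi> n w\<bar> \<le> 2 * C" for n w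
      using C(2)[of n "euler (h n) (G n) (x n) (\<xi> n w) (k n)"] C(3)[of "solution (x n) t w"] by linarith
    show "AE w in M. \<forall>r. strict_mono r \<longrightarrow> (\<lambda>n. ?R (r n) w) \<longlonglongrightarrow> 0 \<longrightarrow> (\<lambda>n. ?\<Phi> (r n) w) \<longlonglongrightarrow> 0"
    proof (intro AE_I2 allI impI)
      fix w and r :: "nat \<Rightarrow> nat" assume w: "w \<in> space M" and r: "strict_mono r" and lim: "(\<lambda>n. ?R (r n) w) \<longlonglongrightarrow> 0"
      have part: "u \<longlonglongrightarrow> 0" if "\<And>n. 0 \<le> u n" "\<And>n. u n \<le> ?R (r n) w" for u
        by (rule tendsto_sandwich[where f = "\<lambda>_. 0" and h = "\<lambda>n. ?R (r n) w"]) (use that lim in auto)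
      have l1: "(\<lambda>n. gap (r n) T w) \<longlonglongrightarrow> 0"
        using gap_nonneg mg by (intro part) (auto simp: add_increasing2)
      have l2: "(\<lambda>n. walk_max (r n) T w * gap (r n) T w) \<longlonglongrightarrow> 0"
        using gap_nonneg mg by (intro part) (auto simp: add_increasing add_increasing2)
      have l3: "(\<lambda>n. ?d (r n) w) \<longlonglongrightarrow> 0"
        using gap_nonneg mg by (intro part) (auto simp: add_increasing)
      obtain B where B: "\<And>n. norm (solution (x n) t w) \<le> B"
        using euler_tendsto_solution(2)[where x = x and r = r and k = k, OF w t x r k l1[unfolded T_def] l2[unfolded T_def] l3] by blast
      show "(\<lambda>n. ?\<Phi> (r n) w) \<longlonglongrightarrow> 0"
        by (rule mixed_tendsto_eval[OF mix r euler_tendsto_solution(1)[where x = x and r = r and k = k, OF w t x r k l1[unfolded T_def] l2[unfolded T_def] l3] B])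
    qed
  qed
  moreover have "expectation (?\<Phi> n) = expectation (\<lambda>w. fs n (euler (h n) (G n) (x n) (\<xi> n w) (k n))) - expectation (\<lambda>w. f (solution (x n) t w))" for n
    by (intro Bochner_Integration.integral_diff integrable_bounded_real[where C = C] C) measurable
  ultimately show ?thesis by simp
qed

end

section \<open>The transition semigroup and its generator\<close>

lemma mixed_tendsto_const:
  fixes f :: "'a::real_normed_vector \<Rightarrow> real"
  assumes "f \<in> bcontfun"
  shows "mixed_tendsto (\<lambda>_. f) f"
proof -
  have "(\<lambda>n::nat. SUP x\<in>cball (0::'a) r. \<bar>f x - f x\<bar>) \<longlonglongrightarrow> 0" if "r \<ge> 0" for r
    using that by simp
  then show ?thesis using assms unfolding mixed_tendsto_def by simp
qed

text \<open>The outermost operator acts at the initial point and so belongs to the first noise; the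
  induction runs over all starting points and peels off the first input.\<close>

lemma (in noise) iterate_eq_expectation_chain:
  fixes \<phi> :: "'a \<Rightarrow> 'a" and f :: "'a \<Rightarrow> real"
  assumes \<phi>[measurable]: "\<phi> \<in> borel_measurable borel"
    and P: "\<And>f. f \<in> bcontfun \<Longrightarrow> (\<lambda>x. \<integral>y. f (\<phi> x + y) \<partial>\<mu>) \<in> bcontfun"
    and f: "f \<in> bcontfun"
  shows "((\<lambda>f x. \<integral>y. f (\<phi> x + y) \<partial>\<mu>) ^^ k) f x = (\<integral>\<zeta>. f (chain (\<lambda>x y. \<phi> x + y) x \<zeta> k) \<partial>W)"
proof (induction k arbitrary: x)
  case 0
  show ?case by simp
next
  case (Suc k)
  obtain B where B: "\<And>x. \<bar>f x\<bar> \<le> B" using bcontfun_bounded[OF f] by blast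
  have [measurable]: "f \<in> borel_measurable borel" by (intro borel_measurable_continuous_onI bcontfun_continuous f)
  have chain: "(\<lambda>\<zeta>. chain (\<lambda>x y. \<phi> x + y) x \<zeta> (Suc k)) \<in> borel_measurable W"
    unfolding measurable_cong_sets[OF sets_W refl] by (rule measurable_chain) (auto simp: split_beta')
  have "((\<lambda>f x. \<integral>y. f (\<phi> x + y) \<partial>\<mu>) ^^ Suc k) f x
    = (\<integral>y. \<integral>\<zeta>. f (chain (\<lambda>x y. \<phi> x + y) (\<phi> x + y) \<zeta> k) \<partial>W \<partial>\<mu>)"
    by (simp add: Suc)
  also have "\<dots> = (\<integral>y. \<integral>\<zeta>. f (chain (\<lambda>x y. \<phi> x + y) x (case_nat y \<zeta>) (Suc k)) \<partial>W \<partial>\<mu>)"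
    by (simp only: chain_case_nat)
  also have "\<dots> = (\<integral>\<zeta>. f (chain (\<lambda>x y. \<phi> x + y) x \<zeta> (Suc k)) \<partial>W)"
    by (rule integral_W_first[symmetric, OF measurable_compose[OF chain] B]) measurable
  finally show ?case .
qed

context euler_scheme
begin

definition propagator :: "('a \<Rightarrow> real) \<Rightarrow> real \<Rightarrow> 'a \<Rightarrow> real" where
  "propagator f t x = expectation (\<lambda>w. f (solution x t w))"

lemma measurable_bcontfun_solution:
  assumes "f \<in> bcontfun" "t \<ge> 0"
  shows "(\<lambda>w. f (solution x t w)) \<in> borel_measurable M"
  by (rule measurable_compose[OF solution_measurable[OF assms(2)]])
     (intro borel_measurable_continuous_onI bcontfun_continuous assms)

lemma abs_propagator_le:
  assumes "f \<in> bcontfun" "t \<ge> 0" "\<And>x. \<bar>f x\<bar> \<le> B"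
  shows "\<bar>propagator f t x\<bar> \<le> B"
  unfolding propagator_def by (intro abs_expectation_le measurable_bcontfun_solution assms)

lemma continuous_on_propagator:
  assumes f: "f \<in> bcontfun" and t: "t \<ge> 0"
  shows "continuous_on UNIV (propagator f t)"
proof (rule continuous_on_sequentiallyI)
  fix u :: "nat \<Rightarrow> 'a" and a assume u: "u \<longlonglongrightarrow> a"
  obtain B where B: "\<And>x. \<bar>f x\<bar> \<le> B" using bcontfun_bounded[OF f] by blast
  show "(\<lambda>n. propagator f t (u n)) \<longlonglongrightarrow> propagator f t a"
    unfolding propagator_def
  proof (rule integral_dominated_convergence[where w = "\<lambda>_. B"])
    show "AE w in M. (\<lambda>n. f (solution (u n) t w)) \<longlonglongrightarrow> f (solution a t w)"
    proof (rule AE_I2)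
      fix w assume w: "w \<in> space M"
      have "(\<lambda>n. solution (u n) t w) \<longlonglongrightarrow> solution a t w"
      proof (rule LIM_zero_cancel, rule Lim_null_comparison)
        show "\<forall>\<^sub>F n in sequentially. norm (solution (u n) t w - solution a t w) \<le> norm (u n - a) * exp (\<omega> * t)"
          by (intro always_eventually allI solution_lipschitz w t)
        show "(\<lambda>n. norm (u n - a) * exp (\<omega> * t)) \<longlonglongrightarrow> 0"
          using tendsto_mult[OF tendsto_norm_zero[OF LIM_zero[OF u]] tendsto_const, of "exp (\<omega> * t)"] by simp
      qed
      then show "(\<lambda>n. f (solution (u n) t w)) \<longlonglongrightarrow> f (solution a t w)"
        using continuous_on_tendsto_compose[OF bcontfun_continuous[OF f]] by simp
    qed
  qed (use B measurable_bcontfun_solution[OF f t] in auto)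
qed

text \<open>Up to time \<open>s n\<close> the drift moves the solution by at most
  \<open>K * s n\<close>, with \<open>K\<close> uniform over the ball of initial values; right
  continuity of the path at 0 does the rest.\<close>

lemma solution_tendsto_initial:
  assumes w: "w \<in> space M" and Y0: "Y 0 w = 0" and x: "\<And>n. norm (x n) \<le> \<rho>"
    and s: "\<And>n. s n \<ge> 0" "s \<longlonglongrightarrow> 0"
  shows "(\<lambda>n. norm (solution (x n) (s n) w - x n)) \<longlonglongrightarrow> 0"
proof -
  have \<rho>: "\<rho> \<ge> 0" using x[of 0] norm_ge_zero order_trans by blast
  obtain B where B: "B \<ge> 0" "\<And>x s. norm x \<le> \<rho> \<Longrightarrow> s \<in> {0..1} \<Longrightarrow> norm (solution x s w) \<le> B"
    using solution_bounded_ball[OF w zero_le_one \<rho>] by blast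
  define K where "K = norm (F 0) + \<omega> * B"
  have Ys: "(\<lambda>n. norm (Y (s n) w)) \<longlonglongrightarrow> 0"
  proof (rule tendstoI)
    fix e :: real assume e: "e > 0"
    have "((\<lambda>t. Y t w) \<longlongrightarrow> Y 0 w) (at_right 0)" using Y_cadlag[of w] unfolding cadlag_def by simp
    then have "\<forall>\<^sub>F u in at_right 0. dist (Y u w) (Y 0 w) < e" using e by (rule tendstoD)
    then obtain b where b: "b > 0" "\<And>u. 0 < u \<Longrightarrow> u < b \<Longrightarrow> norm (Y u w) < e"
      unfolding eventually_at_right_field by (auto simp: Y0)
    have "\<forall>\<^sub>F n in sequentially. s n < b" using s(2) b(1) by (rule order_tendstoD)
    then show "\<forall>\<^sub>F n in sequentially. dist (norm (Y (s n) w)) 0 < e"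
    proof eventually_elim
      case (elim n)
      then show ?case using b(2)[of "s n"] s(1)[of n] e Y0 by (cases "s n = 0") auto
    qed
  qed
  show ?thesis
  proof (rule tendsto_sandwich[where f = "\<lambda>_. 0" and h = "\<lambda>n. K * s n + norm (Y (s n) w)"])
    have "(\<lambda>n. K * s n + norm (Y (s n) w)) \<longlonglongrightarrow> K * 0 + 0" by (intro tendsto_intros s Ys)
    then show "(\<lambda>n. K * s n + norm (Y (s n) w)) \<longlonglongrightarrow> 0" by simp
    have "\<forall>\<^sub>F n in sequentially. s n < 1" using s(2) by (rule order_tendstoD) simp
    then show "\<forall>\<^sub>F n in sequentially. norm (solution (x n) (s n) w - x n) \<le> K * s n + norm (Y (s n) w)"
    proof eventually_elim
      case (elim n)
      have "norm (LINT u:{0..s n}|lborel. F (solution (x n) u w)) \<le> (LINT u:{0..s n}|lborel. K)"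
      proof (rule norm_set_integral_le[OF solution_set_integrable[OF w s(1)] set_integrable_const_Icc])
        fix u assume "u \<in> {0..s n}"
        then have "norm (solution (x n) u w) \<le> B" using elim x[of n] by (intro B(2)) auto
        then show "norm (F (solution (x n) u w)) \<le> K"
          using F_growth[of "solution (x n) u w"] mult_left_mono[OF _ \<omega>_nonneg] unfolding K_def by fastforce
      qed
      also have "\<dots> = K * s n" by (rule set_integral_const_Icc[OF s(1)])
      finally have "norm (LINT u:{0..s n}|lborel. F (solution (x n) u w)) \<le> K * s n" .
      moreover have "solution (x n) (s n) w - x n = (LINT u:{0..s n}|lborel. F (solution (x n) u w)) + Y (s n) w"
        using solution_eq[OF w s(1)[of n], of "x n"] by simp
      ultimately show ?case
        using norm_triangle_ineq[of "LINT u:{0..s n}|lborel. F (solution (x n) u w)" "Y (s n) w"] by simp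
    qed
  qed simp_all
qed

lemma propagator_tendsto_initial:
  assumes g: "g \<in> bcontfun" and x: "\<And>n. norm (x n) \<le> \<rho>" and s: "\<And>n. s n \<ge> 0" "s \<longlonglongrightarrow> 0"
  shows "(\<lambda>n. propagator g (s n) (x n) - g (x n)) \<longlonglongrightarrow> 0"
proof -
  obtain B where B: "\<And>x. \<bar>g x\<bar> \<le> B" using bcontfun_bounded[OF g] by blast
  have "(\<lambda>n. expectation (\<lambda>w. g (solution (x n) (s n) w) - g (x n))) \<longlonglongrightarrow> expectation (\<lambda>_. 0)"
  proof (rule integral_dominated_convergence[where w = "\<lambda>_. 2 * B"])
    show "AE w in M. (\<lambda>n. g (solution (x n) (s n) w) - g (x n)) \<longlonglongrightarrow> 0"
      using AE_Y_0 AE_space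
    proof eventually_elim
      case (elim w)
      show ?case
        using mixed_tendsto_eval[OF mixed_tendsto_const[OF g] strict_mono_id
            solution_tendsto_initial[OF elim(2,1) x s] x] by simp
    qed
    show "AE w in M. norm (g (solution (x n) (s n) w) - g (x n)) \<le> 2 * B" for n
    proof (rule AE_I2)
      show "norm (g (solution (x n) (s n) w) - g (x n)) \<le> 2 * B" for w
        using B[of "solution (x n) (s n) w"] B[of "x n"] unfolding real_norm_def by linarith
    qed
    show "(\<lambda>w. g (solution (x n) (s n) w) - g (x n)) \<in> borel_measurable M" for n
      using measurable_bcontfun_solution[OF g s(1)] by measurable
  qed simp_all
  moreover have "expectation (\<lambda>w. g (solution (x n) (s n) w) - g (x n)) = propagator g (s n) (x n) - g (x n)" for n
    unfolding propagator_def
    using integrable_bounded_real[OF measurable_bcontfun_solution[OF g s(1)[of n]] B, of "x n"] by (simp add: prob_space)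
  ultimately show ?thesis by simp
qed

lemma measurable_propagator:
  assumes g: "g \<in> bcontfun" and t: "t \<ge> 0"
  shows "(\<lambda>s. propagator g (clamp_time t s) x) \<in> borel_measurable borel"
proof -
  have [measurable]: "g \<in> borel_measurable borel" by (intro borel_measurable_continuous_onI bcontfun_continuous g)
  have "progressive M t (\<lambda>s w. g (solution x s w))"
    using measurable_compose[OF progressive_solution[OF t Y_measurable order_refl, unfolded progressive_def], of g borel x]
    unfolding progressive_def by simp
  then show ?thesis unfolding propagator_def by (rule measurable_expectation_progressive)
qed

lemma propagator_set_integrable:
  assumes g: "g \<in> bcontfun" and t: "t \<ge> 0"
  shows "set_integrable lborel {0..t} (\<lambda>s. propagator g s x)"
proof -
  obtain B where B: "\<And>x. \<bar>g x\<bar> \<le> B" using bcontfun_bounded[OF g] by blast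
  show ?thesis
    by (rule clamp_set_integrable[OF measurable_propagator[OF g t], where B = B])
       (use abs_propagator_le[OF g _ B] in auto)
qed

text \<open>The sum in \<open>discrete\<close> is the integral of a step function up to the grid
  point \<open>b n\<close>. For fixed \<open>s < t\<close> the integrand converges because the
  expectation along the scheme tolerates the varying functions \<open>gs\<close>; the constant
  \<open>C\<close> dominates.\<close>

lemma dynkin:
  fixes gs :: "nat \<Rightarrow> 'a \<Rightarrow> real"
  assumes f: "f \<in> bcontfun" and mix: "mixed_tendsto gs g" and t: "t \<ge> 0"
    and discrete: "\<And>n k x. expectation (\<lambda>w. f (euler (h n) (G n) x (\<xi> n w) k)) - f x
      = (\<Sum>j<k. h n * expectation (\<lambda>w. gs n (euler (h n) (G n) x (\<xi> n w) j)))"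
  shows "propagator f t x - f x = (LINT s:{0..t}|lborel. propagator g s x)"
proof -
  have g: "g \<in> bcontfun" using mix by (simp add: mixed_tendsto_def)
  obtain C where C: "C \<ge> 0" "\<And>n x. \<bar>gs n x\<bar> \<le> C" "\<And>x. \<bar>g x\<bar> \<le> C" using mixed_tendsto_bounded[OF mix] by blast
  define \<phi> where "\<phi> n j = expectation (\<lambda>w. gs n (euler (h n) (G n) x (\<xi> n w) j))" for n j
  have gs_meas: "gs n \<in> borel_measurable borel" for n
    using mix by (intro borel_measurable_continuous_onI bcontfun_continuous) (simp add: mixed_tendsto_def)
  have \<phi>_le: "\<bar>\<phi> n j\<bar> \<le> C" for n j
    unfolding \<phi>_def by (rule abs_expectation_le[OF measurable_compose[OF measurable_euler gs_meas] C(2)])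
  define b where "b n = real (time_index (h n) t) * h n" for n
  have b: "b n \<le> t" "b \<longlonglongrightarrow> t" for n
    unfolding b_def by (rule time_index_times(1)[OF t], rule time_index_tendsto[OF t])
  have lhs: "(\<lambda>n. expectation (\<lambda>w. f (euler (h n) (G n) x (\<xi> n w) (time_index (h n) t))) - f x) \<longlonglongrightarrow> propagator f t x - f x"
  proof (rule tendsto_diff[OF _ tendsto_const])
    show "(\<lambda>n. expectation (\<lambda>w. f (euler (h n) (G n) x (\<xi> n w) (time_index (h n) t)))) \<longlonglongrightarrow> propagator f t x"
      using expectation_euler_tendsto[where x = "\<lambda>_. x" and \<rho> = "norm x" and k = "\<lambda>n. time_index (h n) t",
          OF t order_refl time_index_tendsto[OF t] mixed_tendsto_const[OF f]]
      unfolding propagator_def by (rule LIM_zero_cancel)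
  qed
  have rhs: "(\<lambda>n. \<integral>s. indicator {0..b n} s *\<^sub>R \<phi> n (time_index (h n) s) \<partial>lborel) \<longlonglongrightarrow>
    (\<integral>s. indicator {0..t} s *\<^sub>R propagator g (clamp_time t s) x \<partial>lborel)"
  proof (rule integral_dominated_convergence[where w = "\<lambda>s. C * indicator {0..t} s"])
    show "AE s in lborel. (\<lambda>n. indicator {0..b n} s *\<^sub>R \<phi> n (time_index (h n) s)) \<longlonglongrightarrow> indicator {0..t} s *\<^sub>R propagator g (clamp_time t s) x"
      \<comment> \<open>The point \<open>s = t\<close> is discarded, since its membership in
        \<open>{0..b n}\<close> may change with \<open>n\<close>.\<close>
      using AE_lborel_singleton[of t]
    proof eventually_elim
      case (elim s)
      show ?case
      proof (cases "0 \<le> s \<and> s < t")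
        case True
        then have s: "s \<ge> 0" by simp
        have ev: "\<forall>\<^sub>F n in sequentially. s < b n" using b(2) True by (intro order_tendstoD) auto
        have "(\<lambda>n. \<phi> n (time_index (h n) s)) \<longlonglongrightarrow> propagator g s x"
          using expectation_euler_tendsto[where x = "\<lambda>_. x" and \<rho> = "norm x" and k = "\<lambda>n. time_index (h n) s",
              OF s order_refl time_index_tendsto[OF s] mix]
          unfolding propagator_def \<phi>_def by (rule LIM_zero_cancel)
        moreover have "\<forall>\<^sub>F n in sequentially. \<phi> n (time_index (h n) s) = indicator {0..b n} s *\<^sub>R \<phi> n (time_index (h n) s)"
          using ev by eventually_elim (use s in simp)
        ultimately have "(\<lambda>n. indicator {0..b n} s *\<^sub>R \<phi> n (time_index (h n) s)) \<longlonglongrightarrow> propagator g s x"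
          by (rule Lim_transform_eventually)
        then show ?thesis using True by (simp only: real_scaleR_def) simp
      next
        case False
        then have "s \<notin> {0..b n}" "s \<notin> {0..t}" for n using elim b(1)[of n] by auto
        then show ?thesis by (simp del: atLeastAtMost_iff)
      qed
    qed
    show "AE s in lborel. norm (indicator {0..b n} s *\<^sub>R \<phi> n (time_index (h n) s)) \<le> C * indicator {0..t} s" for n
      using \<phi>_le C(1) order_trans[OF _ b(1)] by (intro AE_I2) (auto simp: indicator_def)
    show "integrable lborel (\<lambda>s. C * indicator {0..t} s)"
      by (intro integrable_mult_right integrable_real_indicator) (auto simp: emeasure_lborel_Icc_eq)
    show "(\<lambda>s. indicator {0..t} s *\<^sub>R propagator g (clamp_time t s) x) \<in> borel_measurable lborel"
      using measurable_propagator[OF g t, of x] by measurable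
  qed measurable
  have "(\<lambda>n. expectation (\<lambda>w. f (euler (h n) (G n) x (\<xi> n w) (time_index (h n) t))) - f x)
    = (\<lambda>n. \<integral>s. indicator {0..b n} s *\<^sub>R \<phi> n (time_index (h n) s) \<partial>lborel)"
  proof
    fix n
    have "expectation (\<lambda>w. f (euler (h n) (G n) x (\<xi> n w) (time_index (h n) t))) - f x = (\<Sum>j<time_index (h n) t. h n *\<^sub>R \<phi> n j)"
      unfolding discrete \<phi>_def by simp
    also have "\<dots> = (LINT s:{0..b n}|lborel. \<phi> n (time_index (h n) s))"
      unfolding b_def by (rule step_integral[OF h_pos, symmetric])
    finally show "expectation (\<lambda>w. f (euler (h n) (G n) x (\<xi> n w) (time_index (h n) t))) - f x
      = (\<integral>s. indicator {0..b n} s *\<^sub>R \<phi> n (time_index (h n) s) \<partial>lborel)"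
      by (simp only: set_lebesgue_integral_def)
  qed
  with lhs have "(\<lambda>n. \<integral>s. indicator {0..b n} s *\<^sub>R \<phi> n (time_index (h n) s) \<partial>lborel) \<longlonglongrightarrow> propagator f t x - f x"
    by (simp only:)
  then have "propagator f t x - f x = (\<integral>s. indicator {0..t} s *\<^sub>R propagator g (clamp_time t s) x \<partial>lborel)"
    by (rule LIMSEQ_unique[OF _ rhs])
  also have "\<dots> = (LINT s:{0..t}|lborel. propagator g s x)"
    unfolding set_lebesgue_integral_def
    by (intro Bochner_Integration.integral_cong refl) (auto simp: indicator_def)
  finally show ?thesis .
qed

text \<open>By \<open>dyn\<close> the difference quotient is the average of
  \<open>propagator g s x\<close> over a short interval. It inherits the bound of \<open>g\<close>,
  and it is close to \<open>g x\<close> because the propagator is continuous at time 0, uniformly on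
  balls.\<close>

lemma generator:
  assumes f: "f \<in> bcontfun" and g: "g \<in> bcontfun"
    and dyn: "\<And>t x. t \<ge> 0 \<Longrightarrow> propagator f t x - f x = (LINT s:{0..t}|lborel. propagator g s x)"
  shows "mixed_tendsto_at_0 (\<lambda>t x. (propagator f t x - f x) / t) g"
  unfolding mixed_tendsto_at_0_def
proof (intro allI impI)
  fix \<tau> :: "nat \<Rightarrow> real" assume "null_seq \<tau>"
  then have \<tau>: "\<And>n. \<tau> n > 0" "\<tau> \<longlonglongrightarrow> 0" by (auto simp: null_seq_def)
  obtain C where C: "C \<ge> 0" "\<And>x. \<bar>g x\<bar> \<le> C" using bcontfun_bounded[OF g] by blast
  let ?q = "\<lambda>n x. (propagator f (\<tau> n) x - f x) / \<tau> n"
  have q_le: "\<bar>?q n x\<bar> \<le> C" for n x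
  proof -
    have "norm (LINT s:{0..\<tau> n}|lborel. propagator g s x) \<le> (LINT s:{0..\<tau> n}|lborel. C)"
      using \<tau>(1)[of n] abs_propagator_le[OF g _ C(2)]
      by (intro norm_set_integral_le propagator_set_integrable g set_integrable_const_Icc) auto
    also have "\<dots> = C * \<tau> n" using \<tau>(1)[of n] by (intro set_integral_const_Icc) simp
    finally show ?thesis
      unfolding dyn[OF less_imp_le[OF \<tau>(1)]] using \<tau>(1)[of n] by (simp add: pos_divide_le_eq)
  qed
  have q: "?q n \<in> bcontfun" for n
  proof (rule bcontfunI_abs[OF _ q_le])
    show "continuous_on UNIV (?q n)"
      using \<tau>(1)[of n] by (intro continuous_intros continuous_on_propagator bcontfun_continuous f) auto
  qed
  \<comment> \<open>A failure of uniformity would give sequences of times and points that contradict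
    \<open>propagator_tendsto_initial\<close>.\<close>
  have unif: "\<exists>\<eta>>0. \<forall>s x. 0 \<le> s \<longrightarrow> s \<le> \<eta> \<longrightarrow> norm x \<le> \<rho> \<longrightarrow> \<bar>propagator g s x - g x\<bar> \<le> e" if e: "e > 0" for e \<rho>
  proof (rule ccontr)
    assume neg: "\<not> ?thesis"
    have "\<exists>s x. 0 \<le> s \<and> s \<le> 1 / (real n + 1) \<and> norm x \<le> \<rho> \<and> \<not> \<bar>propagator g s x - g x\<bar> \<le> e" for n :: nat
    proof -
      have "(0::real) < 1 / (real n + 1)" by simp
      then show ?thesis using neg by blast
    qed
    then obtain s x where sx: "\<And>n. 0 \<le> s n" "\<And>n. s n \<le> 1 / (real n + 1)" "\<And>n. norm (x n) \<le> \<rho>"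
      "\<And>n. \<not> \<bar>propagator g (s n) (x n) - g (x n)\<bar> \<le> e" by metis
    have "s \<longlonglongrightarrow> 0"
    proof (rule tendsto_sandwich[where f = "\<lambda>_. 0" and h = "\<lambda>n. 1 / (real n + 1)"])
      show "(\<lambda>n. 1 / (real n + 1)) \<longlonglongrightarrow> 0"
        using LIMSEQ_inverse_real_of_nat by (simp add: inverse_eq_divide add.commute)
    qed (use sx in auto)
    then have "(\<lambda>n. propagator g (s n) (x n) - g (x n)) \<longlonglongrightarrow> 0"
      by (rule propagator_tendsto_initial[OF g sx(3) sx(1)])
    then have "\<forall>\<^sub>F n in sequentially. \<bar>propagator g (s n) (x n) - g (x n)\<bar> < e"
      using e by (simp add: tendsto_iff)
    then obtain n where "\<bar>propagator g (s n) (x n) - g (x n)\<bar> < e" by (auto simp: eventually_sequentially)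
    then show False using sx(4)[of n] by simp
  qed
  have lim: "(\<lambda>n. SUP x\<in>cball 0 \<rho>. \<bar>?q n x - g x\<bar>) \<longlonglongrightarrow> 0" if \<rho>: "\<rho> \<ge> 0" for \<rho>
  proof (rule SUP_tendsto_0_sequential)
    show "cball (0::'a) \<rho> \<noteq> {}" using \<rho> by simp
    show "bdd_above ((\<lambda>x. \<bar>?q n x - g x\<bar>) ` cball 0 \<rho>)" for n
    proof (rule bdd_aboveI2)
      show "\<bar>?q n x - g x\<bar> \<le> C + C" for x using q_le[of n x] C(2)[of x] by linarith
    qed
    fix x :: "nat \<Rightarrow> 'a" assume "\<And>n. x n \<in> cball (0::'a) \<rho>"
    then have x: "norm (x n) \<le> \<rho>" for n by simp
    show "(\<lambda>n. ?q n (x n) - g (x n)) \<longlonglongrightarrow> 0"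
    proof (rule tendstoI)
      fix e :: real assume e: "e > 0"
      obtain \<eta> where \<eta>: "\<eta> > 0" "\<And>s x. 0 \<le> s \<Longrightarrow> s \<le> \<eta> \<Longrightarrow> norm x \<le> \<rho> \<Longrightarrow> \<bar>propagator g s x - g x\<bar> \<le> e / 2"
        using unif[of "e / 2" \<rho>] e by auto
      have "\<forall>\<^sub>F n in sequentially. \<tau> n < \<eta>" using \<tau>(2) \<eta>(1) by (rule order_tendstoD)
      then show "\<forall>\<^sub>F n in sequentially. dist (?q n (x n) - g (x n)) 0 < e"
      proof eventually_elim
        case (elim n)
        have \<tau>n: "0 \<le> \<tau> n" using \<tau>(1)[of n] by simp
        have int: "set_integrable lborel {0..\<tau> n} (\<lambda>s. propagator g s (x n))" by (rule propagator_set_integrable[OF g \<tau>n])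
        have "(propagator f (\<tau> n) (x n) - f (x n)) - \<tau> n * g (x n)
          = (LINT s:{0..\<tau> n}|lborel. propagator g s (x n)) - (LINT s:{0..\<tau> n}|lborel. g (x n))"
          unfolding dyn[OF \<tau>n] set_integral_const_Icc[OF \<tau>n] by simp
        also have "\<dots> = (LINT s:{0..\<tau> n}|lborel. propagator g s (x n) - g (x n))"
          by (intro set_integral_diff(2)[symmetric] int set_integrable_const_Icc)
        also have "norm \<dots> \<le> (LINT s:{0..\<tau> n}|lborel. e / 2)"
        proof (intro norm_set_integral_le set_integral_diff(1) int set_integrable_const_Icc)
          show "norm (propagator g s (x n) - g (x n)) \<le> e / 2" if "s \<in> {0..\<tau> n}" for s
            using that elim unfolding real_norm_def by (intro \<eta>(2) x) auto
        qed
        also have "\<dots> = e / 2 * \<tau> n" by (rule set_integral_const_Icc[OF \<tau>n])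
        finally have "\<bar>(propagator f (\<tau> n) (x n) - f (x n)) - \<tau> n * g (x n)\<bar> \<le> e / 2 * \<tau> n" by simp
        moreover have "?q n (x n) - g (x n) = ((propagator f (\<tau> n) (x n) - f (x n)) - \<tau> n * g (x n)) / \<tau> n"
          using \<tau>(1)[of n] by (simp add: field_simps)
        ultimately have "\<bar>?q n (x n) - g (x n)\<bar> \<le> e / 2"
          using \<tau>(1)[of n] by (simp add: pos_divide_le_eq)
        then show ?case using e by simp
      qed
    qed
  qed
  have "bdd_above (range (\<lambda>n. SUP x. \<bar>?q n x\<bar>))"
    by (rule bdd_aboveI2[where M = C], rule cSUP_least[OF UNIV_not_empty q_le])
  then show "mixed_tendsto (\<lambda>n. ?q n) g"
    unfolding mixed_tendsto_def using q g lim by blast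
qed

end

section \<open>Extracting the subsequence\<close>

text \<open>The displacement is divided into \<open>m\<close> equal steps of norm at most
  \<open>\<delta>\<close>; the deviations add up in the same way as the norms of the steps.\<close>

lemma increment_bound_of_small:
  fixes \<phi> :: "'a::real_normed_vector \<Rightarrow> 'a"
  assumes \<delta>: "\<delta> > 0" and small: "\<And>x u. norm u \<le> \<delta> \<Longrightarrow> norm (\<phi> (x + u) - \<phi> x - u) \<le> c * norm u"
  shows "norm (\<phi> (x + u) - \<phi> x - u) \<le> c * norm u"
proof -
  obtain m :: nat where m: "norm u / \<delta> < real m" using reals_Archimedean2 by blast
  moreover have "0 \<le> norm u / \<delta>" using \<delta> by simp
  ultimately have m0: "real m > 0" by linarith
  define v where "v = u /\<^sub>R real m"
  have v: "norm v \<le> \<delta>"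
    using m m0 \<delta> by (simp add: v_def field_simps)
  have "norm (\<phi> (x + real k *\<^sub>R v) - \<phi> x - real k *\<^sub>R v) \<le> real k * (c * norm v)" for k :: nat
  proof (induction k)
    case (Suc k)
    have eq: "\<phi> (x + real (Suc k) *\<^sub>R v) - \<phi> x - real (Suc k) *\<^sub>R v
      = (\<phi> ((x + real k *\<^sub>R v) + v) - \<phi> (x + real k *\<^sub>R v) - v) + (\<phi> (x + real k *\<^sub>R v) - \<phi> x - real k *\<^sub>R v)"
      by (simp add: algebra_simps)
    have "norm (\<phi> (x + real (Suc k) *\<^sub>R v) - \<phi> x - real (Suc k) *\<^sub>R v) \<le> c * norm v + real k * (c * norm v)"
      unfolding eq by (intro norm_triangle_le add_mono small v Suc)
    then show ?case by (simp add: algebra_simps)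
  qed simp
  from this[of m] have "norm (\<phi> (x + u) - \<phi> x - u) \<le> real m * (c * norm v)" using m0 by (simp add: v_def)
  also have "\<dots> = c * (real m * norm v)" by simp
  also have "real m * norm v = norm u" using m0 by (simp add: v_def)
  finally show ?thesis .
qed

text \<open>An Arzela-Ascoli argument on an unbounded domain. The growth is linear, so dividing by
  \<open>1 + norm x\<close> gives the common bound for a diagonal subsequence on a countable dense
  set. Equicontinuity extends the convergence to all points, and finite nets make it uniform on
  balls.\<close>

lemma lipschitz_subsequence:
  fixes G :: "nat \<Rightarrow> 'a::euclidean_space \<Rightarrow> 'a"
  assumes lip: "\<And>n. lipschitz_on \<omega> UNIV (G n)" and bdd: "\<And>n. norm (G n 0) \<le> c"
  shows "\<exists>(\<rho> :: nat \<Rightarrow> nat) F. strict_mono \<rho> \<and> lipschitz_on \<omega> UNIV F \<and>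
    (\<forall>B \<epsilon>. \<epsilon> > 0 \<longrightarrow> (\<forall>\<^sub>F n in sequentially. \<forall>b. norm b \<le> B \<longrightarrow> norm (G (\<rho> n) b - F b) \<le> \<epsilon>))"
proof -
  have \<omega>: "\<omega> \<ge> 0" using lip[of 0] by (rule lipschitz_on_nonneg)
  have c: "c \<ge> 0" using bdd[of 0] norm_ge_zero order_trans by blast
  have L: "norm (G n a - G n b) \<le> \<omega> * norm (a - b)" for n a b
    using lipschitz_onD[OF lip, of a b n] by (simp add: dist_norm)
  obtain D :: "'a set" where D: "countable D" "\<forall>X. open X \<longrightarrow> X \<noteq> {} \<longrightarrow> (\<exists>d\<in>D. d \<in> X)"
    using countable_dense_exists by blast
  have pos: "1 + norm x > 0" for x :: 'a by (simp add: add_pos_nonneg)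
  obtain \<rho> :: "nat \<Rightarrow> nat" where \<rho>: "strict_mono \<rho>" and lim: "\<And>x. x \<in> D \<Longrightarrow> \<exists>l. (\<lambda>n. G (\<rho> n) x /\<^sub>R (1 + norm x)) \<longlonglongrightarrow> l"
  proof (rule function_convergent_subsequence[of D "\<lambda>n x. G n x /\<^sub>R (1 + norm x)" "c + \<omega>"])
    show "norm (G n x /\<^sub>R (1 + norm x)) \<le> c + \<omega>" for n x
    proof -
      have "norm (G n x) \<le> c + \<omega> * norm x"
        using L[of n x 0] bdd[of n] norm_triangle_sub[of "G n x" "G n 0"] by simp
      also have "\<dots> \<le> (c + \<omega>) * (1 + norm x)" using c \<omega> by (simp add: algebra_simps)
      finally show ?thesis using pos[of x] by (simp add: divide_inverse[symmetric] pos_divide_le_eq mult.commute)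
    qed
  qed (auto simp: D(1))
  have limD: "convergent (\<lambda>n. G (\<rho> n) x)" if xD: "x \<in> D" for x
  proof -
    obtain l where "(\<lambda>n. G (\<rho> n) x /\<^sub>R (1 + norm x)) \<longlonglongrightarrow> l" using lim[OF xD] by blast
    then have "(\<lambda>n. (1 + norm x) *\<^sub>R (G (\<rho> n) x /\<^sub>R (1 + norm x))) \<longlonglongrightarrow> (1 + norm x) *\<^sub>R l"
      by (intro tendsto_scaleR tendsto_const)
    then show ?thesis using pos[of x] by (auto simp: convergent_def)
  qed
  have conv: "convergent (\<lambda>n. G (\<rho> n) x)" for x
  proof (rule convergent_of_eventually_close)
    fix e :: real assume e: "e > 0"
    \<comment> \<open>Moving by \<open>r\<close> changes each function by at most
      \<open>e / 4\<close>; the summand 1 covers \<open>\<omega> = 0\<close>.\<close>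
    define r where "r = e / (4 * (\<omega> + 1))"
    have r: "r > 0" "\<omega> * r \<le> e / 4" using e \<omega> by (auto simp: r_def field_simps)
    obtain d where d: "d \<in> D" "d \<in> ball x r" using D(2)[rule_format, of "ball x r"] r(1) by auto
    obtain l where "(\<lambda>n. G (\<rho> n) d) \<longlonglongrightarrow> l" using limD[OF d(1)] by (auto simp: convergent_def)
    then have "\<forall>\<^sub>F n in sequentially. dist (G (\<rho> n) d) l < e / 4" using e by (intro tendstoD) auto
    then have "\<forall>\<^sub>F n in sequentially. G (\<rho> n) x \<in> {a. norm (a - l) \<le> e / 2}"
    proof eventually_elim
      case (elim n)
      have "norm (G (\<rho> n) x - G (\<rho> n) d) \<le> \<omega> * norm (x - d)" by (rule L)
      also have "\<dots> \<le> \<omega> * r" using d(2) \<omega> by (intro mult_left_mono) (auto simp: dist_norm)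
      finally have "norm (G (\<rho> n) x - G (\<rho> n) d) \<le> e / 4" using r(2) by simp
      then show ?case
        using elim norm_triangle_ineq[of "G (\<rho> n) x - G (\<rho> n) d" "G (\<rho> n) d - l"] by (simp add: dist_norm)
    qed
    moreover have "norm (b - a) \<le> e" if "norm (a - l) \<le> e / 2" "norm (b - l) \<le> e / 2" for a b
      using that norm_triangle_ineq4[of "b - l" "a - l"] by simp
    ultimately show "\<exists>S. (\<forall>\<^sub>F n in sequentially. G (\<rho> n) x \<in> S) \<and> (\<forall>a\<in>S. \<forall>b\<in>S. norm (b - a) \<le> e)"
      by (intro exI[of _ "{a. norm (a - l) \<le> e / 2}"]) auto
  qed
  define F where "F x = lim (\<lambda>n. G (\<rho> n) x)" for x
  have F: "(\<lambda>n. G (\<rho> n) x) \<longlonglongrightarrow> F x" for x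
    unfolding F_def using conv[of x] by (simp add: convergent_LIMSEQ_iff)
  have LF: "norm (F a - F b) \<le> \<omega> * norm (a - b)" for a b
  proof (rule tendsto_upperbound)
    show "(\<lambda>n. norm (G (\<rho> n) a - G (\<rho> n) b)) \<longlonglongrightarrow> norm (F a - F b)" by (intro tendsto_intros F)
  qed (use L in auto)
  show ?thesis
  proof (intro exI conjI allI impI)
    show "strict_mono \<rho>" by (rule \<rho>)
    show "lipschitz_on \<omega> UNIV F" using LF \<omega> by (intro lipschitz_onI) (auto simp: dist_norm)
    fix B \<epsilon> :: real assume \<epsilon>: "\<epsilon> > 0"
    define r where "r = \<epsilon> / (4 * (\<omega> + 1))"
    have r: "r > 0" "\<omega> * r \<le> \<epsilon> / 4" using \<epsilon> \<omega> by (auto simp: r_def field_simps)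
    obtain N where N: "N \<subseteq> cball (0::'a) B" "finite N" "cball 0 B \<subseteq> (\<Union>x\<in>N. ball x r)"
    proof (rule compactE_image[of "cball (0::'a) B" "cball 0 B" "\<lambda>x. ball x r"])
      show "cball (0::'a) B \<subseteq> (\<Union>x\<in>cball 0 B. ball x r)" using r(1) by force
    qed (auto simp: that)
    have "\<forall>\<^sub>F n in sequentially. \<forall>x\<in>N. dist (G (\<rho> n) x) (F x) < \<epsilon> / 2"
      using N(2) F \<epsilon> by (intro eventually_ball_finite ballI tendstoD) auto
    then show "\<forall>\<^sub>F n in sequentially. \<forall>b. norm b \<le> B \<longrightarrow> norm (G (\<rho> n) b - F b) \<le> \<epsilon>"
    proof eventually_elim
      case (elim n)
      show ?case
      proof (intro allI impI)
        fix b :: 'a assume "norm b \<le> B"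
        then obtain x where x: "x \<in> N" "norm (b - x) \<le> r" using N(3) by (force simp: dist_norm norm_minus_commute)
        have w: "\<omega> * norm (b - x) \<le> \<epsilon> / 4" using mult_left_mono[OF x(2) \<omega>] r(2) by linarith
        have "norm (G (\<rho> n) x - F x) < \<epsilon> / 2" using elim x(1) by (simp add: dist_norm)
        then show "norm (G (\<rho> n) b - F b) \<le> \<epsilon>"
          using L[of "\<rho> n" b x] LF[of x b] w
            norm_triangle_ineq[of "G (\<rho> n) b - G (\<rho> n) x" "G (\<rho> n) x - F b"]
            norm_triangle_ineq[of "G (\<rho> n) x - F x" "F x - F b"]
          by (simp add: norm_minus_commute[of x b])
      qed
    qed
  qed
qed

lemma (in euler_scheme) transition_power_eq:
  fixes f :: "'a \<Rightarrow> real"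
  assumes \<phi>: "\<And>n x. \<phi> n x = x + h n *\<^sub>R G n x"
    and P: "\<And>n (f :: 'a \<Rightarrow> real). f \<in> bcontfun \<Longrightarrow> (\<lambda>x. \<integral>y. f (\<phi> n x + y) \<partial>\<mu> n) \<in> bcontfun"
    and f: "f \<in> bcontfun"
  shows "((\<lambda>f x. \<integral>y. f (\<phi> n x + y) \<partial>\<mu> n) ^^ k) f x = expectation (\<lambda>w. f (euler (h n) (G n) x (\<xi> n w) k))"
proof -
  interpret N: noise "\<mu> n" by (rule noise)
  have [measurable]: "f \<in> borel_measurable borel" by (intro borel_measurable_continuous_onI bcontfun_continuous f)
  have [measurable]: "G n \<in> borel_measurable borel"
    by (rule borel_measurable_continuous_onI, rule lipschitz_on_continuous_on[OF G_lip])
  have \<phi>_meas[measurable]: "\<phi> n \<in> borel_measurable borel"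
    unfolding \<phi>[abs_def] by measurable
  have chain: "(\<lambda>\<zeta>. chain (\<lambda>x y. \<phi> n x + y) x \<zeta> k) \<in> borel_measurable N.W"
    unfolding measurable_cong_sets[OF N.sets_W refl] by (rule measurable_chain) (auto simp: split_beta')
  have "((\<lambda>f x. \<integral>y. f (\<phi> n x + y) \<partial>\<mu> n) ^^ k) f x = (\<integral>\<zeta>. f (chain (\<lambda>x y. \<phi> n x + y) x \<zeta> k) \<partial>N.W)"
    by (rule N.iterate_eq_expectation_chain[OF \<phi>_meas _ f]) (rule P)
  also have "\<dots> = expectation (\<lambda>w. f (chain (\<lambda>x y. \<phi> n x + y) x (\<xi> n w) k))"
    by (rule expectation_xi[symmetric, OF measurable_compose[OF chain]]) measurable
  finally show ?thesis by (simp add: \<phi> euler_def)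
qed

text \<open>Since \<open>P^(j+1) f - P^j f = P^j (P f - f)\<close>, the sum telescopes. The power
  formula may be applied to \<open>P f\<close> because that function is again bounded and
  continuous.\<close>

lemma (in euler_scheme) discrete_dynkin:
  fixes f :: "'a \<Rightarrow> real"
  assumes \<phi>: "\<And>n x. \<phi> n x = x + h n *\<^sub>R G n x"
    and P: "\<And>n (f :: 'a \<Rightarrow> real). f \<in> bcontfun \<Longrightarrow> (\<lambda>x. \<integral>y. f (\<phi> n x + y) \<partial>\<mu> n) \<in> bcontfun"
    and f: "f \<in> bcontfun"
  shows "expectation (\<lambda>w. f (euler (h n) (G n) x (\<xi> n w) k)) - f x
    = (\<Sum>j<k. h n * expectation (\<lambda>w. ((\<integral>y. f (\<phi> n (euler (h n) (G n) x (\<xi> n w) j) + y) \<partial>\<mu> n) - f (euler (h n) (G n) x (\<xi> n w) j)) / h n))"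
proof -
  let ?P = "\<lambda>f x. \<integral>y. f (\<phi> n x + y) \<partial>\<mu> n" and ?E = "\<lambda>j w. euler (h n) (G n) x (\<xi> n w) j"
  have power: "(?P ^^ j) g x = expectation (\<lambda>w. g (?E j w))" if "g \<in> bcontfun" for g :: "'a \<Rightarrow> real" and j
    by (rule transition_power_eq[OF \<phi> _ that]) (rule P)
  have Pf: "?P f \<in> bcontfun" by (rule P[OF f])
  have int: "integrable M (\<lambda>w. g (?E j w))" if g: "g \<in> bcontfun" for g :: "'a \<Rightarrow> real" and j
  proof -
    obtain B where "\<And>x. \<bar>g x\<bar> \<le> B" using bcontfun_bounded[OF g] by blast
    moreover have "g \<in> borel_measurable borel" by (intro borel_measurable_continuous_onI bcontfun_continuous g)
    ultimately show ?thesis by (intro integrable_bounded_real[where C = B] measurable_compose[OF measurable_euler])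
  qed
  have "expectation (\<lambda>w. f (?E (Suc j) w)) - expectation (\<lambda>w. f (?E j w)) = h n * expectation (\<lambda>w. (?P f (?E j w) - f (?E j w)) / h n)" for j
  proof -
    have "expectation (\<lambda>w. f (?E (Suc j) w)) = (?P ^^ Suc j) f x" by (rule power[OF f, symmetric])
    also have "\<dots> = (?P ^^ j) (?P f) x" by (simp only: funpow_Suc_right o_apply)
    also have "\<dots> = expectation (\<lambda>w. ?P f (?E j w))" by (rule power[OF Pf])
    finally have "expectation (\<lambda>w. f (?E (Suc j) w)) - expectation (\<lambda>w. f (?E j w)) = expectation (\<lambda>w. ?P f (?E j w) - f (?E j w))"
      using int[OF Pf] int[OF f] by simp
    then show ?thesis using h_pos[of n] by simp
  qed
  then have "(\<Sum>j<k. h n * expectation (\<lambda>w. (?P f (?E j w) - f (?E j w)) / h n)) = (\<Sum>j<k. expectation (\<lambda>w. f (?E (Suc j) w)) - expectation (\<lambda>w. f (?E j w)))"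
    by simp
  also have "\<dots> = expectation (\<lambda>w. f (?E k w)) - expectation (\<lambda>w. f (?E 0 w))" by (rule sum_lessThan_telescope)
  finally show ?thesis by (simp add: prob_space)
qed

lemma small_noiseI:
  fixes \<mu> :: "real \<Rightarrow> 'a::euclidean_space measure"
  assumes noise: "\<And>t. t > 0 \<Longrightarrow> noise (\<mu> t)" and h: "\<And>n. h n > 0" "h \<longlonglongrightarrow> 0"
    and C: "\<And>n. spread (\<mu> (h n)) 1 \<le> C * h n"
    and tails: "\<And>\<epsilon>. \<epsilon> > 0 \<Longrightarrow> \<exists>L>0. \<forall>\<^sub>F n in sequentially. measure (\<mu> (h n)) {y. norm y > L} \<le> \<epsilon> * h n"
  shows "small_noise (\<lambda>n. \<mu> (h n)) h C"
proof (rule small_noise.intro)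
  fix \<epsilon> :: real assume \<epsilon>: "\<epsilon> > 0"
  have "0 \<le> C * h 0" using spread_nonneg[of 1 "\<mu> (h 0)"] C[of 0] by simp
  then have C0: "C \<ge> 0" using h(1)[of 0] by (simp add: zero_le_mult_iff)
  obtain L where L: "L > 0" "\<forall>\<^sub>F n in sequentially. measure (\<mu> (h n)) {y. norm y > L} \<le> \<epsilon> / 4 * h n"
    using tails[of "\<epsilon> / 4"] \<epsilon> by auto
  \<comment> \<open>The bound \<open>spread_le\<close> asks for a truncation level of at least
    1.\<close>
  define L' where "L' = max L 1"
  \<comment> \<open>The tail contributes twice \<open>\<epsilon> / 4\<close>, and this
    \<open>R\<close> makes \<open>3 * L'\<^sup>2 / R * C\<close> at most
    \<open>\<epsilon> / 2\<close>.\<close>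
  define R where "R = max L' (6 * L'\<^sup>2 * C / \<epsilon>)"
  have L': "1 \<le> L'" "L \<le> L'" "L' \<le> R" by (auto simp: L'_def R_def)
  have R: "R > 0" using L' by simp
  have "6 * L'\<^sup>2 * C / \<epsilon> \<le> R" by (simp add: R_def)
  then have RC: "3 * L'\<^sup>2 / R * C \<le> \<epsilon> / 2" using R \<epsilon> by (simp add: field_simps)
  from L(2) have "\<forall>\<^sub>F n in sequentially. spread (\<mu> (h n)) R \<le> \<epsilon> * h n"
  proof eventually_elim
    case (elim n)
    interpret N: noise "\<mu> (h n)" by (rule noise[OF h(1)])
    have "measure (\<mu> (h n)) {y. norm y > L'} \<le> measure (\<mu> (h n)) {y. norm y > L}"
      using L'(2) by (intro N.finite_measure_mono) auto
    then have "2 * measure (\<mu> (h n)) {y. norm y > L'} \<le> \<epsilon> / 2 * h n" using elim by simp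
    moreover have "3 * L'\<^sup>2 / R * spread (\<mu> (h n)) 1 \<le> 3 * L'\<^sup>2 / R * (C * h n)"
      using C[of n] R by (intro mult_left_mono) auto
    moreover have "3 * L'\<^sup>2 / R * (C * h n) \<le> \<epsilon> / 2 * h n"
      using mult_right_mono[OF RC less_imp_le[OF h(1)[of n]]] by (simp add: mult.assoc)
    ultimately show ?case using N.spread_le[OF L'(1,3)] by linarith
  qed
  then show "\<exists>R>0. \<forall>\<^sub>F n in sequentially. spread (\<mu> (h n)) R \<le> \<epsilon> * h n" using R by blast
qed (auto simp: h C intro: noise)

theorem theorem2p1:
  fixes \<mu> :: "real \<Rightarrow> (real ^ 'd) measure"
    and \<psi> :: "real \<Rightarrow> real ^ 'd \<Rightarrow> real ^ 'd"
    and \<omega> \<delta> :: real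
    and s :: "nat \<Rightarrow> real"
  assumes \<mu>_prob: "\<forall>t>0. prob_space (\<mu> t) \<and> sets (\<mu> t) = sets borel"
    and P_operator: "\<forall>t>0. \<forall>f\<in>bcontfun. transition \<mu> \<psi> t f \<in> bcontfun"
    and A1: "\<exists>h0>0. (SUP h\<in>{0<..<h0}.
          ereal (1 / h * ((\<integral>y. min 1 ((norm y)\<^sup>2) \<partial>\<mu> h)
                           + norm (LINT y:{y. norm y \<le> 1}|\<mu> h. y)))) < \<infinity>"
    and A2: "\<forall>\<epsilon>>0. \<exists>M>0.
          Limsup (at_right 0) (\<lambda>h. ereal (1 / h * measure (\<mu> h) {y. norm y > M})) < ereal \<epsilon>"
    and \<omega>_nonneg: "\<omega> \<ge> 0" and \<delta>_pos: "\<delta> > 0"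
    and A3: "\<exists>h0>0. \<forall>u. norm u \<le> \<delta> \<longrightarrow>
          (SUP h\<in>{0<..<h0}. SUP x. ereal (norm (\<psi> h (x + u) - \<psi> h x - u) / h)) \<le> ereal (\<omega> * norm u)"
    and A3': "Limsup (at_right 0) (\<lambda>h. ereal (norm (\<psi> h 0) / h)) < \<infinity>"
    and s_null: "null_seq s"
  shows "\<exists>(h :: nat \<Rightarrow> real) (M :: (real \<Rightarrow> real ^ 'd) measure)
            (Y :: real \<Rightarrow> (real \<Rightarrow> real ^ 'd) \<Rightarrow> real ^ 'd) (F :: real ^ 'd \<Rightarrow> real ^ 'd).
      (\<exists>\<sigma>. strict_mono \<sigma> \<and> h = s \<circ> \<sigma>) \<and>
      levy_process M Y \<and>
      lipschitz_on \<omega> UNIV F \<and>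
      (\<exists>X :: real ^ 'd \<Rightarrow> real \<Rightarrow> (real \<Rightarrow> real ^ 'd) \<Rightarrow> real ^ 'd.
        (\<forall>x. unique_strong_solution M Y F x (X x)) \<and>
        (\<forall>t\<ge>0. \<forall>f\<in>bcontfun. \<forall>k fs.
           (\<lambda>n. real (k n) * h n) \<longlonglongrightarrow> t \<longrightarrow> mixed_tendsto fs f \<longrightarrow>
           (\<forall>r\<ge>0. (\<lambda>n. SUP x\<in>cball 0 r.
                \<bar>(transition \<mu> \<psi> (h n) ^^ k n) (fs n) x - (\<integral>w. f (X x t w) \<partial>M)\<bar>) \<longlonglongrightarrow> 0)) \<and>
        (\<forall>f\<in>bcontfun. \<forall>g.
           mixed_tendsto (\<lambda>n x. (transition \<mu> \<psi> (h n) f x - f x) / h n) g \<longrightarrow>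
           mixed_tendsto_at_0 (\<lambda>t x. ((\<integral>w. f (X x t w) \<partial>M) - f x) / t) g))"
proof -

  \<comment> \<open>Bounds valid for all small step sizes\<close>
  have s: "s n > 0" "s \<longlonglongrightarrow> 0" for n using s_null by (auto simp: null_seq_def)
  have s_at: "filterlim s (at_right 0) sequentially"
    by (rule tendsto_imp_filterlim_at_right[OF s(2)]) (simp add: s(1))
  have noise_\<mu>: "noise (\<mu> t)" if "t > 0" for t
    using \<mu>_prob that by (simp add: noise_def noise_axioms_def)

  obtain h1 where h1: "h1 > 0" "(SUP h\<in>{0<..<h1}. ereal (1 / h * ((\<integral>y. min 1 ((norm y)\<^sup>2) \<partial>\<mu> h)
                           + norm (LINT y:{y. norm y \<le> 1}|\<mu> h. y)))) < \<infinity>"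
    using A1 by blast
  then obtain C :: nat where C: "(SUP h\<in>{0<..<h1}. ereal (1 / h * ((\<integral>y. min 1 ((norm y)\<^sup>2) \<partial>\<mu> h)
                           + norm (LINT y:{y. norm y \<le> 1}|\<mu> h. y)))) < ereal (real C)"
    by (auto simp: less_PInf_Ex_of_nat)
  have spread_C: "spread (\<mu> h) 1 \<le> real C * h" if h: "0 < h" "h < h1" for h
  proof -
    have "ereal (1 / h * ((\<integral>y. min 1 ((norm y)\<^sup>2) \<partial>\<mu> h) + norm (LINT y:{y. norm y \<le> 1}|\<mu> h. y))) < ereal (real C)"
      by (rule le_less_trans[OF SUP_upper C]) (use h in simp)
    then have "1 / h * spread (\<mu> h) 1 < real C" by (simp add: spread_def)
    then show ?thesis using h by (simp add: field_simps)
  qed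

  obtain h2 where h2: "h2 > 0" "\<And>u. norm u \<le> \<delta> \<Longrightarrow>
      (SUP h\<in>{0<..<h2}. SUP x. ereal (norm (\<psi> h (x + u) - \<psi> h x - u) / h)) \<le> ereal (\<omega> * norm u)"
    using A3 by blast
  have \<psi>_inc: "norm (\<psi> h (x + u) - \<psi> h x - u) \<le> (\<omega> * h) * norm u" if h: "0 < h" "h < h2" for h x u
  proof (rule increment_bound_of_small[OF \<delta>_pos])
    fix x u :: "real ^ 'd" assume u: "norm u \<le> \<delta>"
    have "ereal (norm (\<psi> h (x + u) - \<psi> h x - u) / h) \<le> (SUP x. ereal (norm (\<psi> h (x + u) - \<psi> h x - u) / h))"
      by (rule SUP_upper) simp
    also have "\<dots> \<le> (SUP h\<in>{0<..<h2}. SUP x. ereal (norm (\<psi> h (x + u) - \<psi> h x - u) / h))"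
      by (rule SUP_upper) (use h in simp)
    also have "\<dots> \<le> ereal (\<omega> * norm u)" by (rule h2(2)[OF u])
    finally show "norm (\<psi> h (x + u) - \<psi> h x - u) \<le> (\<omega> * h) * norm u" using h by (simp add: field_simps)
  qed

  obtain c :: nat where "Limsup (at_right 0) (\<lambda>h. ereal (norm (\<psi> h 0) / h)) < ereal (real c)"
    using A3' by (auto simp: less_PInf_Ex_of_nat)
  then have ev_c: "\<forall>\<^sub>F h in at_right 0. ereal (norm (\<psi> h 0) / h) < ereal (real c)" by (rule Limsup_lessD)

  have "\<forall>\<^sub>F h in at_right (0::real). h < min h1 h2"
    unfolding eventually_at_right_field using h1(1) h2(1) by (intro exI[of _ "min h1 h2"]) auto
  with ev_c have "\<forall>\<^sub>F h in at_right 0. h < h1 \<and> h < h2 \<and> norm (\<psi> h 0) / h < real c"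
    by eventually_elim simp
  then have "\<forall>\<^sub>F n in sequentially. s n < h1 \<and> s n < h2 \<and> norm (\<psi> (s n) 0) / s n < real c"
    using s_at by (rule eventually_compose_filterlim)
  then obtain N where N: "\<And>n. n \<ge> N \<Longrightarrow> s n < h1 \<and> s n < h2 \<and> norm (\<psi> (s n) 0) / s n < real c"
    unfolding eventually_sequentially by blast
  \<comment> \<open>Discarding finitely many terms makes every bound hold for all indices; the shift
    by \<open>N\<close> reappears in the final subsequence.\<close>
  define s' where "s' n = s (n + N)" for n
  have s': "s' n > 0" "s' n < h1" "s' n < h2" "norm (\<psi> (s' n) 0) / s' n < real c" for n
    using s(1) N[of "n + N"] by (auto simp: s'_def)

  \<comment> \<open>The rescaled drifts and their limit\<close>
  define G where "G n x = (\<psi> (s' n) x - x) /\<^sub>R s' n" for n x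
  have \<psi>_G: "\<psi> (s' n) x = x + s' n *\<^sub>R G n x" for n x using s'(1)[of n] by (simp add: G_def)
  have G_lip: "lipschitz_on \<omega> UNIV (G n)" for n
  proof (rule lipschitz_onI[OF _ \<omega>_nonneg])
    fix a b :: "real ^ 'd"
    have "G n a - G n b = (\<psi> (s' n) (b + (a - b)) - \<psi> (s' n) b - (a - b)) /\<^sub>R s' n"
      by (simp add: G_def scaleR_diff_right)
    then have "dist (G n a) (G n b) = norm (\<psi> (s' n) (b + (a - b)) - \<psi> (s' n) b - (a - b)) / s' n"
      using s'(1)[of n] by (simp add: dist_norm divide_inverse mult.commute)
    also have "\<dots> \<le> ((\<omega> * s' n) * norm (a - b)) / s' n"
      using s'(1,3)[of n] by (intro divide_right_mono \<psi>_inc) auto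
    finally show "dist (G n a) (G n b) \<le> \<omega> * dist a b" using s'(1)[of n] by (simp add: dist_norm)
  qed
  have G_0: "norm (G n 0) \<le> real c" for n
    using s'(1,4)[of n] by (simp add: G_def divide_inverse mult.commute less_imp_le)
  obtain \<rho> :: "nat \<Rightarrow> nat" and F where \<rho>: "strict_mono \<rho>" and F: "lipschitz_on \<omega> UNIV F"
    and F_lim: "\<forall>B \<epsilon>. \<epsilon> > 0 \<longrightarrow> (\<forall>\<^sub>F n in sequentially. \<forall>b. norm b \<le> B \<longrightarrow> norm (G (\<rho> n) b - F b) \<le> \<epsilon>)"
    using lipschitz_subsequence[of \<omega> G, OF G_lip G_0] by blast

  \<comment> \<open>Coupling of the walks and the limit process\<close>
  have sub_mono: "strict_mono (\<lambda>n. \<rho> n + N)" using \<rho> by (simp add: strict_mono_def)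
  have s\<rho>: "(\<lambda>n. s' (\<rho> n)) \<longlonglongrightarrow> 0"
    using LIMSEQ_subseq_LIMSEQ[OF s(2) sub_mono] by (simp add: o_def s'_def)
  interpret small_noise "\<lambda>n. \<mu> (s' (\<rho> n))" "\<lambda>n. s' (\<rho> n)" "real C"
  proof (rule small_noiseI[of \<mu> "\<lambda>n. s' (\<rho> n)"])
    fix \<epsilon> :: real assume "\<epsilon> > 0"
    then obtain L where L: "L > 0" "Limsup (at_right 0) (\<lambda>h. ereal (1 / h * measure (\<mu> h) {y. norm y > L})) < ereal \<epsilon>"
      using A2 by blast
    have "\<forall>\<^sub>F h in at_right 0. ereal (1 / h * measure (\<mu> h) {y. norm y > L}) < ereal \<epsilon>"
      by (rule Limsup_lessD[OF L(2)])
    then have "\<forall>\<^sub>F n in sequentially. ereal (1 / s' (\<rho> n) * measure (\<mu> (s' (\<rho> n))) {y. norm y > L}) < ereal \<epsilon>"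
      by (rule eventually_compose_filterlim) (rule tendsto_imp_filterlim_at_right[OF s\<rho>], simp add: s'(1))
    then have "\<forall>\<^sub>F n in sequentially. measure (\<mu> (s' (\<rho> n))) {y. norm y > L} \<le> \<epsilon> * s' (\<rho> n)"
    proof eventually_elim
      case (elim n)
      then show ?case using s'(1)[of "\<rho> n"] by (simp add: field_simps)
    qed
    then show "\<exists>L>0. \<forall>\<^sub>F n in sequentially. measure (\<mu> (s' (\<rho> n))) {y. norm y > L} \<le> \<epsilon> * s' (\<rho> n)"
      using L(1) by blast
  qed (use s' s\<rho> in \<open>auto intro: noise_\<mu> spread_C\<close>)
  obtain \<kappa> :: "nat \<Rightarrow> nat" and M :: "(real \<Rightarrow> real ^ 'd) measure" and \<xi> y
    where \<kappa>: "strict_mono \<kappa>"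
      and wl: "walk_limit (\<lambda>n. \<mu> (s' (\<rho> (\<kappa> n)))) (\<lambda>n. s' (\<rho> (\<kappa> n))) (real C) M \<xi> y"
    by (rule ex_walk_limit)
  define h where "h n = s' (\<rho> (\<kappa> n))" for n
  have h_pos: "h n > 0" for n by (simp add: h_def s'(1))
  interpret wl: walk_limit "\<lambda>n. \<mu> (h n)" h "real C" M \<xi> y
    using wl unfolding h_def[abs_def] .
  obtain Y where Y: "\<And>t. Y t \<in> borel_measurable M" "\<And>w. cadlag (\<lambda>t. Y t w)"
    "\<And>t. t \<ge> 0 \<Longrightarrow> AE w in M. (\<lambda>n. y (rat_right t n) w) \<longlonglongrightarrow> Y t w"
    by (rule wl.ex_limit_process) blast
  interpret es: euler_scheme "\<lambda>n. \<mu> (h n)" h "real C" M \<xi> y Y F "\<lambda>n. G (\<rho> (\<kappa> n))" \<omega>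
  proof unfold_locales
    show "\<forall>\<^sub>F n in sequentially. \<forall>b. norm b \<le> B \<longrightarrow> norm (G (\<rho> (\<kappa> n)) b - F b) \<le> \<epsilon>" if "\<epsilon> > 0" for \<epsilon> B
      by (rule eventually_subseq[OF \<kappa> F_lim[rule_format, OF that]])
  qed (use Y F G_lip in auto)

  \<comment> \<open>Operator powers as expectations, and the two conclusions\<close>
  have \<phi>: "\<psi> (h n) x = x + h n *\<^sub>R G (\<rho> (\<kappa> n)) x" for n x unfolding h_def by (rule \<psi>_G)
  have tr: "transition \<mu> \<psi> (h n) = (\<lambda>f x. \<integral>y. f (\<psi> (h n) x + y) \<partial>\<mu> (h n))" for n
    by (simp add: transition_def fun_eq_iff)
  have P: "(\<lambda>x. \<integral>y. f (\<psi> (h n) x + y) \<partial>\<mu> (h n)) \<in> bcontfun" if "f \<in> bcontfun" for n and f :: "real ^ 'd \<Rightarrow> real"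
    using P_operator h_pos[of n] that tr[of n] by auto
  let ?E = "\<lambda>n x w k. euler (h n) (G (\<rho> (\<kappa> n))) x (\<xi> n w) k"
  have power: "(transition \<mu> \<psi> (h n) ^^ k) f x = (\<integral>w. f (?E n x w k) \<partial>M)" if "f \<in> bcontfun" for n k x and f :: "real ^ 'd \<Rightarrow> real"
    unfolding tr by (rule es.transition_power_eq[where \<phi> = "\<lambda>n. \<psi> (h n)", OF \<phi> _ that]) (rule P)

  have conv: "(\<lambda>n. SUP x\<in>cball 0 r. \<bar>(transition \<mu> \<psi> (h n) ^^ k n) (fs n) x - (\<integral>w. f (es.solution x t w) \<partial>M)\<bar>) \<longlonglongrightarrow> 0"
    if t: "t \<ge> 0" and k: "(\<lambda>n. real (k n) * h n) \<longlonglongrightarrow> t" and mix: "mixed_tendsto fs f" and r: "r \<ge> 0" for t r f fs and k :: "nat \<Rightarrow> nat"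
  proof (rule SUP_tendsto_0_sequential)
    have f: "f \<in> bcontfun" and fs: "fs n \<in> bcontfun" for n using mix by (auto simp: mixed_tendsto_def)
    obtain B where B: "\<And>n x. \<bar>fs n x\<bar> \<le> B" "\<And>x. \<bar>f x\<bar> \<le> B"
      using mixed_tendsto_bounded[OF mix] by metis
    show "cball (0 :: real ^ 'd) r \<noteq> {}" using r by simp
    show "bdd_above ((\<lambda>x. \<bar>(transition \<mu> \<psi> (h n) ^^ k n) (fs n) x - (\<integral>w. f (es.solution x t w) \<partial>M)\<bar>) ` cball 0 r)" for n
    proof (rule bdd_aboveI2)
      fix x
      have "fs n \<in> borel_measurable borel" by (intro borel_measurable_continuous_onI bcontfun_continuous fs)
      then have "\<bar>\<integral>w. fs n (?E n x w (k n)) \<partial>M\<bar> \<le> B"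
        by (intro wl.abs_expectation_le measurable_compose[OF es.measurable_euler] B(1))
      moreover have "\<bar>\<integral>w. f (es.solution x t w) \<partial>M\<bar> \<le> B"
        by (rule wl.abs_expectation_le[OF es.measurable_bcontfun_solution[OF f t] B(2)])
      ultimately show "\<bar>(transition \<mu> \<psi> (h n) ^^ k n) (fs n) x - (\<integral>w. f (es.solution x t w) \<partial>M)\<bar> \<le> B + B"
        unfolding power[OF fs] by linarith
    qed
    fix x :: "nat \<Rightarrow> real ^ 'd" assume "\<And>n. x n \<in> cball 0 r"
    then have x: "norm (x n) \<le> r" for n by simp
    show "(\<lambda>n. (transition \<mu> \<psi> (h n) ^^ k n) (fs n) (x n) - (\<integral>w. f (es.solution (x n) t w) \<partial>M)) \<longlonglongrightarrow> 0"
      unfolding power[OF fs] by (rule es.expectation_euler_tendsto[where x = x, OF t x k mix])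
  qed

  have gen: "mixed_tendsto_at_0 (\<lambda>t x. ((\<integral>w. f (es.solution x t w) \<partial>M) - f x) / t) g"
    if f: "f \<in> bcontfun" and mix: "mixed_tendsto (\<lambda>n x. (transition \<mu> \<psi> (h n) f x - f x) / h n) g" for f g
  proof -
    have "es.propagator f t x - f x = (LINT s:{0..t}|lborel. es.propagator g s x)" if "t \<ge> 0" for t x
      by (rule es.dynkin[OF f mix that])
         (unfold tr, rule es.discrete_dynkin[where \<phi> = "\<lambda>n. \<psi> (h n)", OF \<phi> _ f], rule P)
    moreover have "g \<in> bcontfun" using mix by (simp add: mixed_tendsto_def)
    ultimately show ?thesis using es.generator[OF f] unfolding es.propagator_def by blast
  qed

  have sub: "\<exists>\<sigma>. strict_mono \<sigma> \<and> h = s \<circ> \<sigma>"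
  proof (intro exI conjI)
    \<comment> \<open>Here \<open>\<rho>\<close> was chosen for the drifts, \<open>\<kappa>\<close>
      for the coupling, and \<open>N\<close> for the uniform bounds.\<close>
    show "strict_mono (\<lambda>n. \<rho> (\<kappa> n) + N)" using strict_mono_o[OF \<rho> \<kappa>] by (simp add: strict_mono_def)
    show "h = s \<circ> (\<lambda>n. \<rho> (\<kappa> n) + N)" by (simp add: h_def s'_def fun_eq_iff)
  qed
  have sol: "\<exists>X. (\<forall>x. unique_strong_solution M Y F x (X x)) \<and>
        (\<forall>t\<ge>0. \<forall>f\<in>bcontfun. \<forall>k fs.
           (\<lambda>n. real (k n) * h n) \<longlonglongrightarrow> t \<longrightarrow> mixed_tendsto fs f \<longrightarrow>
           (\<forall>r\<ge>0. (\<lambda>n. SUP x\<in>cball 0 r.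
                \<bar>(transition \<mu> \<psi> (h n) ^^ k n) (fs n) x - (\<integral>w. f (X x t w) \<partial>M)\<bar>) \<longlonglongrightarrow> 0)) \<and>
        (\<forall>f\<in>bcontfun. \<forall>g.
           mixed_tendsto (\<lambda>n x. (transition \<mu> \<psi> (h n) f x - f x) / h n) g \<longrightarrow>
           mixed_tendsto_at_0 (\<lambda>t x. ((\<integral>w. f (X x t w) \<partial>M) - f x) / t) g)"
    using es.solution_unique_strong conv gen by (intro exI[of _ es.solution]) simp
  show ?thesis
    by (rule exI[of _ h], rule exI[of _ M], rule exI[of _ Y], rule exI[of _ F])
       (rule conjI[OF sub conjI[OF es.levy_process_Y conjI[OF F sol]]])
qed

end
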